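(* Let $n\ge1$, $r\ge2$, let $M$ be an oriented compact $n$-dimensional manifold with an equiaffine structure $(\nabla,\theta)$, let $f:(M,\nabla,\theta)\to(\mathbb{R}^{n+r},\tilde\nabla,\omega)$ be an equiaffine immersion, and let $S$ be a unit ellipsoid in $\bigwedge^{n+r-1}\mathbb{R}^{n+r}$. Suppose that $\tau_S(f)=2$ and that $f(M)$ is contained in an $(n+r-1)$-dimensional affine subspace $L$. Let $L'$ be the $(n+r-1)$-dimensional linear subspace parallel to $L$, let $\xi\in\mathbb{R}^{n+r}\setminus L'$, and define a volume element $\omega_L$ on $L'$ by $$\omega_L(X_1,\dots,X_{n+r-1})=\omega(X_1,\dots,X_{n+r-1},\xi)\qquad(X_1,\dots,X_{n+r-1}\in L').$$ Then: (1) The map $f$ regarded as a map into $L$, $f_L:(M,\nabla,\theta)\to(L,\tilde\nabla|_L,\omega_L)$, is an equiaffine immersion. (2) For an arbitrary unit ellipsoid $S_L$ in $\bigwedge^{n+r-2}L'$ (defined using the volume element $\omega_L$), the total absolute curvature $\tau_{S_L}(f_L)$ of $f_L$ with respect to $S_L$ is equal to $2$.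
   Context: All manifolds and maps are smooth, manifolds are without boundary, all affine connections are torsion-free, and a volume element on a vector bundle of rank $k$ is a nowhere vanishing alternating $k$-form on it. An equiaffine structure on a manifold $M$ is a pair $(\nabla,\theta)$ of an affine connection and a volume element with $\nabla\theta=0$. An $m$-dimensional affine space $V$ (identified with its vector space of translations) is given the equiaffine structure $(\tilde\nabla,\omega)$, where $\tilde\nabla$ is the standard flat connection and $\omega$ is a constant (parallel) volume element. The definitions below are applied both to $V=\mathbb{R}^{n+r}$ with $\omega$ (codimension $k=r$) and to $V=L$ with $\omega_L$ (codimension $k=r-1$). Equiaffine immersion. Let $V$ have dimension $m=n+k$, $k\ge1$, and let $f:M\to V$ be an immersion of an $n$-manifold. A transversal bundle of $f$ is a rank-$k$ subbundle $N$ of $f^*TV$ with $f^*TV=df(TM)\oplus N$. It induces an affine connection $\nabla$ on $M$ and a symmetric $N$-valued tensor $\alpha$ (the affine fundamental form) by $\tilde\nabla_X df(Y)=df(\nabla_XY)+\alpha(X,Y)$. A volume element $\theta^\perp$ on $N$ induces a volume element on $M$ by $\theta(X_1,\dots,X_n)=\omega(df(X_1),\dots,df(X_n),\xi_1,\dots,\xi_k)/\theta^\perp(\xi_1,\dots,\xi_k)$, for any frame $(\xi_i)$ of $N$. Given an equiaffine structure $(\nabla,\theta)$ on $M$, $f:(M,\nabla,\theta)\to(V,\tilde\nabla,\omega)$ is an equiaffine immersion if some pair $(N,\theta^\perp)$ induces $(\nabla,\theta)$. Height functions. Every $\phi\in\bigwedge^{m-1}V$ is decomposable, $\phi=v_1\wedge\cdots\wedge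 v_{m-1}$; put $\tilde h_\phi(v)=\omega(v_1,\dots,v_{m-1},v)$ (independent of the representation). Unit ellipsoid. Let $\omega'$ be the volume element on the $m$-dimensional vector space $\bigwedge^{m-1}V$ with $\omega'(\widehat{v_1}\wedge v_2\wedge\cdots\wedge v_m,\dots,v_1\wedge\cdots\wedge v_{m-1}\wedge\widehat{v_m})=(-1)^{m(m-1)/2}$ for every basis $(v_i)$ of $V$ with $\omega(v_1,\dots,v_m)=1$ (hat denotes omission). For a basis $(\zeta_1,\dots,\zeta_m)$ of $\bigwedge^{m-1}V$ with $\omega'(\zeta_1,\dots,\zeta_m)=1$, the set $S=\{\sum a_i\zeta_i:\sum a_i^2=1\}$ is called a unit ellipsoid. Let $\omega_S$ be the volume element of $S$ corresponding to the standard volume form of the unit sphere $\mathcal S^{m-1}(1)\subset\mathbb{R}^m$ under $(a_i)\mapsto\sum a_i\zeta_i$. Gauss map and total absolute curvature. Fix $(N,\theta^\perp)$ inducing $(\nabla,\theta)$. Define $\tilde\nu_N:\bigwedge^{k-1}N\to\bigwedge^{m-1}V$ by $\tilde\nu_N(\eta)=df(e_1)\wedge\cdots\wedge df(e_n)\wedge\eta$, where $(e_i)$ is a frame of $TM$ with $\theta(e_1,\dots,e_n)=1$ (for $k=1$, $\bigwedge^0N=M\times\mathbb{R}$). The transversal ellipsoid bundle is $B=\tilde\nu_N^{-1}(S)$, and the Gauss map is $\nu=\tilde\nu_N|_B:B\to S$. The Lipschitz–Killing curvature is $G(\eta)=(-1)^n\det[\tilde h_{\nu(\eta)}(\alpha(e_i,e_j))]_{1\le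 i,j\le n}$, where $(e_1,\dots,e_n)$ is a basis of the tangent space of $M$ at the base point of $\eta\in B$ with $\theta(e_1,\dots,e_n)=1$, and $B$ carries a volume element $\omega_B$ satisfying $\nu^*\omega_S=G\,\omega_B$. The total absolute curvature of $f$ with respect to $S$ is $\tau_S(f)=\frac{1}{\operatorname{vol}(\mathcal S^{m-1}(1))}\int_B|G|\,\omega_B$, which by this identity equals $\frac{1}{\operatorname{vol}(\mathcal S^{m-1}(1))}\int_B|\nu^*\omega_S|$ (this may be taken as the definition). It does not depend on the choice of $(N,\theta^\perp)$. *)

theory Defs
  imports
    "HOL-Analysis.Analysis"
    "HOL-Library.Function_Algebras"
    "Jordan_Normal_Form.Determinant"
begin

section \<open>Linear algebra\<close>

text \<open>Pointwise scalar multiplication makes every space of functions into a vector space a real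
  vector space (addition is the pointwise one of \<^theory>\<open>HOL-Library.Function_Algebras\<close>).  It
  is used for tangent spaces, spaces of forms and exterior powers.\<close>

instantiation "fun" :: (type, real_vector) real_vector
begin

definition scaleR_fun :: "real \<Rightarrow> ('a \<Rightarrow> 'b) \<Rightarrow> 'a \<Rightarrow> 'b"
  where "scaleR_fun c f = (\<lambda>x. c *\<^sub>R f x)"

instance
  by standard (auto simp: scaleR_fun_def fun_eq_iff scaleR_add_right scaleR_add_left)

end

definition basis_of :: "'b::real_vector set \<Rightarrow> 'b list \<Rightarrow> bool"
  where "basis_of V vs \<longleftrightarrow> distinct vs \<and> independent (set vs) \<and> span (set vs) = V"

text \<open>Alternating \<open>k\<close>-forms on a subspace \<open>V\<close>.  They are normalised to vanish on lists that
  are not \<open>k\<close>-tuples of vectors of \<open>V\<close>, so that equality of forms is equality of functions.\<close>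

definition forms :: "nat \<Rightarrow> 'b::real_vector set \<Rightarrow> ('b list \<Rightarrow> real) set"
  where "forms k V =
    {\<beta>. (\<forall>xs. length xs = k \<and> set xs \<subseteq> V \<longrightarrow>
            (\<forall>i<k. \<forall>x\<in>V. \<forall>y\<in>V. \<forall>a b.
               \<beta> (xs[i := a *\<^sub>R x + b *\<^sub>R y]) = a * \<beta> (xs[i := x]) + b * \<beta> (xs[i := y])) \<and>
            (\<forall>i<k. \<forall>j<k. i \<noteq> j \<and> xs ! i = xs ! j \<longrightarrow> \<beta> xs = 0)) \<and>
         (\<forall>xs. \<not> (length xs = k \<and> set xs \<subseteq> V) \<longrightarrow> \<beta> xs = 0)}"

definition volume_form :: "nat \<Rightarrow> 'b::real_vector set \<Rightarrow> ('b list \<Rightarrow> real) \<Rightarrow> bool"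
  where "volume_form m V \<beta> \<longleftrightarrow> dim V = m \<and> \<beta> \<in> forms m V \<and> \<beta> \<noteq> 0"

text \<open>The exterior power \<open>\<Lambda>\<^sup>k V\<close> of a finite-dimensional space is modelled as the dual of
  the space of alternating \<open>k\<close>-forms: \<open>v\<^sub>1 \<and> \<dots> \<and> v\<^sub>k\<close> is evaluation at
  \<open>(v\<^sub>1, \<dots>, v\<^sub>k)\<close>, extended by \<open>0\<close> to functions that are not forms.\<close>

definition wedge :: "'b::real_vector set \<Rightarrow> 'b list \<Rightarrow> ('b list \<Rightarrow> real) \<Rightarrow> real"
  where "wedge V vs = (\<lambda>\<beta>. if \<beta> \<in> forms (length vs) V then \<beta> vs else 0)"

text \<open>\<open>ext_power V k W\<close> is the image of \<open>\<Lambda>\<^sup>k W\<close> in \<open>\<Lambda>\<^sup>k V\<close> for a subspace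
  \<open>W \<subseteq> V\<close>.  For \<open>k = 0\<close> it is a line.\<close>

definition ext_power ::
    "'b::real_vector set \<Rightarrow> nat \<Rightarrow> 'b set \<Rightarrow> (('b list \<Rightarrow> real) \<Rightarrow> real) set"
  where "ext_power V k W = span {wedge V vs | vs. length vs = k \<and> set vs \<subseteq> W}"

text \<open>\<open>v\<^sub>1 \<and> \<dots> \<and> v\<^sub>l \<and> \<eta>\<close> for \<open>\<eta> \<in> \<Lambda>\<^sup>j V\<close>.\<close>

definition wedge_left :: "'b::real_vector set \<Rightarrow> nat \<Rightarrow> 'b list \<Rightarrow>
    (('b list \<Rightarrow> real) \<Rightarrow> real) \<Rightarrow> ('b list \<Rightarrow> real) \<Rightarrow> real"
  where "wedge_left V j vs \<eta> =
    (\<lambda>\<beta>. if \<beta> \<in> forms (length vs + j) V then \<eta> (\<lambda>ws. \<beta> (vs @ ws)) else 0)"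

lemma wedge_left_wedge:
  assumes V: "subspace V" and vs: "set vs \<subseteq> V"
  shows "wedge_left V (length ws) vs (wedge V ws) = wedge V (vs @ ws)"
proof -
  have "(\<lambda>ws. \<beta> (vs @ ws)) \<in> forms (length ws) V" if b: "\<beta> \<in> forms (length (vs @ ws)) V" for \<beta>
  proof -
    let ?l = "length vs" and ?k = "length ws"
    have lin: "\<beta> (xs[i := a *\<^sub>R x + b *\<^sub>R y]) = a * \<beta> (xs[i := x]) + b * \<beta> (xs[i := y])"
      if "length xs = ?l + ?k" "set xs \<subseteq> V" "i < ?l + ?k" "x \<in> V" "y \<in> V" for xs i x y a b
      using b that unfolding forms_def by simp
    have alt: "\<beta> xs = 0"
      if "length xs = ?l + ?k" "set xs \<subseteq> V" "i < ?l + ?k" "j < ?l + ?k" "i \<noteq> j" "xs ! i = xs ! j"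
      for xs i j
      using b that unfolding forms_def by simp
    have zero: "\<beta> xs = 0" if "\<not> (length xs = ?l + ?k \<and> set xs \<subseteq> V)" for xs
      using b that unfolding forms_def by simp
    have 1: "\<beta> (vs @ xs[i := a *\<^sub>R x + b *\<^sub>R y]) = a * \<beta> (vs @ xs[i := x]) + b * \<beta> (vs @ xs[i := y])"
      if "length xs = ?k" "set xs \<subseteq> V" "i < ?k" "x \<in> V" "y \<in> V" for xs i x y a b
      using lin[of "vs @ xs" "?l + i" x y a b] that vs by (simp add: list_update_append)
    have 2: "\<beta> (vs @ xs) = 0"
      if "length xs = ?k" "set xs \<subseteq> V" "i < ?k" "j < ?k" "i \<noteq> j" "xs ! i = xs ! j" for xs i j
      using alt[of "vs @ xs" "?l + i" "?l + j"] that vs by (simp add: nth_append)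
    have 3: "\<beta> (vs @ xs) = 0" if "\<not> (length xs = ?k \<and> set xs \<subseteq> V)" for xs
      using zero[of "vs @ xs"] that by auto
    show ?thesis
      unfolding forms_def using 1 2 3 by blast
  qed
  then show ?thesis
    by (auto simp: wedge_left_def wedge_def fun_eq_iff)
qed

text \<open>The volume element \<open>\<omega>'\<close> on \<open>\<Lambda>\<^sup>m\<^sup>-\<^sup>1 V\<close> determined by \<open>\<omega>\<close>.\<close>

definition is_dual_volume :: "nat \<Rightarrow> 'b::real_vector set \<Rightarrow> ('b list \<Rightarrow> real) \<Rightarrow>
    ((('b list \<Rightarrow> real) \<Rightarrow> real) list \<Rightarrow> real) \<Rightarrow> bool"
  where "is_dual_volume m V \<omega> \<omega>' \<longleftrightarrow>
    volume_form m (ext_power V (m - 1) V) \<omega>' \<and>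
    (\<forall>vs. basis_of V vs \<and> \<omega> vs = 1 \<longrightarrow>
       \<omega>' (map (\<lambda>i. wedge V (take i vs @ drop (Suc i) vs)) [0..<m]) = (- 1) ^ (m * (m - 1) div 2))"

text \<open>\<open>S\<close> is the unit ellipsoid \<open>{\<Sum> a\<^sub>i \<zeta>\<^sub>i : \<Sum> a\<^sub>i\<^sup>2 = 1}\<close> of the unimodular basis \<open>\<zeta>\<close>.\<close>

definition unit_ellipsoid :: "nat \<Rightarrow> 'b::real_vector set \<Rightarrow> ('b list \<Rightarrow> real) \<Rightarrow>
    (('b list \<Rightarrow> real) \<Rightarrow> real) list \<Rightarrow> (('b list \<Rightarrow> real) \<Rightarrow> real) set \<Rightarrow> bool"
  where "unit_ellipsoid m V \<omega> \<zeta> S \<longleftrightarrow>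
    basis_of (ext_power V (m - 1) V) \<zeta> \<and>
    (\<exists>\<omega>'. is_dual_volume m V \<omega> \<omega>' \<and> \<omega>' \<zeta> = 1) \<and>
    S = {\<Sum>i<m. a i *\<^sub>R \<zeta> ! i | a :: nat \<Rightarrow> real. (\<Sum>i<m. (a i)\<^sup>2) = 1}"

text \<open>The standard volume form of the unit sphere of \<open>\<real>\<^sup>m\<close> at \<open>a\<close>, on \<open>m - 1\<close> vectors:
  the determinant with the outward normal \<open>a\<close> as first row.\<close>

definition sphere_form :: "nat \<Rightarrow> (nat \<Rightarrow> real) \<Rightarrow> (nat \<Rightarrow> real) list \<Rightarrow> real"
  where "sphere_form m a xs = Determinant.det (Matrix.mat m m (\<lambda>(i, j). ((a # xs) ! i) j))"

text \<open>The volume of the unit sphere of \<open>\<real>\<^sup>m\<close>: the derivative at \<open>\<rho> = 1\<close> of the volume of the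
  \<open>m\<close>-dimensional ball of radius \<open>\<rho>\<close>.\<close>

definition sphere_volume :: "nat \<Rightarrow> real"
  where "sphere_volume m = real m * unit_ball_vol (real m)"

text \<open>\<open>\<omega>\<^sub>S\<close>: transport of \<open>sphere_form\<close> under \<open>(a\<^sub>i) \<mapsto> \<Sum> a\<^sub>i \<zeta>\<^sub>i\<close>.\<close>

definition coords :: "'b::real_vector list \<Rightarrow> 'b \<Rightarrow> nat \<Rightarrow> real"
  where "coords \<zeta> y = (\<lambda>i. if i < length \<zeta> then representation (set \<zeta>) y (\<zeta> ! i) else 0)"

definition ellipsoid_form :: "'b::real_vector list \<Rightarrow> 'b \<Rightarrow> 'b list \<Rightarrow> real"
  where "ellipsoid_form \<zeta> y ys = sphere_form (length \<zeta>) (coords \<zeta> y) (map (coords \<zeta>) ys)"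

section \<open>Smooth manifolds\<close>

text \<open>\<open>\<real>\<^sup>d\<close> is \<^term>\<open>topspace (Euclidean_space d)\<close>, the functions
  \<^typ>\<open>nat \<Rightarrow> real\<close> vanishing from index \<open>d\<close> on.\<close>

definition partial ::
    "nat \<Rightarrow> ((nat \<Rightarrow> real) \<Rightarrow> 'b::real_normed_vector) \<Rightarrow> (nat \<Rightarrow> real) \<Rightarrow> 'b"
  where "partial i F x = vector_derivative (\<lambda>t. F (x(i := t))) (at (x i))"

primrec C_k ::
    "nat \<Rightarrow> nat \<Rightarrow> (nat \<Rightarrow> real) set \<Rightarrow> ((nat \<Rightarrow> real) \<Rightarrow> 'b::real_normed_vector) \<Rightarrow> bool"
  where
    "C_k 0 d U F \<longleftrightarrow> continuous_on U F"
  | "C_k (Suc k) d U F \<longleftrightarrow> continuous_on U F \<and>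
       (\<forall>i<d. (\<forall>x\<in>U. (\<lambda>t. F (x(i := t))) differentiable at (x i)) \<and> C_k k d U (partial i F))"

definition C_inf ::
    "nat \<Rightarrow> (nat \<Rightarrow> real) set \<Rightarrow> ((nat \<Rightarrow> real) \<Rightarrow> 'b::real_normed_vector) \<Rightarrow> bool"
  where "C_inf d U F \<longleftrightarrow> (\<forall>k. C_k k d U F)"

type_synonym 'm atlas = "('m set \<times> ('m \<Rightarrow> nat \<Rightarrow> real)) set"

text \<open>The manifold is the whole type \<open>'m\<close>, with its topology; the atlas need not be maximal.\<close>

definition smooth_manifold ::
    "nat \<Rightarrow> 'm::{t2_space, second_countable_topology} atlas \<Rightarrow> bool"
  where "smooth_manifold n A \<longleftrightarrow>
    (\<Union>(U, \<phi>)\<in>A. U) = UNIV \<and>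
    (\<forall>(U, \<phi>)\<in>A. open U \<and> openin (Euclidean_space n) (\<phi> ` U) \<and>
       homeomorphism U (\<phi> ` U) \<phi> (inv_into U \<phi>)) \<and>
    (\<forall>(U, \<phi>)\<in>A. \<forall>(U', \<phi>')\<in>A. \<forall>i<n. C_inf n (\<phi> ` (U \<inter> U')) (\<lambda>x. \<phi>' (inv_into U \<phi> x) i))"

text \<open>An orientation is given by an atlas with orientation preserving changes of coordinates
  (\<open>n \<ge> 1\<close>).\<close>

definition oriented_atlas :: "nat \<Rightarrow> 'm atlas \<Rightarrow> bool"
  where "oriented_atlas n A \<longleftrightarrow>
    (\<forall>(U, \<phi>)\<in>A. \<forall>(U', \<phi>')\<in>A. \<forall>x\<in>\<phi> ` (U \<inter> U').
       Determinant.det (Matrix.mat n n (\<lambda>(i, j). partial j (\<lambda>x. \<phi>' (inv_into U \<phi> x) i) x)) > 0)"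

definition smooth_on ::
    "nat \<Rightarrow> 'm atlas \<Rightarrow> 'm set \<Rightarrow> ('m \<Rightarrow> 'b::real_normed_vector) \<Rightarrow> bool"
  where "smooth_on n A U h \<longleftrightarrow> (\<forall>(U', \<phi>)\<in>A. C_inf n (\<phi> ` (U \<inter> U')) (\<lambda>x. h (inv_into U' \<phi> x)))"

abbreviation smooth :: "nat \<Rightarrow> 'm atlas \<Rightarrow> ('m \<Rightarrow> 'b::real_normed_vector) \<Rightarrow> bool"
  where "smooth n A h \<equiv> smooth_on n A UNIV h"

text \<open>Tangent vectors are derivations of the algebra of smooth functions, extended by \<open>0\<close> to
  the functions that are not smooth.\<close>

definition tangent_space :: "nat \<Rightarrow> 'm atlas \<Rightarrow> 'm \<Rightarrow> (('m \<Rightarrow> real) \<Rightarrow> real) set"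
  where "tangent_space n A p =
    {v. (\<forall>h. \<not> smooth n A h \<longrightarrow> v h = 0) \<and>
        (\<forall>g h. smooth n A g \<and> smooth n A h \<longrightarrow>
           (\<forall>a b. v (\<lambda>q. a * g q + b * h q) = a * v g + b * v h) \<and>
           v (\<lambda>q. g q * h q) = g p * v h + h p * v g)}"

type_synonym 'm vfield = "'m \<Rightarrow> ('m \<Rightarrow> real) \<Rightarrow> real"

definition vector_fields :: "nat \<Rightarrow> 'm atlas \<Rightarrow> 'm vfield set"
  where "vector_fields n A =
    {X. (\<forall>p. X p \<in> tangent_space n A p) \<and> (\<forall>h. smooth n A h \<longrightarrow> smooth n A (\<lambda>p. X p h))}"

definition bracket :: "'m vfield \<Rightarrow> 'm vfield \<Rightarrow> 'm vfield"
  where "bracket X Y = (\<lambda>p h. X p (\<lambda>q. Y q h) - Y p (\<lambda>q. X q h))"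

text \<open>The derivative \<open>v(W)\<close> of a vector-valued function \<open>W\<close> along a tangent vector, taken
  componentwise.  For \<open>W = f\<close> this is \<open>df(v)\<close>; for a section \<open>W\<close> of \<open>f\<^sup>*TV\<close>, i.e. a function with values
  in the direction space of \<open>V\<close>, it is the covariant derivative given by the standard flat
  connection.\<close>

definition deriv_along :: "(('m \<Rightarrow> real) \<Rightarrow> real) \<Rightarrow> ('m \<Rightarrow> 'v::euclidean_space) \<Rightarrow> 'v"
  where "deriv_along v W = (\<Sum>b\<in>Basis. v (\<lambda>q. W q \<bullet> b) *\<^sub>R b)"

section \<open>Equiaffine structures\<close>

definition torsion_free_connection ::
    "nat \<Rightarrow> 'm atlas \<Rightarrow> ('m vfield \<Rightarrow> 'm vfield \<Rightarrow> 'm vfield) \<Rightarrow> bool"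
  where "torsion_free_connection n A D \<longleftrightarrow>
    (\<forall>X\<in>vector_fields n A. \<forall>Y\<in>vector_fields n A.
       D X Y \<in> vector_fields n A \<and>
       (\<forall>Z\<in>vector_fields n A. D (X + Y) Z = D X Z + D Y Z \<and> D Z (X + Y) = D Z X + D Z Y) \<and>
       (\<forall>h. smooth n A h \<longrightarrow>
          D (\<lambda>p. h p *\<^sub>R X p) Y = (\<lambda>p. h p *\<^sub>R D X Y p) \<and>
          D X (\<lambda>p. h p *\<^sub>R Y p) = (\<lambda>p. X p h *\<^sub>R Y p + h p *\<^sub>R D X Y p)) \<and>
       D X Y - D Y X = bracket X Y)"

definition volume_element ::
    "nat \<Rightarrow> 'm atlas \<Rightarrow> ('m \<Rightarrow> (('m \<Rightarrow> real) \<Rightarrow> real) list \<Rightarrow> real) \<Rightarrow> bool"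
  where "volume_element n A \<theta> \<longleftrightarrow>
    (\<forall>p. volume_form n (tangent_space n A p) (\<theta> p)) \<and>
    (\<forall>Xs. length Xs = n \<and> set Xs \<subseteq> vector_fields n A \<longrightarrow>
       smooth n A (\<lambda>p. \<theta> p (map (\<lambda>X. X p) Xs)))"

definition equiaffine_structure :: "nat \<Rightarrow> 'm atlas \<Rightarrow>
    ('m vfield \<Rightarrow> 'm vfield \<Rightarrow> 'm vfield) \<Rightarrow>
    ('m \<Rightarrow> (('m \<Rightarrow> real) \<Rightarrow> real) list \<Rightarrow> real) \<Rightarrow> bool"
  where "equiaffine_structure n A D \<theta> \<longleftrightarrow>
    torsion_free_connection n A D \<and> volume_element n A \<theta> \<and>
    (\<forall>X\<in>vector_fields n A. \<forall>Ys. length Ys = n \<and> set Ys \<subseteq> vector_fields n A \<longrightarrow>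
       (\<forall>p. X p (\<lambda>q. \<theta> q (map (\<lambda>Y. Y q) Ys)) =
            (\<Sum>i<n. \<theta> p (map (\<lambda>Y. Y p) (Ys[i := D X (Ys ! i)])))))"

section \<open>Equiaffine immersions\<close>

text \<open>The affine space \<open>V\<close> is an affine subspace of a Euclidean space (only the affine structure
  of which is used).\<close>

definition direction :: "'v::real_vector set \<Rightarrow> 'v set"
  where "direction V = {x - y | x y. x \<in> V \<and> y \<in> V}"

definition immersion ::
    "nat \<Rightarrow> 'm atlas \<Rightarrow> 'v::euclidean_space set \<Rightarrow> ('m \<Rightarrow> 'v) \<Rightarrow> bool"
  where "immersion n A V f \<longleftrightarrow>
    range f \<subseteq> V \<and> smooth n A f \<and>
    (\<forall>p. \<forall>v\<in>tangent_space n A p. deriv_along v f = 0 \<longrightarrow> v = 0)"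

text \<open>The fibres of \<open>f\<^sup>*TV\<close> are identified with the direction space of \<open>V\<close>.\<close>

definition transversal_bundle ::
    "nat \<Rightarrow> 'm::topological_space atlas \<Rightarrow> nat \<Rightarrow> 'v::euclidean_space set \<Rightarrow> ('m \<Rightarrow> 'v) \<Rightarrow>
     ('m \<Rightarrow> 'v set) \<Rightarrow> bool"
  where "transversal_bundle n A k V f N \<longleftrightarrow>
    (\<forall>p. subspace (N p) \<and> dim (N p) = k \<and>
       (let T = (\<lambda>v. deriv_along v f) ` tangent_space n A p
        in T \<inter> N p = {0} \<and> direction V = {x + y | x y. x \<in> T \<and> y \<in> N p})) \<and>
    (\<forall>p. \<exists>U \<xi>s. open U \<and> p \<in> U \<and> length \<xi>s = k \<and> (\<forall>\<xi>\<in>set \<xi>s. smooth_on n A U \<xi>) \<and>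
       (\<forall>q\<in>U. basis_of (N q) (map (\<lambda>\<xi>. \<xi> q) \<xi>s)))"

definition bundle_volume_element ::
    "nat \<Rightarrow> 'm::topological_space atlas \<Rightarrow> nat \<Rightarrow> ('m \<Rightarrow> 'v::euclidean_space set) \<Rightarrow>
     ('m \<Rightarrow> 'v list \<Rightarrow> real) \<Rightarrow> bool"
  where "bundle_volume_element n A k N \<theta>N \<longleftrightarrow>
    (\<forall>p. volume_form k (N p) (\<theta>N p)) \<and>
    (\<forall>U \<xi>s. open U \<and> length \<xi>s = k \<and> (\<forall>\<xi>\<in>set \<xi>s. smooth_on n A U \<xi> \<and> (\<forall>q\<in>U. \<xi> q \<in> N q)) \<longrightarrow>
       smooth_on n A U (\<lambda>q. \<theta>N q (map (\<lambda>\<xi>. \<xi> q) \<xi>s)))"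

text \<open>The pair \<open>(N, \<theta>\<^sup>\<bottom>)\<close> induces \<open>(\<nabla>, \<theta>)\<close>.  The vector in \<open>N p\<close> below is \<open>\<alpha>(X, Y)\<close>.\<close>

definition induces :: "nat \<Rightarrow> 'm::topological_space atlas \<Rightarrow>
    ('m vfield \<Rightarrow> 'm vfield \<Rightarrow> 'm vfield) \<Rightarrow>
    ('m \<Rightarrow> (('m \<Rightarrow> real) \<Rightarrow> real) list \<Rightarrow> real) \<Rightarrow>
    nat \<Rightarrow> 'v::euclidean_space set \<Rightarrow> ('v list \<Rightarrow> real) \<Rightarrow> ('m \<Rightarrow> 'v) \<Rightarrow>
    ('m \<Rightarrow> 'v set) \<Rightarrow> ('m \<Rightarrow> 'v list \<Rightarrow> real) \<Rightarrow> bool"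
  where "induces n A D \<theta> k V \<omega> f N \<theta>N \<longleftrightarrow>
    transversal_bundle n A k V f N \<and> bundle_volume_element n A k N \<theta>N \<and>
    (\<forall>X\<in>vector_fields n A. \<forall>Y\<in>vector_fields n A. \<forall>p.
       deriv_along (X p) (\<lambda>q. deriv_along (Y q) f) - deriv_along (D X Y p) f \<in> N p) \<and>
    (\<forall>p vs \<xi>s. length vs = n \<and> set vs \<subseteq> tangent_space n A p \<and> basis_of (N p) \<xi>s \<longrightarrow>
       \<theta> p vs = \<omega> (map (\<lambda>v. deriv_along v f) vs @ \<xi>s) / \<theta>N p \<xi>s)"

definition equiaffine_immersion :: "nat \<Rightarrow> 'm::topological_space atlas \<Rightarrow>
    ('m vfield \<Rightarrow> 'm vfield \<Rightarrow> 'm vfield) \<Rightarrow>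
    ('m \<Rightarrow> (('m \<Rightarrow> real) \<Rightarrow> real) list \<Rightarrow> real) \<Rightarrow>
    nat \<Rightarrow> 'v::euclidean_space set \<Rightarrow> ('v list \<Rightarrow> real) \<Rightarrow> ('m \<Rightarrow> 'v) \<Rightarrow> bool"
  where "equiaffine_immersion n A D \<theta> k V \<omega> f \<longleftrightarrow>
    k \<ge> 1 \<and> affine V \<and> aff_dim V = int (n + k) \<and> volume_form (n + k) (direction V) \<omega> \<and>
    equiaffine_structure n A D \<theta> \<and> immersion n A V f \<and>
    (\<exists>N \<theta>N. induces n A D \<theta> k V \<omega> f N \<theta>N)"

section \<open>Total absolute curvature\<close>

text \<open>\<open>\<nu>\<^sub>N(\<eta>) = df(e\<^sub>1) \<and> \<dots> \<and> df(e\<^sub>n) \<and> \<eta>\<close> for \<open>\<eta>\<close> in the fibre of \<open>\<Lambda>\<^sup>k\<^sup>-\<^sup>1 N\<close> at \<open>p\<close>, where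
  \<open>\<theta>(e\<^sub>1, \<dots>, e\<^sub>n) = 1\<close>; the value does not depend on the chosen frame.\<close>

definition gauss_map :: "nat \<Rightarrow> 'm atlas \<Rightarrow> ('m \<Rightarrow> (('m \<Rightarrow> real) \<Rightarrow> real) list \<Rightarrow> real) \<Rightarrow>
    nat \<Rightarrow> 'v::euclidean_space set \<Rightarrow> ('m \<Rightarrow> 'v) \<Rightarrow>
    'm \<times> (('v list \<Rightarrow> real) \<Rightarrow> real) \<Rightarrow> ('v list \<Rightarrow> real) \<Rightarrow> real"
  where "gauss_map n A \<theta> k V f = (\<lambda>(p, \<eta>).
    let es = SOME es. basis_of (tangent_space n A p) es \<and> \<theta> p es = 1
    in wedge_left (direction V) (k - 1) (map (\<lambda>v. deriv_along v f) es) \<eta>)"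

definition ellipsoid_bundle :: "nat \<Rightarrow> 'm atlas \<Rightarrow>
    ('m \<Rightarrow> (('m \<Rightarrow> real) \<Rightarrow> real) list \<Rightarrow> real) \<Rightarrow>
    nat \<Rightarrow> 'v::euclidean_space set \<Rightarrow> ('m \<Rightarrow> 'v) \<Rightarrow> ('m \<Rightarrow> 'v set) \<Rightarrow>
    (('v list \<Rightarrow> real) \<Rightarrow> real) set \<Rightarrow> ('m \<times> (('v list \<Rightarrow> real) \<Rightarrow> real)) set"
  where "ellipsoid_bundle n A \<theta> k V f N S =
    {(p, \<eta>). \<eta> \<in> ext_power (direction V) (k - 1) (N p) \<and> gauss_map n A \<theta> k V f (p, \<eta>) \<in> S}"

text \<open>Local parametrizations, by open sets \<open>W\<close> of \<open>\<real>\<^sup>d\<close>, of a \<open>d\<close>-dimensional submanifold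
  \<open>B\<close> of the manifold \<open>M \<times> \<Lambda>\<^sup>j V\<close>: immersions that are homeomorphisms onto open subsets of
  \<open>B\<close>.  Smoothness and derivatives are tested on the smooth functions \<open>h\<close> on \<open>M\<close> and on the linear
  functions \<open>\<eta> \<mapsto> \<eta>(\<beta>)\<close> with \<open>\<beta> \<in> \<Lambda>\<^sup>j V\<^sup>*\<close>.  The product topology of the function space restricts
  to the usual topology of the finite-dimensional space \<open>\<Lambda>\<^sup>j V\<close>.\<close>

definition local_param :: "nat \<Rightarrow> 'm::topological_space atlas \<Rightarrow> nat \<Rightarrow> 'v::euclidean_space set \<Rightarrow>
    nat \<Rightarrow> ('m \<times> (('v list \<Rightarrow> real) \<Rightarrow> real)) set \<Rightarrow>
    (nat \<Rightarrow> real) set \<Rightarrow> ((nat \<Rightarrow> real) \<Rightarrow> 'm \<times> (('v list \<Rightarrow> real) \<Rightarrow> real)) \<Rightarrow> bool"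
  where "local_param n A j V d B W \<psi> \<longleftrightarrow>
    openin (Euclidean_space d) W \<and> openin (top_of_set B) (\<psi> ` W) \<and>
    homeomorphism W (\<psi> ` W) \<psi> (inv_into W \<psi>) \<and>
    (\<forall>h :: 'm \<Rightarrow> real. smooth n A h \<longrightarrow> C_inf d W (\<lambda>w. h (fst (\<psi> w)))) \<and>
    (\<forall>\<beta>\<in>forms j V. C_inf d W (\<lambda>w. snd (\<psi> w) \<beta>)) \<and>
    (\<forall>w\<in>W. \<forall>c :: nat \<Rightarrow> real.
       (\<forall>h :: 'm \<Rightarrow> real. smooth n A h \<longrightarrow> (\<Sum>i<d. c i * partial i (\<lambda>w. h (fst (\<psi> w))) w) = 0) \<and>
       (\<forall>\<beta>\<in>forms j V. (\<Sum>i<d. c i * partial i (\<lambda>w. snd (\<psi> w) \<beta>) w) = 0)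
       \<longrightarrow> (\<forall>i<d. c i = 0))"

text \<open>The coefficient of \<open>(\<nu> \<circ> \<psi>)\<^sup>*\<omega>\<^sub>S\<close> with respect to \<open>dw\<^sub>0 \<and> \<dots> \<and> dw\<^sub>d\<^sub>-\<^sub>1\<close>;
  \<open>F\<close> stands for \<open>\<nu> \<circ> \<psi>\<close>.\<close>

definition pullback_density :: "nat \<Rightarrow> (('v list \<Rightarrow> real) \<Rightarrow> real) list \<Rightarrow>
    ((nat \<Rightarrow> real) \<Rightarrow> ('v list \<Rightarrow> real) \<Rightarrow> real) \<Rightarrow> (nat \<Rightarrow> real) \<Rightarrow> real"
  where "pullback_density d \<zeta> F w =
    ellipsoid_form \<zeta> (F w) (map (\<lambda>i \<beta>. partial i (\<lambda>w. F w \<beta>) w) [0..<d])"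

text \<open>Lebesgue integral of \<open>g\<close> over a Borel subset \<open>K\<close> of \<open>\<real>\<^sup>d\<close>.  Elements of the product space
  over \<open>{..<d}\<close> are \<^const>\<open>undefined\<close> from index \<open>d\<close> on, hence the conversion.\<close>

definition integral_Rd :: "nat \<Rightarrow> (nat \<Rightarrow> real) set \<Rightarrow> ((nat \<Rightarrow> real) \<Rightarrow> real) \<Rightarrow> ennreal"
  where "integral_Rd d K g =
    (\<integral>\<^sup>+x. (let w = (\<lambda>i. if i < d then x i else 0) in ennreal (g w) * indicator K w)
       \<partial>(\<Pi>\<^sub>M i\<in>{..<d}. lborel))"

text \<open>\<open>\<integral>\<^sub>B |\<nu>\<^sup>*\<omega>\<^sub>S|\<close> for the \<open>d\<close>-dimensional submanifold \<open>B\<close>.  The density defines a measure on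
  \<open>B\<close>, and \<open>B\<close> is a countable union of parametrized pieces, so its mass is the supremum of the masses
  of finite disjoint unions of Borel pieces \<open>\<psi>\<^sub>i(K\<^sub>i)\<close>, each of which is computed in its
  parametrization.\<close>

definition total_density :: "nat \<Rightarrow> 'm::topological_space atlas \<Rightarrow> nat \<Rightarrow> 'v::euclidean_space set \<Rightarrow>
    nat \<Rightarrow> ('m \<times> (('v list \<Rightarrow> real) \<Rightarrow> real)) set \<Rightarrow> (('v list \<Rightarrow> real) \<Rightarrow> real) list \<Rightarrow>
    ('m \<times> (('v list \<Rightarrow> real) \<Rightarrow> real) \<Rightarrow> ('v list \<Rightarrow> real) \<Rightarrow> real) \<Rightarrow> ennreal"
  where "total_density n A j V d B \<zeta> \<nu> =
    Sup {\<Sum>i<l. integral_Rd d (K i) (\<lambda>w. \<bar>pullback_density d \<zeta> (\<lambda>w. \<nu> (\<psi> i w)) w\<bar>) | (l :: nat) W \<psi> K.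
           (\<forall>i<l. local_param n A j V d B (W i) (\<psi> i) \<and> K i \<subseteq> W i \<and> K i \<in> sets borel) \<and>
           disjoint_family_on (\<lambda>i. \<psi> i ` K i) {..<l}}"

text \<open>\<open>\<tau>\<^sub>S(f)\<close>, computed with the transversal bundle \<open>N\<close>, for an \<open>n\<close>-manifold of codimension \<open>k\<close>
  and the unit ellipsoid \<open>S\<close> of the basis \<open>\<zeta>\<close>.\<close>

definition total_absolute_curvature :: "nat \<Rightarrow> 'm::topological_space atlas \<Rightarrow>
    ('m \<Rightarrow> (('m \<Rightarrow> real) \<Rightarrow> real) list \<Rightarrow> real) \<Rightarrow>
    nat \<Rightarrow> 'v::euclidean_space set \<Rightarrow> ('m \<Rightarrow> 'v) \<Rightarrow> ('m \<Rightarrow> 'v set) \<Rightarrow>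
    (('v list \<Rightarrow> real) \<Rightarrow> real) list \<Rightarrow> (('v list \<Rightarrow> real) \<Rightarrow> real) set \<Rightarrow> ennreal"
  where "total_absolute_curvature n A \<theta> k V f N \<zeta> S =
    total_density n A (k - 1) (direction V) (n + k - 1) (ellipsoid_bundle n A \<theta> k V f N S) \<zeta>
      (gauss_map n A \<theta> k V f) / ennreal (sphere_volume (n + k))"

definition hyperplane_volume ::
    "nat \<Rightarrow> 'v::real_vector set \<Rightarrow> ('v list \<Rightarrow> real) \<Rightarrow> 'v \<Rightarrow> 'v list \<Rightarrow> real"
  where "hyperplane_volume m L' \<omega> \<xi> =
    (\<lambda>xs. if length xs = m \<and> set xs \<subseteq> L' then \<omega> (xs @ [\<xi>]) else 0)"

end

theory Submission
  imports Defs
begin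

text \<open>The Gauss map takes each value \<open>y\<close> of the ellipsoid as often as the height function of \<open>y\<close> has
  critical points.  Hence, by the area formula applied to the cone over the Gauss map,
  \<open>\<tau>\<^sub>S(f)\<close> is the average over the unit ball of the number of critical points of the
  functions \<open>f \<bullet> w\<close>, after a linear change of the variable \<open>w\<close>.  On a compact manifold this number is
  at least 2, so \<open>\<tau>\<^sub>S(f) = 2\<close> holds exactly if it equals 2 for almost every \<open>w\<close>.  If \<open>f(M) \<subseteq> L\<close>, then it
  does not change when a normal vector of \<open>L\<close> is added to \<open>w\<close>, so by Fubini's theorem the condition for
  \<open>f\<close> is the one for \<open>f\<^sub>L\<close>.  The transversal bundle of \<open>f\<^sub>L\<close> is \<open>N \<inter> L'\<close>.\<close>

section \<open>Calculus in coordinates\<close>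

text \<open>The total curvature is the integral of a density on a bundle over an abstract manifold,
  pulled back from an ellipsoid in a dual space. The cone
  \<open>(w, t) \<mapsto> t * \<nu>(w)\<close> replaces it by Lebesgue integrals, because it maps
  between spaces of the same dimension \<open>m\<close>. The radial integral of
  \<open>t ^ (m - 1)\<close> over the interval from 0 to 1 is \<open>1 / m\<close>, and this cancels
  the factor in \<open>sphere_volume m = m * unit_ball_vol m\<close>. Multiplicities of a map are
  not evidently measurable, so the integrand is a measurable function that agrees with them almost
  everywhere.

  The integrals for \<open>f\<close> and its restriction are never compared with each other. Each
  one equals 2 exactly if a certain set is null, and null sets survive every linear substitution;
  thus no trace of the ellipsoid or of the transversal bundle remains in the criterion, and (2)
  follows for all choices at once.

  Compactness enters twice: through extrema of functions, and through a finite atlas of the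
  ellipsoid bundle, which makes the supremum in \<open>total_density\<close> a maximum.\<close>

lemma openin_Euclidean_space_iff:
  "openin (Euclidean_space d) U \<longleftrightarrow> (\<exists>T. open T \<and> U = T \<inter> {x. \<forall>i\<ge>d. x i = 0})"
  by (auto simp: Euclidean_space_def openin_subtopology euclidean_product_topology)

lemma continuous_fun_upd: "continuous_on S (\<lambda>t::real. x(i := t))" for x :: "nat \<Rightarrow> real"
proof (rule continuous_on_coordinatewise_then_product)
  show "continuous_on S (\<lambda>t. (x(i := t)) j)" for j
    by (cases "j = i") (auto intro!: continuous_intros)
qed

lemma eventually_fun_upd_in:
  assumes "openin (Euclidean_space d) U" "x \<in> U" "i < d"
  shows "\<forall>\<^sub>F t in nhds (x i). x(i := t) \<in> U"
proof -
  obtain T where T: "open T" "U = T \<inter> {x. \<forall>i\<ge>d. x i = 0}"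
    using assms(1) by (auto simp: openin_Euclidean_space_iff)
  have "open ((\<lambda>t. x(i := t)) -` T)"
    using continuous_fun_upd[of UNIV x i] T(1) by (simp add: continuous_on_open_vimage)
  moreover have "x i \<in> (\<lambda>t. x(i := t)) -` T" using assms T by simp
  ultimately have "\<forall>\<^sub>F t in nhds (x i). x(i := t) \<in> T"
    by (auto simp: eventually_nhds)
  then show ?thesis
    by eventually_elim (use assms T in auto)
qed

lemma partial_cong:
  assumes "openin (Euclidean_space d) U" "x \<in> U" "i < d" "\<And>x. x \<in> U \<Longrightarrow> F x = G x"
  shows "partial i F x = partial i G x"
  unfolding partial_def
  by (rule vector_derivative_cong_eq)
     (use eventually_fun_upd_in[OF assms(1-3)] assms(4) in \<open>auto elim!: eventually_mono\<close>)

lemma has_vector_derivative_eventually_cong: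
  assumes "(f has_vector_derivative D) (at x)" "\<forall>\<^sub>F t in nhds x. f t = g t"
  shows "(g has_vector_derivative D) (at x)"
proof -
  have "\<forall>\<^sub>F t in nhds x. t \<in> UNIV \<longrightarrow> f t = g t" using assms(2) by simp
  from has_vector_derivative_cong_ev[OF this eventually_nhds_x_imp_x[OF assms(2)], of D] assms(1)
  show ?thesis by simp
qed

lemma C_k_cong:
  assumes "openin (Euclidean_space d) U" "\<And>x. x \<in> U \<Longrightarrow> F x = G x" "C_k k d U F"
  shows "C_k k d U G"
  using assms(2,3)
proof (induction k arbitrary: F G)
  case 0
  then show ?case using continuous_on_cong[of U U F G] by simp
next
  case (Suc k)
  have "(\<lambda>t. G (x(i := t))) differentiable at (x i)" if "i < d" "x \<in> U" for i x
  proof -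
    have "((\<lambda>t. F (x(i := t))) has_vector_derivative partial i F x) (at (x i))"
      using Suc.prems(2) that unfolding partial_def
      by (metis C_k.simps(2) vector_derivative_works)
    then have "((\<lambda>t. G (x(i := t))) has_vector_derivative partial i F x) (at (x i))"
      by (rule has_vector_derivative_eventually_cong)
         (use eventually_fun_upd_in[OF assms(1) that(2,1)] Suc.prems(1) in \<open>auto elim!: eventually_mono\<close>)
    then show ?thesis
      by (rule differentiableI_vector)
  qed
  moreover have "C_k k d U (partial i G)" if "i < d" for i
    using Suc.IH[of "partial i F" "partial i G"] Suc.prems that partial_cong[OF assms(1) _ that]
    by auto
  ultimately show ?case
    using Suc.prems continuous_on_cong[of U U F G] by auto
qed

text \<open>The closure properties of \<open>C_k\<close> all go through this rule: a derivative may
  be given by any formula \<open>F'\<close>, and uniqueness of derivatives identifies it with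
  \<open>partial\<close> on the open set.\<close>

lemma C_k_SucI:
  assumes "openin (Euclidean_space d) U" "continuous_on U F"
    and "\<And>i x. i < d \<Longrightarrow> x \<in> U \<Longrightarrow> ((\<lambda>t. F (x(i := t))) has_vector_derivative F' i x) (at (x i))"
    and "\<And>i. i < d \<Longrightarrow> C_k k d U (F' i)"
  shows "C_k (Suc k) d U F"
proof -
  have "C_k k d U (partial i F)" if "i < d" for i
  proof (rule C_k_cong[OF assms(1) _ assms(4)[OF that]])
    show "F' i x = partial i F x" if "x \<in> U" for x
      unfolding partial_def by (rule vector_derivative_at[OF assms(3)[OF \<open>i < d\<close> that], symmetric])
  qed
  with assms show ?thesis
    by (auto intro: differentiableI_vector)
qed

lemma C_k_SucD:
  assumes "C_k (Suc k) d U F"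
  shows "continuous_on U F"
    and "\<And>i x. i < d \<Longrightarrow> x \<in> U \<Longrightarrow> ((\<lambda>t. F (x(i := t))) has_vector_derivative partial i F x) (at (x i))"
    and "\<And>i. i < d \<Longrightarrow> C_k k d U (partial i F)"
  using assms by (auto simp: partial_def vector_derivative_works[symmetric])

lemma C_k_continuous: "C_k k d U F \<Longrightarrow> continuous_on U F"
  by (cases k) auto

lemma C_k_mono_Suc: "C_k (Suc k) d U F \<Longrightarrow> C_k k d U F"
proof (induction k arbitrary: F)
  case (Suc k)
  have "C_k k d U (partial i F)" if "i < d" for i
    using Suc.IH[of "partial i F"] Suc.prems that by auto
  moreover have "C_k (Suc (Suc k)) d U F" by (fact Suc.prems)
  ultimately show ?case by auto
qed auto

lemma C_k_subset: "C_k k d U F \<Longrightarrow> V \<subseteq> U \<Longrightarrow> C_k k d V F"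
proof (induction k arbitrary: F)
  case 0 then show ?case by (auto intro: continuous_on_subset)
next
  case (Suc k) then show ?case by (auto intro: continuous_on_subset)
qed

lemma continuous_on_eopen_local:
  assumes "openin (Euclidean_space d) U"
    and "\<And>x. x \<in> U \<Longrightarrow> \<exists>V. openin (Euclidean_space d) V \<and> x \<in> V \<and> continuous_on V F"
  shows "continuous_on U F"
proof -
  have "continuous (at x within U) F" if xU: "x \<in> U" for x
  proof -
    obtain V where V: "openin (Euclidean_space d) V" "x \<in> V" "continuous_on V F"
      using assms(2)[OF xU] by blast
    obtain T where T: "open T" "V = T \<inter> {x. \<forall>i\<ge>d. x i = 0}"
      using V(1) by (auto simp: openin_Euclidean_space_iff)
    have U: "U \<subseteq> {x. \<forall>i\<ge>d. x i = 0}"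
      using assms(1) by (auto simp: openin_Euclidean_space_iff)
    have "continuous_on (U \<inter> T) F"
      using V(3) by (rule continuous_on_subset) (use T U in auto)
    then have "continuous (at x within (U \<inter> T)) F"
      using bspec[OF iffD1[OF continuous_on_eq_continuous_within], of "U \<inter> T" F x] xU V(2) T(2) by blast
    moreover have "at x within (U \<inter> T) = at x within U"
      by (rule at_within_nhd[of x T]) (use T V in auto)
    ultimately show ?thesis by simp
  qed
  then show ?thesis by (simp add: continuous_on_eq_continuous_within)
qed

lemma C_k_local:
  assumes "openin (Euclidean_space d) U"
    and "\<And>x. x \<in> U \<Longrightarrow> \<exists>V. openin (Euclidean_space d) V \<and> x \<in> V \<and> C_k k d V F"
  shows "C_k k d U F"
  using assms(2)
proof (induction k arbitrary: F)
  case 0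
  have "continuous_on U F"
    by (rule continuous_on_eopen_local[OF assms(1)]) (use 0 in \<open>simp only: C_k.simps\<close>)
  then show ?case by simp
next
  case (Suc k)
  show ?case
  proof (rule C_k_SucI[OF assms(1), where F' = "\<lambda>i. partial i F"])
    have loc: "\<exists>V. openin (Euclidean_space d) V \<and> x \<in> V \<and> continuous_on V F \<and>
        (\<forall>i<d. ((\<lambda>t. F (x(i := t))) has_vector_derivative partial i F x) (at (x i)) \<and>
          C_k k d V (partial i F))" if xU: "x \<in> U" for x
    proof -
      obtain V where V: "openin (Euclidean_space d) V" "x \<in> V" "C_k (Suc k) d V F"
        using Suc.prems[OF xU] by (elim exE conjE)
      then show ?thesis
        using C_k_SucD[OF V(3)] by (intro exI[of _ V]) simp
    qed
    show "continuous_on U F"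
    proof (rule continuous_on_eopen_local[OF assms(1)])
      fix x assume "x \<in> U"
      from loc[OF this] show "\<exists>V. openin (Euclidean_space d) V \<and> x \<in> V \<and> continuous_on V F"
        by metis
    qed
    show "((\<lambda>t. F (x(i := t))) has_vector_derivative partial i F x) (at (x i))"
      if "i < d" "x \<in> U" for i x
      using loc[OF that(2)] that(1) by metis
    show "C_k k d U (partial i F)" if "i < d" for i
    proof (rule Suc.IH)
      fix x assume "x \<in> U"
      from loc[OF this] show "\<exists>V. openin (Euclidean_space d) V \<and> x \<in> V \<and> C_k k d V (partial i F)"
        using that by metis
    qed
  qed
qed

lemma C_k_bounded_linear:
  assumes "openin (Euclidean_space d) U" "bounded_linear L" "C_k k d U F"
  shows "C_k k d U (\<lambda>x. L (F x))"
  using assms(3)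
proof (induction k arbitrary: F)
  case 0 then show ?case by (auto intro: bounded_linear.continuous_on[OF assms(2)])
next
  case (Suc k)
  show ?case
    by (rule C_k_SucI[OF assms(1), where F' = "\<lambda>i x. L (partial i F x)"])
       (use C_k_SucD[OF Suc.prems] Suc.IH in
         \<open>auto intro: bounded_linear.continuous_on[OF assms(2)] bounded_linear.has_vector_derivative[OF assms(2)]\<close>)
qed

lemma C_k_const: "openin (Euclidean_space d) U \<Longrightarrow> C_k k d U (\<lambda>x. c)"
proof (induction k arbitrary: c)
  case (Suc k)
  show ?case
    by (rule C_k_SucI[OF Suc.prems, where F' = "\<lambda>i x. 0"]) (auto intro: Suc)
qed auto

lemma C_k_add:
  assumes "openin (Euclidean_space d) U" "C_k k d U F" "C_k k d U G"
  shows "C_k k d U (\<lambda>x. F x + G x)"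
  using assms(2,3)
proof (induction k arbitrary: F G)
  case 0 then show ?case by (auto intro: continuous_intros)
next
  case (Suc k)
  show ?case
    by (rule C_k_SucI[OF assms(1), where F' = "\<lambda>i x. partial i F x + partial i G x"])
       (use C_k_SucD[OF Suc.prems(1)] C_k_SucD[OF Suc.prems(2)] Suc.IH in
         \<open>auto intro!: continuous_intros has_vector_derivative_add\<close>)
qed

lemma C_k_sum:
  assumes "openin (Euclidean_space d) U" "\<And>a. a \<in> S \<Longrightarrow> C_k k d U (F a)"
  shows "C_k k d U (\<lambda>x. \<Sum>a\<in>S. F a x)"
  using assms(2)
  by (induction S rule: infinite_finite_induct) (auto intro: C_k_const C_k_add assms(1))

lemma C_k_mult:
  fixes F G :: "(nat \<Rightarrow> real) \<Rightarrow> real"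
  assumes "openin (Euclidean_space d) U" "C_k k d U F" "C_k k d U G"
  shows "C_k k d U (\<lambda>x. F x * G x)"
  using assms(2,3)
proof (induction k arbitrary: F G)
  case 0 then show ?case by (auto intro: continuous_intros)
next
  case (Suc k)
  show ?case
  proof (rule C_k_SucI[OF assms(1), where F' = "\<lambda>i x. F x * partial i G x + partial i F x * G x"])
    show "((\<lambda>t. F (x(i := t)) * G (x(i := t))) has_vector_derivative F x * partial i G x + partial i F x * G x) (at (x i))"
      if "i < d" "x \<in> U" for i x
      using has_vector_derivative_mult[OF C_k_SucD(2)[OF Suc.prems(1) that] C_k_SucD(2)[OF Suc.prems(2) that]]
      by (simp only: fun_upd_triv)
    show "C_k k d U (\<lambda>x. F x * partial i G x + partial i F x * G x)" if "i < d" for i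
      by (intro C_k_add Suc.IH assms(1) C_k_mono_Suc[OF Suc.prems(1)] C_k_mono_Suc[OF Suc.prems(2)]
            C_k_SucD(3)[OF Suc.prems(1) that] C_k_SucD(3)[OF Suc.prems(2) that])
  qed (use C_k_SucD[OF Suc.prems(1)] C_k_SucD[OF Suc.prems(2)] in \<open>auto intro!: continuous_intros\<close>)
qed

lemma C_k_coord: "openin (Euclidean_space d) U \<Longrightarrow> C_k k d U (\<lambda>x. x i)"
proof (cases k)
  case 0 then show ?thesis by (auto intro: continuous_on_subset[OF continuous_on_product_coordinates])
next
  case (Suc l)
  assume U: "openin (Euclidean_space d) U"
  show ?thesis unfolding Suc
  proof (rule C_k_SucI[OF U, where F' = "\<lambda>j x. if j = i then 1 else 0"])
    show "C_k l d U (\<lambda>x. if j = i then 1 else 0)" if "j < d" for j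
      by (rule C_k_const[OF U])
    show "((\<lambda>t. (x(j := t)) i) has_vector_derivative (if j = i then 1 else 0)) (at (x j))" for j x
      by (cases "j = i") auto
  qed (auto intro: continuous_on_subset[OF continuous_on_product_coordinates])
qed

text \<open>The sequence \<open>g\<close> consists of a function on the line and its successive derivatives.\<close>

lemma C_k_compose_real:
  fixes F :: "(nat \<Rightarrow> real) \<Rightarrow> real" and g :: "nat \<Rightarrow> real \<Rightarrow> real"
  assumes "openin (Euclidean_space d) U"
    and g: "\<And>j t. t \<in> I \<Longrightarrow> (g j has_real_derivative g (Suc j) t) (at t)"
    and F: "\<And>x. x \<in> U \<Longrightarrow> F x \<in> I" "C_k k d U F"
  shows "C_k k d U (\<lambda>x. g j (F x))"
  using F
proof (induction k arbitrary: j)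
  have cont: "continuous_on I (g j)" for j
    using g by (auto intro!: DERIV_isCont continuous_at_imp_continuous_on)
  {
    case 0
    then show ?case by (auto intro!: continuous_on_compose2[OF cont])
  next
    case (Suc k)
    show ?case
    proof (rule C_k_SucI[OF assms(1), where F' = "\<lambda>i x. g (Suc j) (F x) * partial i F x"])
      show "continuous_on U (\<lambda>x. g j (F x))"
        using Suc.prems C_k_SucD(1) by (auto intro!: continuous_on_compose2[OF cont])
      show "((\<lambda>t. g j (F (x(i := t)))) has_vector_derivative g (Suc j) (F x) * partial i F x) (at (x i))"
        if "i < d" "x \<in> U" for i x
      proof -
        have "((\<lambda>t. F (x(i := t))) has_real_derivative partial i F x) (at (x i))"
          unfolding has_real_derivative_iff_has_vector_derivative by (rule C_k_SucD(2)[OF Suc.prems(2) that])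
        moreover have "(g j has_real_derivative g (Suc j) (F x)) (at (F (x(i := x i))))"
          using g[OF Suc.prems(1)[OF that(2)], of j] by (simp only: fun_upd_triv)
        ultimately show ?thesis
          unfolding has_real_derivative_iff_has_vector_derivative[symmetric] by (rule DERIV_chain2[rotated])
      qed
      show "C_k k d U (\<lambda>x. g (Suc j) (F x) * partial i F x)" if "i < d" for i
        by (intro C_k_mult assms(1) Suc.IH C_k_SucD(3)[OF Suc.prems(2) that] C_k_mono_Suc[OF Suc.prems(2)] Suc.prems(1))
    qed
  }
qed

lemma C_k_powr:
  fixes F :: "(nat \<Rightarrow> real) \<Rightarrow> real"
  assumes "openin (Euclidean_space d) U" "\<And>x. x \<in> U \<Longrightarrow> F x > 0" "C_k k d U F"
  shows "C_k k d U (\<lambda>x. F x powr a)"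
proof -
  \<comment> \<open>\<open>?g j\<close> is the \<open>j\<close>-th derivative of the power function;
    the product is the falling factorial of \<open>a\<close>.\<close>
  let ?g = "\<lambda>j t. (\<Prod>l<j. a - real l) * t powr (a - real j)"
  have "(?g j has_real_derivative ?g (Suc j) t) (at t)" if "t \<in> {0<..}" for j t
    using that by (auto intro!: derivative_eq_intros simp: algebra_simps)
  from C_k_compose_real[of d U "{0<..}" ?g F k 0, OF assms(1) this] assms
  show ?thesis by simp
qed

text \<open>Written as \<open>F\<close> times the inverse of \<open>F * F\<close>, because
  \<open>powr\<close> is differentiated at positive arguments while \<open>F\<close> may have either
  sign.\<close>

lemma C_k_inverse:
  fixes F :: "(nat \<Rightarrow> real) \<Rightarrow> real"
  assumes "openin (Euclidean_space d) U" "\<And>x. x \<in> U \<Longrightarrow> F x \<noteq> 0" "C_k k d U F"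
  shows "C_k k d U (\<lambda>x. inverse (F x))"
proof (rule C_k_cong[OF assms(1)])
  show "C_k k d U (\<lambda>x. F x * (F x * F x) powr (-1))"
    by (intro C_k_mult C_k_powr assms(1,3)) (use assms(2) not_real_square_gt_zero in blast)
  show "F x * (F x * F x) powr (-1) = inverse (F x)" if "x \<in> U" for x
    using assms(2)[OF that] by (simp add: powr_minus field_simps)
qed

section \<open>First-order expansion and the chain rule\<close>

lemma eopen_contains_box:
  assumes "openin (Euclidean_space d) U" "x \<in> U"
  obtains \<delta> where "\<delta> > 0" "\<And>y. (\<forall>i\<ge>d. y i = 0) \<Longrightarrow> (\<forall>i<d. \<bar>y i - x i\<bar> \<le> \<delta>) \<Longrightarrow> y \<in> U"
proof -
  obtain T where T: "open T" "U = T \<inter> {x. \<forall>i\<ge>d. x i = 0}"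
    using assms(1) by (auto simp: openin_Euclidean_space_iff)
  have "openin (product_topology (\<lambda>i. euclidean) UNIV) T"
    using T(1) by (simp add: euclidean_product_topology)
  from product_topology_open_contains_basis[OF this, of x] assms T
  obtain X where X: "x \<in> (\<Pi>\<^sub>E i\<in>UNIV. X i)" "\<And>i. open (X i)" "(\<Pi>\<^sub>E i\<in>UNIV. X i) \<subseteq> T"
    by auto
  have "\<exists>e>0. cball (x i) e \<subseteq> X i" for i
    using X(1,2) open_contains_cball[of "X i"] by (auto simp: PiE_def)
  then obtain e where e: "\<And>i. e i > 0" "\<And>i. cball (x i) (e i) \<subseteq> X i" by metis
  define \<delta> where "\<delta> = Min (insert 1 (e ` {..<d}))"
  have \<delta>: "\<delta> > 0" "\<And>i. i < d \<Longrightarrow> \<delta> \<le> e i"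
    using e by (auto simp: \<delta>_def)
  show ?thesis
  proof (rule that[OF \<delta>(1)])
    fix y assume y: "\<forall>i\<ge>d. y i = 0" "\<forall>i<d. \<bar>y i - x i\<bar> \<le> \<delta>"
    have "y i \<in> X i" for i
    proof (cases "i < d")
      case True
      then have "dist (x i) (y i) \<le> e i"
        using y(2) \<delta>(2)[of i] by (force simp: dist_real_def)
      then show ?thesis using e(2)[of i] by auto
    next
      case False
      then have "y i = x i" using y assms T by auto
      then show ?thesis using X(1) by auto
    qed
    then show "y \<in> U" using X(3) T y by auto
  qed
qed

text \<open>Total differentiability at \<open>x\<close>, stated as an estimate in the coordinates
  since points are functions on \<open>nat\<close>. Continuity of the partial derivatives keeps them
  within \<epsilon> of their values at \<open>x\<close>, and the mean value inequality is applied to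
  one coordinate at a time.\<close>

lemma C_1_estimate:
  fixes F :: "(nat \<Rightarrow> real) \<Rightarrow> real"
  assumes U: "openin (Euclidean_space d) U" and x: "x \<in> U" and F: "C_k 1 d U F" and "\<epsilon> > 0"
  obtains \<delta> where "\<delta> > 0"
    "\<And>y. (\<forall>i\<ge>d. y i = 0) \<Longrightarrow> (\<forall>i<d. \<bar>y i - x i\<bar> \<le> \<delta>) \<Longrightarrow>
       \<bar>F y - F x - (\<Sum>i<d. (y i - x i) * partial i F x)\<bar> \<le> \<epsilon> * (\<Sum>i<d. \<bar>y i - x i\<bar>)"
proof -
  have F': "continuous_on U (partial i F)" if "i < d" for i
    using C_k_SucD(3)[of 0 d U F i] F that by simp
  obtain T where T: "open T" "U = T \<inter> {x. \<forall>i\<ge>d. x i = 0}"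
    using U by (auto simp: openin_Euclidean_space_iff)
  define V where "V = {y \<in> U. \<forall>i<d. \<bar>partial i F y - partial i F x\<bar> < \<epsilon>}"
  have "openin (top_of_set U) {y \<in> U. \<forall>i<d. \<bar>partial i F y - partial i F x\<bar> < \<epsilon>}"
  proof -
    have "openin (top_of_set U) (\<Inter>i\<in>{..<d}. {y\<in>U. \<bar>partial i F y - partial i F x\<bar> < \<epsilon>})" if "d > 0"
    proof (rule openin_INT2)
      fix i assume "i \<in> {..<d}"
      then have "continuous_on U (\<lambda>y. \<bar>partial i F y - partial i F x\<bar>)"
        by (intro continuous_intros F') auto
      from continuous_openin_preimage_gen[OF this, of "{..<\<epsilon>}"]
      show "openin (top_of_set U) {y\<in>U. \<bar>partial i F y - partial i F x\<bar> < \<epsilon>}"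
        using open_lessThan[of \<epsilon>] by (simp add: vimage_def Int_def)
    qed (use that in auto)
    moreover have "(\<Inter>i\<in>{..<d}. {y\<in>U. \<bar>partial i F y - partial i F x\<bar> < \<epsilon>}) =
       {y \<in> U. \<forall>i<d. \<bar>partial i F y - partial i F x\<bar> < \<epsilon>}" if "d > 0" using that by auto
    ultimately show ?thesis by (cases "d = 0") auto
  qed
  then obtain T' where "open T'" "V = U \<inter> T'" unfolding V_def by (auto simp: openin_open)
  then have V: "openin (Euclidean_space d) V"
    using T unfolding openin_Euclidean_space_iff by (intro exI[of _ "T \<inter> T'"]) auto
  have "x \<in> V" using x \<open>\<epsilon> > 0\<close> by (auto simp: V_def)
  from eopen_contains_box[OF V this] obtain \<delta> where \<delta>: "\<delta> > 0"
    "\<And>y. (\<forall>i\<ge>d. y i = 0) \<Longrightarrow> (\<forall>i<d. \<bar>y i - x i\<bar> \<le> \<delta>) \<Longrightarrow> y \<in> V" by metis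
  show ?thesis
  proof (rule that[OF \<delta>(1)])
    fix y assume y: "\<forall>i\<ge>d. y i = 0" "\<forall>i<d. \<bar>y i - x i\<bar> \<le> \<delta>"
    have x0: "\<forall>i\<ge>d. x i = 0" using x T by auto
    \<comment> \<open>\<open>z 0, ..., z d\<close> leads from \<open>x\<close> to \<open>y\<close>
      and changes one coordinate in each step; the segments stay in the box, hence in
      \<open>V\<close>.\<close>
    define z where "z j = (\<lambda>i. if i < j then y i else x i)" for j :: nat
    have z: "z 0 = x" "z d = y" using y x0 by (auto simp: z_def fun_eq_iff)
    have step: "\<bar>F (z (Suc j)) - F (z j) - (y j - x j) * partial j F x\<bar> \<le> \<epsilon> * \<bar>y j - x j\<bar>"
      if "j < d" for j
    proof -
      have zz: "z (Suc j) = (z j)(j := y j)" "z j = (z j)(j := x j)"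
        by (auto simp: z_def fun_eq_iff less_Suc_eq)
      let ?S = "closed_segment (x j) (y j)"
      have inV: "(z j)(j := t) \<in> V" if "t \<in> ?S" for t
      proof (rule \<delta>(2))
        have "\<bar>t - x j\<bar> \<le> \<bar>y j - x j\<bar>"
          using that by (auto simp: closed_segment_eq_real_ivl split: if_splits)
        also have "\<dots> \<le> \<delta>" using y \<open>j < d\<close> by auto
        finally show "\<forall>i<d. \<bar>((z j)(j := t)) i - x i\<bar> \<le> \<delta>"
          using y \<delta>(1) by (auto simp: z_def)
        show "\<forall>i\<ge>d. ((z j)(j := t)) i = 0"
          using y x0 \<open>j < d\<close> by (auto simp: z_def)
      qed
      have "norm ((F ((z j)(j := y j)) - y j * partial j F x) - (F ((z j)(j := x j)) - x j * partial j F x))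
          \<le> \<epsilon> * norm (y j - x j)"
      proof (rule field_differentiable_bound[of ?S])
        show "((\<lambda>t. F ((z j)(j := t)) - t * partial j F x) has_field_derivative
            (partial j F ((z j)(j := t)) - partial j F x)) (at t within ?S)" if "t \<in> ?S" for t
        proof -
          have "((\<lambda>s. F (((z j)(j := t))(j := s))) has_vector_derivative partial j F ((z j)(j := t))) (at (((z j)(j := t)) j))"
            using C_k_SucD(2)[OF F[unfolded One_nat_def] \<open>j < d\<close>, of "(z j)(j := t)"] inV[OF that]
            unfolding V_def by (simp only: mem_Collect_eq)
          then have "((\<lambda>s. F ((z j)(j := s))) has_real_derivative partial j F ((z j)(j := t))) (at t within ?S)"
            by (simp add: has_real_derivative_iff_has_vector_derivative has_vector_derivative_at_within)
          then show ?thesis by (auto intro!: derivative_eq_intros)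
        qed
        show "norm (partial j F ((z j)(j := t)) - partial j F x) \<le> \<epsilon>" if "t \<in> ?S" for t
          using inV[OF that] \<open>j < d\<close> by (auto simp: V_def intro: less_imp_le)
      qed auto
      then show ?thesis using zz by (simp add: algebra_simps)
    qed
    have "F y - F x - (\<Sum>i<d. (y i - x i) * partial i F x) =
        (\<Sum>j<d. F (z (Suc j)) - F (z j) - (y j - x j) * partial j F x)"
      using sum_lessThan_telescope[of "\<lambda>j. F (z j)" d] z by (simp add: sum_subtractf)
    also have "\<bar>\<dots>\<bar> \<le> (\<Sum>j<d. \<epsilon> * \<bar>y j - x j\<bar>)"
      by (rule order_trans[OF sum_abs sum_mono]) (use step in auto)
    finally show "\<bar>F y - F x - (\<Sum>i<d. (y i - x i) * partial i F x)\<bar> \<le> \<epsilon> * (\<Sum>i<d. \<bar>y i - x i\<bar>)"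
      by (simp add: sum_distrib_left)
  qed
qed

lemma has_derivative_C_1_compose:
  fixes F :: "(nat \<Rightarrow> real) \<Rightarrow> real" and \<gamma> :: "'z::real_normed_vector \<Rightarrow> nat \<Rightarrow> real"
  assumes U: "openin (Euclidean_space d) U" and F: "C_k 1 d U F" and "\<gamma> z \<in> U"
    and \<gamma>0: "\<And>z i. i \<ge> d \<Longrightarrow> \<gamma> z i = 0"
    and \<gamma>: "\<And>i. i < d \<Longrightarrow> ((\<lambda>z. \<gamma> z i) has_derivative \<gamma>' i) (at z)"
  shows "((\<lambda>z. F (\<gamma> z)) has_derivative (\<lambda>h. \<Sum>i<d. \<gamma>' i h * partial i F (\<gamma> z))) (at z)"
  unfolding has_derivative_at_alt
proof (intro conjI allI impI)
  let ?P = "\<lambda>i. partial i F (\<gamma> z)"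
  have bl: "bounded_linear (\<gamma>' i)" if "i < d" for i
    using \<gamma>[OF that] by (rule has_derivative_bounded_linear)
  show "bounded_linear (\<lambda>h. \<Sum>i<d. \<gamma>' i h * ?P i)"
    by (rule bounded_linear_sum) (use bl in \<open>auto intro: bounded_linear_mult_const\<close>)
  fix e :: real assume "e > 0"
  have "\<exists>K. \<forall>h. norm (\<gamma>' i h) \<le> K * norm h" if "i < d" for i
    using bounded_linear.bounded[OF bl[OF that]] by (metis mult.commute)
  then obtain K where K: "\<And>i h. i < d \<Longrightarrow> norm (\<gamma>' i h) \<le> K i * norm h" by metis
  \<comment> \<open>\<open>M\<close> bounds the sum of the increments of the coordinates of \<gamma>
    in units of \<open>norm (y - z)\<close>, and \<open>R\<close> the sum of the absolute partial
    derivatives of \<open>F\<close>. One half of \<open>e\<close> is spent on the expansion of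
    \<open>F\<close> (divided by \<open>M\<close>), the other on that of \<gamma> (divided by
    \<open>R\<close>).\<close>
  define M where "M = (\<Sum>i<d. \<bar>K i\<bar> + 1) + 1"
  define R where "R = (\<Sum>i<d. \<bar>?P i\<bar>) + 1"
  have M: "M > 0" and R: "R > 0" by (auto simp: M_def R_def intro!: add_nonneg_pos sum_nonneg)
  obtain \<delta> where \<delta>: "\<delta> > 0" "\<And>y. (\<forall>i\<ge>d. y i = 0) \<Longrightarrow> (\<forall>i<d. \<bar>y i - \<gamma> z i\<bar> \<le> \<delta>) \<Longrightarrow>
       \<bar>F y - F (\<gamma> z) - (\<Sum>i<d. (y i - \<gamma> z i) * ?P i)\<bar> \<le> (e / 2 / M) * (\<Sum>i<d. \<bar>y i - \<gamma> z i\<bar>)"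
    using C_1_estimate[OF U \<open>\<gamma> z \<in> U\<close> F, of "e / 2 / M"] \<open>e > 0\<close> M by auto
  define \<eta> where "\<eta> = min 1 (e / 2 / R)"
  have \<eta>: "\<eta> > 0" "\<eta> \<le> 1" "\<eta> * R \<le> e / 2" using \<open>e > 0\<close> R by (auto simp: \<eta>_def min_def field_simps)
  have "\<exists>r>0. \<forall>y. norm (y - z) < r \<longrightarrow> norm (\<gamma> y i - \<gamma> z i - \<gamma>' i (y - z)) \<le> \<eta> * norm (y - z)" if "i < d" for i
    using \<gamma>[OF that] \<eta>(1) unfolding has_derivative_at_alt by blast
  then obtain r where r: "\<And>i. i < d \<Longrightarrow> r i > 0"
    "\<And>i y. i < d \<Longrightarrow> norm (y - z) < r i \<Longrightarrow> norm (\<gamma> y i - \<gamma> z i - \<gamma>' i (y - z)) \<le> \<eta> * norm (y - z)"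
    by metis
  define \<rho> where "\<rho> = Min (insert (\<delta> / M) (r ` {..<d}))"
  have \<rho>: "\<rho> > 0" "\<rho> \<le> \<delta> / M" "\<And>i. i < d \<Longrightarrow> \<rho> \<le> r i"
    using r(1) \<delta>(1) M by (auto simp: \<rho>_def)
  show "\<exists>da>0. \<forall>y. norm (y - z) < da \<longrightarrow>
      norm (F (\<gamma> y) - F (\<gamma> z) - (\<Sum>i<d. \<gamma>' i (y - z) * ?P i)) \<le> e * norm (y - z)"
  proof (intro exI[of _ \<rho>] conjI allI impI \<rho>(1))
    fix y assume y: "norm (y - z) < \<rho>"
    have lip: "\<bar>\<gamma> y i - \<gamma> z i\<bar> \<le> (\<bar>K i\<bar> + 1) * norm (y - z)" if "i < d" for i
    proof -
      have "\<bar>\<gamma> y i - \<gamma> z i\<bar> \<le> \<bar>\<gamma>' i (y - z)\<bar> + \<bar>\<gamma> y i - \<gamma> z i - \<gamma>' i (y - z)\<bar>" by linarith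
      also have "\<dots> \<le> K i * norm (y - z) + \<eta> * norm (y - z)"
        using K[OF that, of "y - z"] r(2)[OF that, of y] \<rho>(3)[OF that] y by auto
      also have "\<dots> \<le> \<bar>K i\<bar> * norm (y - z) + 1 * norm (y - z)"
        by (intro add_mono mult_right_mono \<eta>) auto
      finally show ?thesis by (simp add: algebra_simps)
    qed
    have sum_lip: "(\<Sum>i<d. \<bar>\<gamma> y i - \<gamma> z i\<bar>) \<le> M * norm (y - z)"
    proof -
      have "(\<Sum>i<d. \<bar>\<gamma> y i - \<gamma> z i\<bar>) \<le> (\<Sum>i<d. \<bar>K i\<bar> + 1) * norm (y - z)"
        unfolding sum_distrib_right by (rule sum_mono) (use lip in auto)
      also have "\<dots> \<le> M * norm (y - z)" by (rule mult_right_mono) (auto simp: M_def)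
      finally show ?thesis .
    qed
    have "\<bar>\<gamma> y i - \<gamma> z i\<bar> \<le> \<delta>" if "i < d" for i
    proof -
      have "\<bar>\<gamma> y i - \<gamma> z i\<bar> \<le> (\<Sum>i<d. \<bar>\<gamma> y i - \<gamma> z i\<bar>)"
        using that by (intro member_le_sum) auto
      also have "\<dots> \<le> M * norm (y - z)" by (rule sum_lip)
      also have "\<dots> \<le> M * (\<delta> / M)" using y \<rho>(2) M by (intro mult_left_mono) auto
      finally show ?thesis using M by simp
    qed
    then have 1: "\<bar>F (\<gamma> y) - F (\<gamma> z) - (\<Sum>i<d. (\<gamma> y i - \<gamma> z i) * ?P i)\<bar> \<le> (e / 2 / M) * (M * norm (y - z))"
      by (intro order_trans[OF \<delta>(2)] mult_left_mono sum_lip) (use \<gamma>0 \<open>e > 0\<close> M in auto)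
    have "\<bar>(\<Sum>i<d. (\<gamma> y i - \<gamma> z i) * ?P i) - (\<Sum>i<d. \<gamma>' i (y - z) * ?P i)\<bar>
        = \<bar>\<Sum>i<d. (\<gamma> y i - \<gamma> z i - \<gamma>' i (y - z)) * ?P i\<bar>"
      by (simp add: sum_subtractf left_diff_distrib)
    also have "\<dots> \<le> (\<Sum>i<d. (\<eta> * norm (y - z)) * \<bar>?P i\<bar>)"
    proof (rule order_trans[OF sum_abs sum_mono])
      fix i assume "i \<in> {..<d}"
      then show "\<bar>(\<gamma> y i - \<gamma> z i - \<gamma>' i (y - z)) * ?P i\<bar> \<le> (\<eta> * norm (y - z)) * \<bar>?P i\<bar>"
        using r(2)[of i y] \<rho>(3)[of i] y by (auto simp: abs_mult intro!: mult_right_mono)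
    qed
    also have "\<dots> \<le> \<eta> * norm (y - z) * R"
      unfolding sum_distrib_left[symmetric] R_def using \<eta> by (intro mult_left_mono) auto
    also have "\<dots> \<le> e / 2 * norm (y - z)"
      using mult_right_mono[OF \<eta>(3), of "norm (y - z)"] by (simp add: mult_ac)
    finally have 2: "\<bar>(\<Sum>i<d. (\<gamma> y i - \<gamma> z i) * ?P i) - (\<Sum>i<d. \<gamma>' i (y - z) * ?P i)\<bar> \<le> e / 2 * norm (y - z)" .
    show "norm (F (\<gamma> y) - F (\<gamma> z) - (\<Sum>i<d. \<gamma>' i (y - z) * ?P i)) \<le> e * norm (y - z)"
    proof -
      have "(e / 2 / M) * (M * norm (y - z)) + e / 2 * norm (y - z) = e * norm (y - z)"
        using M by (simp add: field_simps)
      then show ?thesis using 1 2 unfolding real_norm_def by linarith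
    qed
  qed
qed

lemma C_k_compose:
  fixes F :: "(nat \<Rightarrow> real) \<Rightarrow> real"
  assumes U: "openin (Euclidean_space n) U" and W: "openin (Euclidean_space d) W"
    and g: "\<And>w. w \<in> W \<Longrightarrow> g w \<in> U" "\<And>j. j < n \<Longrightarrow> C_k k d W (\<lambda>w. g w j)"
    and F: "C_k k n U F"
  shows "C_k k d W (\<lambda>w. F (g w))"
  using g(2) F
proof (induction k arbitrary: F)
  have U0: "x i = 0" if "x \<in> U" "i \<ge> n" for x i
    using U that by (auto simp: openin_Euclidean_space_iff)
  have cont: "continuous_on W (\<lambda>w. F (g w))" if "\<And>j. j < n \<Longrightarrow> continuous_on W (\<lambda>w. g w j)"
    "continuous_on U F" for F :: "(nat \<Rightarrow> real) \<Rightarrow> real"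
  proof (rule continuous_on_compose2[OF that(2)])
    show "continuous_on W g"
    proof (rule continuous_on_coordinatewise_then_product)
      fix j show "continuous_on W (\<lambda>w. g w j)"
      proof (cases "j < n")
        case False
        then show ?thesis using g(1) U0 by (subst continuous_on_cong[of W W _ "\<lambda>w. 0"]) auto
      qed (use that in auto)
    qed
  qed (use g(1) in auto)
  {
    case 0 then show ?case using cont by auto
  next
    case (Suc k)
    show ?case
    proof (rule C_k_SucI[OF W, where F' = "\<lambda>i w. \<Sum>j<n. partial i (\<lambda>w. g w j) w * partial j F (g w)"])
      show "continuous_on W (\<lambda>w. F (g w))"
        using cont Suc.prems C_k_continuous by blast
      show "C_k k d W (\<lambda>w. \<Sum>j<n. partial i (\<lambda>w. g w j) w * partial j F (g w))" if "i < d" for i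
      proof (intro C_k_sum C_k_mult W)
        fix j assume j: "j \<in> {..<n}"
        show "C_k k d W (partial i (\<lambda>w. g w j))"
          using C_k_SucD(3)[OF Suc.prems(1) that] j by auto
        show "C_k k d W (\<lambda>w. partial j F (g w))"
          by (rule Suc.IH) (use Suc.prems C_k_mono_Suc C_k_SucD(3) j in blast)+
      qed
      show "((\<lambda>t. F (g (w(i := t)))) has_vector_derivative (\<Sum>j<n. partial i (\<lambda>w. g w j) w * partial j F (g w))) (at (w i))"
        if i: "i < d" and w: "w \<in> W" for i w
      proof -
        \<comment> \<open>The curve \<open>t \<mapsto> g (w(i := t))\<close>, with the coordinates
          from \<open>n\<close> on set to 0: the chain rule asks for this at every \<open>t\<close>,
          whereas \<open>g\<close> is known to map into \<open>U\<close> only on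
          \<open>W\<close>.\<close>
        define \<gamma> where "\<gamma> t j = (if j < n then g (w(i := t)) j else 0)" for t j
        have \<gamma>: "\<gamma> t = g (w(i := t))" if "w(i := t) \<in> W" for t
          using g(1)[OF that] U0 by (auto simp: \<gamma>_def fun_eq_iff)
        have \<gamma>w: "\<gamma> (w i) = g w" using \<gamma>[of "w i"] w by simp
        have "C_k 1 n U F"
          using Suc.prems(2)
        proof (induction k)
          case (Suc k) then show ?case using C_k_mono_Suc by blast
        qed simp
        then have "((\<lambda>t. F (\<gamma> t)) has_derivative (\<lambda>h. \<Sum>j<n. h *\<^sub>R partial i (\<lambda>w. g w j) w * partial j F (\<gamma> (w i)))) (at (w i))"
        proof (rule has_derivative_C_1_compose[OF U])
          show "\<gamma> (w i) \<in> U" using \<gamma>w g(1)[OF w] by simp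
          fix j assume "j < n"
          then show "((\<lambda>t. \<gamma> t j) has_derivative (\<lambda>h. h *\<^sub>R partial i (\<lambda>w. g w j) w)) (at (w i))"
            using C_k_SucD(2)[OF Suc.prems(1) i w, of j] unfolding \<gamma>_def has_vector_derivative_def by (simp only: if_True)
        qed (auto simp: \<gamma>_def)
        then have "((\<lambda>t. F (\<gamma> t)) has_vector_derivative (\<Sum>j<n. partial i (\<lambda>w. g w j) w * partial j F (g w))) (at (w i))"
          by (simp add: has_vector_derivative_def \<gamma>w sum_distrib_left mult.assoc)
        then show ?thesis
          by (rule has_vector_derivative_eventually_cong)
             (use eventually_fun_upd_in[OF W w i] \<gamma> in \<open>auto elim!: eventually_mono\<close>)
      qed
    qed
  }
qed

section \<open>The area formula\<close>

text \<open>The change of variables formula for injective maps, put into the language of nonnegative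
  integrals. Boundedness of the image makes its measure finite, as the formula with real integrals
  requires.\<close>

lemma emeasure_injective_differentiable_image:
  fixes \<Phi> :: "real^'e::{finite,wellorder} \<Rightarrow> real^'e::_"
  assumes C: "C \<in> sets lebesgue" and der: "\<And>z. z \<in> C \<Longrightarrow> (\<Phi> has_derivative \<Phi>' z) (at z)"
    and inj: "inj_on \<Phi> C" and bdd: "bounded (\<Phi> ` C)"
  shows "\<Phi> ` C \<in> sets lebesgue"
    and "emeasure lebesgue (\<Phi> ` C) = (\<integral>\<^sup>+z. indicator C z * ennreal \<bar>Determinants.det (matrix (\<Phi>' z))\<bar> \<partial>lebesgue)"
proof -
  have derC: "(\<Phi> has_derivative \<Phi>' z) (at z within C)" if "z \<in> C" for z
    using der[OF that] by (rule has_derivative_at_withinI)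
  then have "\<Phi> differentiable_on C" by (auto simp: differentiable_on_def differentiable_def)
  then show L: "\<Phi> ` C \<in> sets lebesgue"
    by (intro differentiable_image_in_sets_lebesgue C) auto
  then have lm: "\<Phi> ` C \<in> lmeasurable" using bdd by (simp add: bounded_set_imp_lmeasurable)
  with has_measure_differentiable_image[OF C derC inj]
  have "((\<lambda>z. \<bar>Determinants.det (matrix (\<Phi>' z))\<bar>) has_integral measure lebesgue (\<Phi> ` C)) C" by blast
  from nn_integral_has_integral_lebesgue[OF _ this]
  have "(\<integral>\<^sup>+z. ennreal (indicator C z * \<bar>Determinants.det (matrix (\<Phi>' z))\<bar>) \<partial>lborel) = ennreal (measure lebesgue (\<Phi> ` C))"
    by simp
  also have "\<dots> = emeasure lebesgue (\<Phi> ` C)"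
    using lm by (simp add: emeasure_eq_measure2 fmeasurableD2)
  finally show "emeasure lebesgue (\<Phi> ` C) = (\<integral>\<^sup>+z. indicator C z * ennreal \<bar>Determinants.det (matrix (\<Phi>' z))\<bar> \<partial>lebesgue)"
    by (simp add: nn_integral_completion ennreal_mult' ennreal_indicator)
qed

text \<open>A continuously varying invertible derivative makes \<Phi> injective on a small ball
  around each point, and by Lindelof's theorem countably many of these balls suffice.\<close>

lemma countable_injectivity_cover:
  fixes \<Phi> :: "real^'e::{finite,wellorder} \<Rightarrow> real^'e::_"
  assumes R: "open R" and der: "\<And>z. z \<in> R \<Longrightarrow> (\<Phi> has_derivative \<Phi>' z) (at z)"
    and cont: "\<And>i j. continuous_on R (\<lambda>z. vec_nth (vec_nth (matrix (\<Phi>' z)) i) j)"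
    and det: "\<And>z. z \<in> R \<Longrightarrow> Determinants.det (matrix (\<Phi>' z)) \<noteq> 0"
  shows "\<exists>O' :: nat \<Rightarrow> (real^'e::_) set.
    (\<forall>j. open (O' j)) \<and> (\<forall>j. inj_on \<Phi> (O' j)) \<and> (\<Union>j. O' j) = R"
proof -
  define \<F> where "\<F> = {ball z r | z r. ball z r \<subseteq> R \<and> inj_on \<Phi> (ball z r)}"
  have lin: "bounded_linear (\<Phi>' z)" if "z \<in> R" for z
    using der[OF that] by (rule has_derivative_bounded_linear)
  have loc: "\<exists>r>0. ball a r \<subseteq> R \<and> inj_on \<Phi> (ball a r)" if a: "a \<in> R" for a
  proof -
    obtain s where s: "s > 0" "ball a s \<subseteq> R" using R a open_contains_ball by blast
    let ?A = "matrix (\<Phi>' a)"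
    have "invertible ?A" using det[OF a] by (simp add: invertible_det_nz)
    then obtain A' where A': "A' ** ?A = Finite_Cartesian_Product.mat 1" by (auto simp: invertible_def)
    have "\<exists>r>0. ball a r \<subseteq> ball a s \<and> inj_on \<Phi> (ball a r)"
    proof (rule has_derivative_locally_injective[of a "ball a s" "(*v) A'" "\<lambda>x. if x \<in> ball a s then \<Phi>' x else \<Phi>' a" \<Phi>])
      show "(*v) A' \<circ> (if a \<in> ball a s then \<Phi>' a else \<Phi>' a) = id"
      proof
        fix v
        have "\<Phi>' a v = ?A *v v" using matrix_vector_mul(3)[OF lin[OF a]] by metis
        then show "((*v) A' \<circ> (if a \<in> ball a s then \<Phi>' a else \<Phi>' a)) v = id v"
          using A' by (simp add: matrix_vector_mul_assoc)
      qed
      fix e :: real assume e: "e > 0"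
      \<comment> \<open>The number of matrix entries: entries below \<open>e / (2 * N)\<close> give
        an operator norm of at most \<open>e / 2\<close>.\<close>
      define N where "N = real CARD('e) * real CARD('e)"
      have N: "N > 0" by (simp add: N_def)
      have "\<exists>d>0. \<forall>x\<in>ball a s. dist a x < d \<longrightarrow> \<bar>vec_nth (vec_nth (matrix (\<Phi>' x)) i) j - vec_nth (vec_nth ?A i) j\<bar> < e / (2 * N)" for i j
      proof -
        have "continuous_on (ball a s) (\<lambda>z. vec_nth (vec_nth (matrix (\<Phi>' z)) i) j)"
          using cont continuous_on_subset s(2) by blast
        then show ?thesis
          unfolding continuous_on_iff dist_real_def using s(1) e N
          by (metis centre_in_ball dist_commute divide_pos_pos mult_pos_pos zero_less_numeral)
      qed
      then obtain \<delta> where \<delta>: "\<And>i j. \<delta> i j > 0"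
        "\<And>i j x. x \<in> ball a s \<Longrightarrow> dist a x < \<delta> i j \<Longrightarrow> \<bar>vec_nth (vec_nth (matrix (\<Phi>' x)) i) j - vec_nth (vec_nth ?A i) j\<bar> < e / (2 * N)"
        by metis
      define D where "D = Min (range (\<lambda>(i, j). \<delta> i j))"
      have D: "D > 0" "\<And>i j. D \<le> \<delta> i j"
      proof -
        show "D > 0" using \<delta>(1) by (auto simp: D_def)
        have "\<delta> i j \<in> range (\<lambda>(i, j). \<delta> i j)" for i j by (rule image_eqI[of _ _ "(i, j)"]) auto
        then show "D \<le> \<delta> i j" for i j unfolding D_def by (intro Min_le) auto
      qed
      show "\<exists>d>0. \<forall>x. dist a x < d \<longrightarrow> onorm (\<lambda>v. (if x \<in> ball a s then \<Phi>' x else \<Phi>' a) v - (if a \<in> ball a s then \<Phi>' a else \<Phi>' a) v) < e"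
      proof (intro exI[of _ D] conjI D(1) allI impI)
        fix x assume x: "dist a x < D"
        show "onorm (\<lambda>v. (if x \<in> ball a s then \<Phi>' x else \<Phi>' a) v - (if a \<in> ball a s then \<Phi>' a else \<Phi>' a) v) < e"
        proof (cases "x \<in> ball a s")
          case True
          then have xR: "x \<in> R" using s by auto
          have "(\<lambda>v. \<Phi>' x v - \<Phi>' a v) = (*v) (matrix (\<Phi>' x) - ?A)"
            using fun_cong[OF matrix_vector_mul(3)[OF lin[OF a]]] fun_cong[OF matrix_vector_mul(3)[OF lin[OF xR]]]
            by (intro ext) (simp add: matrix_vector_mult_diff_rdistrib)
          moreover have "onorm ((*v) (matrix (\<Phi>' x) - ?A)) \<le> real CARD('e) * real CARD('e) * (e / (2 * N))"
            by (rule onorm_le_matrix_component) (use \<delta>(2)[OF True less_le_trans[OF x D(2)]] in \<open>auto intro!: less_imp_le\<close>)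
          ultimately show ?thesis using True s e N by (simp add: N_def)
        qed (use e in \<open>simp add: onorm_zero\<close>)
      qed
    qed (use s a der in \<open>auto intro: matrix_vector_mul_bounded_linear\<close>)
    then show ?thesis using s by blast
  qed
  obtain \<F>' where \<F>': "\<F>' \<subseteq> \<F>" "countable \<F>'" "\<Union>\<F>' = \<Union>\<F>"
    using Lindelof[of \<F>] by (auto simp: \<F>_def)
  have U: "\<Union>\<F> = R"
  proof
    show "R \<subseteq> \<Union>\<F>"
    proof
      fix a assume "a \<in> R"
      from loc[OF this] obtain r where "r > 0" "ball a r \<subseteq> R" "inj_on \<Phi> (ball a r)" by blast
      then have "a \<in> ball a r" "ball a r \<in> \<F>" by (auto simp: \<F>_def)
      then show "a \<in> \<Union>\<F>" by blast
    qed
  qed (auto simp: \<F>_def)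
  \<comment> \<open>\<open>from_nat_into\<close> enumerates nonempty sets only, so the empty family
    is treated apart.\<close>
  define O' where "O' j = (if \<F>' = {} then {} else from_nat_into \<F>' j)" for j
  have mem: "O' j = {} \<or> O' j \<in> \<F>" for j
    using \<F>'(1) from_nat_into[of \<F>' j] by (auto simp: O'_def)
  show ?thesis
  proof (intro exI[of _ O'] conjI allI)
    show "open (O' j)" "inj_on \<Phi> (O' j)" for j
      using mem[of j] by (auto simp: \<F>_def)
    have "(\<Union>j. O' j) = \<Union>\<F>'"
      using \<F>'(2) range_from_nat_into[of \<F>'] by (auto simp: O'_def)
    then show "(\<Union>j. O' j) = R" using \<F>'(3) U by simp
  qed
qed

text \<open>By Sard's theorem the points with vanishing determinant have a null image. The others
  are cut into countably many disjoint measurable pieces on which \<Phi> is injective, and the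
  injective case is summed. The function \<open>g\<close> adds up the indicators of the images of
  the pieces; it is measurable by construction and differs from the multiplicity at most on the null
  image.\<close>

lemma area_formula:
  fixes \<Phi> :: "real^'e::{finite,wellorder} \<Rightarrow> real^'e::_"
  assumes \<Omega>: "open \<Omega>" and der: "\<And>z. z \<in> \<Omega> \<Longrightarrow> (\<Phi> has_derivative \<Phi>' z) (at z)"
    and cont: "\<And>i j. continuous_on \<Omega> (\<lambda>z. vec_nth (vec_nth (matrix (\<Phi>' z)) i) j)"
    and C: "C \<in> sets lebesgue" "C \<subseteq> \<Omega>" and bdd: "bounded (\<Phi> ` C)"
  obtains g where "g \<in> borel_measurable lebesgue"
    "AE y in lebesgue. g y = emeasure (count_space UNIV) {z\<in>C. \<Phi> z = y}"
    "(\<integral>\<^sup>+y. g y \<partial>lebesgue) = (\<integral>\<^sup>+z. indicator C z * ennreal \<bar>Determinants.det (matrix (\<Phi>' z))\<bar> \<partial>lebesgue)"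
proof -
  let ?D = "\<lambda>z. Determinants.det (matrix (\<Phi>' z))"
  have contD: "continuous_on \<Omega> ?D"
    unfolding Determinants.det_def by (intro continuous_intros cont)
  define R where "R = {z\<in>\<Omega>. ?D z \<noteq> 0}"
  have "R = \<Omega> \<inter> ?D -` (- {0})" by (auto simp: R_def)
  then have R: "open R"
    using continuous_open_preimage[OF contD \<Omega>, of "- {0}"] by auto
  have "R \<subseteq> \<Omega>" by (auto simp: R_def)
  then have contR: "\<And>i j. continuous_on R (\<lambda>z. vec_nth (vec_nth (matrix (\<Phi>' z)) i) j)"
    by (rule continuous_on_subset[OF cont])
  have derR: "\<And>z. z \<in> R \<Longrightarrow> (\<Phi> has_derivative \<Phi>' z) (at z)" and detR: "\<And>z. z \<in> R \<Longrightarrow> ?D z \<noteq> 0"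
    using der by (auto simp: R_def)
  from countable_injectivity_cover[OF R derR contR detR]
  obtain O' :: "nat \<Rightarrow> (real^'e::_) set"
    where "(\<forall>j. open (O' j)) \<and> (\<forall>j. inj_on \<Phi> (O' j)) \<and> (\<Union>j. O' j) = R" by (rule exE)
  then have O': "\<And>j. open (O' j)" "\<And>j. inj_on \<Phi> (O' j)" "(\<Union>j. O' j) = R" by simp_all
  define P where "P j = C \<inter> disjointed O' j" for j :: nat
  have PO: "P j \<subseteq> O' j" for j using disjointed_subset[of O' j] by (auto simp: P_def)
  have disj: "disjoint_family P"
    using disjoint_family_disjointed[of O'] by (auto simp: disjoint_family_on_def P_def)
  have UP: "(\<Union>j. P j) = C \<inter> R"
    using UN_disjointed_eq[of O'] O'(3) by (auto simp: P_def)
  have "range (disjointed O') \<subseteq> sets lebesgue"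
    by (rule sets.range_disjointed_sets) (use O'(1) in auto)
  then have Pm: "P j \<in> sets lebesgue" for j using C by (auto simp: P_def)
  have Pder: "(\<Phi> has_derivative \<Phi>' z) (at z)" if "z \<in> P j" for z j
    using that C der by (auto simp: P_def)
  have Pinj: "inj_on \<Phi> (P j)" for j using O'(2) PO inj_on_subset by blast
  have Pbdd: "bounded (\<Phi> ` P j)" for j
    by (rule bounded_subset[OF bdd]) (auto simp: P_def)
  have P1 [measurable]: "\<Phi> ` P j \<in> sets lebesgue" for j
    by (rule emeasure_injective_differentiable_image(1)[OF Pm Pder Pinj Pbdd])
  have P2: "emeasure lebesgue (\<Phi> ` P j) = (\<integral>\<^sup>+z. indicator (P j) z * ennreal \<bar>?D z\<bar> \<partial>lebesgue)" for j
    by (rule emeasure_injective_differentiable_image(2)[OF Pm Pder Pinj Pbdd])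
  define g :: "real^'e::_ \<Rightarrow> ennreal" where "g y = (\<Sum>j. indicator (\<Phi> ` P j) y)" for y
  have gm: "g \<in> borel_measurable lebesgue"
    unfolding g_def by measurable
  have "(\<lambda>z. indicator \<Omega> z *\<^sub>R ?D z) \<in> borel_measurable borel"
    by (rule borel_measurable_continuous_on_indicator[OF _ contD]) (use \<Omega> in simp)
  then have hm: "(\<lambda>z. ennreal \<bar>indicator \<Omega> z *\<^sub>R ?D z\<bar>) \<in> borel_measurable lebesgue"
    by (intro measurable_compose[OF _ measurable_ennreal] borel_measurable_abs measurable_completion) simp
  \<comment> \<open>As a measure, the density is countably additive, which adds up the integrals
    over the pieces \<open>P j\<close>.\<close>
  define M where "M = density lebesgue (\<lambda>z. ennreal \<bar>indicator \<Omega> z *\<^sub>R ?D z\<bar>)"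
  have M: "emeasure M X = (\<integral>\<^sup>+z. indicator X z * ennreal \<bar>?D z\<bar> \<partial>lebesgue)"
    if "X \<in> sets lebesgue" "X \<subseteq> \<Omega>" for X
    unfolding M_def emeasure_density[OF hm that(1)]
    by (rule nn_integral_cong) (use that(2) in \<open>auto simp: indicator_def\<close>)
  have "(\<integral>\<^sup>+y. g y \<partial>lebesgue) = (\<Sum>j. \<integral>\<^sup>+y. indicator (\<Phi> ` P j) y \<partial>lebesgue)"
    unfolding g_def by (rule nn_integral_suminf) measurable
  also have "\<dots> = (\<Sum>j. emeasure M (P j))"
  proof (rule suminf_cong)
    fix j
    have "P j \<subseteq> \<Omega>" using C by (auto simp: P_def)
    then show "(\<integral>\<^sup>+y. indicator (\<Phi> ` P j) y \<partial>lebesgue) = emeasure M (P j)"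
      by (simp add: M[OF Pm] P2[symmetric])
  qed
  also have "\<dots> = emeasure M (\<Union>j. P j)"
    by (rule suminf_emeasure[OF _ disj]) (use Pm in \<open>auto simp: M_def\<close>)
  also have "\<dots> = (\<integral>\<^sup>+z. indicator (C \<inter> R) z * ennreal \<bar>?D z\<bar> \<partial>lebesgue)"
    unfolding UP by (rule M) (use C R in auto)
  also have "\<dots> = (\<integral>\<^sup>+z. indicator C z * ennreal \<bar>?D z\<bar> \<partial>lebesgue)"
    by (rule nn_integral_cong) (use C in \<open>auto simp: R_def indicator_def\<close>)
  finally have int: "(\<integral>\<^sup>+y. g y \<partial>lebesgue) = (\<integral>\<^sup>+z. indicator C z * ennreal \<bar>?D z\<bar> \<partial>lebesgue)" .
  have "negligible (\<Phi> ` (C - R))"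
  proof (rule baby_Sard)
    show "(\<Phi> has_derivative \<Phi>' z) (at z within (C - R))" if "z \<in> C - R" for z
      using der[of z] that C by (auto intro: has_derivative_at_withinI)
    show "rank (matrix (\<Phi>' z)) < CARD('e)" if "z \<in> C - R" for z
      using that C by (auto simp: R_def det_eq_0_rank[symmetric])
  qed simp
  then have "AE y in lebesgue. y \<notin> \<Phi> ` (C - R)"
    by (intro AE_not_in) (simp add: negligible_iff_null_sets)
  then have AE: "AE y in lebesgue. g y = emeasure (count_space UNIV) {z\<in>C. \<Phi> z = y}"
  proof eventually_elim
    case (elim y)
    \<comment> \<open>Away from the null image all preimages of \<open>y\<close> lie in the pieces,
      and each piece contains at most one of them.\<close>
    have "{z\<in>C. \<Phi> z = y} = (\<Union>j. {z\<in>P j. \<Phi> z = y})"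
      using elim UP by auto
    moreover have "(\<Sum>j. emeasure (count_space UNIV) {z\<in>P j. \<Phi> z = y}) =
        emeasure (count_space UNIV) (\<Union>j. {z\<in>P j. \<Phi> z = y})"
      by (rule suminf_emeasure) (use disj in \<open>auto simp: disjoint_family_on_def\<close>)
    moreover have "emeasure (count_space UNIV) {z\<in>P j. \<Phi> z = y} = indicator (\<Phi> ` P j) y" for j
    proof (cases "y \<in> \<Phi> ` P j")
      case True
      then obtain z where z: "z \<in> P j" "\<Phi> z = y" by auto
      then have "{z\<in>P j. \<Phi> z = y} = {z}" using Pinj[of j] by (auto simp: inj_on_def)
      then show ?thesis using True by simp
    next
      case False
      then have eq: "{z\<in>P j. \<Phi> z = y} = {}" by auto
      show ?thesis unfolding eq using False by simp
    qed
    ultimately show ?case by (simp add: g_def)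
  qed
  show ?thesis by (rule that[OF gm AE int])
qed

section \<open>Coordinates indexed by a finite type\<close>

text \<open>Two determinants meet here: the area formula uses vectors indexed by a finite type,
  \<open>sphere_form\<close> matrices indexed by numbers. Transporting permutations along \<iota>
  and \<kappa> matches the two Leibniz sums together with the signs.\<close>

lemma det_reindex:
  fixes \<iota> :: "nat \<Rightarrow> 'e::finite"
  assumes \<iota>: "bij_betw \<iota> {..<m} UNIV" and \<kappa>: "\<And>i. i < m \<Longrightarrow> \<kappa> (\<iota> i) = i"
  shows "Determinants.det (\<chi> e e'. J (\<kappa> e) (\<kappa> e') :: real^'e^'e) = Determinant.det (Matrix.mat m m (\<lambda>(i, j). J i j))"
proof -
  have inj: "inj_on \<iota> {0..<m}" and im: "\<iota> ` {0..<m} = UNIV"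
    using \<iota> by (auto simp: bij_betw_def atLeast0LessThan)
  have bij: "bij_betw \<iota> {0..<m} UNIV" using inj im by (simp add: bij_betw_def)
  have \<kappa>inj: "inj_on \<kappa> UNIV" "\<kappa> ` UNIV = {0..<m}"
    using im \<kappa> by (auto simp: inj_on_def) (metis UNIV_I atLeastLessThan_iff imageE image_iff)+
  have \<kappa>bij: "bij_betw \<kappa> UNIV {0..<m}" using \<kappa>inj by (simp add: bij_betw_def)
  let ?S = "{p. p permutes {0..<m}}"
  let ?T = "{p. p permutes (UNIV :: 'e set)}"
  have "Determinants.det (\<chi> e e'. J (\<kappa> e) (\<kappa> e') :: real^'e^'e) =
      (\<Sum>p\<in>?T. of_int (sign p) * (\<Prod>e\<in>UNIV. J (\<kappa> e) (\<kappa> (p e))))"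
    by (simp add: Determinants.det_def)
  also have "\<dots> = (\<Sum>p\<in>?S. of_int (sign p) * (\<Prod>i = 0..<m. J i (p i)))"
  proof (rule sum.reindex_bij_witness[where i = "map_permutation {0..<m} \<iota>" and j = "map_permutation UNIV \<kappa>"])
    fix p assume p: "p \<in> ?T"
    show "map_permutation {0..<m} \<iota> (map_permutation UNIV \<kappa> p) = p"
      by (rule map_permutation_compose_inv[OF \<kappa>bij]) (use p in auto, metis \<kappa> atLeastLessThan_iff im imageE iso_tuple_UNIV_I)
    show "map_permutation UNIV \<kappa> p \<in> ?S"
      using map_permutation_permutes[OF \<kappa>bij] p by auto
    have "(\<Prod>e\<in>UNIV. J (\<kappa> e) (\<kappa> (p e))) = (\<Prod>e\<in>UNIV. J (\<kappa> e) (map_permutation UNIV \<kappa> p (\<kappa> e)))"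
      using \<kappa>inj(1) by (simp add: map_permutation_apply)
    also have "\<dots> = (\<Prod>i = 0..<m. J i (map_permutation UNIV \<kappa> p i))"
      by (rule prod.reindex_bij_betw[OF \<kappa>bij])
    finally show "of_int (sign (map_permutation UNIV \<kappa> p)) * (\<Prod>i = 0..<m. J i (map_permutation UNIV \<kappa> p i)) =
        of_int (sign p) * (\<Prod>e\<in>UNIV. J (\<kappa> e) (\<kappa> (p e)))"
      using sign_map_permutation[OF \<kappa>inj(1), of p] p by simp
  next
    fix p assume p: "p \<in> ?S"
    show "map_permutation UNIV \<kappa> (map_permutation {0..<m} \<iota> p) = p"
      by (rule map_permutation_compose_inv[OF bij]) (use p \<kappa> in auto)
    show "map_permutation {0..<m} \<iota> p \<in> ?T"
      using map_permutation_permutes[OF bij] p by auto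
  qed
  also have "\<dots> = Determinant.det (Matrix.mat m m (\<lambda>(i, j). J i j))"
    by (subst det_def'[of _ m]) (auto intro!: sum.cong prod.cong simp: permutes_in_image)
  finally show ?thesis .
qed

lemma measurable_lborel_vec:
  fixes \<iota> :: "nat \<Rightarrow> 'e::finite"
  assumes \<iota>: "bij_betw \<iota> {..<m} UNIV" and \<kappa>: "\<And>i. i < m \<Longrightarrow> \<kappa> (\<iota> i) = i"
  shows "(\<lambda>x. \<chi> e. x (\<kappa> e) :: real^'e) \<in> borel_measurable (\<Pi>\<^sub>M i\<in>{..<m}. lborel)"
proof -
  have \<kappa>m: "\<kappa> e < m" for e
  proof -
    have "e \<in> \<iota> ` {..<m}" using \<iota> by (auto simp: bij_betw_def)
    then show "\<kappa> e < m" using \<kappa> by auto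
  qed
  show "(\<lambda>x. \<chi> e. x (\<kappa> e) :: real^'e) \<in> borel_measurable (\<Pi>\<^sub>M i\<in>{..<m}. lborel)"
  proof (rule measurable_cong[THEN iffD1])
    show "(\<lambda>x. \<Sum>e\<in>UNIV. x (\<kappa> e) *\<^sub>R axis e 1 :: real^'e) \<in> borel_measurable (\<Pi>\<^sub>M i\<in>{..<m}. lborel)"
      using \<kappa>m by (intro borel_measurable_sum borel_measurable_scaleR borel_measurable_const) measurable
    show "(\<Sum>e\<in>UNIV. x (\<kappa> e) *\<^sub>R axis e 1) = (\<chi> e. x (\<kappa> e))" for x :: "nat \<Rightarrow> real"
      by (simp add: Finite_Cartesian_Product.vec_eq_iff axis_def if_distrib sum_component cong: if_cong)
  qed
qed

text \<open>Both measures give a box the product of its side lengths. The lemma passes from the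
  vectors of the area formula to the product measure in \<open>integral_Rd\<close>.\<close>

lemma lborel_vec:
  fixes \<iota> :: "nat \<Rightarrow> 'e::finite"
  assumes \<iota>: "bij_betw \<iota> {..<m} UNIV" and \<kappa>: "\<And>i. i < m \<Longrightarrow> \<kappa> (\<iota> i) = i"
  shows "(lborel :: (real^'e) measure) = distr (\<Pi>\<^sub>M i\<in>{..<m}. lborel) borel (\<lambda>x. \<chi> e. x (\<kappa> e))"
proof (rule lborel_eqI)
  interpret product_sigma_finite "\<lambda>_. lborel :: real measure" ..
  have \<kappa>m: "\<kappa> e < m" "\<iota> (\<kappa> e) = e" for e
  proof -
    have "e \<in> \<iota> ` {..<m}" using \<iota> by (auto simp: bij_betw_def)
    then show "\<kappa> e < m" "\<iota> (\<kappa> e) = e" using \<kappa> by auto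
  qed
  note meas = measurable_lborel_vec[OF \<iota> \<kappa>]
  fix l u :: "real^'e"
  assume lu: "\<And>b. b \<in> Basis \<Longrightarrow> l \<bullet> b \<le> u \<bullet> b"
  have lu': "vec_nth l e \<le> vec_nth u e" for e
    using lu[of "axis e 1"] by (simp add: inner_axis axis_in_Basis_iff)
  have "(\<lambda>x. \<chi> e. x (\<kappa> e)) -` box l u \<inter> space (\<Pi>\<^sub>M i\<in>{..<m}. lborel) =
      (\<Pi>\<^sub>E i\<in>{..<m}. {vec_nth l (\<iota> i)<..<vec_nth u (\<iota> i)})"
  proof -
    have "(\<forall>e. vec_nth l e < x (\<kappa> e) \<and> x (\<kappa> e) < vec_nth u e) \<longleftrightarrow>
        (\<forall>i\<in>{..<m}. vec_nth l (\<iota> i) < x i \<and> x i < vec_nth u (\<iota> i))" for x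
    proof
      assume R: "\<forall>i\<in>{..<m}. vec_nth l (\<iota> i) < x i \<and> x i < vec_nth u (\<iota> i)"
      show "\<forall>e. vec_nth l e < x (\<kappa> e) \<and> x (\<kappa> e) < vec_nth u e"
        using R[rule_format, of "\<kappa> e" for e] \<kappa>m by simp
    next
      assume L: "\<forall>e. vec_nth l e < x (\<kappa> e) \<and> x (\<kappa> e) < vec_nth u e"
      show "\<forall>i\<in>{..<m}. vec_nth l (\<iota> i) < x i \<and> x i < vec_nth u (\<iota> i)"
      proof
        fix i assume "i \<in> {..<m}"
        then show "vec_nth l (\<iota> i) < x i \<and> x i < vec_nth u (\<iota> i)"
          using L[rule_format, of "\<iota> i"] \<kappa>[of i] by simp
      qed
    qed
    then show ?thesis by (auto simp: space_PiM mem_box_cart PiE_def Pi_iff)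
  qed
  then have "emeasure (distr (\<Pi>\<^sub>M i\<in>{..<m}. lborel) borel (\<lambda>x. \<chi> e. x (\<kappa> e))) (box l u) =
      emeasure (\<Pi>\<^sub>M i\<in>{..<m}. lborel) (\<Pi>\<^sub>E i\<in>{..<m}. {vec_nth l (\<iota> i)<..<vec_nth u (\<iota> i)})"
    by (subst emeasure_distr[OF meas]) auto
  also have "\<dots> = (\<Prod>i<m. emeasure lborel {vec_nth l (\<iota> i)<..<vec_nth u (\<iota> i)})"
    by (rule emeasure_PiM) auto
  also have "\<dots> = (\<Prod>i<m. ennreal (vec_nth u (\<iota> i) - vec_nth l (\<iota> i)))"
    using lu' by simp
  also have "\<dots> = (\<Prod>e\<in>UNIV. ennreal (vec_nth u e - vec_nth l e))"
    by (rule prod.reindex_bij_betw[OF \<iota>])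
  also have "\<dots> = ennreal (\<Prod>e\<in>UNIV. vec_nth u e - vec_nth l e)"
    using lu' by (intro prod_ennreal) auto
  also have "(\<Prod>e\<in>UNIV. vec_nth u e - vec_nth l e) = (\<Prod>b\<in>Basis. (u - l) \<bullet> b)"
  proof -
    have B: "(Basis :: (real^'e) set) = range (\<lambda>e. axis e 1)" by (auto simp: Basis_vec_def)
    have "inj (\<lambda>e. axis e (1::real) :: real^'e)" by (auto simp: inj_on_def axis_eq_axis)
    then show ?thesis unfolding B by (subst prod.reindex) (auto simp: inner_axis)
  qed
  finally show "emeasure (distr (\<Pi>\<^sub>M i\<in>{..<m}. lborel) borel (\<lambda>x. \<chi> e. x (\<kappa> e))) (box l u) = (\<Prod>b\<in>Basis. (u - l) \<bullet> b)" .
qed simp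


section \<open>Maps into the unit sphere and their cones\<close>

lemma emeasure_count_space_bij:
  assumes "bij_betw f X Y"
  shows "emeasure (count_space UNIV) X = emeasure (count_space UNIV) Y"
  using bij_betw_finite[OF assms] bij_betw_same_card[OF assms] by (simp add: emeasure_count_space)

text \<open>A map of a \<open>d\<close>-dimensional parameter domain into the unit sphere, given by
  its \<open>d + 1\<close> coordinates. The domain of its cone is indexed by \<open>'e\<close>: the
  index \<open>\<iota> d\<close> carries the radius, the indices \<open>\<iota> i\<close> with
  \<open>i < d\<close> carry the parameters.\<close>

locale sphere_param =
  fixes d :: nat and W :: "(nat \<Rightarrow> real) set" and a :: "nat \<Rightarrow> (nat \<Rightarrow> real) \<Rightarrow> real"
    and \<iota> :: "nat \<Rightarrow> 'e::{finite,wellorder}" and \<kappa> :: "'e \<Rightarrow> nat"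
  assumes d: "d \<ge> 1" and W: "openin (Euclidean_space d) W"
    and a: "\<And>l. l < Suc d \<Longrightarrow> C_k 1 d W (a l)"
    and unit: "\<And>w. w \<in> W \<Longrightarrow> (\<Sum>l<Suc d. (a l w)\<^sup>2) = 1"
    and \<iota>: "bij_betw \<iota> {..<Suc d} UNIV" and \<kappa>: "\<And>i. i < Suc d \<Longrightarrow> \<kappa> (\<iota> i) = i"
begin

lemma \<kappa>_less: "\<kappa> e < Suc d" and \<iota>_\<kappa>: "\<iota> (\<kappa> e) = e"
proof -
  have "e \<in> \<iota> ` {..<Suc d}" using \<iota> by (auto simp: bij_betw_def)
  then show "\<kappa> e < Suc d" "\<iota> (\<kappa> e) = e" using \<kappa> by auto
qed

lemma \<kappa>_bij: "bij_betw \<kappa> UNIV {..<Suc d}"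
  by (rule bij_betwI[of _ _ _ \<iota>]) (use \<kappa>_less \<kappa> \<iota>_\<kappa> in auto)

definition jac :: "(nat \<Rightarrow> real) \<Rightarrow> real"
  where "jac w = sphere_form (Suc d) (\<lambda>l. a l w) (map (\<lambda>i l. partial i (a l) w) [0..<d])"

definition base :: "real^'e::_ \<Rightarrow> nat \<Rightarrow> real"
  where "base z = (\<lambda>i. if i < d then vec_nth z (\<iota> i) else 0)"

definition cone :: "real^'e::_ \<Rightarrow> real^'e::_"
  where "cone z = (\<chi> e. vec_nth z (\<iota> d) * a (\<kappa> e) (base z))"

definition cone' :: "real^'e::_ \<Rightarrow> real^'e::_ \<Rightarrow> real^'e::_"
  where "cone' z h = (\<chi> e. vec_nth z (\<iota> d) * (\<Sum>i<d. vec_nth h (\<iota> i) * partial i (a (\<kappa> e)) (base z)) +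
      vec_nth h (\<iota> d) * a (\<kappa> e) (base z))"

definition dom :: "(real^'e::_) set"
  where "dom = {z. 0 < vec_nth z (\<iota> d) \<and> base z \<in> W}"

lemma continuous_base: "continuous_on S base"
  unfolding base_def
proof (rule continuous_on_coordinatewise_then_product)
  fix i show "continuous_on S (\<lambda>z. if i < d then vec_nth z (\<iota> i) else 0)"
    by (cases "i < d") (auto intro!: continuous_intros)
qed

lemma open_dom: "open dom"
proof -
  obtain T where T: "open T" "W = T \<inter> {x. \<forall>i\<ge>d. x i = 0}"
    using W by (auto simp: openin_Euclidean_space_iff)
  have "base z \<in> W \<longleftrightarrow> base z \<in> T" for z
    unfolding T(2) by (auto simp: base_def)
  then have "dom = {z. 0 < vec_nth z (\<iota> d)} \<inter> base -` T"
    by (auto simp: dom_def)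
  moreover have "open (base -` T)"
    using continuous_base[of UNIV] T(1) by (simp add: continuous_on_open_vimage)
  moreover have "open {z :: real^'e::_. 0 < vec_nth z (\<iota> d)}"
    by (intro open_Collect_less continuous_intros)
  ultimately show ?thesis by auto
qed

lemma continuous_a:
  assumes "l < Suc d"
  shows "continuous_on W (a l)" "\<And>i. i < d \<Longrightarrow> continuous_on W (partial i (a l))"
  using C_k_SucD[of 0 d W "a l"] a[OF assms] by auto

lemma cone_derivative:
  assumes "z \<in> dom"
  shows "(cone has_derivative cone' z) (at z)"
proof -
  have "((\<lambda>z. vec_nth (cone z) e) has_derivative (\<lambda>h. vec_nth (cone' z h) e)) (at z)" for e
  proof -
    have "((\<lambda>z. a (\<kappa> e) (base z)) has_derivative
        (\<lambda>h. \<Sum>i<d. vec_nth h (\<iota> i) * partial i (a (\<kappa> e)) (base z))) (at z)"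
    proof (rule has_derivative_C_1_compose[OF W a[OF \<kappa>_less]])
      show "base z \<in> W" using assms by (simp add: dom_def)
      show "((\<lambda>z. base z i) has_derivative (\<lambda>h. vec_nth h (\<iota> i))) (at z)" if "i < d" for i
        using that by (simp add: base_def bounded_linear_imp_has_derivative bounded_linear_vec_nth)
    qed (auto simp: base_def)
    from has_derivative_mult[OF bounded_linear_imp_has_derivative[OF bounded_linear_vec_nth] this, of "\<iota> d"]
    show ?thesis by (simp add: cone_def cone'_def)
  qed
  then show ?thesis
    unfolding has_derivative_componentwise_within[of cone]
    by (auto simp: Basis_vec_def inner_axis)
qed

lemma matrix_cone':
  "vec_nth (vec_nth (matrix (cone' z)) e) e' =
    (if \<kappa> e' = d then a (\<kappa> e) (base z) else vec_nth z (\<iota> d) * partial (\<kappa> e') (a (\<kappa> e)) (base z))"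
proof -
  have ax: "vec_nth (axis e' (1::real)) (\<iota> i) = (if i = \<kappa> e' then 1 else 0)" if "i < Suc d" for i
    using \<kappa>[OF that] \<iota>_\<kappa>[of e'] by (auto simp: axis_def)
  have "(\<Sum>i<d. vec_nth (axis e' 1) (\<iota> i) * partial i (a (\<kappa> e)) (base z)) =
      (\<Sum>i<d. if i = \<kappa> e' then partial i (a (\<kappa> e)) (base z) else 0)"
    by (rule sum.cong) (use ax in auto)
  also have "\<dots> = (if \<kappa> e' < d then partial (\<kappa> e') (a (\<kappa> e)) (base z) else 0)" by simp
  finally show ?thesis
    using \<kappa>_less[of e'] ax[of d] by (auto simp: matrix_def cone'_def less_Suc_eq)
qed

text \<open>The columns of the Jacobian matrix are the multiples by the radius of the partial
  derivatives of \<open>a\<close> and, for the radial direction, \<open>a\<close> itself. Pulling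
  the radius out of \<open>d\<close> columns leaves the determinant of \<open>sphere_form\<close>,
  except that \<open>a\<close> comes last instead of first; the absolute value removes the sign of
  this permutation.\<close>

lemma det_cone': "\<bar>Determinants.det (matrix (cone' z))\<bar> = \<bar>vec_nth z (\<iota> d)\<bar> ^ d * \<bar>jac (base z)\<bar>"
proof -
  let ?t = "vec_nth z (\<iota> d)"
  define J where "J s l = (((\<lambda>l. a l (base z)) # map (\<lambda>i l. partial i (a l) (base z)) [0..<d]) ! s) l" for s l
  \<comment> \<open>The row of \<open>sphere_form\<close> that corresponds to column
    \<open>i\<close>: the radial column \<open>d\<close> belongs to row 0.\<close>
  define slot where "slot i = (if i = d then 0 else Suc i)" for i
  define \<pi> where "\<pi> e = \<iota> (slot (\<kappa> e))" for e
  have slot: "slot i < Suc d" if "i < Suc d" for i using that by (auto simp: slot_def)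
  have \<kappa>\<pi>: "\<kappa> (\<pi> e) = slot (\<kappa> e)" for e unfolding \<pi>_def by (rule \<kappa>[OF slot[OF \<kappa>_less]])
  have "inj \<pi>"
  proof (rule injI)
    fix e e' assume "\<pi> e = \<pi> e'"
    then have "slot (\<kappa> e) = slot (\<kappa> e')" using \<kappa>\<pi> by metis
    then have "\<kappa> e = \<kappa> e'" by (auto simp: slot_def split: if_splits)
    then show "e = e'" using \<iota>_\<kappa> by metis
  qed
  then have "bij_betw \<pi> UNIV UNIV" using finite_UNIV_inj_surj[OF finite_class.finite_UNIV] by (simp add: bij_def)
  then have perm: "\<pi> permutes UNIV" by (rule bij_imp_permutes) simp
  define B where "B = (\<chi> e e'. J (\<kappa> e) (\<kappa> e') :: (real^'e::_)^'e::_)"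
  have tr: "transpose (matrix (cone' z)) = (\<chi> e'. (if \<kappa> e' = d then 1 else ?t) *s vec_nth B (\<pi> e'))"
  proof -
    have "vec_nth (vec_nth (matrix (cone' z)) e) e' = (if \<kappa> e' = d then 1 else ?t) * J (slot (\<kappa> e')) (\<kappa> e)" for e e'
      using \<kappa>_less[of e'] by (auto simp: matrix_cone' slot_def J_def simp del: upt_Suc)
    then show ?thesis
      by (simp add: Finite_Cartesian_Product.vec_eq_iff transpose_def B_def \<kappa>\<pi>)
  qed
  have "Determinants.det (matrix (cone' z)) =
      (\<Prod>e'\<in>UNIV. if \<kappa> e' = d then 1 else ?t) * Determinants.det (\<chi> e'. vec_nth B (\<pi> e'))"
    using Determinants.det_rows_mul[of "\<lambda>e'. if \<kappa> e' = d then 1 else ?t" "\<lambda>e'. vec_nth B (\<pi> e')"]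
    unfolding tr[symmetric] Determinants.det_transpose .
  also have "Determinants.det (\<chi> e'. vec_nth B (\<pi> e')) = of_int (sign \<pi>) * Determinants.det B"
    by (rule Determinants.det_permute_rows[OF perm])
  also have "Determinants.det B = jac (base z)"
    unfolding B_def jac_def sphere_form_def J_def[symmetric] by (rule det_reindex[OF \<iota>]) (rule \<kappa>)
  also have "(\<Prod>e'\<in>UNIV. if \<kappa> e' = d then 1 else ?t) = (\<Prod>i<Suc d. if i = d then 1 else ?t)"
    by (rule prod.reindex_bij_betw[OF \<kappa>_bij])
  also have "\<dots> = ?t ^ d" by simp
  finally show ?thesis by (simp add: abs_mult power_abs sign_def)
qed

lemma norm_cone: "z \<in> dom \<Longrightarrow> norm (cone z) = vec_nth z (\<iota> d)"
proof -
  assume z: "z \<in> dom"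
  have "(\<Sum>e\<in>UNIV. (a (\<kappa> e) (base z))\<^sup>2) = 1"
    using unit[of "base z"] z sum.reindex_bij_betw[OF \<kappa>_bij, of "\<lambda>l. (a l (base z))\<^sup>2"] by (simp add: dom_def)
  then have "(\<Sum>e\<in>UNIV. (vec_nth (cone z) e)\<^sup>2) = (vec_nth z (\<iota> d))\<^sup>2"
    by (simp add: cone_def power_mult_distrib sum_distrib_left[symmetric])
  then show ?thesis using z by (simp add: norm_vec_def L2_set_def dom_def)
qed

lemma continuous_jac: "continuous_on W jac"
proof -
  have 1: "sphere_form (Suc d) (\<lambda>l. a l w) (map (\<lambda>i l. partial i (a l) w) [0..<d]) =
     (\<Sum>p\<in>{p. p permutes {0..<Suc d}}. signof p *
        (\<Prod>i = 0..<Suc d. if i = 0 then a (p i) w else partial (i - 1) (a (p i)) w))" for w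
    unfolding sphere_form_def det_def'[OF mat_carrier]
  proof (intro sum.cong[OF refl] arg_cong2[where f = "(*)"] prod.cong[OF refl] refl)
    fix p i assume p: "p \<in> {p. p permutes {0..<Suc d}}" and i: "i \<in> {0..<Suc d}"
    then have "p i < Suc d" using permutes_in_image[of p "{0..<Suc d}" i] by simp
    then show "Matrix.mat (Suc d) (Suc d) (\<lambda>(i, j). (((\<lambda>l. a l w) # map (\<lambda>i l. partial i (a l) w) [0..<d]) ! i) j) $$ (i, p i) =
        (if i = 0 then a (p i) w else partial (i - 1) (a (p i)) w)"
      using i by (cases i) (simp_all del: upt_Suc)
  qed
  have "continuous_on W (\<lambda>w. if i = 0 then a (p i) w else partial (i - 1) (a (p i)) w)"
    if "p permutes {0..<Suc d}" "i < Suc d" for p i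
  proof -
    have "p i < Suc d" using that permutes_in_image[of p "{0..<Suc d}" i] by simp
    then show ?thesis using continuous_a[of "p i"] that(2) by (cases i) auto
  qed
  then show ?thesis
    unfolding jac_def 1 by (intro continuous_on_sum continuous_on_mult continuous_on_const continuous_on_prod) auto
qed

lemma continuous_matrix_cone': "continuous_on dom (\<lambda>z. vec_nth (vec_nth (matrix (cone' z)) e) e')"
proof -
  have base: "continuous_on dom (\<lambda>z. f (base z))" if "continuous_on W f" for f :: "(nat \<Rightarrow> real) \<Rightarrow> real"
    by (rule continuous_on_compose2[OF that continuous_base]) (auto simp: dom_def)
  show ?thesis
    unfolding matrix_cone'
  proof (cases "\<kappa> e' = d")
    case True
    then show "continuous_on dom (\<lambda>z. if \<kappa> e' = d then a (\<kappa> e) (base z) else vec_nth z (\<iota> d) * partial (\<kappa> e') (a (\<kappa> e)) (base z))"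
      by (simp only: True simp_thms if_True base continuous_a(1) \<kappa>_less)
  next
    case False
    then have "\<kappa> e' < d" using \<kappa>_less[of e'] by simp
    then show "continuous_on dom (\<lambda>z. if \<kappa> e' = d then a (\<kappa> e) (base z) else vec_nth z (\<iota> d) * partial (\<kappa> e') (a (\<kappa> e)) (base z))"
      using False by (auto intro!: continuous_intros base continuous_a \<kappa>_less)
  qed
qed

lemma nn_integral_power_01: "(\<integral>\<^sup>+t. indicator {0<..1::real} t * ennreal (t ^ d) \<partial>lborel) = ennreal (1 / real (Suc d))"
proof -
  \<comment> \<open>The endpoint 0 may be added because \<open>0 ^ d = 0\<close> for
    \<open>d \<ge> 1\<close>.\<close>
  have "(\<integral>\<^sup>+t. indicator {0<..1::real} t * ennreal (t ^ d) \<partial>lborel) =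
      (\<integral>\<^sup>+t. ennreal (t ^ d) * indicator {0..1::real} t \<partial>lborel)"
    by (rule nn_integral_cong) (use d in \<open>auto simp: indicator_def zero_power\<close>)
  also have "\<dots> = ennreal (1 ^ Suc d / real (Suc d) - 0 ^ Suc d / real (Suc d))"
  proof (rule nn_integral_FTC_Icc)
    show "((\<lambda>t. t ^ Suc d / real (Suc d)) has_real_derivative t ^ d) (at t)" for t
      using DERIV_cdivide[OF DERIV_pow[of "Suc d" t], of "real (Suc d)"] by simp
  qed auto
  finally show ?thesis by simp
qed

text \<open>The area formula for the cone over \<open>K\<close>, with radii from 0 (excluded) to 1.
  Since \<open>a\<close> has length 1, the preimages of \<open>y\<close> are the pairs of the radius
  \<open>norm y\<close> and a parameter with \<open>a w = y / norm y\<close>. The integral of the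
  determinant splits into the integral over \<open>K\<close> and a radial integral of value
  \<open>1 / Suc d\<close>, which explains the factor.\<close>

lemma sphere_area:
  assumes K: "K \<in> sets borel" "K \<subseteq> W"
  obtains g where "g \<in> borel_measurable lebesgue"
    "AE y in lebesgue. g y = (if 0 < norm y \<and> norm y \<le> 1
       then emeasure (count_space UNIV) {w\<in>K. \<forall>l<Suc d. norm y * a l w = vec_nth y (\<iota> l)} else 0)"
    "integral_Rd d K (\<lambda>w. \<bar>jac w\<bar>) = ennreal (real (Suc d)) * (\<integral>\<^sup>+y. g y \<partial>lebesgue)"
proof -
  define C where "C = {z. 0 < vec_nth z (\<iota> d) \<and> vec_nth z (\<iota> d) \<le> 1 \<and> base z \<in> K}"
  have Cdom: "C \<subseteq> dom" using K by (auto simp: C_def dom_def)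
  have base_m: "base \<in> borel_measurable borel"
    by (rule borel_measurable_continuous_onI[OF continuous_base])
  have Wb: "W \<in> sets borel"
  proof -
    obtain T where T: "open T" "W = T \<inter> {x. \<forall>i\<ge>d. x i = 0}"
      using W by (auto simp: openin_Euclidean_space_iff)
    have "closed {x :: nat \<Rightarrow> real. x i = 0}" for i
      by (intro closed_Collect_eq continuous_on_product_coordinates continuous_intros)
    then have "closed (\<Inter>i\<in>{d..}. {x :: nat \<Rightarrow> real. x i = 0})" by (intro closed_INT) auto
    moreover have "{x :: nat \<Rightarrow> real. \<forall>i\<ge>d. x i = 0} = (\<Inter>i\<in>{d..}. {x. x i = 0})" by auto
    ultimately show ?thesis using T by auto
  qed
  have "C = {z. 0 < vec_nth z (\<iota> d) \<and> vec_nth z (\<iota> d) \<le> 1} \<inter> (base -` K \<inter> space borel)"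
    by (auto simp: C_def)
  moreover have "{z :: real^'e::_. 0 < vec_nth z (\<iota> d) \<and> vec_nth z (\<iota> d) \<le> 1} \<in> sets borel"
  proof -
    have "open {z :: real^'e::_. 0 < vec_nth z (\<iota> d)}" "closed {z :: real^'e::_. vec_nth z (\<iota> d) \<le> 1}"
      by (intro open_Collect_less closed_Collect_le continuous_intros)+
    then show ?thesis by (simp add: Collect_conj_eq)
  qed
  ultimately have Cb: "C \<in> sets borel"
    using measurable_sets[OF base_m K(1)] by auto
  have bdd: "bounded (cone ` C)"
    using norm_cone Cdom by (intro boundedI[of _ 1]) (auto simp: C_def subset_iff)
  obtain g where g: "g \<in> borel_measurable lebesgue"
    "AE y in lebesgue. g y = emeasure (count_space UNIV) {z\<in>C. cone z = y}"
    "(\<integral>\<^sup>+y. g y \<partial>lebesgue) = (\<integral>\<^sup>+z. indicator C z * ennreal \<bar>Determinants.det (matrix (cone' z))\<bar> \<partial>lebesgue)"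
    using area_formula[OF open_dom cone_derivative continuous_matrix_cone' _ Cdom bdd] Cb by auto
  have count: "emeasure (count_space UNIV) {z\<in>C. cone z = y} = (if 0 < norm y \<and> norm y \<le> 1
       then emeasure (count_space UNIV) {w\<in>K. \<forall>l<Suc d. norm y * a l w = vec_nth y (\<iota> l)} else 0)" for y
  proof (cases "0 < norm y \<and> norm y \<le> 1")
    case True
    \<comment> \<open>The inverse of \<open>base\<close> on the fibre: it puts the only possible
      radius, \<open>norm y\<close>, into the radial coordinate.\<close>
    define f where "f w = ((\<chi> e. if \<kappa> e = d then norm y else w (\<kappa> e)) :: real^'e::_)" for w
    have W0: "w i = 0" if "w \<in> K" "i \<ge> d" for w i
      using that K(2) W by (auto simp: openin_Euclidean_space_iff)
    have bf: "base (f w) = w" if "w \<in> K" for w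
      using W0[OF that] \<kappa> by (auto simp: base_def f_def fun_eq_iff)
    have fd: "vec_nth (f w) (\<iota> d) = norm y" for w using \<kappa>[of d] by (simp add: f_def)
    have "bij_betw f {w\<in>K. \<forall>l<Suc d. norm y * a l w = vec_nth y (\<iota> l)} {z\<in>C. cone z = y}"
    proof (rule bij_betwI[of _ _ _ base])
      show "f \<in> {w\<in>K. \<forall>l<Suc d. norm y * a l w = vec_nth y (\<iota> l)} \<rightarrow> {z\<in>C. cone z = y}"
        using True bf fd \<kappa>_less \<iota>_\<kappa> by (auto simp: C_def cone_def Finite_Cartesian_Product.vec_eq_iff)
      have cy: "vec_nth z (\<iota> d) = norm y" if "z \<in> C" "cone z = y" for z
        using norm_cone[of z] that Cdom by auto
      show "base \<in> {z\<in>C. cone z = y} \<rightarrow> {w\<in>K. \<forall>l<Suc d. norm y * a l w = vec_nth y (\<iota> l)}"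
      proof safe
        fix z l assume z: "z \<in> C" "y = cone z" "l < Suc d"
        show "norm (cone z) * a l (base z) = vec_nth (cone z) (\<iota> l)"
          using cy[OF z(1)] z \<kappa>[of l] by (simp add: cone_def)
      qed (auto simp: C_def)
      show "f (base z) = z" if "z \<in> {z\<in>C. cone z = y}" for z
        using that cy[of z] \<iota>_\<kappa> \<kappa>_less less_SucE by (auto simp: f_def base_def Finite_Cartesian_Product.vec_eq_iff) metis+
      show "base (f w) = w" if "w \<in> {w\<in>K. \<forall>l<Suc d. norm y * a l w = vec_nth y (\<iota> l)}" for w
        using bf that by auto
    qed
    from emeasure_count_space_bij[OF this] show ?thesis using True by simp
  next
    case False
    have eq: "{z\<in>C. cone z = y} = {}"
    proof (intro equals0I)
      fix z assume "z \<in> {z\<in>C. cone z = y}"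
      then have "norm y = vec_nth z (\<iota> d)" "0 < vec_nth z (\<iota> d)" "vec_nth z (\<iota> d) \<le> 1"
        using norm_cone[of z] Cdom by (auto simp: C_def)
      then show False using False by simp
    qed
    show ?thesis unfolding eq using False by auto
  qed
  \<comment> \<open>\<open>jac\<close> is continuous on \<open>W\<close> only; extended by 0 it
    becomes a Borel function on the whole space.\<close>
  define h where "h w = ennreal \<bar>indicator W w *\<^sub>R jac w\<bar> * indicator K w" for w
  define \<phi> where "\<phi> t = indicator {0<..1::real} t * ennreal (t ^ d)" for t
  have hm [measurable]: "h \<in> borel_measurable borel"
    unfolding h_def
    by (intro borel_measurable_times_ennreal measurable_compose[OF _ measurable_ennreal] borel_measurable_abs
        borel_measurable_continuous_on_indicator[OF Wb continuous_jac] borel_measurable_indicator K)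
  have \<phi>m [measurable]: "\<phi> \<in> borel_measurable borel" unfolding \<phi>_def by measurable
  have G: "indicator C z * ennreal \<bar>Determinants.det (matrix (cone' z))\<bar> = \<phi> (vec_nth z (\<iota> d)) * h (base z)" for z
    using K(2) by (auto simp: C_def \<phi>_def h_def indicator_def det_cone' ennreal_mult' power_abs[symmetric])
  have vm: "(\<lambda>z. vec_nth z (\<iota> d)) \<in> borel_measurable (borel :: (real^'e::_) measure)"
    by (rule borel_measurable_continuous_onI) (intro continuous_intros)
  interpret product_sigma_finite "\<lambda>_. lborel :: real measure" ..
  have cut: "(\<lambda>x i. if i < d then x i else 0) \<in> borel_measurable (\<Pi>\<^sub>M i\<in>I. lborel :: real measure)" if "{..<d} \<subseteq> I" for I
  proof (rule measurable_coordinatewise_then_product)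
    fix i show "(\<lambda>x. if i < d then x i else 0) \<in> borel_measurable (\<Pi>\<^sub>M i\<in>I. lborel :: real measure)"
      using that by (cases "i < d") auto
  qed
  have vecm: "(\<lambda>x. \<chi> e. x (\<kappa> e)) \<in> measurable (\<Pi>\<^sub>M i\<in>{..<Suc d}. lborel) (borel :: (real^'e::_) measure)"
    by (rule measurable_lborel_vec[OF \<iota> \<kappa>])
  have "(\<integral>\<^sup>+y. g y \<partial>lebesgue) = (\<integral>\<^sup>+z. \<phi> (vec_nth z (\<iota> d)) * h (base z) \<partial>lborel)"
    unfolding g(3) unfolding G nn_integral_completion ..
  also have "\<dots> = (\<integral>\<^sup>+x. \<phi> (x d) * h (\<lambda>i. if i < d then x i else 0) \<partial>(\<Pi>\<^sub>M i\<in>{..<Suc d}. lborel))"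
  proof -
    have m: "(\<lambda>z. \<phi> (vec_nth z (\<iota> d)) * h (base z)) \<in> borel_measurable borel"
      by (intro borel_measurable_times_ennreal measurable_compose[OF vm \<phi>m] measurable_compose[OF base_m hm])
    have L: "(lborel :: (real^'e::_) measure) = distr (\<Pi>\<^sub>M i\<in>{..<Suc d}. lborel) borel (\<lambda>x. \<chi> e. x (\<kappa> e))"
      by (rule lborel_vec[OF \<iota>]) (rule \<kappa>)
    have "(\<integral>\<^sup>+z. \<phi> (vec_nth z (\<iota> d)) * h (base z) \<partial>lborel) =
        (\<integral>\<^sup>+x. \<phi> (vec_nth (\<chi> e. x (\<kappa> e)) (\<iota> d)) * h (base (\<chi> e. x (\<kappa> e))) \<partial>(\<Pi>\<^sub>M i\<in>{..<Suc d}. lborel))"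
      unfolding L by (rule nn_integral_distr[OF vecm]) (use m in simp)
    also have "(\<integral>\<^sup>+x. \<phi> (vec_nth (\<chi> e. x (\<kappa> e)) (\<iota> d)) * h (base (\<chi> e. x (\<kappa> e))) \<partial>(\<Pi>\<^sub>M i\<in>{..<Suc d}. lborel)) =
        (\<integral>\<^sup>+x. \<phi> (x d) * h (\<lambda>i. if i < d then x i else 0) \<partial>(\<Pi>\<^sub>M i\<in>{..<Suc d}. lborel))"
    proof (rule nn_integral_cong)
      fix x :: "nat \<Rightarrow> real"
      have "base (\<chi> e. x (\<kappa> e)) = (\<lambda>i. if i < d then x i else 0)"
        using \<kappa> by (auto simp: base_def fun_eq_iff)
      then show "\<phi> (vec_nth (\<chi> e. x (\<kappa> e)) (\<iota> d)) * h (base (\<chi> e. x (\<kappa> e))) = \<phi> (x d) * h (\<lambda>i. if i < d then x i else 0)"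
        using \<kappa>[of d] by simp
    qed
    finally show ?thesis .
  qed
  also have "\<dots> = (\<integral>\<^sup>+x. (\<integral>\<^sup>+t. \<phi> t * h (\<lambda>i. if i < d then x i else 0) \<partial>lborel) \<partial>(\<Pi>\<^sub>M i\<in>{..<d}. lborel))"
  proof -
    have I: "{..<Suc d} = insert d {..<d}" by auto
    have m: "(\<lambda>x. \<phi> (x d) * h (\<lambda>i. if i < d then x i else 0)) \<in> borel_measurable (\<Pi>\<^sub>M i\<in>insert d {..<d}. lborel)"
      by (intro borel_measurable_times_ennreal measurable_compose[OF _ \<phi>m] measurable_compose[OF cut hm])
         (auto intro!: measurable_component_singleton)
    have upd: "(\<lambda>i. if i < d then (x(d := t)) i else 0) = (\<lambda>i. if i < d then x i else 0)" for x :: "nat \<Rightarrow> real" and t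
      by auto
    show ?thesis
      unfolding I by (subst product_nn_integral_insert[OF _ _ m]) (simp_all only: upd fun_upd_same, auto)
  qed
  also have "\<dots> = (\<integral>\<^sup>+x. ennreal (1 / real (Suc d)) * h (\<lambda>i. if i < d then x i else 0) \<partial>(\<Pi>\<^sub>M i\<in>{..<d}. lborel))"
    using nn_integral_power_01 by (simp add: nn_integral_multc \<phi>_def[symmetric])
  also have "\<dots> = ennreal (1 / real (Suc d)) * (\<integral>\<^sup>+x. h (\<lambda>i. if i < d then x i else 0) \<partial>(\<Pi>\<^sub>M i\<in>{..<d}. lborel))"
    by (rule nn_integral_cmult) (rule measurable_compose[OF cut hm], simp)
  also have "(\<integral>\<^sup>+x. h (\<lambda>i. if i < d then x i else 0) \<partial>(\<Pi>\<^sub>M i\<in>{..<d}. lborel)) = integral_Rd d K (\<lambda>w. \<bar>jac w\<bar>)"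
    unfolding integral_Rd_def Let_def h_def
    by (rule nn_integral_cong) (use K(2) in \<open>auto simp: indicator_def\<close>)
  finally have int: "(\<integral>\<^sup>+y. g y \<partial>lebesgue) = ennreal (1 / real (Suc d)) * integral_Rd d K (\<lambda>w. \<bar>jac w\<bar>)" .
  have "ennreal (real (Suc d)) * ennreal (1 / real (Suc d)) = 1"
    by (subst ennreal_mult[symmetric]) auto
  then have "integral_Rd d K (\<lambda>w. \<bar>jac w\<bar>) = ennreal (real (Suc d)) * (\<integral>\<^sup>+y. g y \<partial>lebesgue)"
    unfolding int by (simp add: mult.assoc[symmetric])
  with g(1,2) show ?thesis
    by (intro that[of g]) (simp_all only: count)
qed

end

lemma sum_fun_apply: "(\<Sum>i\<in>I. f i) x = (\<Sum>i\<in>I. f i x)"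
  by (induction I rule: infinite_finite_induct) auto

section \<open>Multilinear and alternating forms\<close>

text \<open>The linearity clause of \<open>forms\<close> on its own. It also covers the contractions
  below, for which no statement about lists outside \<open>V\<close> is made.\<close>

definition multilinear_on :: "nat \<Rightarrow> 'b::real_vector set \<Rightarrow> ('b list \<Rightarrow> real) \<Rightarrow> bool"
  where "multilinear_on k V \<Lambda> \<longleftrightarrow>
    (\<forall>xs. length xs = k \<and> set xs \<subseteq> V \<longrightarrow>
       (\<forall>i<k. \<forall>x\<in>V. \<forall>y\<in>V. \<forall>a b.
          \<Lambda> (xs[i := a *\<^sub>R x + b *\<^sub>R y]) = a * \<Lambda> (xs[i := x]) + b * \<Lambda> (xs[i := y])))"

lemma multilinear_on_update:
  assumes "multilinear_on k V \<Lambda>" "length xs = k" "set xs \<subseteq> V" "i < k" "x \<in> V" "y \<in> V"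
  shows "\<Lambda> (xs[i := a *\<^sub>R x + b *\<^sub>R y]) = a * \<Lambda> (xs[i := x]) + b * \<Lambda> (xs[i := y])"
  using assms(1)[unfolded multilinear_on_def, rule_format, of xs i x y a b] assms(2-) by simp

lemma multilinear_onD:
  assumes "multilinear_on k V \<Lambda>" "set us \<subseteq> V" "set ws \<subseteq> V" "length us + 1 + length ws = k" "x \<in> V" "y \<in> V"
  shows "\<Lambda> (us @ (a *\<^sub>R x + b *\<^sub>R y) # ws) = a * \<Lambda> (us @ x # ws) + b * \<Lambda> (us @ y # ws)"
proof -
  have "length (us @ x # ws) = k" "set (us @ x # ws) \<subseteq> V" "length us < k" using assms by auto
  then have "\<Lambda> ((us @ x # ws)[length us := a *\<^sub>R x + b *\<^sub>R y])
      = a * \<Lambda> ((us @ x # ws)[length us := x]) + b * \<Lambda> ((us @ x # ws)[length us := y])"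
    by (rule multilinear_on_update[OF assms(1) _ _ _ assms(5,6)])
  then show ?thesis by simp
qed

lemma multilinear_on_sum:
  assumes "subspace V" "multilinear_on k V \<Lambda>" "set us \<subseteq> V" "set ws \<subseteq> V" "length us + 1 + length ws = k"
    and "finite S" "\<And>s. s \<in> S \<Longrightarrow> v s \<in> V"
  shows "\<Lambda> (us @ (\<Sum>s\<in>S. c s *\<^sub>R v s) # ws) = (\<Sum>s\<in>S. c s * \<Lambda> (us @ v s # ws))"
  using assms(6,7)
proof (induction S rule: finite_induct)
  case empty
  have "\<Lambda> (us @ (0 *\<^sub>R 0 + 0 *\<^sub>R 0) # ws) = 0"
    by (subst multilinear_onD[OF assms(2-5)]) (auto simp: subspace_0[OF assms(1)])
  then show ?case by simp
next
  case (insert s S)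
  have "\<Lambda> (us @ (c s *\<^sub>R v s + 1 *\<^sub>R (\<Sum>s\<in>S. c s *\<^sub>R v s)) # ws) =
      c s * \<Lambda> (us @ v s # ws) + 1 * \<Lambda> (us @ (\<Sum>s\<in>S. c s *\<^sub>R v s) # ws)"
    by (rule multilinear_onD[OF assms(2-5)])
       (use insert.prems in \<open>auto intro!: subspace_sum subspace_scale assms(1)\<close>)
  then show ?case using insert by simp
qed

text \<open>Expanding every argument in \<open>B\<close> turns the value into a polynomial in the
  coefficients \<open>c\<close> and the values on lists from \<open>B\<close>. A property
  \<open>P\<close> that is stable under sums and under products with coefficients in
  \<open>R\<close> therefore passes to the value. The lemma serves for vanishing, smoothness,
  continuity and \<open>C_k\<close> alike.\<close>

lemma multilinear_on_closure:
  fixes \<Lambda> :: "'z \<Rightarrow> 'b::real_vector list \<Rightarrow> real"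
  assumes P: "P (\<lambda>z. 0)" "\<And>f g. P f \<Longrightarrow> P g \<Longrightarrow> P (\<lambda>z. f z + g z)" "\<And>f g. R f \<Longrightarrow> P g \<Longrightarrow> P (\<lambda>z. f z * g z)"
      "\<And>f g. P f \<Longrightarrow> (\<And>z. z \<in> Z \<Longrightarrow> f z = g z) \<Longrightarrow> P g"
    and V: "subspace V" "finite B" "B \<subseteq> V"
    and \<Lambda>: "\<And>z. z \<in> Z \<Longrightarrow> multilinear_on k V (\<Lambda> z)"
    and vs: "\<And>z. z \<in> Z \<Longrightarrow> length (vs z) = k" "\<And>z. z \<in> Z \<Longrightarrow> set (vs z) \<subseteq> V"
      "\<And>z i. z \<in> Z \<Longrightarrow> i < k \<Longrightarrow> vs z ! i = (\<Sum>b\<in>B. c i b z *\<^sub>R b)"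
      "\<And>i b. i < k \<Longrightarrow> b \<in> B \<Longrightarrow> R (c i b)"
    and base: "\<And>bs. length bs = k \<Longrightarrow> set bs \<subseteq> B \<Longrightarrow> P (\<lambda>z. \<Lambda> z bs)"
  shows "P (\<lambda>z. \<Lambda> z (vs z))"
proof -
  have sum: "P (\<lambda>z. \<Sum>b\<in>S. f b z)" if "finite S" "\<And>b. b \<in> S \<Longrightarrow> P (f b)" for S :: "'b set" and f
    using that by (induction S rule: finite_induct) (auto intro: P(1,2))
  \<comment> \<open>Induction on the number \<open>j\<close> of places that still hold the varying
    vectors; the places behind them hold elements of \<open>B\<close>.\<close>
  have "P (\<lambda>z. \<Lambda> z (take j (vs z) @ bs))" if "j \<le> k" "length bs = k - j" "set bs \<subseteq> B" for j bs
    using that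
  proof (induction j arbitrary: bs)
    case 0
    then show ?case using base by simp
  next
    case (Suc j)
    have "P (\<lambda>z. \<Sum>b\<in>B. c j b z * \<Lambda> z (take j (vs z) @ b # bs))"
      by (intro sum V P(3) vs(4) Suc.IH) (use Suc.prems in auto)
    then show ?case
    proof (rule P(4))
      fix z assume z: "z \<in> Z"
      have "take (Suc j) (vs z) @ bs = take j (vs z) @ (\<Sum>b\<in>B. c j b z *\<^sub>R b) # bs"
        using vs(1,3)[OF z] Suc.prems by (simp add: take_Suc_conv_app_nth)
      moreover have "\<Lambda> z (take j (vs z) @ (\<Sum>b\<in>B. c j b z *\<^sub>R b) # bs) =
          (\<Sum>b\<in>B. c j b z * \<Lambda> z (take j (vs z) @ b # bs))"
        by (rule multilinear_on_sum[OF V(1) \<Lambda>[OF z]])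
           (use vs(1,2)[OF z] Suc.prems V in \<open>auto dest: in_set_takeD\<close>)
      ultimately show "(\<Sum>b\<in>B. c j b z * \<Lambda> z (take j (vs z) @ b # bs)) = \<Lambda> z (take (Suc j) (vs z) @ bs)"
        by simp
    qed
  qed
  from this[of k "[]"] have "P (\<lambda>z. \<Lambda> z (take k (vs z)))" by simp
  then show ?thesis by (rule P(4)) (use vs(1) in auto)
qed

lemma basis_ofD:
  assumes "basis_of V b"
  shows "distinct b" "independent (set b)" "span (set b) = V" "set b \<subseteq> V" "length b = dim V" "subspace V"
  using assms dim_span_eq_card_independent[of "set b"] distinct_card[of b] span_superset[of "set b"] subspace_span[of "set b"]
  by (auto simp: basis_of_def)

lemma basis_of_representation:
  assumes "basis_of V b" "v \<in> V"
  shows "v = (\<Sum>x\<in>set b. representation (set b) v x *\<^sub>R x)"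
  using sum_representation_eq[of "set b" v "set b"] basis_ofD[OF assms(1)] assms(2) by auto

lemma multilinear_on_eq_zero:
  assumes "basis_of V b" "multilinear_on k V \<Lambda>"
    and "\<And>bs. length bs = k \<Longrightarrow> set bs \<subseteq> set b \<Longrightarrow> \<Lambda> bs = 0"
    and "length xs = k" "set xs \<subseteq> V"
  shows "\<Lambda> xs = 0"
proof -
  let ?Z = "{xs. length xs = k \<and> set xs \<subseteq> V}"
  have "\<forall>z\<in>?Z. \<Lambda> z = 0"
  proof (rule multilinear_on_closure[where P = "\<lambda>f. \<forall>z\<in>?Z. f z = 0" and R = "\<lambda>_. True" and Z = ?Z and B = "set b"
        and V = V and k = k and c = "\<lambda>i x z. representation (set b) (z ! i) x" and \<Lambda> = "\<lambda>z. \<Lambda>" and vs = "\<lambda>z. z"])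
    show "z ! i = (\<Sum>x\<in>set b. representation (set b) (z ! i) x *\<^sub>R x)" if "z \<in> ?Z" "i < k" for z i
      by (rule basis_of_representation[OF assms(1)]) (use that in auto)
  qed (use assms basis_ofD[OF assms(1)] in auto)
  then show ?thesis using assms by auto
qed

lemma forms_linear: "\<beta> \<in> forms k V \<Longrightarrow> multilinear_on k V \<beta>"
  unfolding forms_def multilinear_on_def by simp

lemma forms_alternating:
  assumes "\<beta> \<in> forms k V" "\<not> distinct xs"
  shows "\<beta> xs = 0"
proof (cases "length xs = k \<and> set xs \<subseteq> V")
  case True
  then obtain i j where "i < k" "j < k" "i \<noteq> j" "xs ! i = xs ! j"
    using assms(2) by (auto simp: distinct_conv_nth)
  with True assms(1) show ?thesis unfolding forms_def by simp
next
  case False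
  then show ?thesis using assms(1) unfolding forms_def by simp
qed

lemma forms_zero: "\<beta> \<in> forms k V \<Longrightarrow> \<not> (length xs = k \<and> set xs \<subseteq> V) \<Longrightarrow> \<beta> xs = 0"
  unfolding forms_def by simp

lemma formsI:
  assumes "multilinear_on k V \<beta>"
    and "\<And>xs. length xs = k \<Longrightarrow> set xs \<subseteq> V \<Longrightarrow> \<not> distinct xs \<Longrightarrow> \<beta> xs = 0"
    and "\<And>xs. \<not> (length xs = k \<and> set xs \<subseteq> V) \<Longrightarrow> \<beta> xs = 0"
  shows "\<beta> \<in> forms k V"
proof -
  have 1: "\<beta> (xs[i := a *\<^sub>R x + b *\<^sub>R y]) = a * \<beta> (xs[i := x]) + b * \<beta> (xs[i := y])"
    if "length xs = k" "set xs \<subseteq> V" "i < k" "x \<in> V" "y \<in> V" for xs i x y a b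
    by (rule multilinear_on_update[OF assms(1) that])
  have 2: "\<beta> xs = 0"
    if "length xs = k" "set xs \<subseteq> V" "i < k" "j < k" "i \<noteq> j" "xs ! i = xs ! j" for xs i j
    by (rule assms(2)) (use that in \<open>auto simp: distinct_conv_nth\<close>)
  show ?thesis
    unfolding forms_def using 1 2 assms(3) by simp
qed

lemma forms_lincomb:
  assumes "\<beta> \<in> forms k V" "\<gamma> \<in> forms k V"
  shows "(\<lambda>xs. a * \<beta> xs + b * \<gamma> xs) \<in> forms k V"
proof (rule formsI)
  have "\<beta> (xs[i := c *\<^sub>R x + d *\<^sub>R y]) = c * \<beta> (xs[i := x]) + d * \<beta> (xs[i := y])"
    "\<gamma> (xs[i := c *\<^sub>R x + d *\<^sub>R y]) = c * \<gamma> (xs[i := x]) + d * \<gamma> (xs[i := y])"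
    if "length xs = k" "set xs \<subseteq> V" "i < k" "x \<in> V" "y \<in> V" for xs i x y c d
    using that by (auto intro!: multilinear_on_update forms_linear assms)
  then show "multilinear_on k V (\<lambda>xs. a * \<beta> xs + b * \<gamma> xs)"
    unfolding multilinear_on_def by (simp add: algebra_simps)
qed (use forms_alternating[OF assms(1)] forms_alternating[OF assms(2)] forms_zero[OF assms(1)] forms_zero[OF assms(2)] in auto)

lemma multilinear_on_subset:
  "multilinear_on k V \<Lambda> \<Longrightarrow> W \<subseteq> V \<Longrightarrow> multilinear_on k W \<Lambda>"
  unfolding multilinear_on_def by (simp add: subset_iff)

lemma multilinear_on_cong:
  assumes "\<And>xs. length xs = k \<Longrightarrow> set xs \<subseteq> V \<Longrightarrow> \<Lambda> xs = \<Lambda>' xs" "multilinear_on k V \<Lambda>" "subspace V"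
  shows "multilinear_on k V \<Lambda>'"
  unfolding multilinear_on_def
proof (intro allI impI ballI)
  fix xs i x y a b assume *: "length xs = k \<and> set xs \<subseteq> V" "i < k" "x \<in> V" "y \<in> V"
  have sub: "set (xs[i := z]) \<subseteq> V" if "z \<in> V" for z
    using * that set_update_subset_insert[of xs i z] by auto
  have "a *\<^sub>R x + b *\<^sub>R y \<in> V" using * assms(3) by (simp add: subspace_add subspace_scale)
  then have eq: "\<Lambda>' (xs[i := z]) = \<Lambda> (xs[i := z])" if "z \<in> {x, y, a *\<^sub>R x + b *\<^sub>R y}" for z
    using * that by (intro assms(1)[symmetric] sub) auto
  have "\<Lambda> (xs[i := a *\<^sub>R x + b *\<^sub>R y]) = a * \<Lambda> (xs[i := x]) + b * \<Lambda> (xs[i := y])"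
    by (rule multilinear_on_update[OF assms(2)]) (use * in auto)
  then show "\<Lambda>' (xs[i := a *\<^sub>R x + b *\<^sub>R y]) = a * \<Lambda>' (xs[i := x]) + b * \<Lambda>' (xs[i := y])"
    by (simp add: eq)
qed

lemma forms_restrict:
  assumes "\<beta> \<in> forms k V" "W \<subseteq> V" "subspace W"
  shows "(\<lambda>xs. if set xs \<subseteq> W then \<beta> xs else 0) \<in> forms k W"
proof (rule formsI)
  show "multilinear_on k W (\<lambda>xs. if set xs \<subseteq> W then \<beta> xs else 0)"
    by (rule multilinear_on_cong[OF _ multilinear_on_subset[OF forms_linear[OF assms(1)] assms(2)] assms(3)]) auto
qed (use forms_alternating[OF assms(1)] forms_zero[OF assms(1)] in auto)

lemma forms_swap:
  assumes V: "subspace V" and \<beta>: "\<beta> \<in> forms k V"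
  shows "\<beta> (us @ y # x # ws) = - \<beta> (us @ x # y # ws)"
proof (cases "length (us @ x # y # ws) = k \<and> set (us @ x # y # ws) \<subseteq> V")
  case True
  note lin = multilinear_onD[OF forms_linear[OF \<beta>], where a = 1 and b = 1, simplified]
  have xy: "x + y \<in> V" using True V by (auto intro: subspace_add)
  have "0 = \<beta> (us @ (x + y) # (x + y) # ws)"
    by (rule forms_alternating[OF \<beta>, symmetric]) simp
  also have "\<dots> = \<beta> (us @ x # (x + y) # ws) + \<beta> (us @ y # (x + y) # ws)"
    by (rule lin) (use True xy in auto)
  also have "\<beta> (us @ x # (x + y) # ws) = \<beta> (us @ x # x # ws) + \<beta> (us @ x # y # ws)"
    using lin[of "us @ [x]" ws x y] True by simp
  also have "\<beta> (us @ y # (x + y) # ws) = \<beta> (us @ y # x # ws) + \<beta> (us @ y # y # ws)"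
    using lin[of "us @ [y]" ws x y] True by simp
  also have "\<beta> (us @ x # x # ws) = 0" by (rule forms_alternating[OF \<beta>]) simp
  also have "\<beta> (us @ y # y # ws) = 0" by (rule forms_alternating[OF \<beta>]) simp
  finally show ?thesis by simp
next
  case False
  then show ?thesis using forms_zero[OF \<beta>, of "us @ x # y # ws"] forms_zero[OF \<beta>, of "us @ y # x # ws"] by auto
qed

text \<open>Adjacent transpositions generate all rearrangements. The prefix \<open>us\<close>
  collects the entries that have already reached their place.\<close>

lemma mset_eq_induct_swap:
  assumes "\<And>us x y ws. Q (us @ x # y # ws) \<Longrightarrow> Q (us @ y # x # ws)"
    and "mset xs = mset ys" "Q (us @ xs)"
  shows "Q (us @ ys)"
  using assms(2,3)
proof (induction ys arbitrary: xs us)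
  case (Cons y ys)
  have move: "Q (us @ y # as @ bs)" if "Q (us @ as @ y # bs)" for as bs
    using that
  proof (induction as arbitrary: bs rule: rev_induct)
    case (snoc a as)
    have "Q ((us @ as) @ y # a # bs)" by (rule assms(1)) (use snoc.prems in simp)
    then show ?case using snoc.IH[of "a # bs"] by simp
  qed simp
  have "y \<in> set xs" using Cons.prems(1) by (metis list.set_intros(1) set_mset_mset)
  then obtain as bs where xs: "xs = as @ y # bs" by (auto simp: in_set_conv_decomp)
  then have "mset (as @ bs) = mset ys" using Cons.prems(1) by simp
  then have "Q ((us @ [y]) @ ys)"
    by (rule Cons.IH) (use move[of as bs] Cons.prems(2) xs in simp)
  then show ?case by simp
qed simp

text \<open>Vanishing is insensitive to the sign of a transposition, so rearrangements can be used
  without keeping track of signs.\<close>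

lemma forms_mset_zero:
  assumes "subspace V" "\<beta> \<in> forms k V" "mset xs = mset ys" "\<beta> xs = 0"
  shows "\<beta> ys = 0"
proof -
  have "\<beta> ([] @ ys) = 0"
  proof (rule mset_eq_induct_swap[where Q = "\<lambda>xs. \<beta> xs = 0", OF _ assms(3)])
    show "\<beta> (us @ y # x # ws) = 0" if "\<beta> (us @ x # y # ws) = 0" for us x y ws
      using that forms_swap[OF assms(1,2), of us y x ws] by linarith
  qed (use assms(4) in simp)
  then show ?thesis by simp
qed

lemma forms_eq_zero:
  assumes "basis_of V b" "\<beta> \<in> forms k V"
    and "\<And>bs. length bs = k \<Longrightarrow> set bs \<subseteq> set b \<Longrightarrow> distinct bs \<Longrightarrow> \<beta> bs = 0"
  shows "\<beta> = (\<lambda>_. 0)"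
proof
  fix xs
  show "\<beta> xs = 0"
  proof (cases "length xs = k \<and> set xs \<subseteq> V")
    case True
    show ?thesis
      by (rule multilinear_on_eq_zero[OF assms(1) forms_linear[OF assms(2)]])
         (use assms(3) forms_alternating[OF assms(2)] True in auto)
  qed (rule forms_zero[OF assms(2)])
qed

lemma form_vanishing_on_basis:
  assumes "basis_of V b" "\<beta> \<in> forms (length b) V" "\<beta> b = 0"
  shows "\<beta> = (\<lambda>_. 0)"
proof (rule forms_eq_zero[OF assms(1,2)])
  fix bs assume bs: "length bs = length b" "set bs \<subseteq> set b" "distinct bs"
  note b = basis_ofD[OF assms(1)]
  have "set bs = set b"
    using bs b by (metis List.finite_set card_subset_eq distinct_card)
  then have "mset b = mset bs" using bs b by (simp add: set_eq_iff_mset_eq_distinct)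
  then show "\<beta> bs = 0" by (rule forms_mset_zero[OF b(6) assms(2) _ assms(3)])
qed

lemma forms_above_dim:
  assumes "basis_of V b" "\<beta> \<in> forms k V" "length b < k"
  shows "\<beta> = (\<lambda>_. 0)"
proof (rule forms_eq_zero[OF assms(1,2)])
  fix bs assume bs: "length bs = k" "set bs \<subseteq> set b" "distinct bs"
  then have "k \<le> length b"
    by (metis List.finite_set card_length card_mono distinct_card order_trans)
  then show "\<beta> bs = 0" using assms(3) by simp
qed

lemma volume_form_basis:
  assumes "volume_form m V \<omega>" "basis_of V b"
  shows "length b = m" "\<omega> b \<noteq> 0"
proof -
  show l: "length b = m" using assms basis_ofD[OF assms(2)] by (simp add: volume_form_def)
  show "\<omega> b \<noteq> 0"
    using form_vanishing_on_basis[OF assms(2), of \<omega>] assms(1) l by (auto simp: volume_form_def zero_fun_def)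
qed

lemma forms_proportional:
  assumes "basis_of V b" "\<theta> \<in> forms (length b) V" "\<beta> \<in> forms (length b) V" "\<theta> b \<noteq> 0"
  shows "\<beta> xs = \<beta> b / \<theta> b * \<theta> xs"
proof -
  have "(\<lambda>xs. 1 * \<beta> xs + (- (\<beta> b / \<theta> b)) * \<theta> xs) = (\<lambda>_. 0)"
    by (rule form_vanishing_on_basis[OF assms(1) forms_lincomb[OF assms(3,2)]]) (use assms(4) in simp)
  from fun_cong[OF this, of xs] show ?thesis by simp
qed

definition omit :: "nat \<Rightarrow> 'a list \<Rightarrow> 'a list"
  where "omit i xs = take i xs @ drop (Suc i) xs"

lemma length_omit: "i < length xs \<Longrightarrow> length (omit i xs) = length xs - 1"
  by (simp add: omit_def)

lemma set_omit_subset: "set (omit i xs) \<subseteq> set xs"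
  by (auto simp: omit_def dest: in_set_takeD in_set_dropD)

lemma mset_omit: "i < length xs \<Longrightarrow> mset (omit i xs @ [xs ! i]) = mset xs"
proof -
  assume "i < length xs"
  then have "mset xs = mset (take i xs @ xs ! i # drop (Suc i) xs)" by (simp add: id_take_nth_drop[symmetric])
  then show ?thesis by (simp add: omit_def)
qed

lemma nth_in_omit: "i < length xs \<Longrightarrow> j < length xs \<Longrightarrow> i \<noteq> j \<Longrightarrow> xs ! j \<in> set (omit i xs)"
proof -
  assume *: "i < length xs" "j < length xs" "i \<noteq> j"
  show ?thesis
  proof (cases "j < i")
    case True
    then show ?thesis using * by (auto simp: omit_def in_set_conv_nth intro!: exI[of _ j])
  next
    case False
    then have "drop (Suc i) xs ! (j - Suc i) = xs ! j" "j - Suc i < length (drop (Suc i) xs)" using * by auto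
    then show ?thesis unfolding omit_def by (metis UnCI nth_mem set_append)
  qed
qed

lemma basis_of_mset:
  assumes "basis_of V b" "mset c = mset b"
  shows "basis_of V c"
  using assms mset_eq_imp_distinct_iff[of c b] mset_eq_setD[of c b] by (auto simp: basis_of_def)

lemma volume_form_omit:
  assumes "volume_form m V \<omega>" "basis_of V b" "i < m"
  shows "\<omega> (omit i b @ [b ! i]) \<noteq> 0"
  by (rule volume_form_basis(2)[OF assms(1) basis_of_mset[OF assms(2) mset_omit]])
     (use volume_form_basis(1)[OF assms(1,2)] assms(3) in simp)

text \<open>A list of \<open>k - 1\<close> distinct elements of a basis of length \<open>k\<close>
  misses exactly one of them, so it is a rearrangement of some \<open>omit i b\<close>.\<close>

lemma forms_omit_zero:
  assumes "basis_of V b" "length b = k" "k \<ge> 1" "\<beta> \<in> forms (k - 1) V"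
    and "\<And>i. i < k \<Longrightarrow> \<beta> (omit i b) = 0"
  shows "\<beta> = (\<lambda>_. 0)"
proof (rule forms_eq_zero[OF assms(1,4)])
  fix bs assume bs: "length bs = k - 1" "set bs \<subseteq> set b" "distinct bs"
  note b = basis_ofD[OF assms(1)]
  have "card (set b - set bs) = 1"
    using bs b assms(2,3) by (simp add: card_Diff_subset distinct_card)
  then obtain x where x: "set b - set bs = {x}" by (auto simp: card_1_singleton_iff)
  then obtain i where i: "i < k" "b ! i = x" using assms(2) by (metis Diff_iff in_set_conv_nth insertI1)
  have 1: "mset (omit i b) + {#x#} = mset b" using mset_omit[of i b] i assms(2) by simp
  have "distinct (bs @ [x])" "set (bs @ [x]) = set b" using x bs by auto
  then have "mset (bs @ [x]) = mset b" using b(1) set_eq_iff_mset_eq_distinct by blast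
  then have "add_mset x (mset (omit i b)) = add_mset x (mset bs)" using 1 by simp
  then have "mset (omit i b) = mset bs" by simp
  then show "\<beta> bs = 0" by (rule forms_mset_zero[OF b(6) assms(4)]) (use assms(5) i in simp)
qed

text \<open>Here \<eta> stands for an element of the \<open>j\<close>-th exterior power, inserted
  behind the first \<open>n\<close> arguments. With \<open>l = 1\<close> this describes a height
  function as a function of its argument and, for the Gauss map, of the frame in front.\<close>

lemma multilinear_on_contract:
  assumes "\<beta> \<in> forms (n + j + l) V"
    and \<eta>: "\<And>\<beta> \<gamma> a b. \<beta> \<in> forms j V \<Longrightarrow> \<gamma> \<in> forms j V \<Longrightarrow>
       \<eta> (\<lambda>xs. a * \<beta> xs + b * \<gamma> xs) = a * \<eta> \<beta> + b * \<eta> \<gamma>"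
    and f: "\<And>xs. length xs = n + l \<Longrightarrow> set xs \<subseteq> V \<Longrightarrow> (\<lambda>ws. \<beta> (take n xs @ ws @ drop n xs)) \<in> forms j V"
    and V: "subspace V"
  shows "multilinear_on (n + l) V (\<lambda>xs. \<eta> (\<lambda>ws. \<beta> (take n xs @ ws @ drop n xs)))"
  unfolding multilinear_on_def
proof (intro allI impI ballI)
  fix xs i x y a b
  assume xs: "length xs = n + l \<and> set xs \<subseteq> V" and i: "i < n + l" and xy: "x \<in> V" "y \<in> V"
  have sub: "set (xs[i := z]) \<subseteq> V" if "z \<in> V" for z
    using xs that set_update_subset_insert[of xs i z] by auto
  let ?F = "\<lambda>z ws. \<beta> (take n (xs[i := z]) @ ws @ drop n (xs[i := z]))"
  have F: "?F z \<in> forms j V" if "z \<in> V" for z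
    by (rule f) (use xs sub[OF that] in auto)
  have z: "a *\<^sub>R x + b *\<^sub>R y \<in> V" using xy V by (simp add: subspace_add subspace_scale)
  have "?F (a *\<^sub>R x + b *\<^sub>R y) ws = a * ?F x ws + b * ?F y ws" for ws
  proof (cases "length ws = j \<and> set ws \<subseteq> V")
    case True
    define us where "us = take n xs @ ws @ drop n xs"
    define i' where "i' = (if i < n then i else i + j)"
    have us: "length us = n + j + l" "set us \<subseteq> V"
      using xs True by (auto simp: us_def dest: in_set_takeD in_set_dropD)
    have i': "i' < n + j + l" using i by (auto simp: i'_def)
    have "?F z ws = \<beta> (us[i' := z])" for z
    proof (cases "i < n")
      case T: True
      then show ?thesis using xs by (simp add: us_def i'_def take_update_swap list_update_append)
    next
      case F: False
      then have "us[i' := z] = take n xs @ ws @ (drop n xs)[i - n := z]"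
        using xs True by (auto simp: us_def i'_def list_update_append)
      then show ?thesis using F xs by (simp add: drop_update_swap)
    qed
    then show ?thesis
      using multilinear_on_update[OF forms_linear[OF assms(1)] us i' xy] by simp
  next
    case False
    then show ?thesis using forms_zero[OF F[OF z], of ws] forms_zero[OF F[OF xy(1)], of ws] forms_zero[OF F[OF xy(2)], of ws]
      by auto
  qed
  then have "?F (a *\<^sub>R x + b *\<^sub>R y) = (\<lambda>ws. a * ?F x ws + b * ?F y ws)" by blast
  then show "\<eta> (?F (a *\<^sub>R x + b *\<^sub>R y)) = a * \<eta> (?F x) + b * \<eta> (?F y)"
    using \<eta>[OF F[OF xy(1)] F[OF xy(2)], of a b] by simp
qed

lemma forms_contract:
  assumes \<beta>: "\<beta> \<in> forms (length as + j + length bs) V" and "set as \<subseteq> V" "set bs \<subseteq> V"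
  shows "(\<lambda>ws. \<beta> (as @ ws @ bs)) \<in> forms j V"
proof (rule formsI)
  show "multilinear_on j V (\<lambda>ws. \<beta> (as @ ws @ bs))"
    unfolding multilinear_on_def
  proof (intro allI impI ballI)
    fix xs i x y a b
    assume *: "length xs = j \<and> set xs \<subseteq> V" "i < j" "x \<in> V" "y \<in> V"
    have "as @ xs[i := z] @ bs = (as @ xs @ bs)[length as + i := z]" for z
      using * by (simp add: list_update_append)
    moreover have "length (as @ xs @ bs) = length as + j + length bs" "set (as @ xs @ bs) \<subseteq> V" using * assms by auto
    ultimately show "\<beta> (as @ xs[i := a *\<^sub>R x + b *\<^sub>R y] @ bs) = a * \<beta> (as @ xs[i := x] @ bs) + b * \<beta> (as @ xs[i := y] @ bs)"
      using multilinear_on_update[OF forms_linear[OF \<beta>], of "as @ xs @ bs" "length as + i" x y a b] * by simp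
  qed
  show "\<beta> (as @ xs @ bs) = 0" if "\<not> distinct xs" for xs
    by (rule forms_alternating[OF \<beta>]) (use that in simp)
  show "\<beta> (as @ xs @ bs) = 0" if "\<not> (length xs = j \<and> set xs \<subseteq> V)" for xs
    by (rule forms_zero[OF \<beta>]) (use that in auto)
qed

section \<open>Exterior powers\<close>

lemma wedge_form: "\<beta> \<in> forms (length vs) V \<Longrightarrow> wedge V vs \<beta> = \<beta> vs"
  by (simp add: wedge_def)

lemma ext_power_nonform:
  assumes "\<eta> \<in> ext_power V j W" "\<beta> \<notin> forms j V"
  shows "\<eta> \<beta> = 0"
  using assms(1) unfolding ext_power_def
proof (induction rule: span_induct_alt)
  case (step c x y)
  then show ?case using assms(2) by (auto simp: wedge_def scaleR_fun_def)
qed simp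

lemma ext_power_linear:
  assumes "\<eta> \<in> ext_power V j W" "\<beta> \<in> forms j V" "\<gamma> \<in> forms j V"
  shows "\<eta> (\<lambda>xs. a * \<beta> xs + b * \<gamma> xs) = a * \<eta> \<beta> + b * \<eta> \<gamma>"
  using assms(1) unfolding ext_power_def
proof (induction rule: span_induct_alt)
  case (step c x y)
  then show ?case using assms(2,3) forms_lincomb[OF assms(2,3), of a b]
    by (auto simp: wedge_def scaleR_fun_def algebra_simps)
qed simp

text \<open>On a \<open>k\<close>-dimensional space the volume form \<theta> turns vectors
  \<open>v\<close> into all the forms \<open>\<theta>(\<dots>, v)\<close> of degree
  \<open>k - 1\<close>. Such a form is determined by its values on the lists
  \<open>omit i b\<close>, so the wedge products of these lists span. The coefficients of the wedge
  product of \<open>vs\<close> are the quotients of \<open>\<theta> (vs @ [b ! i])\<close> by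
  \<open>\<theta> (omit i b @ [b ! i])\<close>.\<close>

lemma ext_power_iff:
  assumes W: "subspace V" "W \<subseteq> V" "basis_of W b" "volume_form k W \<theta>" "k \<ge> 1"
  shows "\<eta> \<in> ext_power V (k - 1) W \<longleftrightarrow> (\<exists>u. \<eta> = (\<Sum>i<k. u i *\<^sub>R wedge V (omit i b)))"
proof
  note b = basis_ofD[OF W(3)] and lb = volume_form_basis(1)[OF W(4,3)]
  have \<theta>: "\<theta> \<in> forms k W" using W(4) by (simp add: volume_form_def)
  define s where "s i = \<theta> (omit i b @ [b ! i])" for i
  have s: "s i \<noteq> 0" if "i < k" for i unfolding s_def by (rule volume_form_omit[OF W(4,3) that])
  have bi: "b ! i \<in> W" if "i < k" for i using b(4) lb that by auto
  have omitW: "set (omit i b) \<subseteq> W" for i using set_omit_subset[of i b] b(4) by blast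
  assume "\<eta> \<in> ext_power V (k - 1) W"
  then show "\<exists>u. \<eta> = (\<Sum>i<k. u i *\<^sub>R wedge V (omit i b))"
    unfolding ext_power_def
  proof (induction rule: span_induct_alt)
    case base
    show ?case by (intro exI[of _ "\<lambda>_. 0"]) simp
  next
    case (step c x y)
    then obtain vs where vs: "x = wedge V vs" "length vs = k - 1" "set vs \<subseteq> W" by auto
    define u where "u i = \<theta> (vs @ [b ! i]) / s i" for i
    have "wedge V vs = (\<Sum>i<k. u i *\<^sub>R wedge V (omit i b))"
    proof
      fix \<beta>
      show "wedge V vs \<beta> = (\<Sum>i<k. u i *\<^sub>R wedge V (omit i b)) \<beta>"
      proof (cases "\<beta> \<in> forms (k - 1) V")
        case True
        define \<gamma> where "\<gamma> = (\<lambda>xs. if set xs \<subseteq> W then \<beta> xs else 0)"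
        have \<gamma>: "\<gamma> \<in> forms (k - 1) W" unfolding \<gamma>_def by (rule forms_restrict[OF True W(2) b(6)])
        \<comment> \<open>The vector that represents \<gamma> through \<theta>; evaluation at
          \<open>omit i b\<close> forces its coefficients.\<close>
        define v where "v = (\<Sum>i<k. (\<gamma> (omit i b) / s i) *\<^sub>R b ! i)"
        have v: "v \<in> W" unfolding v_def by (intro subspace_sum subspace_scale b(6) bi) auto
        have expand: "\<theta> (xs @ [v]) = (\<Sum>i<k. \<gamma> (omit i b) / s i * \<theta> (xs @ [b ! i]))"
          if "length xs = k - 1" "set xs \<subseteq> W" for xs
          unfolding v_def
          by (rule multilinear_on_sum[OF b(6) forms_linear[OF \<theta>]]) (use that W(5) bi in auto)
        \<comment> \<open>The factors 1 and -1 and the empty list give the difference the shape of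
          \<open>forms_lincomb\<close> and \<open>forms_contract\<close>.\<close>
        have "(\<lambda>xs. 1 * \<gamma> xs + (- 1) * \<theta> ([] @ xs @ [v])) = (\<lambda>_. 0)"
        proof (rule forms_omit_zero[OF W(3) lb W(5)])
          show "(\<lambda>xs. 1 * \<gamma> xs + (- 1) * \<theta> ([] @ xs @ [v])) \<in> forms (k - 1) W"
            by (intro forms_lincomb \<gamma> forms_contract) (use \<theta> v W(5) in auto)
          fix j assume j: "j < k"
          have "\<theta> (omit j b @ [v]) = (\<Sum>i<k. \<gamma> (omit i b) / s i * \<theta> (omit j b @ [b ! i]))"
            by (rule expand) (use length_omit[of j b] lb j omitW in auto)
          also have "\<dots> = (\<Sum>i<k. if i = j then \<gamma> (omit j b) else 0)"
          proof (rule sum.cong)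
            fix i assume i: "i \<in> {..<k}"
            show "\<gamma> (omit i b) / s i * \<theta> (omit j b @ [b ! i]) = (if i = j then \<gamma> (omit j b) else 0)"
            proof (cases "i = j")
              case True
              then show ?thesis using s[OF j] by (simp add: s_def)
            next
              case False
              then have "\<theta> (omit j b @ [b ! i]) = 0"
                by (intro forms_alternating[OF \<theta>]) (use nth_in_omit[of j b i] i j lb in auto)
              then show ?thesis using False by simp
            qed
          qed simp
          also have "\<dots> = \<gamma> (omit j b)" using j by simp
          finally show "1 * \<gamma> (omit j b) + (- 1) * \<theta> ([] @ omit j b @ [v]) = 0" by simp
        qed
        from fun_cong[OF this, of vs] have "\<gamma> vs = \<theta> (vs @ [v])" by simp
        also have "\<dots> = (\<Sum>i<k. \<gamma> (omit i b) / s i * \<theta> (vs @ [b ! i]))" by (rule expand[OF vs(2,3)])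
        also have "\<dots> = (\<Sum>i<k. u i * \<beta> (omit i b))"
          by (rule sum.cong) (use omitW in \<open>auto simp: u_def \<gamma>_def\<close>)
        also have "\<dots> = (\<Sum>i<k. u i *\<^sub>R wedge V (omit i b)) \<beta>"
          using True lb by (auto simp: sum_fun_apply scaleR_fun_def wedge_def length_omit intro!: sum.cong)
        finally show ?thesis using True vs by (simp add: \<gamma>_def wedge_def)
      next
        case False
        then show ?thesis using vs lb by (auto simp: sum_fun_apply scaleR_fun_def wedge_def length_omit intro!: sum.neutral)
      qed
    qed
    moreover obtain u' where "y = (\<Sum>i<k. u' i *\<^sub>R wedge V (omit i b))" using step by auto
    ultimately show ?case
      unfolding vs(1) by (intro exI[of _ "\<lambda>i. c * u i + u' i"])
        (auto simp: sum_fun_apply scaleR_fun_def sum_distrib_left sum.distrib algebra_simps)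
  qed
next
  assume "\<exists>u. \<eta> = (\<Sum>i<k. u i *\<^sub>R wedge V (omit i b))"
  then obtain u where u: "\<eta> = (\<Sum>i<k. u i *\<^sub>R wedge V (omit i b))" by auto
  show "\<eta> \<in> ext_power V (k - 1) W"
    unfolding ext_power_def u
  proof (intro span_sum span_scale span_base)
    fix i assume "i \<in> {..<k}"
    then show "wedge V (omit i b) \<in> {wedge V vs |vs. length vs = k - 1 \<and> set vs \<subseteq> W}"
      using length_omit[of i b] volume_form_basis(1)[OF W(4,3)] set_omit_subset[of i b] basis_ofD(4)[OF W(3)] by auto
  qed
qed

text \<open>The linear function \<open>v \<mapsto> \<omega>(v\<^sub>1, \<dots>, v\<^sub>m\<^sub>-\<^sub>1, v)\<close> of \<open>y = v\<^sub>1 \<and> \<dots> \<and> v\<^sub>m\<^sub>-\<^sub>1\<close>.\<close>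

definition height :: "('b::real_vector list \<Rightarrow> real) \<Rightarrow> (('b list \<Rightarrow> real) \<Rightarrow> real) \<Rightarrow> 'b \<Rightarrow> real"
  where "height \<omega> y v = y (\<lambda>xs. \<omega> (xs @ [v]))"

lemma height_sum: "height \<omega> (\<Sum>i\<in>I. u i *\<^sub>R y i) v = (\<Sum>i\<in>I. u i * height \<omega> (y i) v)"
  by (simp add: height_def sum_fun_apply scaleR_fun_def)

lemma height_wedge:
  assumes "\<omega> \<in> forms (Suc (length xs)) V" "v \<in> V"
  shows "height \<omega> (wedge V xs) v = \<omega> (xs @ [v])"
  unfolding height_def
  by (rule wedge_form) (use forms_contract[of \<omega> "[]" "length xs" "[v]" V] assms in auto)

lemma height_linear:
  assumes "subspace V" "\<omega> \<in> forms m V" "m \<ge> 1" "y \<in> ext_power V (m - 1) W" "finite S" "\<And>s. s \<in> S \<Longrightarrow> v s \<in> V"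
  shows "height \<omega> y (\<Sum>s\<in>S. c s *\<^sub>R v s) = (\<Sum>s\<in>S. c s * height \<omega> y (v s))"
proof -
  have "multilinear_on (0 + 1) V (\<lambda>xs. y (\<lambda>ws. \<omega> (take 0 xs @ ws @ drop 0 xs)))"
  proof (rule multilinear_on_contract)
    show "\<omega> \<in> forms (0 + (m - 1) + 1) V" using assms by simp
    show "(\<lambda>ws. \<omega> (take 0 xs @ ws @ drop 0 xs)) \<in> forms (m - 1) V" if "length xs = 0 + 1" "set xs \<subseteq> V" for xs
      using forms_contract[of \<omega> "[]" "m - 1" xs V] that assms by simp
  qed (use assms ext_power_linear[OF assms(4)] in auto)
  from multilinear_on_sum[OF assms(1) this, of "[]" "[]" S v c] assms(5,6) show ?thesis
    by (simp add: height_def)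
qed

text \<open>Since \<open>\<omega> (omit i b @ [b ! j])\<close> vanishes for
  \<open>i \<noteq> j\<close>, the heights of the basis vectors determine all coefficients of
  \<open>y\<close>. Elements of this exterior power may thus be compared through their heights on a
  basis.\<close>

lemma height_eq_zero:
  assumes V: "basis_of V b" "volume_form m V \<omega>" "m \<ge> 1" and y: "y \<in> ext_power V (m - 1) V"
    and zero: "\<And>v. v \<in> set b \<Longrightarrow> height \<omega> y v = 0"
  shows "y = 0"
proof -
  note b = basis_ofD[OF V(1)] and lb = volume_form_basis(1)[OF V(2,1)]
  have \<omega>: "\<omega> \<in> forms m V" using V(2) by (simp add: volume_form_def)
  obtain u where u: "y = (\<Sum>i<m. u i *\<^sub>R wedge V (omit i b))"
    using y ext_power_iff[OF b(6) order_refl V(1,2,3)] by auto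
  have "u j = 0" if j: "j < m" for j
  proof -
    have "0 = height \<omega> y (b ! j)" using zero lb j by simp
    also have "\<dots> = (\<Sum>i<m. u i * height \<omega> (wedge V (omit i b)) (b ! j))" unfolding u height_sum ..
    also have "\<dots> = (\<Sum>i<m. if i = j then u j * \<omega> (omit j b @ [b ! j]) else 0)"
    proof (rule sum.cong)
      fix i assume i: "i \<in> {..<m}"
      have h: "height \<omega> (wedge V (omit i b)) (b ! j) = \<omega> (omit i b @ [b ! j])"
        by (rule height_wedge) (use \<omega> length_omit[of i b] i j lb b(4) in auto)
      show "u i * height \<omega> (wedge V (omit i b)) (b ! j) = (if i = j then u j * \<omega> (omit j b @ [b ! j]) else 0)"
      proof (cases "i = j")
        case False
        then have "\<omega> (omit i b @ [b ! j]) = 0"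
          by (intro forms_alternating[OF \<omega>]) (use nth_in_omit[of i b j] i j lb in auto)
        then show ?thesis using False h by simp
      qed (use h in simp)
    qed simp
    also have "\<dots> = u j * \<omega> (omit j b @ [b ! j])" using j by simp
    finally show "u j = 0" using volume_form_omit[OF V(2,1) j] by simp
  qed
  then show ?thesis unfolding u by simp
qed

section \<open>Smooth functions on manifolds\<close>

text \<open>With \<open>u = 1 / t\<close>, the derivative of \<open>p(u) exp(-u)\<close> with
  respect to \<open>t\<close> is \<open>u^2 (p(u) - p'(u)) exp(-u)\<close>; the factor
  \<open>[:0, 0, 1:]\<close> is \<open>u^2\<close>.\<close>

fun flat_poly :: "nat \<Rightarrow> real poly"
  where "flat_poly 0 = 1" | "flat_poly (Suc j) = [:0, 0, 1:] * (flat_poly j - pderiv (flat_poly j))"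

text \<open>The \<open>j\<close>-th derivative of the function \<open>exp (-1/t)\<close>, extended by \<open>0\<close> to \<open>t \<le> 0\<close>.\<close>

definition flat :: "nat \<Rightarrow> real \<Rightarrow> real"
  where "flat j t = (if t > 0 then poly (flat_poly j) (inverse t) * exp (- inverse t) else 0)"

lemma poly_exp_tendsto_0: "((\<lambda>u. poly p u * exp (- u)) \<longlongrightarrow> (0::real)) at_top"
proof -
  have "((\<lambda>u. \<Sum>i\<le>degree p. coeff p i * (u ^ i / exp u)) \<longlongrightarrow> (\<Sum>i\<le>degree p. coeff p i * 0)) at_top"
    by (intro tendsto_sum tendsto_mult tendsto_const tendsto_power_div_exp_0)
  then show ?thesis
    by (simp add: poly_altdef sum_distrib_right exp_minus divide_inverse mult.assoc)
qed

lemma flat_derivative: "(flat j has_real_derivative flat (Suc j) t) (at t)"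
proof -
  consider "t > 0" | "t < 0" | "t = 0" by linarith
  then show ?thesis
  proof cases
    case 1
    let ?p = "flat_poly j" and ?u = "inverse t"
    have inv: "(inverse has_real_derivative - (?u ^ Suc (Suc 0))) (at t)"
      by (rule DERIV_inverse) (use 1 in simp)
    have "((\<lambda>t. poly ?p (inverse t) * exp (- inverse t)) has_real_derivative
        (poly (pderiv ?p) ?u * - (?u ^ Suc (Suc 0))) * exp (- ?u) +
        (exp (- ?u) * - (- (?u ^ Suc (Suc 0)))) * poly ?p ?u) (at t)"
      by (intro DERIV_mult DERIV_chain2[OF poly_DERIV inv] DERIV_chain2[OF DERIV_exp DERIV_minus[OF inv]])
    also have "(poly (pderiv ?p) ?u * - (?u ^ Suc (Suc 0))) * exp (- ?u) +
        (exp (- ?u) * - (- (?u ^ Suc (Suc 0)))) * poly ?p ?u = flat (Suc j) t"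
      using 1 by (simp add: flat_def algebra_simps)
    finally have der: "((\<lambda>t. poly ?p (inverse t) * exp (- inverse t)) has_real_derivative flat (Suc j) t) (at t)" .
    have ev: "\<forall>\<^sub>F x in nhds t. flat j x = poly (flat_poly j) (inverse x) * exp (- inverse x)"
      using eventually_nhds_in_open[of "{0<..}" t] 1 by (auto simp: flat_def elim!: eventually_mono)
    show ?thesis by (rule iffD2[OF DERIV_cong_ev[OF refl ev refl] der])
  next
    case 2
    have ev: "\<forall>\<^sub>F x in nhds t. flat j x = 0"
      using eventually_nhds_in_open[of "{..<0}" t] 2 by (auto simp: flat_def elim!: eventually_mono)
    have der: "((\<lambda>x. 0) has_real_derivative flat (Suc j) t) (at t)" using 2 by (simp add: flat_def)
    show ?thesis by (rule iffD2[OF DERIV_cong_ev[OF refl ev refl] der])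
  next
    case 3
    \<comment> \<open>At 0 the difference quotient is \<open>u p(u) exp(-u)\<close> with
      \<open>u = 1 / h\<close> on the right, where the exponential wins, and 0 on the left.\<close>
    have "((\<lambda>h. flat j h / h) \<longlongrightarrow> 0) (at_right 0)"
    proof (rule Lim_transform_eventually)
      show "((\<lambda>h. poly ([:0, 1:] * flat_poly j) (inverse h) * exp (- inverse h)) \<longlongrightarrow> 0) (at_right 0)"
        by (rule filterlim_compose[OF poly_exp_tendsto_0 filterlim_inverse_at_top_right])
      show "\<forall>\<^sub>F h in at_right 0. poly ([:0, 1:] * flat_poly j) (inverse h) * exp (- inverse h) = flat j h / h"
        using eventually_at_right_less[of 0] by eventually_elim (simp add: flat_def divide_inverse)
    qed
    moreover have "((\<lambda>h. flat j h / h) \<longlongrightarrow> 0) (at_left 0)"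
    proof (rule Lim_transform_eventually)
      show "((\<lambda>h. 0) \<longlongrightarrow> (0::real)) (at_left 0)" by simp
      show "\<forall>\<^sub>F h in at_left 0. 0 = flat j h / h"
        by (simp add: eventually_at_filter flat_def)
    qed
    ultimately have "((\<lambda>h. flat j h / h) \<longlongrightarrow> 0) (at 0)"
      by (simp add: filterlim_split_at)
    then show ?thesis using 3 by (simp add: DERIV_def flat_def)
  qed
qed

lemma C_k_flat:
  assumes "openin (Euclidean_space d) U" "C_k k d U F"
  shows "C_k k d U (\<lambda>x. flat 0 (F x))"
  by (rule C_k_compose_real[OF assms(1), where I = UNIV and g = flat]) (auto intro: flat_derivative assms(2))

lemma C_k_prod:
  assumes "openin (Euclidean_space d) U" "finite S" "\<And>a. a \<in> S \<Longrightarrow> C_k k d U (F a)"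
  shows "C_k k d U (\<lambda>x. \<Prod>a\<in>S. F a x :: real)"
  using assms(2,3)
  by (induction S rule: finite_induct) (auto intro: C_k_const C_k_mult assms(1))

section \<open>Rules for partial derivatives\<close>

lemma partial_lincomb:
  fixes F G :: "(nat \<Rightarrow> real) \<Rightarrow> real"
  assumes "C_k 1 d U F" "C_k 1 d U G" "x \<in> U" "i < d"
  shows "partial i (\<lambda>x. a * F x + b * G x) x = a * partial i F x + b * partial i G x"
proof -
  note F = C_k_SucD(2)[OF assms(1)[unfolded One_nat_def] assms(4,3)]
    and G = C_k_SucD(2)[OF assms(2)[unfolded One_nat_def] assms(4,3)]
  have "((\<lambda>t. a * F (x(i := t)) + b * G (x(i := t))) has_vector_derivative a * partial i F x + b * partial i G x) (at (x i))"
    by (intro has_vector_derivative_add has_vector_derivative_mult_right F G)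
  from vector_derivative_at[OF this] show ?thesis unfolding partial_def .
qed

lemma partial_mult:
  fixes F G :: "(nat \<Rightarrow> real) \<Rightarrow> real"
  assumes "C_k 1 d U F" "C_k 1 d U G" "x \<in> U" "i < d"
  shows "partial i (\<lambda>x. F x * G x) x = F x * partial i G x + partial i F x * G x"
proof -
  note F = C_k_SucD(2)[OF assms(1)[unfolded One_nat_def] assms(4,3)]
    and G = C_k_SucD(2)[OF assms(2)[unfolded One_nat_def] assms(4,3)]
  have "((\<lambda>t. F (x(i := t)) * G (x(i := t))) has_vector_derivative
      F (x(i := x i)) * partial i G x + partial i F x * G (x(i := x i))) (at (x i))"
    by (rule has_vector_derivative_mult[OF F G])
  from vector_derivative_at[OF this] show ?thesis unfolding partial_def by (simp only: fun_upd_triv)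
qed

lemma partial_bounded_linear:
  assumes "C_k 1 d U F" "x \<in> U" "i < d" "bounded_linear L"
  shows "partial i (\<lambda>x. L (F x)) x = L (partial i F x)"
proof -
  have "((\<lambda>t. L (F (x(i := t)))) has_vector_derivative L (partial i F x)) (at (x i))"
    by (rule bounded_linear.has_vector_derivative[OF assms(4) C_k_SucD(2)[OF assms(1)[unfolded One_nat_def] assms(3,2)]])
  from vector_derivative_at[OF this] show ?thesis unfolding partial_def .
qed

lemma partial_coord: "partial i (\<lambda>x. x j) x = (if i = j then 1 else 0)"
proof (cases "i = j")
  case True
  have "((\<lambda>t. (x(i := t)) j) has_vector_derivative 1) (at (x i))" using True by simp
  from vector_derivative_at[OF this] show ?thesis using True unfolding partial_def by simp
next
  case False
  have "((\<lambda>t. (x(i := t)) j) has_vector_derivative 0) (at (x i))" using False by simp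
  from vector_derivative_at[OF this] show ?thesis using False unfolding partial_def by simp
qed

text \<open>A product of intervals and points, compact by Tychonoff's theorem. Bump functions will
  have their support in such boxes.\<close>

lemma openin_box:
  fixes a :: "nat \<Rightarrow> real"
  assumes "\<And>i. i \<ge> n \<Longrightarrow> a i = 0"
  shows "compact {y. (\<forall>i\<ge>n. y i = 0) \<and> (\<forall>i<n. \<bar>y i - a i\<bar> \<le> \<delta>)}"
proof -
  have "{y. (\<forall>i\<ge>n. y i = 0) \<and> (\<forall>i<n. \<bar>y i - a i\<bar> \<le> \<delta>)} =
      (\<Pi>\<^sub>E i\<in>UNIV. if i < n then {a i - \<delta>..a i + \<delta>} else {0})"
    by (auto simp: PiE_def Pi_iff abs_le_iff split: if_splits) (smt (verit))+
  moreover have "compactin (product_topology (\<lambda>i. euclidean) UNIV)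
      (\<Pi>\<^sub>E i\<in>(UNIV :: nat set). if i < n then {a i - \<delta>..a i + \<delta>} else {0})"
    by (subst compactin_PiE) auto
  ultimately show ?thesis by (simp add: euclidean_product_topology)
qed

section \<open>Smooth functions on a manifold and their extension\<close>

locale manifold =
  fixes n :: nat and A :: "'m::{t2_space, second_countable_topology} atlas"
  assumes manifold: "smooth_manifold n A"
begin

lemma chart_cover: obtains U \<phi> where "(U, \<phi>) \<in> A" "p \<in> U"
proof -
  have "p \<in> (\<Union>(U, \<phi>)\<in>A. U)" using manifold by (simp add: smooth_manifold_def)
  then show ?thesis using that by auto
qed

lemma chart:
  assumes "(U, \<phi>) \<in> A"
  shows "open U" "openin (Euclidean_space n) (\<phi> ` U)" "homeomorphism U (\<phi> ` U) \<phi> (inv_into U \<phi>)"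
    "inj_on \<phi> U" "continuous_on U \<phi>"
proof -
  show "open U" "openin (Euclidean_space n) (\<phi> ` U)" and hom: "homeomorphism U (\<phi> ` U) \<phi> (inv_into U \<phi>)"
    using manifold assms unfolding smooth_manifold_def by auto
  show "inj_on \<phi> U" "continuous_on U \<phi>"
    using hom unfolding homeomorphism_def by (auto intro: inj_on_inverseI)
qed

lemma chart_inv: "(U, \<phi>) \<in> A \<Longrightarrow> q \<in> U \<Longrightarrow> inv_into U \<phi> (\<phi> q) = q"
  using chart(4) by (simp add: inv_into_f_f)

lemma chart_coord_zero: "(U, \<phi>) \<in> A \<Longrightarrow> q \<in> U \<Longrightarrow> i \<ge> n \<Longrightarrow> \<phi> q i = 0"
  using chart(2)[of U \<phi>] by (auto simp: openin_Euclidean_space_iff)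

lemma chart_image_open:
  assumes "(U, \<phi>) \<in> A" "open V"
  shows "openin (Euclidean_space n) (\<phi> ` (V \<inter> U))"
proof -
  have "openin (top_of_set U) (V \<inter> U)" using assms(2) by (auto simp: openin_open)
  from homeomorphism_imp_open_map[OF chart(3)[OF assms(1)] this]
  obtain T where T: "open T" "\<phi> ` (V \<inter> U) = \<phi> ` U \<inter> T" by (auto simp: openin_open)
  obtain T' where T': "open T'" "\<phi> ` U = T' \<inter> {x. \<forall>i\<ge>n. x i = 0}"
    using chart(2)[OF assms(1)] by (auto simp: openin_Euclidean_space_iff)
  show ?thesis
    unfolding openin_Euclidean_space_iff T(2) T'(2) using T(1) T'(1)
    by (intro exI[of _ "T' \<inter> T"]) auto
qed

lemma smooth_onI:
  "(\<And>U \<phi> k. (U, \<phi>) \<in> A \<Longrightarrow> C_k k n (\<phi> ` (V \<inter> U)) (\<lambda>x. h (inv_into U \<phi> x))) \<Longrightarrow> smooth_on n A V h"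
  by (auto simp: smooth_on_def C_inf_def)

lemma smooth_onD:
  "smooth_on n A V h \<Longrightarrow> (U, \<phi>) \<in> A \<Longrightarrow> C_k k n (\<phi> ` (V \<inter> U)) (\<lambda>x. h (inv_into U \<phi> x))"
  by (auto simp: smooth_on_def C_inf_def)

lemma smooth_on_const: "open V \<Longrightarrow> smooth_on n A V (\<lambda>q. c)"
  by (rule smooth_onI) (rule C_k_const[OF chart_image_open])

lemma smooth_on_add:
  assumes "open V" "smooth_on n A V g" "smooth_on n A V h"
  shows "smooth_on n A V (\<lambda>q. g q + h q)"
proof (rule smooth_onI)
  fix U \<phi> k assume U: "(U, \<phi>) \<in> A"
  show "C_k k n (\<phi> ` (V \<inter> U)) (\<lambda>x. g (inv_into U \<phi> x) + h (inv_into U \<phi> x))"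
    by (rule C_k_add[OF chart_image_open[OF U assms(1)] smooth_onD[OF assms(2) U] smooth_onD[OF assms(3) U]])
qed

lemma smooth_on_mult:
  fixes g h :: "'m \<Rightarrow> real"
  assumes "open V" "smooth_on n A V g" "smooth_on n A V h"
  shows "smooth_on n A V (\<lambda>q. g q * h q)"
proof (rule smooth_onI)
  fix U \<phi> k assume U: "(U, \<phi>) \<in> A"
  show "C_k k n (\<phi> ` (V \<inter> U)) (\<lambda>x. g (inv_into U \<phi> x) * h (inv_into U \<phi> x))"
    by (rule C_k_mult[OF chart_image_open[OF U assms(1)] smooth_onD[OF assms(2) U] smooth_onD[OF assms(3) U]])
qed

lemma smooth_on_sum:
  assumes "open V" "\<And>s. s \<in> S \<Longrightarrow> smooth_on n A V (h s)"
  shows "smooth_on n A V (\<lambda>q. \<Sum>s\<in>S. h s q)"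
proof (rule smooth_onI)
  fix U \<phi> k assume U: "(U, \<phi>) \<in> A"
  show "C_k k n (\<phi> ` (V \<inter> U)) (\<lambda>x. \<Sum>s\<in>S. h s (inv_into U \<phi> x))"
    by (rule C_k_sum[OF chart_image_open[OF U assms(1)]]) (rule smooth_onD[OF assms(2) U])
qed

lemma smooth_on_inverse:
  fixes h :: "'m \<Rightarrow> real"
  assumes "open V" "smooth_on n A V h" "\<And>q. q \<in> V \<Longrightarrow> h q \<noteq> 0"
  shows "smooth_on n A V (\<lambda>q. inverse (h q))"
proof (rule smooth_onI)
  fix U \<phi> k assume U: "(U, \<phi>) \<in> A"
  show "C_k k n (\<phi> ` (V \<inter> U)) (\<lambda>x. inverse (h (inv_into U \<phi> x)))"
    by (rule C_k_inverse[OF chart_image_open[OF U assms(1)] _ smooth_onD[OF assms(2) U]])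
       (use assms(3) chart_inv[OF U] in auto)
qed

lemma smooth_on_divide:
  assumes "open V" "smooth_on n A V g" "smooth_on n A V h" "\<And>q. q \<in> V \<Longrightarrow> h q \<noteq> (0::real)"
  shows "smooth_on n A V (\<lambda>q. g q / h q)"
  unfolding divide_inverse by (rule smooth_on_mult[OF assms(1,2) smooth_on_inverse[OF assms(1,3,4)]])

lemma smooth_on_bounded_linear:
  assumes "open V" "bounded_linear L" "smooth_on n A V h"
  shows "smooth_on n A V (\<lambda>q. L (h q))"
proof (rule smooth_onI)
  fix U \<phi> k assume U: "(U, \<phi>) \<in> A"
  show "C_k k n (\<phi> ` (V \<inter> U)) (\<lambda>x. L (h (inv_into U \<phi> x)))"
    by (rule C_k_bounded_linear[OF chart_image_open[OF U assms(1)] assms(2) smooth_onD[OF assms(3) U]])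
qed

lemma smooth_on_cong:
  assumes "open V" "smooth_on n A V g" "\<And>q. q \<in> V \<Longrightarrow> g q = h q"
  shows "smooth_on n A V h"
proof (rule smooth_onI)
  fix U \<phi> k assume U: "(U, \<phi>) \<in> A"
  show "C_k k n (\<phi> ` (V \<inter> U)) (\<lambda>x. h (inv_into U \<phi> x))"
    by (rule C_k_cong[OF chart_image_open[OF U assms(1)] _ smooth_onD[OF assms(2) U]])
       (use assms(3) chart_inv[OF U] in auto)
qed

lemma smooth_on_subset:
  assumes "smooth_on n A V h" "W \<subseteq> V"
  shows "smooth_on n A W h"
proof (rule smooth_onI)
  fix U \<phi> k assume U: "(U, \<phi>) \<in> A"
  show "C_k k n (\<phi> ` (W \<inter> U)) (\<lambda>x. h (inv_into U \<phi> x))"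
    by (rule C_k_subset[OF smooth_onD[OF assms(1) U]]) (use assms(2) in auto)
qed

lemma smooth_on_local:
  assumes "open V" "\<And>p. p \<in> V \<Longrightarrow> \<exists>W. open W \<and> p \<in> W \<and> smooth_on n A W h"
  shows "smooth_on n A V h"
proof (rule smooth_onI, rule C_k_local)
  fix U \<phi> k assume U: "(U, \<phi>) \<in> A"
  show "openin (Euclidean_space n) (\<phi> ` (V \<inter> U))" by (rule chart_image_open[OF U assms(1)])
  fix x assume "x \<in> \<phi> ` (V \<inter> U)"
  then obtain p where p: "p \<in> V" "p \<in> U" "x = \<phi> p" by auto
  obtain W where W: "open W" "p \<in> W" "smooth_on n A W h" using assms(2)[OF p(1)] by auto
  show "\<exists>Va. openin (Euclidean_space n) Va \<and> x \<in> Va \<and> C_k k n Va (\<lambda>x. h (inv_into U \<phi> x))"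
    by (intro exI[of _ "\<phi> ` (W \<inter> U)"] conjI chart_image_open[OF U W(1)] smooth_onD[OF W(3) U])
       (use p W in auto)
qed

text \<open>Smoothness is defined through all charts at once; composition with the smooth changes of
  coordinates reduces it to a single chart.\<close>

lemma smooth_on_chartI:
  fixes h :: "'m \<Rightarrow> real"
  assumes U: "(U, \<phi>) \<in> A" and V: "open V" "V \<subseteq> U" and h: "\<And>k. C_k k n (\<phi> ` V) (\<lambda>x. h (inv_into U \<phi> x))"
  shows "smooth_on n A V h"
proof (rule smooth_onI)
  fix U' \<phi>' k assume U': "(U', \<phi>') \<in> A"
  have UV: "V \<inter> U = V" using V(2) by auto
  have W: "openin (Euclidean_space n) (\<phi>' ` (V \<inter> U'))" by (rule chart_image_open[OF U' V(1)])
  show "C_k k n (\<phi>' ` (V \<inter> U')) (\<lambda>x. h (inv_into U' \<phi>' x))"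
  proof (rule C_k_cong[OF W])
    show "C_k k n (\<phi>' ` (V \<inter> U')) (\<lambda>x. h (inv_into U \<phi> (\<phi> (inv_into U' \<phi>' x))))"
    proof (rule C_k_compose[where F = "\<lambda>y. h (inv_into U \<phi> y)" and g = "\<lambda>x. \<phi> (inv_into U' \<phi>' x)", OF _ W])
      show "openin (Euclidean_space n) (\<phi> ` V)" using chart_image_open[OF U V(1)] UV by simp
      show "\<phi> (inv_into U' \<phi>' w) \<in> \<phi> ` V" if "w \<in> \<phi>' ` (V \<inter> U')" for w
        using that chart_inv[OF U'] by auto
      show "C_k k n (\<phi>' ` (V \<inter> U')) (\<lambda>w. \<phi> (inv_into U' \<phi>' w) j)" if "j < n" for j
      proof (rule C_k_subset)
        show "C_k k n (\<phi>' ` (U' \<inter> U)) (\<lambda>w. \<phi> (inv_into U' \<phi>' w) j)"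
          using manifold U U' that unfolding smooth_manifold_def C_inf_def by fast
      qed (use V in auto)
    qed (rule h)
    show "h (inv_into U \<phi> (\<phi> (inv_into U' \<phi>' x))) = h (inv_into U' \<phi>' x)" if "x \<in> \<phi>' ` (V \<inter> U')" for x
      using that chart_inv[OF U'] chart_inv[OF U] V by auto
  qed
qed

lemma smooth_on_coord:
  assumes U: "(U, \<phi>) \<in> A"
  shows "smooth_on n A U (\<lambda>q. \<phi> q i)"
proof (rule smooth_on_chartI[OF U chart(1)[OF U] order_refl])
  fix k
  show "C_k k n (\<phi> ` U) (\<lambda>x. \<phi> (inv_into U \<phi> x) i)"
    by (rule C_k_cong[OF chart(2)[OF U] _ C_k_coord[OF chart(2)[OF U], of k i]])
       (use chart_inv[OF U] in auto)
qed

text \<open>Tangent vectors and parametrizations are tested on globally smooth functions, so a local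
  function \<open>g\<close> is replaced by \<open>b * g\<close>, extended by 0. The function
  \<open>b\<close> is a product of flat functions, one for each coordinate, and vanishes outside a
  compact box. A nonzero value at \<open>p\<close> is enough: later \<open>b\<close> is eliminated
  by the product rule or by division.\<close>

lemma bump:
  assumes O: "open O'" and p: "p \<in> O'"
  obtains b :: "'m \<Rightarrow> real" where "smooth n A b" "b p \<noteq> 0"
    "\<And>g :: 'm \<Rightarrow> real. smooth_on n A O' g \<Longrightarrow> smooth n A (\<lambda>q. if q \<in> O' then b q * g q else 0)"
proof -
  obtain U \<phi> where U: "(U, \<phi>) \<in> A" "p \<in> U" by (rule chart_cover)
  define V where "V = O' \<inter> U"
  have V: "open V" "V \<subseteq> U" "p \<in> V" using O p U chart(1)[OF U(1)] by (auto simp: V_def)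
  have W: "openin (Euclidean_space n) (\<phi> ` V)"
    unfolding V_def by (rule chart_image_open[OF U(1) O])
  obtain \<delta> where \<delta>: "\<delta> > 0" "\<And>y. (\<forall>i\<ge>n. y i = 0) \<Longrightarrow> (\<forall>i<n. \<bar>y i - \<phi> p i\<bar> \<le> \<delta>) \<Longrightarrow> y \<in> \<phi> ` V"
    using eopen_contains_box[OF W imageI[OF V(3)]] by metis
  define K where "K = {y. (\<forall>i\<ge>n. y i = 0) \<and> (\<forall>i<n. \<bar>y i - \<phi> p i\<bar> \<le> \<delta>)}"
  have K: "compact K" "K \<subseteq> \<phi> ` V"
    using openin_box[of n "\<phi> p" \<delta>] chart_coord_zero[OF U] \<delta>(2) by (auto simp: K_def)
  have "continuous_on K (inv_into U \<phi>)"
    using chart(3)[OF U(1)] K(2) V(2) unfolding homeomorphism_def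
    by (meson continuous_on_subset image_mono order_trans)
  then have cl: "closed (inv_into U \<phi> ` K)"
    using K(1) compact_continuous_image compact_imp_closed by blast
  define b where "b q = (if q \<in> V then \<Prod>i<n. flat 0 (\<delta>\<^sup>2 - (\<phi> q i - \<phi> p i)\<^sup>2) else 0)" for q
  have b0: "b q = 0" if "q \<notin> inv_into U \<phi> ` K" for q
  proof (cases "q \<in> V")
    case True
    then have "\<phi> q \<notin> K" using that chart_inv[OF U(1), of q] V by (metis image_eqI subsetD)
    then obtain i where i: "i < n" "\<bar>\<phi> q i - \<phi> p i\<bar> > \<delta>"
      using True V chart_coord_zero[OF U(1), of q] by (auto simp: K_def not_le)
    then have "(\<phi> q i - \<phi> p i)\<^sup>2 > \<delta>\<^sup>2" using \<delta>(1) by (metis abs_ge_zero less_imp_le power2_abs power_strict_mono zero_less_numeral)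
    then have "flat 0 (\<delta>\<^sup>2 - (\<phi> q i - \<phi> p i)\<^sup>2) = 0" by (simp add: flat_def)
    then show ?thesis using i(1) by (auto simp: b_def intro!: prod_zero)
  qed (simp add: b_def)
  have coord: "smooth_on n A V (\<lambda>q. \<phi> q i)" for i
    by (rule smooth_on_subset[OF smooth_on_coord[OF U(1)] V(2)])
  have bV: "smooth_on n A V b"
  proof (rule smooth_on_chartI[OF U(1) V(1,2)], rule C_k_cong[OF W])
    fix k
    show "C_k k n (\<phi> ` V) (\<lambda>x. \<Prod>i<n. flat 0 (\<delta>\<^sup>2 + (-1) * ((x i + (- \<phi> p i)) * (x i + (- \<phi> p i)))))"
      by (intro C_k_prod C_k_flat C_k_add C_k_mult C_k_const C_k_coord W) auto
    show "(\<Prod>i<n. flat 0 (\<delta>\<^sup>2 + (-1) * ((x i + (- \<phi> p i)) * (x i + (- \<phi> p i))))) = b (inv_into U \<phi> x)"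
      if "x \<in> \<phi> ` V" for x
      using that chart_inv[OF U(1)] V(2) by (auto simp: b_def power2_eq_square)
  qed
  have ext: "smooth n A (\<lambda>q. if q \<in> O' then b q * g q else 0)" if g: "smooth_on n A O' g" for g :: "'m \<Rightarrow> real"
  proof (rule smooth_on_local)
    \<comment> \<open>Two open sets cover the manifold: \<open>V\<close>, where \<open>g\<close> is
      available, and the complement of the compact preimage of the box, where the function is
      0.\<close>
    fix q :: 'm
    show "\<exists>W. open W \<and> q \<in> W \<and> smooth_on n A W (\<lambda>q. if q \<in> O' then b q * g q else 0)"
    proof (cases "q \<in> inv_into U \<phi> ` K")
      case True
      then obtain x where x: "q = inv_into U \<phi> x" "x \<in> K" by (rule imageE)
      then obtain q' where "x = \<phi> q'" "q' \<in> V" using K(2) by blast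
      then have "q \<in> V" using chart_inv[OF U(1), of q'] V(2) x(1) by auto
      moreover have "smooth_on n A V (\<lambda>q. if q \<in> O' then b q * g q else 0)"
      proof (rule smooth_on_cong[OF V(1)])
        show "smooth_on n A V (\<lambda>q. b q * g q)"
          by (intro smooth_on_mult V(1) bV smooth_on_subset[OF g]) (auto simp: V_def)
      qed (auto simp: V_def)
      ultimately show ?thesis using V(1) by blast
    next
      case False
      have "smooth_on n A (- inv_into U \<phi> ` K) (\<lambda>q. if q \<in> O' then b q * g q else 0)"
        by (rule smooth_on_cong[OF _ smooth_on_const[of _ 0]]) (use cl b0 in auto)
      then show ?thesis using False cl by (intro exI[of _ "- inv_into U \<phi> ` K"]) auto
    qed
  qed simp
  show ?thesis
  proof (rule that[of b])
    have "smooth n A (\<lambda>q. if q \<in> O' then b q * 1 else 0)" by (rule ext) (rule smooth_on_const[OF O])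
    moreover have "(\<lambda>q. if q \<in> O' then b q * 1 else 0) = b" by (auto simp: b_def V_def)
    ultimately show "smooth n A b" by simp
    show "b p \<noteq> 0" using V(3) \<delta>(1) by (simp add: b_def flat_def)
  qed (rule ext)
qed


end

context manifold begin

section \<open>Tangent vectors\<close>

lemma subspace_tangent_space: "subspace (tangent_space n A p)"
  unfolding subspace_def tangent_space_def
  by (auto simp: scaleR_fun_def algebra_simps)

lemma tangent_lincomb:
  "v \<in> tangent_space n A p \<Longrightarrow> smooth n A g \<Longrightarrow> smooth n A h \<Longrightarrow> v (\<lambda>q. a * g q + b * h q) = a * v g + b * v h"
  unfolding tangent_space_def by simp

lemma tangent_mult:
  "v \<in> tangent_space n A p \<Longrightarrow> smooth n A g \<Longrightarrow> smooth n A h \<Longrightarrow> v (\<lambda>q. g q * h q) = g p * v h + h p * v g"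
  unfolding tangent_space_def by simp

lemma tangent_const:
  assumes "v \<in> tangent_space n A p"
  shows "v (\<lambda>q. c) = 0"
proof -
  have s: "smooth n A (\<lambda>q. 1 :: real)" by (rule smooth_on_const) simp
  have "v (\<lambda>q. 1) = 0" using tangent_mult[OF assms s s] by simp
  then show ?thesis using tangent_lincomb[OF assms s s, of c 0] by simp
qed

lemma tangent_sum:
  assumes "v \<in> tangent_space n A p" "finite S" "\<And>s. s \<in> S \<Longrightarrow> smooth n A (h s)"
  shows "v (\<lambda>q. \<Sum>s\<in>S. c s * h s q) = (\<Sum>s\<in>S. c s * v (h s))"
  using assms(2,3)
proof (induction S rule: finite_induct)
  case empty
  then show ?case using tangent_const[OF assms(1), of 0] by simp
next
  case (insert s S)
  have "smooth n A (\<lambda>q. \<Sum>s\<in>S. c s * h s q)"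
    by (intro smooth_on_sum smooth_on_mult smooth_on_const open_UNIV) (use insert.prems in auto)
  from tangent_lincomb[OF assms(1) insert.prems[of s] this, of "c s" 1] insert show ?case by simp
qed

lemma deriv_along_inner:
  fixes W :: "'m \<Rightarrow> 'v::euclidean_space"
  assumes "v \<in> tangent_space n A p" "smooth n A W"
  shows "deriv_along v W \<bullet> a = v (\<lambda>q. W q \<bullet> a)"
proof -
  have "(\<lambda>q. W q \<bullet> a) = (\<lambda>q. \<Sum>b\<in>Basis. (b \<bullet> a) * (W q \<bullet> b))"
    by (subst euclidean_inner) (simp add: mult.commute inner_commute)
  moreover have "v (\<lambda>q. \<Sum>b\<in>Basis. (b \<bullet> a) * (W q \<bullet> b)) = (\<Sum>b\<in>Basis. (b \<bullet> a) * v (\<lambda>q. W q \<bullet> b))"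
    by (rule tangent_sum[OF assms(1)])
       (auto intro!: smooth_on_bounded_linear[OF open_UNIV bounded_linear_inner_left assms(2)])
  ultimately show ?thesis
    by (simp add: deriv_along_def inner_sum_left mult.commute)
qed

lemma deriv_along_sum:
  "deriv_along (\<Sum>i\<in>I. c i *\<^sub>R v i) f = (\<Sum>i\<in>I. c i *\<^sub>R deriv_along (v i) f)"
proof -
  have "deriv_along (\<Sum>i\<in>I. c i *\<^sub>R v i) f = (\<Sum>b\<in>Basis. \<Sum>i\<in>I. c i *\<^sub>R v i (\<lambda>q. f q \<bullet> b) *\<^sub>R b)"
    unfolding deriv_along_def sum_fun_apply scaleR_fun_def by (simp add: scaleR_sum_left)
  also have "\<dots> = (\<Sum>i\<in>I. c i *\<^sub>R deriv_along (v i) f)"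
    unfolding deriv_along_def scaleR_sum_right by (rule sum.swap)
  finally show ?thesis .
qed

definition coord_vec :: "'m set \<Rightarrow> ('m \<Rightarrow> nat \<Rightarrow> real) \<Rightarrow> 'm \<Rightarrow> nat \<Rightarrow> ('m \<Rightarrow> real) \<Rightarrow> real"
  where "coord_vec U \<phi> p i = (\<lambda>h. if smooth n A h then partial i (\<lambda>x. h (inv_into U \<phi> x)) (\<phi> p) else 0)"

lemma smooth_chart: "smooth n A h \<Longrightarrow> (U, \<phi>) \<in> A \<Longrightarrow> C_k k n (\<phi> ` U) (\<lambda>x. h (inv_into U \<phi> x))"
  using smooth_onD[of UNIV h U \<phi> k] by simp

lemma coord_vec_tangent:
  assumes U: "(U, \<phi>) \<in> A" "p \<in> U" "i < n"
  shows "coord_vec U \<phi> p i \<in> tangent_space n A p"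
  unfolding tangent_space_def
proof (intro CollectI conjI allI impI)
  show "coord_vec U \<phi> p i h = 0" if "\<not> smooth n A h" for h using that by (simp add: coord_vec_def)
  fix g h :: "'m \<Rightarrow> real" assume gh: "smooth n A g \<and> smooth n A h"
  note G = smooth_chart[OF conjunct1[OF gh] U(1)] and H = smooth_chart[OF conjunct2[OF gh] U(1)]
  have p: "\<phi> p \<in> \<phi> ` U" using U(2) by (rule imageI)
  show "coord_vec U \<phi> p i (\<lambda>q. a * g q + b * h q) = a * coord_vec U \<phi> p i g + b * coord_vec U \<phi> p i h" for a b
  proof -
    have "smooth n A (\<lambda>q. a * g q + b * h q)"
      by (intro smooth_on_add smooth_on_mult smooth_on_const open_UNIV) (use gh in auto)
    then show ?thesis using gh partial_lincomb[OF G H p U(3), of a b] by (simp add: coord_vec_def)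
  qed
  show "coord_vec U \<phi> p i (\<lambda>q. g q * h q) = g p * coord_vec U \<phi> p i h + h p * coord_vec U \<phi> p i g"
  proof -
    have "smooth n A (\<lambda>q. g q * h q)" by (intro smooth_on_mult open_UNIV) (use gh in auto)
    then show ?thesis using gh partial_mult[OF G H p U(3)] chart_inv[OF U(1,2)] by (simp add: coord_vec_def)
  qed
qed

text \<open>The hypothesis is applied to \<open>b\<close> and to \<open>b * \<phi>\<^sub>j\<close>
  for a bump function \<open>b\<close> at \<open>p\<close>. By the product rule the second sum is
  \<open>c j * b p\<close> plus a multiple of the first. The form with partial derivatives matches
  the condition in \<open>local_param\<close>.\<close>

lemma coord_vec_independent:
  fixes c :: "nat \<Rightarrow> real"
  assumes U: "(U, \<phi>) \<in> A" "p \<in> U"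
    and zero: "\<And>h :: 'm \<Rightarrow> real. smooth n A h \<Longrightarrow> (\<Sum>i<n. c i * partial i (\<lambda>x. h (inv_into U \<phi> x)) (\<phi> p)) = 0"
    and j: "j < n"
  shows "c j = 0"
proof -
  obtain b where b: "smooth n A b" "b p \<noteq> 0"
    "\<And>g :: 'm \<Rightarrow> real. smooth_on n A U g \<Longrightarrow> smooth n A (\<lambda>q. if q \<in> U then b q * g q else 0)"
    using bump[OF chart(1)[OF U(1)] U(2)] by metis
  let ?b = "\<lambda>x. b (inv_into U \<phi> x)"
  let ?h = "\<lambda>q. if q \<in> U then b q * \<phi> q j else 0"
  have p: "\<phi> p \<in> \<phi> ` U" using U(2) by (rule imageI)
  have h: "smooth n A ?h" by (rule b(3)[OF smooth_on_coord[OF U(1)]])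
  have "partial i (\<lambda>x. ?h (inv_into U \<phi> x)) (\<phi> p) = b p * (if i = j then 1 else 0) + partial i ?b (\<phi> p) * \<phi> p j" if "i < n" for i
  proof -
    have "partial i (\<lambda>x. ?h (inv_into U \<phi> x)) (\<phi> p) = partial i (\<lambda>x. ?b x * x j) (\<phi> p)"
      by (rule partial_cong[OF chart(2)[OF U(1)] p that]) (use chart_inv[OF U(1)] in auto)
    also have "\<dots> = ?b (\<phi> p) * partial i (\<lambda>x. x j) (\<phi> p) + partial i ?b (\<phi> p) * \<phi> p j"
      by (rule partial_mult[OF smooth_chart[OF b(1) U(1)] C_k_coord[OF chart(2)[OF U(1)]] p that])
    finally show ?thesis by (simp add: partial_coord chart_inv[OF U])
  qed
  then have "0 = (\<Sum>i<n. c i * (b p * (if i = j then 1 else 0) + partial i ?b (\<phi> p) * \<phi> p j))"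
    using zero[OF h] by simp
  also have "\<dots> = (\<Sum>i<n. if i = j then c j * b p else 0) + (\<Sum>i<n. c i * partial i ?b (\<phi> p)) * \<phi> p j"
    unfolding sum_distrib_right sum.distrib[symmetric] by (rule sum.cong) (auto simp: algebra_simps)
  also have "\<dots> = c j * b p" using zero[OF b(1)] j by simp
  finally show ?thesis using b(2) by simp
qed

text \<open>The dimension of the tangent space is supplied by the volume element, so
  \<open>n\<close> independent vectors in it already span.\<close>

lemma coord_vec_basis:
  assumes U: "(U, \<phi>) \<in> A" "p \<in> U" and dim: "dim (tangent_space n A p) = n" "n \<ge> 1"
  shows "basis_of (tangent_space n A p) (map (coord_vec U \<phi> p) [0..<n])"
proof -
  let ?T = "tangent_space n A p" and ?v = "coord_vec U \<phi> p"
  have ind: "c j = 0" if "(\<Sum>i<n. c i *\<^sub>R ?v i) = 0" "j < n" for c j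
  proof (rule coord_vec_independent[OF U _ that(2), where c = c])
    fix h :: "'m \<Rightarrow> real" assume h: "smooth n A h"
    have "(\<Sum>i<n. c i *\<^sub>R ?v i) h = 0" using fun_cong[OF that(1), of h] by (simp only: zero_fun_def)
    then show "(\<Sum>i<n. c i * partial i (\<lambda>x. h (inv_into U \<phi> x)) (\<phi> p)) = 0"
      unfolding sum_fun_apply scaleR_fun_def coord_vec_def real_scaleR_def by (simp only: h if_True)
  qed
  have inj: "inj_on ?v {..<n}"
  proof (rule inj_onI)
    fix i j assume ij: "i \<in> {..<n}" "j \<in> {..<n}" "?v i = ?v j"
    show "i = j"
    proof (rule ccontr)
      assume "i \<noteq> j"
      let ?c = "\<lambda>l. if l = i then 1 else if l = j then - 1 else (0::real)"
      have "(\<Sum>l<n. ?c l *\<^sub>R ?v l) = (\<Sum>l\<in>{i, j}. ?c l *\<^sub>R ?v l)"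
        by (rule sum.mono_neutral_right) (use ij(1,2) in auto)
      also have "\<dots> = ?v i - ?v j" using \<open>i \<noteq> j\<close> by simp
      also have "\<dots> = 0" by (simp only: ij(3) diff_self)
      finally have "?c i = 0" by (rule ind) (use ij(1) in simp)
      then show False by simp
    qed
  qed
  let ?S = "?v ` {..<n}"
  have finS: "finite ?S" by (rule finite_imageI[OF finite_lessThan])
  have indep: "independent ?S"
  proof
    assume "dependent ?S"
    then have "\<exists>f. (\<exists>x\<in>?S. f x \<noteq> 0) \<and> (\<Sum>x\<in>?S. f x *\<^sub>R x) = 0"
      unfolding dependent_finite[OF finS] .
    then obtain f where f: "(\<exists>x\<in>?S. f x \<noteq> 0) \<and> (\<Sum>x\<in>?S. f x *\<^sub>R x) = 0" by (rule exE)
    obtain j where j: "j < n" "f (?v j) \<noteq> 0" using conjunct1[OF f] by auto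
    have "(\<Sum>i<n. f (?v i) *\<^sub>R ?v i) = (\<Sum>x\<in>?S. f x *\<^sub>R x)"
      by (simp only: sum.reindex[OF inj] o_def)
    also have "\<dots> = 0" by (rule conjunct2[OF f])
    finally have "f (?v j) = 0" by (rule ind[where c = "\<lambda>i. f (?v i)", OF _ j(1)])
    then show False using j(2) by simp
  qed
  have ST: "?S \<subseteq> ?T"
  proof (rule image_subsetI)
    fix i assume "i \<in> {..<n}"
    then show "?v i \<in> ?T" using coord_vec_tangent[OF U] by simp
  qed
  obtain B where B: "B \<subseteq> ?T" "independent B" "?T \<subseteq> span B" "card B = dim ?T"
    by (rule basis_exists[of ?T])
  have cardB: "card B = n" by (simp only: B(4) dim(1))
  \<comment> \<open>Infinite sets have \<open>card\<close> 0, so \<open>n \<ge> 1\<close> is what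
    makes \<open>B\<close> finite.\<close>
  have finB: "finite B" using cardB dim(2) card_ge_0_finite[of B] by simp
  have cardS: "card ?S = n" using card_image[OF inj] by simp
  have "?T \<subseteq> span ?S"
  proof
    fix v assume v: "v \<in> ?T"
    show "v \<in> span ?S"
    proof (rule ccontr)
      assume *: "v \<notin> span ?S"
      then have "independent (insert v ?S)" using indep by (simp add: independent_insertI)
      moreover have "insert v ?S \<subseteq> span B" using v ST B(3) by auto
      ultimately have "finite (insert v ?S) \<and> card (insert v ?S) \<le> card B"
        by (rule independent_span_bound[OF finB])
      then have c: "card (insert v ?S) \<le> n" unfolding cardB by (rule conjunct2)
      have "v \<notin> ?S" using * span_base[of v ?S] by (rule contrapos_nn)
      then have "card (insert v ?S) = Suc n" using card_insert_disjoint[OF finS] cardS by metis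
      then show False using c by linarith
    qed
  qed
  then have sp: "span ?S = ?T" using span_minimal[OF ST subspace_tangent_space] by (rule antisym[rotated])
  have S: "set (map ?v [0..<n]) = ?S" by auto
  have "distinct (map ?v [0..<n])" using inj by (simp add: distinct_map atLeast0LessThan)
  then show ?thesis unfolding basis_of_def S using indep sp by (intro conjI)
qed

definition coord_deriv :: "'m set \<Rightarrow> ('m \<Rightarrow> nat \<Rightarrow> real) \<Rightarrow> ('m \<Rightarrow> 'v::euclidean_space) \<Rightarrow> nat \<Rightarrow> 'm \<Rightarrow> 'v"
  where "coord_deriv U \<phi> f i q = partial i (\<lambda>x. f (inv_into U \<phi> x)) (\<phi> q)"

lemma deriv_along_coord_vec:
  fixes f :: "'m \<Rightarrow> 'v::euclidean_space"
  assumes U: "(U, \<phi>) \<in> A" "p \<in> U" "i < n" and f: "smooth n A f"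
  shows "deriv_along (coord_vec U \<phi> p i) f = coord_deriv U \<phi> f i p"
proof (rule euclidean_eqI)
  fix b :: 'v assume "b \<in> Basis"
  have s: "smooth n A (\<lambda>q. f q \<bullet> b)"
    by (rule smooth_on_bounded_linear[OF open_UNIV bounded_linear_inner_left f])
  have "deriv_along (coord_vec U \<phi> p i) f \<bullet> b = coord_vec U \<phi> p i (\<lambda>q. f q \<bullet> b)"
    by (rule deriv_along_inner[OF coord_vec_tangent[OF U] f])
  also have "\<dots> = partial i (\<lambda>x. f (inv_into U \<phi> x) \<bullet> b) (\<phi> p)" using s by (simp add: coord_vec_def)
  also have "\<dots> = coord_deriv U \<phi> f i p \<bullet> b"
    unfolding coord_deriv_def
    by (rule partial_bounded_linear[OF smooth_chart[OF f U(1)] imageI[OF U(2)] U(3) bounded_linear_inner_left])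
  finally show "deriv_along (coord_vec U \<phi> p i) f \<bullet> b = coord_deriv U \<phi> f i p \<bullet> b" .
qed

lemma smooth_on_componentwise:
  fixes h :: "'m \<Rightarrow> 'v::euclidean_space"
  assumes "open V" "\<And>b. b \<in> Basis \<Longrightarrow> smooth_on n A V (\<lambda>q. h q \<bullet> b)"
  shows "smooth_on n A V h"
proof (rule smooth_on_cong[OF assms(1)])
  show "smooth_on n A V (\<lambda>q. \<Sum>b\<in>Basis. (h q \<bullet> b) *\<^sub>R b)"
    by (intro smooth_on_sum assms(1) smooth_on_bounded_linear[OF assms(1) bounded_linear_scaleR_left] assms(2))
qed (simp add: euclidean_representation)

lemma smooth_on_inner: "open V \<Longrightarrow> smooth_on n A V h \<Longrightarrow> smooth_on n A V (\<lambda>q. h q \<bullet> b)"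
  by (rule smooth_on_bounded_linear[OF _ bounded_linear_inner_left])

lemma smooth_on_scaleR:
  fixes h :: "'m \<Rightarrow> 'v::euclidean_space"
  assumes "open V" "smooth_on n A V g" "smooth_on n A V h"
  shows "smooth_on n A V (\<lambda>q. g q *\<^sub>R h q)"
proof (rule smooth_on_componentwise[OF assms(1)])
  fix b :: 'v
  have "smooth_on n A V (\<lambda>q. g q * (h q \<bullet> b))"
    by (rule smooth_on_mult[OF assms(1,2) smooth_on_inner[OF assms(1,3)]])
  then show "smooth_on n A V (\<lambda>q. (g q *\<^sub>R h q) \<bullet> b)" by simp
qed

lemma smooth_on_coord_deriv:
  fixes f :: "'m \<Rightarrow> 'v::euclidean_space"
  assumes U: "(U, \<phi>) \<in> A" and i: "i < n" and f: "smooth n A f"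
  shows "smooth_on n A U (coord_deriv U \<phi> f i)"
proof (rule smooth_on_componentwise[OF chart(1)[OF U]], rule smooth_on_chartI[OF U chart(1)[OF U] order_refl])
  fix b :: 'v and k
  have "C_k k n (\<phi> ` U) (\<lambda>x. partial i (\<lambda>x. f (inv_into U \<phi> x)) x \<bullet> b)"
    by (rule C_k_bounded_linear[OF chart(2)[OF U] bounded_linear_inner_left C_k_SucD(3)[OF smooth_chart[OF f U] i]])
  then show "C_k k n (\<phi> ` U) (\<lambda>x. coord_deriv U \<phi> f i (inv_into U \<phi> x) \<bullet> b)"
    by (rule C_k_cong[OF chart(2)[OF U], rotated]) (use chart_inv[OF U] in \<open>auto simp: coord_deriv_def\<close>)
qed

lemma critical_at_max:
  fixes g :: "'m \<Rightarrow> real"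
  assumes g: "smooth n A g" and max: "\<And>q. g q \<le> g p"
    and dim: "dim (tangent_space n A p) = n" "n \<ge> 1" and v: "v \<in> tangent_space n A p"
  shows "v g = 0"
proof -
  obtain U \<phi> where U: "(U, \<phi>) \<in> A" "p \<in> U" by (rule chart_cover)
  have 0: "coord_vec U \<phi> p i g = 0" if i: "i < n" for i
  proof -
    have "((\<lambda>t. g (inv_into U \<phi> ((\<phi> p)(i := t)))) has_vector_derivative coord_vec U \<phi> p i g) (at (\<phi> p i))"
      using C_k_SucD(2)[OF smooth_chart[OF g U(1), of "Suc 0"] i imageI[OF U(2)]] g by (simp only: coord_vec_def if_True)
    then have "((\<lambda>t. g (inv_into U \<phi> ((\<phi> p)(i := t)))) has_real_derivative coord_vec U \<phi> p i g) (at (\<phi> p i))"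
      unfolding has_real_derivative_iff_has_vector_derivative .
    moreover have "g (inv_into U \<phi> ((\<phi> p)(i := \<phi> p i))) = g p"
      unfolding fun_upd_triv using chart_inv[OF U] by simp
    ultimately show ?thesis
      by (intro DERIV_local_max[of "\<lambda>t. g (inv_into U \<phi> ((\<phi> p)(i := t)))" _ "\<phi> p i" 1]) (simp_all only: zero_less_one max simp_thms)
  qed
  note b = coord_vec_basis[OF U dim]
  let ?S = "set (map (coord_vec U \<phi> p) [0..<n])"
  have "v g = (\<Sum>x\<in>?S. representation ?S v x *\<^sub>R x) g"
    by (rule fun_cong[OF basis_of_representation[OF b v]])
  also have "\<dots> = (\<Sum>x\<in>?S. representation ?S v x * x g)"
    by (simp only: sum_fun_apply scaleR_fun_def real_scaleR_def)
  also have "\<dots> = 0" using 0 by (auto intro!: sum.neutral)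
  finally show ?thesis .
qed

lemma two_points:
  assumes "n \<ge> 1"
  obtains q :: 'm where "q \<noteq> p"
proof -
  obtain U \<phi> where U: "(U, \<phi>) \<in> A" "p \<in> U" by (rule chart_cover)
  obtain \<delta> where \<delta>: "\<delta> > 0" "\<And>y. (\<forall>i\<ge>n. y i = 0) \<Longrightarrow> (\<forall>i<n. \<bar>y i - \<phi> p i\<bar> \<le> \<delta>) \<Longrightarrow> y \<in> \<phi> ` U"
    using eopen_contains_box[OF chart(2)[OF U(1)] imageI[OF U(2)]] by metis
  have "(\<phi> p)(0 := \<phi> p 0 + \<delta>) \<in> \<phi> ` U"
    by (rule \<delta>(2)) (use assms chart_coord_zero[OF U] \<delta>(1) in auto)
  then obtain q where "\<phi> q = (\<phi> p)(0 := \<phi> p 0 + \<delta>)" by auto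
  then have "\<phi> q 0 \<noteq> \<phi> p 0" using \<delta>(1) by simp
  then have "q \<noteq> p" by auto
  then show ?thesis by (rule that)
qed

text \<open>A maximum and a minimum are critical. If they are the same point, \<open>g\<close> is
  constant, and any second point of the manifold will do.\<close>

lemma two_critical_points:
  fixes g :: "'m \<Rightarrow> real"
  assumes g: "smooth n A g" and dim: "\<And>p. dim (tangent_space n A p) = n" "n \<ge> 1" and "compact (UNIV :: 'm set)"
  obtains p q where "p \<noteq> q" "\<And>v. v \<in> tangent_space n A p \<Longrightarrow> v g = 0" "\<And>v. v \<in> tangent_space n A q \<Longrightarrow> v g = 0"
proof -
  have cont: "continuous_on UNIV g"
  proof (rule continuous_at_imp_continuous_on, rule ballI)
    fix p :: 'm
    obtain U \<phi> where U: "(U, \<phi>) \<in> A" "p \<in> U" by (rule chart_cover)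
    have "continuous_on U (\<lambda>q. g (inv_into U \<phi> (\<phi> q)))"
      by (rule continuous_on_compose2[OF C_k_continuous[OF smooth_chart[OF g U(1), of 0]] chart(5)[OF U(1)]]) simp
    then have "continuous_on U g"
      using continuous_on_cong[of U U "\<lambda>q. g (inv_into U \<phi> (\<phi> q))" g] chart_inv[OF U(1)] by auto
    then show "isCont g p" using U chart(1)[OF U(1)] by (simp add: continuous_on_eq_continuous_at)
  qed
  obtain p where p: "\<And>q. g q \<le> g p"
    using continuous_attains_sup[OF assms(4) _ cont] by auto
  obtain q where q: "\<And>x. g q \<le> g x"
    using continuous_attains_inf[OF assms(4) _ cont] by auto
  have crit: "v g = 0" if "g x = g p \<or> g x = g q" "v \<in> tangent_space n A x" for v x
  proof (cases "g x = g p")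
    case True
    then show ?thesis using critical_at_max[OF g _ dim that(2)] p by simp
  next
    case False
    have neg: "smooth n A (\<lambda>y. (-1) * g y)"
      by (rule smooth_on_mult[OF open_UNIV smooth_on_const[OF open_UNIV] g])
    have "v (\<lambda>y. (-1) * g y) = 0"
      by (rule critical_at_max[OF neg _ dim that(2)]) (use q False that(1) in simp)
    then show ?thesis using tangent_lincomb[OF that(2) g g, of "-1" 0] by simp
  qed
  obtain p' where p': "p' \<noteq> p" using two_points[OF dim(2)] by metis
  show ?thesis
  proof (cases "p = q")
    case True
    then have "g p' = g p" using p[of p'] q[of p'] by simp
    show ?thesis
      by (rule that[OF p']) (rule crit; use \<open>g p' = g p\<close> in simp)+
  next
    case False
    show ?thesis
      by (rule that[OF False]) (rule crit; simp)+
  qed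
qed

end

section \<open>Forms and bases\<close>

lemma basis_of_span_independent:
  assumes "basis_of V b" "S \<subseteq> V" "independent S" "card S = length b" "finite S"
  shows "span S = V"
proof
  note b = basis_ofD[OF assms(1)]
  show "span S \<subseteq> V" by (rule span_minimal[OF assms(2) b(6)])
  show "V \<subseteq> span S"
  proof (rule subsetI, rule ccontr)
    fix v assume v: "v \<in> V" "v \<notin> span S"
    have 1: "independent (insert v S)" using v(2) assms(3) by (rule independent_insertI)
    have 2: "insert v S \<subseteq> span (set b)" using v(1) assms(2) b(3) by auto
    have "card (insert v S) \<le> card (set b)"
      using independent_span_bound[OF List.finite_set 1 2] by (rule conjunct2)
    moreover have "v \<notin> S" using v(2) span_base[of v S] by auto
    ultimately show False using assms(4,5) distinct_card[OF b(1)] by simp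
  qed
qed

text \<open>If one argument were a combination of the others, expansion would leave only terms with
  a repeated argument. The number of arguments being the dimension, independence implies
  spanning.\<close>

lemma form_nonzero_basis:
  assumes b: "basis_of V b" and \<omega>: "\<omega> \<in> forms (length b) V" and nz: "\<omega> xs \<noteq> 0"
  shows "basis_of V xs"
proof -
  note B = basis_ofD[OF b]
  have xs: "length xs = length b" "set xs \<subseteq> V" using forms_zero[OF \<omega>, of xs] nz by auto
  have d: "distinct xs" using forms_alternating[OF \<omega>, of xs] nz by auto
  have ind: "independent (set xs)"
  proof
    assume "dependent (set xs)"
    then obtain x where x: "x \<in> set xs" "x \<in> span (set xs - {x})" unfolding dependent_def by auto
    obtain us ws where uw: "xs = us @ x # ws" using x(1) by (auto simp: in_set_conv_decomp)
    have S: "set xs - {x} = set us \<union> set ws" using d uw by auto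
    obtain c where c: "x = (\<Sum>s\<in>set xs - {x}. c s *\<^sub>R s)"
      using x(2) span_finite[of "set xs - {x}"] by auto
    have "\<omega> xs = \<omega> (us @ (\<Sum>s\<in>set xs - {x}. c s *\<^sub>R s) # ws)" using uw c by simp
    also have "\<dots> = (\<Sum>s\<in>set xs - {x}. c s * \<omega> (us @ s # ws))"
      by (rule multilinear_on_sum[OF B(6) forms_linear[OF \<omega>]]) (use xs uw in auto)
    also have "\<dots> = 0"
    proof (rule sum.neutral, rule ballI)
      fix s assume "s \<in> set xs - {x}"
      then have "\<not> distinct (us @ s # ws)" using S by auto
      then show "c s * \<omega> (us @ s # ws) = 0" using forms_alternating[OF \<omega>] by simp
    qed
    finally show False using nz by simp
  qed
  have "span (set xs) = V"
    by (rule basis_of_span_independent[OF b xs(2) ind]) (use distinct_card[OF d] xs(1) in simp_all)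
  then show ?thesis unfolding basis_of_def using d ind by simp
qed

lemma orthonormal_list:
  fixes V :: "'v::euclidean_space set"
  assumes "subspace V"
  obtains e where "basis_of V e" "\<And>v. v \<in> V \<Longrightarrow> v = (\<Sum>b\<in>set e. (v \<bullet> b) *\<^sub>R b)"
proof -
  obtain B where B: "B \<subseteq> V" "pairwise real_inner_class.orthogonal B" "\<And>x. x \<in> B \<Longrightarrow> norm x = 1" "independent B" "card B = dim V" "span B = V"
    using orthonormal_basis_subspace[OF assms] by metis
  have fin: "finite B" using B(4) by (rule independent_imp_finite)
  obtain e where e: "set e = B" "distinct e" using finite_distinct_list[OF fin] by auto
  show ?thesis
  proof (rule that[of e])
    show "basis_of V e" unfolding basis_of_def using e B by simp
    show "v = (\<Sum>b\<in>set e. (v \<bullet> b) *\<^sub>R b)" if "v \<in> V" for v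
      using orthonormal_basis_expand[OF B(2,3) _ fin, of v] that B(6) e(1) by simp
  qed
qed

lemma wedge_in_ext_power: "length vs = j \<Longrightarrow> set vs \<subseteq> W \<Longrightarrow> wedge V vs \<in> ext_power V j W"
  unfolding ext_power_def by (rule span_base) auto

lemma subspace_ext_power: "subspace (ext_power V j W)"
  unfolding ext_power_def by (rule subspace_span)

lemma deriv_along_lincomb: "deriv_along (a *\<^sub>R x + b *\<^sub>R y) f = a *\<^sub>R deriv_along x f + b *\<^sub>R deriv_along y f"
  by (simp add: deriv_along_def scaleR_fun_def scaleR_add_left sum.distrib scaleR_sum_right)

lemma (in manifold) smooth_on_continuous:
  assumes h: "smooth_on n A V h" and V: "open V"
  shows "continuous_on V h"
proof (rule continuous_at_imp_continuous_on, rule ballI)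
  fix p assume p: "p \<in> V"
  obtain U \<phi> where U: "(U, \<phi>) \<in> A" "p \<in> U" by (rule chart_cover)
  have VU: "open (V \<inter> U)" using V chart(1)[OF U(1)] by (rule open_Int)
  have "continuous_on (V \<inter> U) (\<lambda>q. h (inv_into U \<phi> (\<phi> q)))"
    by (rule continuous_on_compose2[OF C_k_continuous[OF smooth_onD[OF h U(1), of 0]]
          continuous_on_subset[OF chart(5)[OF U(1)]]]) auto
  then have "continuous_on (V \<inter> U) h"
    using continuous_on_cong[of "V \<inter> U" "V \<inter> U" "\<lambda>q. h (inv_into U \<phi> (\<phi> q))" h] chart_inv[OF U(1)] by simp
  then show "isCont h p" using p U(2) VU by (simp add: continuous_on_eq_continuous_at)
qed

section \<open>The Gauss map\<close>

text \<open>The hypotheses common to the immersion into the whole space and the immersion into the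
  hyperplane, so that the Gauss map is treated once for both.\<close>

locale gauss_setup = manifold n A for n :: nat and A :: "'m::{t2_space, second_countable_topology} atlas" +
  fixes \<theta> :: "'m \<Rightarrow> (('m \<Rightarrow> real) \<Rightarrow> real) list \<Rightarrow> real" and k :: nat and V :: "'v::euclidean_space set"
    and \<omega> :: "'v list \<Rightarrow> real" and f :: "'m \<Rightarrow> 'v" and N :: "'m \<Rightarrow> 'v set" and \<theta>N :: "'m \<Rightarrow> 'v list \<Rightarrow> real"
  assumes n1: "n \<ge> 1" and k1: "k \<ge> 1" and cpt: "compact (UNIV :: 'm set)"
    and \<theta>: "\<And>p. volume_form n (tangent_space n A p) (\<theta> p)"
    and V': "subspace (direction V)" and \<omega>: "volume_form (n + k) (direction V) \<omega>"
    and imm: "immersion n A V f"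
    and tb: "transversal_bundle n A k V f N" and bv: "bundle_volume_element n A k N \<theta>N"
    and ind: "\<And>p vs \<xi>s. length vs = n \<Longrightarrow> set vs \<subseteq> tangent_space n A p \<Longrightarrow> basis_of (N p) \<xi>s \<Longrightarrow>
       \<theta> p vs = \<omega> (map (\<lambda>v. deriv_along v f) vs @ \<xi>s) / \<theta>N p \<xi>s"
begin

abbreviation V' :: "'v set" where "V' \<equiv> direction V"
abbreviation T :: "'m \<Rightarrow> (('m \<Rightarrow> real) \<Rightarrow> real) set" where "T p \<equiv> tangent_space n A p"
abbreviation m :: nat where "m \<equiv> n + k"
abbreviation gauss where "gauss \<equiv> gauss_map n A \<theta> k V f"

lemma f: "smooth n A f"
  using imm by (simp add: immersion_def)

lemma \<omega>_forms: "\<omega> \<in> forms m V'" and dim_V': "dim V' = m"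
  using \<omega> by (simp_all add: volume_form_def)

lemma dim_T: "dim (T p) = n"
  using \<theta> by (simp add: volume_form_def)

lemma \<theta>_forms: "\<theta> p \<in> forms n (T p)"
  using \<theta> by (simp add: volume_form_def)

lemma N: "subspace (N p)" "dim (N p) = k" "volume_form k (N p) (\<theta>N p)"
  using tb bv by (simp_all add: transversal_bundle_def bundle_volume_element_def)

lemma direction_eq: "V' = {x + y | x y. x \<in> (\<lambda>v. deriv_along v f) ` T p \<and> y \<in> N p}"
  using tb by (simp add: transversal_bundle_def Let_def)

lemma df_V': "v \<in> T p \<Longrightarrow> deriv_along v f \<in> V'" and N_V': "N p \<subseteq> V'"
proof -
  assume v: "v \<in> T p"
  have "deriv_along v f + 0 \<in> V'"
    unfolding direction_eq[of p] using imageI[OF v, of "\<lambda>v. deriv_along v f"] subspace_0[OF N(1)[of p]] by blast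
  then show "deriv_along v f \<in> V'" by simp
next
  have 0: "0 \<in> (\<lambda>v. deriv_along v f) ` T p"
    by (rule image_eqI[of _ _ 0]) (simp_all add: deriv_along_def subspace_0[OF subspace_tangent_space])
  show "N p \<subseteq> V'"
  proof
    fix y assume "y \<in> N p"
    then have "0 + y \<in> V'" unfolding direction_eq[of p] using 0 by blast
    then show "y \<in> V'" by simp
  qed
qed

definition frame :: "'m set \<Rightarrow> ('m \<Rightarrow> nat \<Rightarrow> real) \<Rightarrow> 'm \<Rightarrow> 'v list"
  where "frame U \<phi> q = map (\<lambda>i. coord_deriv U \<phi> f i q) [0..<n]"

text \<open>The density of \<theta> in a chart. Dividing by it compensates for the use of the
  coordinate frame instead of a unimodular one in the Gauss map.\<close>

definition \<tau> :: "'m set \<Rightarrow> ('m \<Rightarrow> nat \<Rightarrow> real) \<Rightarrow> 'm \<Rightarrow> real"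
  where "\<tau> U \<phi> q = \<theta> q (map (coord_vec U \<phi> q) [0..<n])"

lemma length_frame: "length (frame U \<phi> q) = n"
  by (simp add: frame_def)

context
  fixes U :: "'m set" and \<phi> :: "'m \<Rightarrow> nat \<Rightarrow> real" and q :: 'm
  assumes U: "(U, \<phi>) \<in> A" and q: "q \<in> U"
begin

lemma coord_basis: "basis_of (T q) (map (coord_vec U \<phi> q) [0..<n])"
  by (rule coord_vec_basis[OF U q dim_T n1])

lemma \<tau>_nonzero: "\<tau> U \<phi> q \<noteq> 0"
  unfolding \<tau>_def by (rule volume_form_basis(2)[OF \<theta> coord_basis])

lemma frame_eq: "map (\<lambda>v. deriv_along v f) (map (coord_vec U \<phi> q) [0..<n]) = frame U \<phi> q"
  unfolding frame_def by (simp add: deriv_along_coord_vec[OF U q _ f])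

lemma frame_V': "set (frame U \<phi> q) \<subseteq> V'"
  unfolding frame_eq[symmetric] by (auto intro!: df_V' coord_vec_tangent[OF U q])

lemma \<tau>_eq: "basis_of (N q) \<xi>s \<Longrightarrow> \<tau> U \<phi> q = \<omega> (frame U \<phi> q @ \<xi>s) / \<theta>N q \<xi>s"
  unfolding \<tau>_def frame_eq[symmetric]
  by (rule ind) (use coord_vec_tangent[OF U q] in auto)

lemma frame_nonzero: "basis_of (N q) \<xi>s \<Longrightarrow> \<omega> (frame U \<phi> q @ \<xi>s) \<noteq> 0"
  using \<tau>_eq[of \<xi>s] \<tau>_nonzero by auto

lemma basis_V': "basis_of (N q) \<xi>s \<Longrightarrow> basis_of V' (frame U \<phi> q @ \<xi>s)"
proof -
  assume \<xi>s: "basis_of (N q) \<xi>s"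
  obtain e where e: "basis_of V' e" "\<And>v. v \<in> V' \<Longrightarrow> v = (\<Sum>b\<in>set e. (v \<bullet> b) *\<^sub>R b)"
    using orthonormal_list[OF V'] by metis
  have "\<omega> \<in> forms (length e) V'" using \<omega>_forms basis_ofD(5)[OF e(1)] dim_V' by simp
  from form_nonzero_basis[OF e(1) this frame_nonzero[OF \<xi>s]] show ?thesis .
qed

lemma \<eta>_cong_linear:
  assumes "\<eta> \<in> ext_power V' (k - 1) (N q)" "\<beta> \<in> forms (k - 1) V'"
  shows "\<eta> (\<lambda>ws. c * \<beta> ws) = c * \<eta> \<beta>"
  using ext_power_linear[OF assms assms(2), of c 0] by simp

lemma contract_frame: "\<beta> \<in> forms (m - 1) V' \<Longrightarrow> (\<lambda>ws. \<beta> (frame U \<phi> q @ ws)) \<in> forms (k - 1) V'"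
  using forms_contract[of \<beta> "frame U \<phi> q" "k - 1" "[]" V'] k1 frame_V' by (simp add: length_frame)

text \<open>The frame chosen by \<open>SOME\<close> in \<open>gauss_map\<close> is replaced by the
  coordinate frame. Pulled back by \<open>df\<close> in its first \<open>n\<close> arguments,
  \<beta> becomes a top-degree form on the tangent space, hence a multiple of \<theta>; so the two
  frames give results that differ by the factor \<tau>.\<close>

lemma gauss_eq:
  assumes \<eta>: "\<eta> \<in> ext_power V' (k - 1) (N q)"
  shows "gauss (q, \<eta>) \<beta> = (if \<beta> \<in> forms (m - 1) V' then \<eta> (\<lambda>ws. \<beta> (frame U \<phi> q @ ws)) / \<tau> U \<phi> q else 0)"
proof -
  let ?b = "map (coord_vec U \<phi> q) [0..<n]"
  let ?es = "SOME es. basis_of (T q) es \<and> \<theta> q es = 1"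
  \<comment> \<open>Dividing the first coordinate vector by \<tau> makes the coordinate frame
    unimodular, so \<open>SOME\<close> does pick a unimodular frame.\<close>
  obtain h t where ht: "?b = h # t" using n1 by (cases ?b) auto
  have V: "h \<in> T q" "set t \<subseteq> T q"
    using basis_ofD(4)[OF coord_basis] unfolding ht by simp_all
  have lt: "1 + length t = n" using arg_cong[OF ht, of length] by simp
  have lin: "\<theta> q (a *\<^sub>R h # t) = a * \<theta> q ?b" for a
  proof -
    have "\<theta> q ([] @ (a *\<^sub>R h + 0 *\<^sub>R h) # t) = a * \<theta> q ([] @ h # t) + 0 * \<theta> q ([] @ h # t)"
      by (rule multilinear_onD[OF forms_linear[OF \<theta>_forms]]) (use V lt in auto)
    then show ?thesis unfolding ht by simp
  qed
  have one: "\<theta> q (inverse (\<tau> U \<phi> q) *\<^sub>R h # t) = 1"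
    unfolding lin using \<tau>_nonzero by (simp add: \<tau>_def)
  then have "\<theta> q (inverse (\<tau> U \<phi> q) *\<^sub>R h # t) \<noteq> 0" by simp
  then have "basis_of (T q) (inverse (\<tau> U \<phi> q) *\<^sub>R h # t)"
    by (rule form_nonzero_basis[OF coord_basis, rotated]) (use \<theta>_forms in simp)
  with one have "\<exists>es. basis_of (T q) es \<and> \<theta> q es = 1" by blast
  from someI_ex[OF this] have es: "basis_of (T q) ?es" "\<theta> q ?es = 1" by simp_all
  have les: "length ?es = n" using basis_ofD(5)[OF es(1)] dim_T by simp
  have esT: "set ?es \<subseteq> T q" by (rule basis_ofD(4)[OF es(1)])
  have eq: "\<beta> (map (\<lambda>v. deriv_along v f) ?es @ ws) = inverse (\<tau> U \<phi> q) * \<beta> (frame U \<phi> q @ ws)"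
    if \<beta>: "\<beta> \<in> forms (m - 1) V'" for ws
  proof (cases "length ws = k - 1 \<and> set ws \<subseteq> V'")
    case True
    \<comment> \<open>The pullback of \<beta> with the last arguments \<open>ws\<close> fixed, set
      to 0 where \<open>forms\<close> demands it.\<close>
    define \<gamma> where "\<gamma> vs = (if length vs = n \<and> set vs \<subseteq> T q then \<beta> (map (\<lambda>v. deriv_along v f) vs @ ws) else 0)" for vs
    have "\<gamma> \<in> forms (length ?b) (T q)"
    proof (rule formsI)
      show "multilinear_on (length ?b) (T q) \<gamma>"
        unfolding multilinear_on_def
      proof (intro allI impI ballI)
        fix xs i x y a b
        assume xs: "length xs = length ?b \<and> set xs \<subseteq> T q" and i: "i < length ?b" and x: "x \<in> T q" and y: "y \<in> T q"
        let ?ys = "map (\<lambda>v. deriv_along v f) xs @ ws"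
        have ok: "length (xs[i := z]) = n \<and> set (xs[i := z]) \<subseteq> T q" if "z \<in> T q" for z
          using xs that set_update_subset_insert[of xs i z] by auto
        have up: "\<gamma> (xs[i := z]) = \<beta> (?ys[i := deriv_along z f])" if "z \<in> T q" for z
          using ok[OF that] xs i by (simp add: \<gamma>_def map_update list_update_append)
        have z: "a *\<^sub>R x + b *\<^sub>R y \<in> T q"
          using x y subspace_tangent_space by (simp add: subspace_add subspace_scale)
        have "\<beta> (?ys[i := a *\<^sub>R deriv_along x f + b *\<^sub>R deriv_along y f]) =
            a * \<beta> (?ys[i := deriv_along x f]) + b * \<beta> (?ys[i := deriv_along y f])"
          by (rule multilinear_on_update[OF forms_linear[OF \<beta>]])
             (use xs True i x y df_V' k1 in auto)
        then show "\<gamma> (xs[i := a *\<^sub>R x + b *\<^sub>R y]) = a * \<gamma> (xs[i := x]) + b * \<gamma> (xs[i := y])"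
          unfolding up[OF x] up[OF y] up[OF z] deriv_along_lincomb .
      qed
      show "\<gamma> xs = 0" if "\<not> distinct xs" for xs
        using that forms_alternating[OF \<beta>, of "map (\<lambda>v. deriv_along v f) xs @ ws"] by (auto simp: \<gamma>_def distinct_map)
    qed (auto simp: \<gamma>_def)
    from forms_proportional[OF coord_basis _ this, of "\<theta> q" ?es]
    have "\<gamma> ?es = \<gamma> ?b / \<tau> U \<phi> q" using \<theta>_forms \<tau>_nonzero es(2) by (simp add: \<tau>_def)
    moreover have "\<gamma> ?es = \<beta> (map (\<lambda>v. deriv_along v f) ?es @ ws)" using les esT by (simp add: \<gamma>_def)
    moreover have "\<gamma> ?b = \<beta> (frame U \<phi> q @ ws)"
      using basis_ofD(4)[OF coord_basis] unfolding \<gamma>_def frame_eq by simp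
    ultimately show ?thesis by (simp add: divide_inverse)
  next
    case False
    have z: "\<beta> (xs @ ws) = 0" if "length xs = n" for xs
      by (rule forms_zero[OF \<beta>]) (use False that k1 in auto)
    have "length (map (\<lambda>v. deriv_along v f) ?es) = n" using les by simp
    then show ?thesis using z length_frame by simp
  qed
  have mk: "n + (k - 1) = m - 1" using k1 by simp
  show ?thesis
  proof (cases "\<beta> \<in> forms (m - 1) V'")
    case True
    have "gauss (q, \<eta>) \<beta> = \<eta> (\<lambda>ws. \<beta> (map (\<lambda>v. deriv_along v f) ?es @ ws))"
      using True les mk by (simp add: gauss_map_def Let_def wedge_left_def)
    also have "\<dots> = \<eta> (\<lambda>ws. inverse (\<tau> U \<phi> q) * \<beta> (frame U \<phi> q @ ws))"
      unfolding eq[OF True] ..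
    also have "\<dots> = inverse (\<tau> U \<phi> q) * \<eta> (\<lambda>ws. \<beta> (frame U \<phi> q @ ws))"
      by (rule \<eta>_cong_linear[OF \<eta> contract_frame[OF True]])
    finally show ?thesis using True by (simp add: divide_inverse)
  next
    case False
    then show ?thesis using les mk by (simp add: gauss_map_def Let_def wedge_left_def)
  qed
qed

lemma contract_last: "v \<in> V' \<Longrightarrow> (\<lambda>xs. \<omega> (xs @ [v])) \<in> forms (m - 1) V'"
  using forms_contract[of \<omega> "[]" "m - 1" "[v]" V'] \<omega>_forms k1 by simp

lemma height_gauss:
  assumes "\<eta> \<in> ext_power V' (k - 1) (N q)" "v \<in> V'"
  shows "height \<omega> (gauss (q, \<eta>)) v = \<eta> (\<lambda>ws. \<omega> (frame U \<phi> q @ ws @ [v])) / \<tau> U \<phi> q"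
  unfolding height_def gauss_eq[OF assms(1)] using contract_last[OF assms(2)] by simp

section \<open>Elements of the exterior power of \<open>N\<close> with prescribed heights\<close>

context
  fixes \<xi>s :: "'v list"
  assumes \<xi>s: "basis_of (N q) \<xi>s"
begin

lemma length_\<xi>s: "length \<xi>s = k" and \<xi>s_V': "set \<xi>s \<subseteq> V'" and omit_V': "set (omit j \<xi>s) \<subseteq> V'"
  and \<xi>s_N: "set (omit j \<xi>s) \<subseteq> N q"
proof -
  show "length \<xi>s = k" using basis_ofD(5)[OF \<xi>s] N(2) by simp
  show "set \<xi>s \<subseteq> V'" using basis_ofD(4)[OF \<xi>s] N_V'[of q] by (rule order_trans)
  show o: "set (omit j \<xi>s) \<subseteq> N q" using set_omit_subset[of j \<xi>s] basis_ofD(4)[OF \<xi>s] by (rule order_trans)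
  then show "set (omit j \<xi>s) \<subseteq> V'" using N_V'[of q] by (rule order_trans)
qed

definition pairing :: "nat \<Rightarrow> real"
  where "pairing j = \<omega> (frame U \<phi> q @ omit j \<xi>s @ [\<xi>s ! j])"

lemma pairing_nonzero: "j < k \<Longrightarrow> pairing j \<noteq> 0"
proof -
  assume j: "j < k"
  have "basis_of (N q) (omit j \<xi>s @ [\<xi>s ! j])"
    by (rule basis_of_mset[OF \<xi>s mset_omit]) (use length_\<xi>s j in simp)
  from frame_nonzero[OF this] show ?thesis by (simp add: pairing_def)
qed

lemma ext_N: "\<eta> \<in> ext_power V' (k - 1) (N q) \<longleftrightarrow> (\<exists>u. \<eta> = (\<Sum>j<k. u j *\<^sub>R wedge V' (omit j \<xi>s)))"
  by (rule ext_power_iff[OF V' N_V' \<xi>s N(3) k1])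

lemma height_gauss_sum:
  assumes "v \<in> V'"
  shows "height \<omega> (gauss (q, \<Sum>j<k. u j *\<^sub>R wedge V' (omit j \<xi>s))) v =
    (\<Sum>j<k. u j * \<omega> (frame U \<phi> q @ omit j \<xi>s @ [v])) / \<tau> U \<phi> q"
proof -
  have "(\<Sum>j<k. u j *\<^sub>R wedge V' (omit j \<xi>s)) \<in> ext_power V' (k - 1) (N q)" unfolding ext_N by (rule exI, rule refl)
  moreover have "wedge V' (omit j \<xi>s) (\<lambda>ws. \<omega> (frame U \<phi> q @ ws @ [v])) = \<omega> (frame U \<phi> q @ omit j \<xi>s @ [v])" if "j < k" for j
    by (rule wedge_form)
       (use forms_contract[of \<omega> "frame U \<phi> q" "k - 1" "[v]" V'] \<omega>_forms frame_V' assms k1 that length_omit[of j \<xi>s] length_\<xi>s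
        in \<open>simp add: length_frame\<close>)
  ultimately show ?thesis
    using assms by (simp add: height_gauss sum_fun_apply scaleR_fun_def)
qed

lemma pairing_delta:
  assumes "i < k" "j < k"
  shows "\<omega> (frame U \<phi> q @ omit j \<xi>s @ [\<xi>s ! i]) = (if i = j then pairing j else 0)"
proof (cases "i = j")
  case False
  then have "\<xi>s ! i \<in> set (omit j \<xi>s)" using nth_in_omit[of j \<xi>s i] assms length_\<xi>s by simp
  then show ?thesis using False forms_alternating[OF \<omega>_forms, of "frame U \<phi> q @ omit j \<xi>s @ [\<xi>s ! i]"] by simp
qed (simp add: pairing_def)

text \<open>The coefficients make the Gauss image have height \<open>g j\<close> at the
  \<open>j\<close>-th frame vector of \<open>N\<close>: only the term with \<open>omit j\<close>
  contributes there, with the value \<open>pairing j\<close>, and \<tau> undoes the division in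
  \<open>gauss_eq\<close>. Thus the \<open>k\<close> heights are linear coordinates on the fibre of
  the exterior power.\<close>

definition dual_vec :: "(nat \<Rightarrow> real) \<Rightarrow> ('v list \<Rightarrow> real) \<Rightarrow> real"
  where "dual_vec g = (\<Sum>j<k. (g j * \<tau> U \<phi> q / pairing j) *\<^sub>R wedge V' (omit j \<xi>s))"

lemma dual_vec_ext: "dual_vec g \<in> ext_power V' (k - 1) (N q)"
  unfolding ext_N dual_vec_def by (rule exI, rule refl)

lemma height_dual_vec:
  assumes "v \<in> V'"
  shows "height \<omega> (gauss (q, dual_vec g)) v = (\<Sum>j<k. g j / pairing j * \<omega> (frame U \<phi> q @ omit j \<xi>s @ [v]))"
  unfolding dual_vec_def height_gauss_sum[OF assms] sum_divide_distrib
  by (rule sum.cong) (use \<tau>_nonzero in \<open>simp_all add: field_simps\<close>)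

lemma height_dual_vec_\<xi>: "i < k \<Longrightarrow> height \<omega> (gauss (q, dual_vec g)) (\<xi>s ! i) = g i"
proof -
  assume i: "i < k"
  have "\<xi>s ! i \<in> V'" using \<xi>s_V' length_\<xi>s i by auto
  then have "height \<omega> (gauss (q, dual_vec g)) (\<xi>s ! i) = (\<Sum>j<k. g j / pairing j * (if i = j then pairing j else 0))"
    unfolding height_dual_vec[OF \<open>\<xi>s ! i \<in> V'\<close>] using pairing_delta[OF i] by simp
  also have "\<dots> = (\<Sum>j<k. if i = j then g i else 0)"
    by (rule sum.cong) (use pairing_nonzero in auto)
  finally show ?thesis using i by simp
qed

lemma dual_vec_unique:
  assumes "\<eta> \<in> ext_power V' (k - 1) (N q)"
  shows "\<eta> = dual_vec (\<lambda>j. height \<omega> (gauss (q, \<eta>)) (\<xi>s ! j))"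
proof -
  obtain u where u: "\<eta> = (\<Sum>j<k. u j *\<^sub>R wedge V' (omit j \<xi>s))" using assms unfolding ext_N by (rule exE)
  have eta: "\<eta> = dual_vec (\<lambda>j. u j * pairing j / \<tau> U \<phi> q)"
    unfolding u dual_vec_def by (rule sum.cong) (use pairing_nonzero \<tau>_nonzero in simp_all)
  have g: "height \<omega> (gauss (q, \<eta>)) (\<xi>s ! j) = u j * pairing j / \<tau> U \<phi> q" if "j < k" for j
    unfolding eta by (rule height_dual_vec_\<xi>[OF that])
  show ?thesis
    by (subst eta) (unfold dual_vec_def, rule sum.cong, simp_all add: g)
qed

end

lemma ex_basis_N: obtains \<xi>s where "basis_of (N q) \<xi>s"
  using orthonormal_list[OF N(1)[of q]] by metis

lemma gauss_ext:
  assumes \<eta>: "\<eta> \<in> ext_power V' (k - 1) (N q)"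
  shows "gauss (q, \<eta>) \<in> ext_power V' (m - 1) V'"
proof -
  obtain \<xi>s where \<xi>s: "basis_of (N q) \<xi>s" by (rule ex_basis_N)
  obtain u where u: "\<eta> = (\<Sum>j<k. u j *\<^sub>R wedge V' (omit j \<xi>s))" using \<eta> unfolding ext_N[OF \<xi>s] by (rule exE)
  have l: "length (frame U \<phi> q @ omit j \<xi>s) = m - 1" if "j < k" for j
    using length_omit[of j \<xi>s] length_\<xi>s[OF \<xi>s] that by (simp add: length_frame)
  have "gauss (q, \<eta>) = (\<Sum>j<k. (u j / \<tau> U \<phi> q) *\<^sub>R wedge V' (frame U \<phi> q @ omit j \<xi>s))"
  proof
    fix \<beta>
    show "gauss (q, \<eta>) \<beta> = (\<Sum>j<k. (u j / \<tau> U \<phi> q) *\<^sub>R wedge V' (frame U \<phi> q @ omit j \<xi>s)) \<beta>"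
    proof (cases "\<beta> \<in> forms (m - 1) V'")
      case True
      have w: "wedge V' (omit j \<xi>s) (\<lambda>ws. \<beta> (frame U \<phi> q @ ws)) = wedge V' (frame U \<phi> q @ omit j \<xi>s) \<beta>" if "j < k" for j
      proof -
        have "wedge V' (omit j \<xi>s) (\<lambda>ws. \<beta> (frame U \<phi> q @ ws)) = \<beta> (frame U \<phi> q @ omit j \<xi>s)"
          by (rule wedge_form) (use contract_frame[OF True] length_omit[of j \<xi>s] length_\<xi>s[OF \<xi>s] that in simp)
        also have "\<dots> = wedge V' (frame U \<phi> q @ omit j \<xi>s) \<beta>"
          by (rule wedge_form[symmetric]) (use True l[OF that] in simp)
        finally show ?thesis .
      qed
      show ?thesis
        using True unfolding gauss_eq[OF \<eta>] unfolding u
        by (simp add: sum_fun_apply scaleR_fun_def sum_divide_distrib w)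
    next
      case False
      have "wedge V' (frame U \<phi> q @ omit j \<xi>s) \<beta> = 0" if "j < k" for j
        using False l[OF that] by (simp add: wedge_def)
      then show ?thesis using False unfolding gauss_eq[OF \<eta>] by (simp add: sum_fun_apply scaleR_fun_def)
    qed
  qed
  moreover have "\<dots> \<in> ext_power V' (m - 1) V'"
  proof (intro subspace_sum subspace_scale subspace_ext_power wedge_in_ext_power l)
    show "set (frame U \<phi> q @ omit j \<xi>s) \<subseteq> V'" for j using frame_V' omit_V'[OF \<xi>s, of j] by simp
  qed auto
  ultimately show ?thesis by simp
qed

lemma gauss_scale:
  assumes \<eta>: "\<eta> \<in> ext_power V' (k - 1) (N q)"
  shows "gauss (q, c *\<^sub>R \<eta>) = c *\<^sub>R gauss (q, \<eta>)"
proof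
  fix \<beta>
  have "c *\<^sub>R \<eta> \<in> ext_power V' (k - 1) (N q)" by (rule subspace_scale[OF subspace_ext_power \<eta>])
  from gauss_eq[OF this] gauss_eq[OF \<eta>] show "gauss (q, c *\<^sub>R \<eta>) \<beta> = (c *\<^sub>R gauss (q, \<eta>)) \<beta>"
    by (simp add: scaleR_fun_def)
qed

lemma df_frame:
  assumes "v \<in> T q"
  obtains c where "deriv_along v f = (\<Sum>i<n. c i *\<^sub>R frame U \<phi> q ! i)"
proof -
  let ?b = "map (coord_vec U \<phi> q) [0..<n]"
  have inj: "inj_on (coord_vec U \<phi> q) {..<n}"
    using basis_ofD(1)[OF coord_basis] by (simp add: distinct_map atLeast0LessThan)
  have S: "set ?b = coord_vec U \<phi> q ` {..<n}" by auto
  have "v = (\<Sum>x\<in>set ?b. representation (set ?b) v x *\<^sub>R x)"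
    by (rule basis_of_representation[OF coord_basis assms])
  also have "\<dots> = (\<Sum>i<n. representation (set ?b) v (coord_vec U \<phi> q i) *\<^sub>R coord_vec U \<phi> q i)"
    unfolding S by (simp only: sum.reindex[OF inj] o_def)
  finally have "deriv_along v f = deriv_along (\<Sum>i<n. representation (set ?b) v (coord_vec U \<phi> q i) *\<^sub>R coord_vec U \<phi> q i) f" by (rule arg_cong)
  also have "\<dots> = (\<Sum>i<n. representation (set ?b) v (coord_vec U \<phi> q i) *\<^sub>R deriv_along (coord_vec U \<phi> q i) f)"
    by (rule deriv_along_sum)
  also have "\<dots> = (\<Sum>i<n. representation (set ?b) v (coord_vec U \<phi> q i) *\<^sub>R frame U \<phi> q ! i)"
    by (rule sum.cong) (simp_all add: frame_def deriv_along_coord_vec[OF U q _ f])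
  finally show ?thesis by (rule that)
qed

lemma frame_df: "i < n \<Longrightarrow> frame U \<phi> q ! i \<in> (\<lambda>v. deriv_along v f) ` T q"
  using coord_vec_tangent[OF U q] deriv_along_coord_vec[OF U q _ f] by (force simp: frame_def)

text \<open>A tangent vector is a combination of frame vectors, and each of these then occurs twice
  among the arguments of \<omega>.\<close>

lemma height_gauss_df:
  assumes \<eta>: "\<eta> \<in> ext_power V' (k - 1) (N q)" and v: "v \<in> T q"
  shows "height \<omega> (gauss (q, \<eta>)) (deriv_along v f) = 0"
proof -
  obtain c where c: "deriv_along v f = (\<Sum>i<n. c i *\<^sub>R frame U \<phi> q ! i)" by (rule df_frame[OF v])
  have FV: "frame U \<phi> q ! i \<in> V'" if "i < n" for i using frame_V' that by (auto simp: length_frame)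
  have 0: "height \<omega> (gauss (q, \<eta>)) (frame U \<phi> q ! i) = 0" if "i < n" for i
  proof -
    have "(\<lambda>ws. \<omega> (frame U \<phi> q @ ws @ [frame U \<phi> q ! i])) = (\<lambda>ws. 0 * \<omega> (frame U \<phi> q @ ws @ [frame U \<phi> q ! i]))"
    proof
      fix ws
      have "frame U \<phi> q ! i \<in> set (frame U \<phi> q)" using that by (simp add: length_frame)
      then show "\<omega> (frame U \<phi> q @ ws @ [frame U \<phi> q ! i]) = 0 * \<omega> (frame U \<phi> q @ ws @ [frame U \<phi> q ! i])"
        using forms_alternating[OF \<omega>_forms, of "frame U \<phi> q @ ws @ [frame U \<phi> q ! i]"] by simp
    qed
    moreover have "(\<lambda>ws. \<omega> (frame U \<phi> q @ ws @ [frame U \<phi> q ! i])) \<in> forms (k - 1) V'"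
      using forms_contract[of \<omega> "frame U \<phi> q" "k - 1" "[frame U \<phi> q ! i]" V'] \<omega>_forms frame_V' FV[OF that] k1
      by (simp add: length_frame)
    ultimately have "\<eta> (\<lambda>ws. \<omega> (frame U \<phi> q @ ws @ [frame U \<phi> q ! i])) = 0"
      using \<eta>_cong_linear[OF \<eta>, of _ 0] by (metis mult_zero_left)
    then show ?thesis using height_gauss[OF \<eta> FV[OF that]] by simp
  qed
  have "height \<omega> (gauss (q, \<eta>)) (\<Sum>i<n. c i *\<^sub>R frame U \<phi> q ! i) = (\<Sum>i<n. c i * height \<omega> (gauss (q, \<eta>)) (frame U \<phi> q ! i))"
    by (rule height_linear[OF V' \<omega>_forms _ gauss_ext[OF \<eta>]]) (use FV k1 in auto)
  then show ?thesis unfolding c using 0 by simp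
qed

lemma gauss_inj:
  assumes "\<eta> \<in> ext_power V' (k - 1) (N q)" "\<eta>' \<in> ext_power V' (k - 1) (N q)" "gauss (q, \<eta>) = gauss (q, \<eta>')"
  shows "\<eta> = \<eta>'"
proof -
  obtain \<xi>s where \<xi>s: "basis_of (N q) \<xi>s" by (rule ex_basis_N)
  show ?thesis
    by (subst dual_vec_unique[OF \<xi>s assms(1)], subst dual_vec_unique[OF \<xi>s assms(2)]) (simp only: assms(3))
qed

lemma gauss_surj:
  assumes y: "y \<in> ext_power V' (m - 1) V'" and crit: "\<And>v. v \<in> T q \<Longrightarrow> height \<omega> y (deriv_along v f) = 0"
  obtains \<eta> where "\<eta> \<in> ext_power V' (k - 1) (N q)" "gauss (q, \<eta>) = y"
proof -
  obtain \<xi>s where \<xi>s: "basis_of (N q) \<xi>s" by (rule ex_basis_N)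
  define \<eta> where "\<eta> = dual_vec \<xi>s (\<lambda>j. height \<omega> y (\<xi>s ! j))"
  have \<eta>: "\<eta> \<in> ext_power V' (k - 1) (N q)" unfolding \<eta>_def by (rule dual_vec_ext[OF \<xi>s])
  \<comment> \<open>The difference of the two elements, written as a sum over two indices so that
    \<open>height_sum\<close> applies to it. It vanishes because both have the same heights on the
    frame and on a basis of \<open>N q\<close>.\<close>
  have "(\<Sum>i\<in>{True, False}. (if i then 1 else - 1) *\<^sub>R (if i then gauss (q, \<eta>) else y)) = 0" (is "?d = 0")
  proof (rule height_eq_zero[OF basis_V'[OF \<xi>s] \<omega>])
    show "?d \<in> ext_power V' (m - 1) V'"
      by (intro subspace_sum subspace_scale subspace_ext_power) (use y gauss_ext[OF \<eta>] in auto)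
    fix v assume v: "v \<in> set (frame U \<phi> q @ \<xi>s)"
    have "height \<omega> (gauss (q, \<eta>)) v = height \<omega> y v"
    proof (cases "v \<in> set (frame U \<phi> q)")
      case True
      then obtain i where "i < n" "v = frame U \<phi> q ! i" by (auto simp: in_set_conv_nth length_frame)
      then obtain x where "x \<in> T q" "v = deriv_along x f" using frame_df by auto
      then show ?thesis using crit height_gauss_df[OF \<eta>] by simp
    next
      case False
      then obtain i where "i < k" "v = \<xi>s ! i" using v length_\<xi>s[OF \<xi>s] by (auto simp: in_set_conv_nth)
      then show ?thesis using height_dual_vec_\<xi>[OF \<xi>s] by (simp add: \<eta>_def)
    qed
    then show "height \<omega> ?d v = 0" unfolding height_sum by simp
  qed (use k1 in simp)
  then have "gauss (q, \<eta>) = y" by (simp add: fun_eq_iff scaleR_fun_def)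
  with \<eta> show ?thesis by (rule that)
qed

end

definition crit :: "(('v list \<Rightarrow> real) \<Rightarrow> real) \<Rightarrow> 'm set"
  where "crit y = {p. \<forall>v\<in>T p. height \<omega> y (deriv_along v f) = 0}"

text \<open>Over a fixed point the Gauss map is injective, and its image consists of exactly those
  \<open>y\<close> whose height vanishes on the image of \<open>df\<close>, by
  \<open>height_gauss_df\<close> and \<open>gauss_surj\<close>.\<close>

lemma bij_fiber_crit:
  assumes S: "S \<subseteq> ext_power V' (m - 1) V'" and y: "y \<in> S"
  shows "bij_betw fst {x \<in> ellipsoid_bundle n A \<theta> k V f N S. gauss x = y} (crit y)"
  unfolding bij_betw_def
proof
  show "inj_on fst {x \<in> ellipsoid_bundle n A \<theta> k V f N S. gauss x = y}"
  proof (rule inj_onI)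
    fix x x'
    assume x: "x \<in> {x \<in> ellipsoid_bundle n A \<theta> k V f N S. gauss x = y}"
      and x': "x' \<in> {x \<in> ellipsoid_bundle n A \<theta> k V f N S. gauss x = y}" and eq: "fst x = fst x'"
    obtain p \<eta> where p: "x = (p, \<eta>)" by (cases x) auto
    obtain \<eta>' where p': "x' = (p, \<eta>')" using eq p by (cases x') auto
    have *: "gauss (p, \<eta>) = gauss (p, \<eta>')" "\<eta> \<in> ext_power V' (k - 1) (N p)" "\<eta>' \<in> ext_power V' (k - 1) (N p)"
      using x x' unfolding p p' by (auto simp: ellipsoid_bundle_def)
    obtain U \<phi> where U: "(U, \<phi>) \<in> A" "p \<in> U" by (rule chart_cover)
    have "\<eta> = \<eta>'" by (rule gauss_inj[OF U *(2,3,1)])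
    then show "x = x'" unfolding p p' by simp
  qed
  show "fst ` {x \<in> ellipsoid_bundle n A \<theta> k V f N S. gauss x = y} = crit y"
  proof (intro equalityI subsetI)
    fix p assume "p \<in> fst ` {x \<in> ellipsoid_bundle n A \<theta> k V f N S. gauss x = y}"
    then obtain \<eta> where \<eta>: "\<eta> \<in> ext_power V' (k - 1) (N p)" "gauss (p, \<eta>) = y"
      by (auto simp: ellipsoid_bundle_def)
    obtain U \<phi> where U: "(U, \<phi>) \<in> A" "p \<in> U" by (rule chart_cover)
    show "p \<in> crit y" unfolding crit_def using height_gauss_df[OF U \<eta>(1)] \<eta>(2) by simp
  next
    fix p assume p: "p \<in> crit y"
    obtain U \<phi> where U: "(U, \<phi>) \<in> A" "p \<in> U" by (rule chart_cover)
    have c: "\<And>v. v \<in> T p \<Longrightarrow> height \<omega> y (deriv_along v f) = 0" using p by (simp add: crit_def)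
    obtain \<eta> where "\<eta> \<in> ext_power V' (k - 1) (N p)" "gauss (p, \<eta>) = y"
      by (rule gauss_surj[OF U subsetD[OF S y] c])
    then show "p \<in> fst ` {x \<in> ellipsoid_bundle n A \<theta> k V f N S. gauss x = y}"
      using y by (intro image_eqI[of _ _ "(p, \<eta>)"]) (auto simp: ellipsoid_bundle_def)
  qed
qed

end

section \<open>Parametrizations of the ellipsoid bundle\<close>

text \<open>In an orthonormal basis of \<open>V\<close> the value is a polynomial in the inner
  products of the functions with the basis vectors.\<close>

lemma (in manifold) smooth_on_multilinear:
  fixes V :: "'v::euclidean_space set" and fs :: "('m \<Rightarrow> 'v) list"
  assumes V: "subspace V" and \<beta>: "multilinear_on j V \<beta>" and W: "open W"
    and fs: "length fs = j" "\<And>x. x \<in> set fs \<Longrightarrow> smooth_on n A W x"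
      "\<And>q. q \<in> W \<Longrightarrow> set (map (\<lambda>x. x q) fs) \<subseteq> V"
  shows "smooth_on n A W (\<lambda>q. \<beta> (map (\<lambda>x. x q) fs))"
proof -
  obtain e where e: "basis_of V e" "\<And>v. v \<in> V \<Longrightarrow> v = (\<Sum>b\<in>set e. (v \<bullet> b) *\<^sub>R b)"
    using orthonormal_list[OF V] by metis
  show ?thesis
  proof (rule multilinear_on_closure[where P = "smooth_on n A W" and R = "smooth_on n A W" and Z = W and B = "set e"
        and V = V and k = j and c = "\<lambda>i b q. (fs ! i) q \<bullet> b" and \<Lambda> = "\<lambda>q. \<beta>"])
    show "smooth_on n A W (\<lambda>z. 0)" by (rule smooth_on_const[OF W])
    show "smooth_on n A W (\<lambda>z. g z + h z)" if "smooth_on n A W g" "smooth_on n A W h" for g h :: "'m \<Rightarrow> real"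
      by (rule smooth_on_add[OF W that])
    show "smooth_on n A W (\<lambda>z. g z * h z)" if "smooth_on n A W g" "smooth_on n A W h" for g h :: "'m \<Rightarrow> real"
      by (rule smooth_on_mult[OF W that])
    show "smooth_on n A W h" if "smooth_on n A W g" "\<And>z. z \<in> W \<Longrightarrow> g z = h z" for g h :: "'m \<Rightarrow> real"
      by (rule smooth_on_cong[OF W that])
    show "set e \<subseteq> V" by (rule basis_ofD(4)[OF e(1)])
    show "map (\<lambda>x. x q) fs ! i = (\<Sum>b\<in>set e. ((fs ! i) q \<bullet> b) *\<^sub>R b)" if "q \<in> W" "i < j" for q i
      using e(2)[of "(fs ! i) q"] fs(1) fs(3)[OF that(1)] that(2) by (simp add: image_subset_iff)
    show "smooth_on n A W (\<lambda>q. (fs ! i) q \<bullet> b)" if "i < j" "b \<in> set e" for i b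
      by (rule smooth_on_inner[OF W fs(2)]) (use fs(1) that in simp)
    show "smooth_on n A W (\<lambda>z. \<beta> bs)" for bs by (rule smooth_on_const[OF W])
  qed (use V \<beta> fs in simp_all)
qed

locale ellipsoid_setup = gauss_setup n A \<theta> k V \<omega> f N \<theta>N
  for n :: nat and A :: "'m::{t2_space, second_countable_topology} atlas"
    and \<theta> :: "'m \<Rightarrow> (('m \<Rightarrow> real) \<Rightarrow> real) list \<Rightarrow> real" and k :: nat and V :: "'v::euclidean_space set"
    and \<omega> :: "'v::euclidean_space list \<Rightarrow> real" and f :: "'m \<Rightarrow> 'v::euclidean_space"
    and N :: "'m \<Rightarrow> 'v::euclidean_space set" and \<theta>N :: "'m \<Rightarrow> 'v::euclidean_space list \<Rightarrow> real" +
  fixes \<zeta> :: "(('v::euclidean_space list \<Rightarrow> real) \<Rightarrow> real) list" and S :: "(('v::euclidean_space list \<Rightarrow> real) \<Rightarrow> real) set"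
  assumes \<zeta>: "basis_of (ext_power V' (m - 1) V') \<zeta>" and length_\<zeta>: "length \<zeta> = m"
    and S: "S = {\<Sum>i<m. a i *\<^sub>R \<zeta> ! i | a :: nat \<Rightarrow> real. (\<Sum>i<m. (a i)\<^sup>2) = 1}"
begin

abbreviation E where "E \<equiv> ext_power V' (m - 1) V'"
abbreviation B where "B \<equiv> ellipsoid_bundle n A \<theta> k V f N S"
abbreviation d :: nat where "d \<equiv> n + k - 1"

lemma \<zeta>_mem: "l < m \<Longrightarrow> \<zeta> ! l \<in> E"
  using basis_ofD(4)[OF \<zeta>] length_\<zeta> by auto

lemma sum_set_\<zeta>: "(\<Sum>x\<in>set \<zeta>. h x) = (\<Sum>l<m. h (\<zeta> ! l))"
proof -
  have "bij_betw ((!) \<zeta>) {..<m} (set \<zeta>)"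
    using bij_betw_nth[OF basis_ofD(1)[OF \<zeta>] refl refl] length_\<zeta> by simp
  from sum.reindex_bij_betw[OF this, of h] show ?thesis by simp
qed

lemma coords_sum:
  assumes "\<And>i. i \<in> I \<Longrightarrow> y i \<in> E"
  shows "coords \<zeta> (\<Sum>i\<in>I. c i *\<^sub>R y i) l = (\<Sum>i\<in>I. c i * coords \<zeta> (y i) l)"
proof -
  note b = basis_ofD[OF \<zeta>]
  have "representation (set \<zeta>) (\<Sum>i\<in>I. c i *\<^sub>R y i) = (\<lambda>x. \<Sum>i\<in>I. representation (set \<zeta>) (c i *\<^sub>R y i) x)"
    by (rule representation_sum[OF b(2)]) (use assms in \<open>simp add: b(3) subspace_scale[OF subspace_ext_power]\<close>)
  moreover have "representation (set \<zeta>) (c i *\<^sub>R y i) = (\<lambda>x. c i * representation (set \<zeta>) (y i) x)" if "i \<in> I" for i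
    by (rule representation_scale[OF b(2)]) (use assms[OF that] b(3) in simp)
  ultimately show ?thesis by (simp add: coords_def)
qed

lemma coords_expand: "y \<in> E \<Longrightarrow> y = (\<Sum>l<m. coords \<zeta> y l *\<^sub>R \<zeta> ! l)"
proof -
  assume "y \<in> E"
  from basis_of_representation[OF \<zeta> this] show ?thesis unfolding sum_set_\<zeta> using length_\<zeta> by (simp add: coords_def)
qed

lemma coords_\<zeta>: "i < m \<Longrightarrow> l < m \<Longrightarrow> coords \<zeta> (\<zeta> ! i) l = (if i = l then 1 else 0)"
proof -
  assume il: "i < m" "l < m"
  have "representation (set \<zeta>) (\<zeta> ! i) = (\<lambda>v. if v = \<zeta> ! i then 1 else 0)"
    by (rule representation_basis[OF basis_ofD(2)[OF \<zeta>]]) (use il length_\<zeta> in simp)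
  then show ?thesis using il length_\<zeta> nth_eq_iff_index_eq[OF basis_ofD(1)[OF \<zeta>]] by (auto simp: coords_def)
qed

lemma coords_comb: "l < m \<Longrightarrow> coords \<zeta> (\<Sum>i<m. a i *\<^sub>R \<zeta> ! i) l = a l"
proof -
  assume l: "l < m"
  have "coords \<zeta> (\<Sum>i<m. a i *\<^sub>R \<zeta> ! i) l = (\<Sum>i<m. a i * coords \<zeta> (\<zeta> ! i) l)"
    by (rule coords_sum) (use \<zeta>_mem in auto)
  also have "\<dots> = (\<Sum>i<m. if i = l then a l else 0)" by (rule sum.cong) (use l coords_\<zeta> in auto)
  finally show ?thesis using l by simp
qed

lemma coords_scale: "y \<in> E \<Longrightarrow> coords \<zeta> (c *\<^sub>R y) l = c * coords \<zeta> y l"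
  using coords_sum[of "{()}" "\<lambda>_. y" "\<lambda>_. c" l] by simp

lemma comb_mem: "(\<Sum>i<m. a i *\<^sub>R \<zeta> ! i) \<in> E"
  by (intro subspace_sum subspace_scale subspace_ext_power) (use \<zeta>_mem in auto)

lemma S_iff: "y \<in> S \<longleftrightarrow> y \<in> E \<and> (\<Sum>l<m. (coords \<zeta> y l)\<^sup>2) = 1"
proof
  assume "y \<in> S"
  then obtain a where a: "y = (\<Sum>i<m. a i *\<^sub>R \<zeta> ! i)" "(\<Sum>i<m. (a i)\<^sup>2) = 1" unfolding S by auto
  then show "y \<in> E \<and> (\<Sum>l<m. (coords \<zeta> y l)\<^sup>2) = 1" using comb_mem coords_comb by simp
next
  assume y: "y \<in> E \<and> (\<Sum>l<m. (coords \<zeta> y l)\<^sup>2) = 1"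
  then show "y \<in> S" unfolding S using coords_expand[of y] by auto
qed

text \<open>Heights at a basis determine an element linearly, hence also its coordinates with
  respect to \<zeta>. Smoothness of the Gauss map thereby reduces to smoothness of its heights at
  fixed vectors.\<close>

lemma coords_height:
  "\<exists>b c. (\<forall>j<m. b j \<in> V') \<and> (\<forall>y\<in>E. \<forall>l. coords \<zeta> y l = (\<Sum>j<m. height \<omega> y (b j) * c j l))"
proof -
  obtain e where e: "basis_of V' e" using orthonormal_list[OF V'] by metis
  have le: "length e = m" using basis_ofD(5)[OF e] dim_V' by simp
  have m1: "m \<ge> 1" using n1 by simp
  have eV: "e ! j \<in> V'" if "j < m" for j using basis_ofD(4)[OF e] that le by auto
  define s where "s j = \<omega> (omit j e @ [e ! j])" for j
  have s: "s j \<noteq> 0" if "j < m" for j unfolding s_def by (rule volume_form_omit[OF \<omega> e that])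
  have wE: "wedge V' (omit j e) \<in> E" if "j < m" for j
    by (rule wedge_in_ext_power) (use length_omit[of j e] le that set_omit_subset[of j e] basis_ofD(4)[OF e] in auto)
  have main: "coords \<zeta> y l = (\<Sum>j<m. height \<omega> y (e ! j) * (coords \<zeta> (wedge V' (omit j e)) l / s j))" if y: "y \<in> E" for y l
  proof -
    have "\<exists>u. y = (\<Sum>i<m. u i *\<^sub>R wedge V' (omit i e))"
      using y unfolding ext_power_iff[OF V' order_refl e \<omega> m1] .
    then obtain u where u: "y = (\<Sum>i<m. u i *\<^sub>R wedge V' (omit i e))" by (rule exE)
    have h: "height \<omega> y (e ! j) = u j * s j" if j: "j < m" for j
    proof -
      have "height \<omega> y (e ! j) = (\<Sum>i<m. u i * height \<omega> (wedge V' (omit i e)) (e ! j))" unfolding u height_sum ..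
      also have "\<dots> = (\<Sum>i<m. if i = j then u j * s j else 0)"
      proof (rule sum.cong)
        fix i assume i: "i \<in> {..<m}"
        have w: "height \<omega> (wedge V' (omit i e)) (e ! j) = \<omega> (omit i e @ [e ! j])"
        proof (rule height_wedge[where V = V'])
          have "Suc (length (omit i e)) = m" using length_omit[of i e] i le n1 by simp
          then show "\<omega> \<in> forms (Suc (length (omit i e))) V'" using \<omega>_forms by simp
        qed (use eV[OF j] in auto)
        show "u i * height \<omega> (wedge V' (omit i e)) (e ! j) = (if i = j then u j * s j else 0)"
        proof (cases "i = j")
          case False
          then have "\<omega> (omit i e @ [e ! j]) = 0"
            by (intro forms_alternating[OF \<omega>_forms]) (use nth_in_omit[of i e j] i j le in auto)
          then show ?thesis using False w by simp
        qed (use w in \<open>simp add: s_def\<close>)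
      qed simp
      finally show ?thesis using j by simp
    qed
    have "coords \<zeta> y l = (\<Sum>j<m. u j * coords \<zeta> (wedge V' (omit j e)) l)"
      unfolding u by (rule coords_sum) (use wE in auto)
    also have "\<dots> = (\<Sum>j<m. height \<omega> y (e ! j) * (coords \<zeta> (wedge V' (omit j e)) l / s j))"
      by (rule sum.cong) (use h s in simp_all)
    finally show ?thesis .
  qed
  show ?thesis
    by (intro exI[of _ "(!) e"] exI[of _ "\<lambda>j l. coords \<zeta> (wedge V' (omit j e)) l / s j"]) (use eV main in simp)
qed

lemma bundle_mem: "x \<in> B \<longleftrightarrow> snd x \<in> ext_power V' (k - 1) (N (fst x)) \<and> gauss x \<in> S"
  by (cases x) (simp add: ellipsoid_bundle_def)

lemma zero_notin_S: "0 \<notin> S"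
  using coords_sum[of "{}"] unfolding S_iff by simp

section \<open>Local charts of the bundle\<close>

definition frame_funs :: "'m set \<Rightarrow> ('m \<Rightarrow> nat \<Rightarrow> real) \<Rightarrow> ('m \<Rightarrow> 'v) list"
  where "frame_funs U \<phi> = map (coord_deriv U \<phi> f) [0..<n]"

lemma frame_funs: "frame U \<phi> q = map (\<lambda>x. x q) (frame_funs U \<phi>)"
  by (simp add: frame_def frame_funs_def)

lemma smooth_frame_funs:
  assumes "(U, \<phi>) \<in> A" "W \<subseteq> U" "x \<in> set (frame_funs U \<phi>)"
  shows "smooth_on n A W x"
proof -
  obtain i where "i < n" "x = coord_deriv U \<phi> f i" using assms(3) by (auto simp: frame_funs_def)
  then show ?thesis using smooth_on_subset[OF smooth_on_coord_deriv[OF assms(1) _ f] assms(2)] by simp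
qed

context
  fixes O' U :: "'m set" and \<phi> :: "'m \<Rightarrow> nat \<Rightarrow> real" and \<xi>s :: "('m \<Rightarrow> 'v) list"
  assumes U: "(U, \<phi>) \<in> A" and O': "open O'" "O' \<subseteq> U"
    and \<xi>s: "length \<xi>s = k" "\<And>x. x \<in> set \<xi>s \<Longrightarrow> smooth_on n A O' x"
      "\<And>q. q \<in> O' \<Longrightarrow> basis_of (N q) (map (\<lambda>x. x q) \<xi>s)"
begin

definition X :: "'m \<Rightarrow> 'v list" where "X q = map (\<lambda>x. x q) \<xi>s"

lemma XN: "q \<in> O' \<Longrightarrow> basis_of (N q) (X q)"
  unfolding X_def by (rule \<xi>s(3))

lemma qU: "q \<in> O' \<Longrightarrow> q \<in> U"
  using O'(2) by auto

lemma omit_X: "omit j (X q) = map (\<lambda>x. x q) (omit j \<xi>s)"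
  by (simp add: omit_def X_def take_map drop_map)

lemma X_nth: "j < k \<Longrightarrow> X q ! j = (\<xi>s ! j) q"
  by (simp add: X_def \<xi>s(1))

lemma smooth_omit: "x \<in> set (omit j \<xi>s) \<Longrightarrow> smooth_on n A O' x"
  using \<xi>s(2) set_omit_subset[of j \<xi>s] by auto

lemma smooth_pairing_at:
  assumes j: "j < k" and v: "smooth_on n A O' v" "\<And>q. q \<in> O' \<Longrightarrow> v q \<in> V'"
  shows "smooth_on n A O' (\<lambda>q. \<omega> (frame U \<phi> q @ omit j (X q) @ [v q]))"
proof -
  have "smooth_on n A O' (\<lambda>q. \<omega> (map (\<lambda>x. x q) (frame_funs U \<phi> @ omit j \<xi>s @ [v])))"
  proof (rule smooth_on_multilinear[OF V' forms_linear[OF \<omega>_forms] O'(1)])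
    show "length (frame_funs U \<phi> @ omit j \<xi>s @ [v]) = m"
      using length_omit[of j \<xi>s] \<xi>s(1) j by (simp add: frame_funs_def)
    show "smooth_on n A O' x" if "x \<in> set (frame_funs U \<phi> @ omit j \<xi>s @ [v])" for x
      using that smooth_frame_funs[OF U O'(2)] smooth_omit v(1) by auto
    fix q assume q: "q \<in> O'"
    have "set (frame U \<phi> q @ omit j (X q) @ [v q]) \<subseteq> V'"
      using frame_V'[OF U qU[OF q]] omit_V'[OF U qU[OF q] XN[OF q], of j] v(2)[OF q] by simp
    then show "set (map (\<lambda>x. x q) (frame_funs U \<phi> @ omit j \<xi>s @ [v])) \<subseteq> V'"
      unfolding map_append frame_funs[symmetric] omit_X[symmetric] by simp
  qed
  then show ?thesis by (simp add: frame_funs omit_X)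
qed

definition pair_fun :: "nat \<Rightarrow> 'm \<Rightarrow> real" where "pair_fun j q = \<omega> (frame U \<phi> q @ omit j (X q) @ [X q ! j])"

lemma pair_fun_eq: "q \<in> O' \<Longrightarrow> pairing U \<phi> q (X q) j = pair_fun j q"
  using pairing_def[OF U qU XN] by (simp add: pair_fun_def)

lemma pair_fun_nonzero: "q \<in> O' \<Longrightarrow> j < k \<Longrightarrow> pair_fun j q \<noteq> 0"
  using pairing_nonzero[OF U qU XN] pair_fun_eq by metis

lemma smooth_pair_fun: "j < k \<Longrightarrow> smooth_on n A O' (pair_fun j)"
proof -
  assume j: "j < k"
  have "smooth_on n A O' (\<lambda>q. \<omega> (frame U \<phi> q @ omit j (X q) @ [(\<xi>s ! j) q]))"
  proof (rule smooth_pairing_at[OF j])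
    show "smooth_on n A O' (\<xi>s ! j)" using \<xi>s(1,2) j by simp
    show "(\<xi>s ! j) q \<in> V'" if "q \<in> O'" for q
      using \<xi>s_V'[OF U qU[OF that] XN[OF that]] j \<xi>s(1) by (auto simp: X_def)
  qed
  then show ?thesis unfolding pair_fun_def[abs_def] using X_nth[OF j] by simp
qed

lemma smooth_\<tau>: "smooth_on n A O' (\<tau> U \<phi>)"
proof (rule smooth_on_cong[OF O'(1)])
  have 1: "smooth_on n A O' (\<lambda>q. \<theta>N q (X q))"
  proof -
    have "\<forall>U \<xi>s. open U \<and> length \<xi>s = k \<and> (\<forall>\<xi>\<in>set \<xi>s. smooth_on n A U \<xi> \<and> (\<forall>q\<in>U. \<xi> q \<in> N q)) \<longrightarrow>
       smooth_on n A U (\<lambda>q. \<theta>N q (map (\<lambda>\<xi>. \<xi> q) \<xi>s))"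
      using bv unfolding bundle_volume_element_def by (rule conjunct2)
    from this[rule_format, of O' \<xi>s] show ?thesis
      unfolding X_def using O'(1) \<xi>s(1,2) basis_ofD(4)[OF \<xi>s(3)] by auto
  qed
  have 2: "smooth_on n A O' (\<lambda>q. \<omega> (map (\<lambda>x. x q) (frame_funs U \<phi> @ \<xi>s)))"
  proof (rule smooth_on_multilinear[OF V' forms_linear[OF \<omega>_forms] O'(1)])
    show "length (frame_funs U \<phi> @ \<xi>s) = m" using \<xi>s(1) by (simp add: frame_funs_def)
    show "smooth_on n A O' x" if "x \<in> set (frame_funs U \<phi> @ \<xi>s)" for x
      using that smooth_frame_funs[OF U O'(2)] \<xi>s(2) by auto
    fix q assume q: "q \<in> O'"
    show "set (map (\<lambda>x. x q) (frame_funs U \<phi> @ \<xi>s)) \<subseteq> V'"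
      using frame_V'[OF U qU[OF q]] \<xi>s_V'[OF U qU[OF q] XN[OF q]] by (simp add: frame_funs X_def)
  qed
  show "smooth_on n A O' (\<lambda>q. \<omega> (map (\<lambda>x. x q) (frame_funs U \<phi> @ \<xi>s)) / \<theta>N q (X q))"
    by (rule smooth_on_divide[OF O'(1) 2 1]) (rule volume_form_basis(2)[OF N(3) XN])
  show "\<omega> (map (\<lambda>x. x q) (frame_funs U \<phi> @ \<xi>s)) / \<theta>N q (X q) = \<tau> U \<phi> q" if "q \<in> O'" for q
    using \<tau>_eq[OF U qU[OF that] XN[OF that]] by (simp add: frame_funs X_def)
qed

definition \<tau>' :: "'m \<Rightarrow> real" where "\<tau>' q = \<tau> U \<phi> q"

text \<open>The fibre coordinates on the bundle: heights of the Gauss image at the vectors of the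
  local frame of \<open>N\<close>.\<close>

definition Hh :: "nat \<Rightarrow> 'm \<times> (('v list \<Rightarrow> real) \<Rightarrow> real) \<Rightarrow> real"
  where "Hh j x = height \<omega> (gauss x) ((\<xi>s ! j) (fst x))"

lemma k0: "0 < k"
  using k1 by simp

text \<open>The height is \<eta> applied to a contraction of \<omega>, divided by \<tau>. With
  constant vectors in the contraction, \<eta> is evaluated at a fixed argument, which is continuous
  in the product topology; the vectors that depend on the base point are then inserted by
  multilinearity.\<close>

lemma continuous_Hh:
  assumes j: "j < k"
  shows "continuous_on {x \<in> B. fst x \<in> O'} (Hh j)"
proof -
  let ?Z = "{x \<in> B. fst x \<in> O'}"
  let ?C = "continuous_on ?Z :: ('m \<times> (('v list \<Rightarrow> real) \<Rightarrow> real) \<Rightarrow> real) \<Rightarrow> bool"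
  let ?fs = "frame_funs U \<phi> @ [\<xi>s ! j]"
  let ?\<Lambda> = "\<lambda>x xs. snd x (\<lambda>ws. \<omega> (take n xs @ ws @ drop n xs))"
  obtain e where e: "basis_of V' e" "\<And>v. v \<in> V' \<Longrightarrow> v = (\<Sum>b\<in>set e. (v \<bullet> b) *\<^sub>R b)"
    using orthonormal_list[OF V'] by metis
  have comp: "?C (\<lambda>x. g (fst x))" if "smooth_on n A O' g" for g :: "'m \<Rightarrow> real"
    by (rule continuous_on_compose2[OF smooth_on_continuous[OF that O'(1)] continuous_on_fst[OF continuous_on_id]]) auto
  have lenfs: "length ?fs = n + 1" by (simp add: frame_funs_def)
  have fsV: "set (map (\<lambda>y. y q) ?fs) \<subseteq> V'" if "q \<in> O'" for q
    using frame_V'[OF U qU[OF that]] \<xi>s_V'[OF U qU[OF that] XN[OF that]] j \<xi>s(1)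
    by (auto simp: frame_funs X_def)
  have "?C (\<lambda>x. ?\<Lambda> x (map (\<lambda>y. y (fst x)) ?fs))"
  proof (rule multilinear_on_closure[where P = ?C and R = ?C and Z = ?Z and B = "set e"
        and V = V' and k = "n + 1" and c = "\<lambda>i b x. (?fs ! i) (fst x) \<bullet> b" and \<Lambda> = ?\<Lambda>])
    show "?C (\<lambda>z. 0)" by (rule continuous_on_const)
    show "?C (\<lambda>z. g z + h z)" if "?C g" "?C h" for g h by (rule continuous_on_add[OF that])
    show "?C (\<lambda>z. g z * h z)" if "?C g" "?C h" for g h by (rule continuous_on_mult[OF that])
    show "?C h" if "?C g" "\<And>z. z \<in> ?Z \<Longrightarrow> g z = h z" for g h
      using that continuous_on_cong[of ?Z ?Z g h] by simp
    show "set e \<subseteq> V'" by (rule basis_ofD(4)[OF e(1)])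
    show "multilinear_on (n + 1) V' (?\<Lambda> x)" if x: "x \<in> ?Z" for x
    proof (rule multilinear_on_contract)
      have "snd x \<in> ext_power V' (k - 1) (N (fst x))" using x by (simp add: bundle_mem)
      from ext_power_linear[OF this]
      show "snd x (\<lambda>xs. a * \<beta> xs + b * \<gamma> xs) = a * snd x \<beta> + b * snd x \<gamma>"
        if "\<beta> \<in> forms (k - 1) V'" "\<gamma> \<in> forms (k - 1) V'" for \<beta> \<gamma> a b using that .
      show "\<omega> \<in> forms (n + (k - 1) + 1) V'" using \<omega>_forms k1 by simp
      show "(\<lambda>ws. \<omega> (take n xs @ ws @ drop n xs)) \<in> forms (k - 1) V'" if "length xs = n + 1" "set xs \<subseteq> V'" for xs
        by (rule forms_contract) (use that \<omega>_forms k1 set_take_subset[of n xs] set_drop_subset[of n xs] in auto)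
    qed (rule V')
    show "map (\<lambda>y. y (fst x)) ?fs ! i = (\<Sum>b\<in>set e. ((?fs ! i) (fst x) \<bullet> b) *\<^sub>R b)" if "x \<in> ?Z" "i < n + 1" for x i
    proof -
      have nth: "map (\<lambda>y. y (fst x)) ?fs ! i = (?fs ! i) (fst x)" using that(2) lenfs by (intro nth_map) simp
      have "(?fs ! i) (fst x) \<in> V'"
        using fsV[of "fst x"] that lenfs nth_mem[of i "map (\<lambda>y. y (fst x)) ?fs"] nth by auto
      then show ?thesis unfolding nth by (rule e(2))
    qed
    show "?C (\<lambda>x. (?fs ! i) (fst x) \<bullet> b)" if "i < n + 1" "b \<in> set e" for i b
    proof -
      have "?fs ! i \<in> set ?fs" using that(1) lenfs by (intro nth_mem) simp
      then have "smooth_on n A O' (?fs ! i)" using smooth_frame_funs[OF U O'(2)] \<xi>s(1,2) j by auto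
      from comp[OF smooth_on_inner[OF O'(1) this]] show ?thesis .
    qed
    show "?C (\<lambda>x. ?\<Lambda> x bs)" for bs
      by (rule continuous_on_product_then_coordinatewise[OF continuous_on_snd[OF continuous_on_id]])
  qed (use V' lenfs fsV in simp_all)
  then have "?C (\<lambda>x. ?\<Lambda> x (map (\<lambda>y. y (fst x)) ?fs) / \<tau> U \<phi> (fst x))"
    by (rule continuous_on_divide[OF _ comp[OF smooth_\<tau>]]) (use \<tau>_nonzero[OF U qU] in auto)
  moreover have "?\<Lambda> x (map (\<lambda>y. y (fst x)) ?fs) / \<tau> U \<phi> (fst x) = Hh j x" if x: "x \<in> ?Z" for x
  proof -
    have q: "fst x \<in> O'" and \<eta>: "snd x \<in> ext_power V' (k - 1) (N (fst x))" using x by (simp_all add: bundle_mem)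
    have v: "(\<xi>s ! j) (fst x) \<in> V'" using fsV[OF q] by simp
    have l: "length (frame_funs U \<phi>) = n" by (simp add: frame_funs_def)
    show ?thesis
      unfolding Hh_def using height_gauss[OF U qU[OF q] \<eta> v] l by (simp add: frame_funs)
  qed
  ultimately show ?thesis by (rule continuous_on_eq)
qed

section \<open>An explicit chart of the ellipsoid bundle\<close>

definition xpart :: "(nat \<Rightarrow> real) \<Rightarrow> nat \<Rightarrow> real" where "xpart w = (\<lambda>i. if i < n then w i else 0)"
definition pdom :: "(nat \<Rightarrow> real) set" where "pdom = {w. (\<forall>i\<ge>d. w i = 0) \<and> xpart w \<in> \<phi> ` O'}"
definition pt :: "(nat \<Rightarrow> real) \<Rightarrow> 'm" where "pt w = inv_into U \<phi> (xpart w)"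
text \<open>Heights scaled so that the one with index 0 is 1. The other \<open>k - 1\<close> heights
  are the free parameters \<open>w n, ..., w (d - 1)\<close>, whence the shift by
  \<open>n - 1\<close>.\<close>

definition gco :: "(nat \<Rightarrow> real) \<Rightarrow> nat \<Rightarrow> real" where "gco w j = (if j = 0 then 1 else w (n + j - 1))"
definition pvec :: "(nat \<Rightarrow> real) \<Rightarrow> ('v list \<Rightarrow> real) \<Rightarrow> real"
  where "pvec w = dual_vec U \<phi> (pt w) (X (pt w)) (gco w)"
definition Q :: "(nat \<Rightarrow> real) \<Rightarrow> real" where "Q w = (\<Sum>l<m. (coords \<zeta> (gauss (pt w, pvec w)) l)\<^sup>2)"
text \<open>The ray through \<open>pvec w\<close> is intersected with the ellipsoid:
  \<open>Q w\<close> is the squared length of its Gauss image in the coordinates \<zeta>. Such a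
  chart reaches the half of each fibre on which the height with index 0 is positive.\<close>

definition \<psi> :: "(nat \<Rightarrow> real) \<Rightarrow> 'm \<times> (('v list \<Rightarrow> real) \<Rightarrow> real)"
  where "\<psi> w = (pt w, (Q w powr (-1/2)) *\<^sub>R pvec w)"

lemma image_O': "openin (Euclidean_space n) (\<phi> ` O')"
  using chart_image_open[OF U O'(1)] O'(2) by (simp add: Int_absorb2)

lemma pt_O': "w \<in> pdom \<Longrightarrow> pt w \<in> O'" and \<phi>_pt: "w \<in> pdom \<Longrightarrow> \<phi> (pt w) = xpart w"
  using chart_inv[OF U] O'(2) by (auto simp: pdom_def pt_def)

lemma pdom_open: "openin (Euclidean_space d) pdom"
proof -
  obtain T where T: "open T" "\<phi> ` O' = T \<inter> {x. \<forall>i\<ge>n. x i = 0}"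
    using image_O' by (auto simp: openin_Euclidean_space_iff)
  have "continuous_on UNIV xpart"
  proof (rule continuous_on_coordinatewise_then_product)
    fix i show "continuous_on UNIV (\<lambda>w. xpart w i)"
      by (cases "i < n") (auto simp: xpart_def intro: continuous_on_product_coordinates)
  qed
  then have "open (xpart -` T)" using T(1) by (simp add: continuous_on_open_vimage)
  moreover have "pdom = xpart -` T \<inter> {x. \<forall>i\<ge>d. x i = 0}" using T(2) by (auto simp: pdom_def xpart_def)
  ultimately show ?thesis unfolding openin_Euclidean_space_iff by blast
qed

lemma C_k_pt: "smooth_on n A O' g \<Longrightarrow> C_k i d pdom (\<lambda>w. g (pt w) :: real)"
proof -
  assume g: "smooth_on n A O' g"
  have "C_k i n (\<phi> ` O') (\<lambda>x. g (inv_into U \<phi> x))"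
    using smooth_onD[OF g U, of i] O'(2) by (simp add: Int_absorb2)
  from C_k_compose[where F = "\<lambda>x. g (inv_into U \<phi> x)" and g = xpart, OF image_O' pdom_open _ _ this]
  show ?thesis unfolding pt_def using C_k_coord[OF pdom_open] by (simp add: pdom_def xpart_def)
qed

lemma C_k_gco: "C_k i d pdom (\<lambda>w. gco w j)"
  using C_k_const[OF pdom_open, of i 1] C_k_coord[OF pdom_open, of i "n + j - 1"]
  by (cases "j = 0") (simp_all add: gco_def)

lemma pvec_ext: "w \<in> pdom \<Longrightarrow> pvec w \<in> ext_power V' (k - 1) (N (pt w))"
  unfolding pvec_def by (rule dual_vec_ext[OF U qU[OF pt_O'] XN[OF pt_O']])

lemma gauss_pvec_E: "w \<in> pdom \<Longrightarrow> gauss (pt w, pvec w) \<in> E"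
  by (rule gauss_ext[OF U qU[OF pt_O'] pvec_ext])

lemma height_pvec:
  assumes "w \<in> pdom" "v \<in> V'"
  shows "height \<omega> (gauss (pt w, pvec w)) v =
    (\<Sum>j<k. gco w j * inverse (pair_fun j (pt w)) * \<omega> (frame U \<phi> (pt w) @ omit j (X (pt w)) @ [v]))"
  unfolding pvec_def height_dual_vec[OF U qU[OF pt_O'[OF assms(1)]] XN[OF pt_O'[OF assms(1)]] assms(2)]
  by (simp add: pair_fun_eq[OF pt_O'[OF assms(1)]] divide_inverse)

lemma height_pvec_\<xi>: "w \<in> pdom \<Longrightarrow> j < k \<Longrightarrow> height \<omega> (gauss (pt w, pvec w)) ((\<xi>s ! j) (pt w)) = gco w j"
  unfolding pvec_def X_nth[symmetric]
  by (rule height_dual_vec_\<xi>[OF U qU[OF pt_O'] XN[OF pt_O']])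

lemma C_k_height:
  assumes v: "v \<in> V'"
  shows "C_k i d pdom (\<lambda>w. height \<omega> (gauss (pt w, pvec w)) v)"
proof (rule C_k_cong[OF pdom_open height_pvec[symmetric, OF _ v]], assumption)
  show "C_k i d pdom (\<lambda>w. \<Sum>j<k. gco w j * inverse (pair_fun j (pt w)) * \<omega> (frame U \<phi> (pt w) @ omit j (X (pt w)) @ [v]))"
  proof (rule C_k_sum[OF pdom_open])
    fix j assume j: "j \<in> {..<k}"
    have 1: "C_k i d pdom (\<lambda>w. inverse (pair_fun j (pt w)))"
      by (rule C_k_inverse[OF pdom_open _ C_k_pt[OF smooth_pair_fun]]) (use pair_fun_nonzero[OF pt_O'] j in auto)
    have 2: "C_k i d pdom (\<lambda>w. \<omega> (frame U \<phi> (pt w) @ omit j (X (pt w)) @ [v]))"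
      by (rule C_k_pt, rule smooth_pairing_at) (use j v smooth_on_const[OF O'(1)] in auto)
    show "C_k i d pdom (\<lambda>w. gco w j * inverse (pair_fun j (pt w)) * \<omega> (frame U \<phi> (pt w) @ omit j (X (pt w)) @ [v]))"
      by (rule C_k_mult[OF pdom_open C_k_mult[OF pdom_open C_k_gco 1] 2])
  qed
qed

lemma C_k_Q: "C_k i d pdom Q"
proof -
  obtain b c where "(\<forall>j<m. b j \<in> V') \<and> (\<forall>y\<in>E. \<forall>l. coords \<zeta> y l = (\<Sum>j<m. height \<omega> y (b j) * c j l))"
    using coords_height by (elim exE)
  then have bc: "\<And>j. j < m \<Longrightarrow> b j \<in> V'"
    "\<And>y l. y \<in> E \<Longrightarrow> coords \<zeta> y l = (\<Sum>j<m. height \<omega> y (b j) * c j l)" by simp_all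
  have co: "C_k i d pdom (\<lambda>w. coords \<zeta> (gauss (pt w, pvec w)) l)" for l
  proof (rule C_k_cong[OF pdom_open bc(2)[symmetric, OF gauss_pvec_E]], assumption)
    show "C_k i d pdom (\<lambda>w. \<Sum>j<m. height \<omega> (gauss (pt w, pvec w)) (b j) * c j l)"
      by (rule C_k_sum[OF pdom_open], rule C_k_mult[OF pdom_open C_k_height C_k_const[OF pdom_open]]) (use bc(1) in simp)
  qed
  show ?thesis unfolding Q_def[abs_def] power2_eq_square
    by (rule C_k_sum[OF pdom_open], rule C_k_mult[OF pdom_open co co])
qed

text \<open>The Gauss image of \<open>pvec w\<close> has height 1 at the first frame vector, so it
  is not 0.\<close>

lemma Q_pos: "w \<in> pdom \<Longrightarrow> Q w > 0"
proof -
  assume w: "w \<in> pdom"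
  have "Q w \<noteq> 0"
  proof
    assume "Q w = 0"
    then have "coords \<zeta> (gauss (pt w, pvec w)) l = 0" if "l < m" for l
      using that unfolding Q_def by (simp add: sum_nonneg_eq_0_iff)
    then have "gauss (pt w, pvec w) = 0" by (subst coords_expand[OF gauss_pvec_E[OF w]]) simp
    then show False using height_pvec_\<xi>[OF w k0] by (simp add: height_def gco_def)
  qed
  moreover have "Q w \<ge> 0" unfolding Q_def by (rule sum_nonneg) simp
  ultimately show ?thesis by simp
qed

definition Rr :: "(nat \<Rightarrow> real) \<Rightarrow> real" where "Rr w = Q w powr (-1/2)"

lemma Rr_pos: "w \<in> pdom \<Longrightarrow> Rr w > 0"
  unfolding Rr_def using Q_pos[of w] by (metis less_irrefl powr_gt_zero)

lemma Rr_sq: "w \<in> pdom \<Longrightarrow> (Rr w)\<^sup>2 * Q w = 1"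
proof -
  assume w: "w \<in> pdom"
  have "(Rr w)\<^sup>2 = Q w powr (-1)"
    unfolding Rr_def power2_eq_square powr_add[symmetric] by simp
  then show ?thesis using Q_pos[OF w] by (simp add: powr_minus)
qed

lemma C_k_Rr: "C_k i d pdom Rr"
  unfolding Rr_def[abs_def] by (rule C_k_powr[OF pdom_open Q_pos C_k_Q])

lemma gauss_\<psi>: "w \<in> pdom \<Longrightarrow> gauss (\<psi> w) = Rr w *\<^sub>R gauss (pt w, pvec w)"
  unfolding \<psi>_def Rr_def[symmetric] by (rule gauss_scale[OF U qU[OF pt_O'] pvec_ext])

lemma \<psi>_B: "w \<in> pdom \<Longrightarrow> \<psi> w \<in> B"
proof -
  assume w: "w \<in> pdom"
  have "gauss (\<psi> w) \<in> S"
    unfolding gauss_\<psi>[OF w] S_iff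
  proof
    show "Rr w *\<^sub>R gauss (pt w, pvec w) \<in> E" by (rule subspace_scale[OF subspace_ext_power gauss_pvec_E[OF w]])
    have "(\<Sum>l<m. (coords \<zeta> (Rr w *\<^sub>R gauss (pt w, pvec w)) l)\<^sup>2) = (Rr w)\<^sup>2 * Q w"
      unfolding Q_def coords_scale[OF gauss_pvec_E[OF w]] power_mult_distrib sum_distrib_left ..
    then show "(\<Sum>l<m. (coords \<zeta> (Rr w *\<^sub>R gauss (pt w, pvec w)) l)\<^sup>2) = 1" using Rr_sq[OF w] by simp
  qed
  then show ?thesis
    unfolding bundle_mem using subspace_scale[OF subspace_ext_power pvec_ext[OF w]] by (simp add: \<psi>_def)
qed

lemma Hh_\<psi>: "w \<in> pdom \<Longrightarrow> j < k \<Longrightarrow> Hh j (\<psi> w) = Rr w * gco w j"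
proof -
  assume w: "w \<in> pdom" and j: "j < k"
  have "fst (\<psi> w) = pt w" by (simp add: \<psi>_def)
  then show ?thesis
    unfolding Hh_def gauss_\<psi>[OF w] using height_pvec_\<xi>[OF w j] by (simp add: height_def scaleR_fun_def)
qed

text \<open>Dividing by the height with index 0 cancels the radial factor of \<psi>;
  \<open>i + 1 - n\<close> reverses the shift in \<open>gco\<close>.\<close>

definition inv_param :: "'m \<times> (('v list \<Rightarrow> real) \<Rightarrow> real) \<Rightarrow> nat \<Rightarrow> real"
  where "inv_param x = (\<lambda>i. if i < n then \<phi> (fst x) i else if i < d then Hh (i + 1 - n) x / Hh 0 x else 0)"

lemma inv_param_\<psi>: "w \<in> pdom \<Longrightarrow> inv_param (\<psi> w) = w"
proof
  fix i assume w: "w \<in> pdom"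
  have "fst (\<psi> w) = pt w" by (simp add: \<psi>_def)
  consider "i < n" | "n \<le> i" "i < d" | "d \<le> i" by linarith
  then show "inv_param (\<psi> w) i = w i"
  proof cases
    case 1
    then show ?thesis using \<phi>_pt[OF w] \<open>fst (\<psi> w) = pt w\<close> by (simp add: inv_param_def xpart_def)
  next
    case 2
    then have "i + 1 - n < k" "i + 1 - n \<noteq> 0" "n + (i + 1 - n) - 1 = i" by linarith+
    then show ?thesis using 2 Hh_\<psi>[OF w, of "i + 1 - n"] Hh_\<psi>[OF w k0] Rr_pos[OF w] by (simp add: inv_param_def gco_def)
  next
    case 3
    then have "\<not> i < n" using k1 by linarith
    then show ?thesis using w 3 by (simp add: inv_param_def pdom_def)
  qed
qed

lemma \<psi>_inv_param:
  assumes x: "x \<in> B" "fst x \<in> O'" "Hh 0 x > 0"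
  shows "inv_param x \<in> pdom" "\<psi> (inv_param x) = x"
proof -
  obtain q \<eta> where x': "x = (q, \<eta>)" by (cases x)
  have q: "q \<in> O'" using x(2) x' by simp
  have \<eta>: "\<eta> \<in> ext_power V' (k - 1) (N q)" and gS: "gauss (q, \<eta>) \<in> S" using x(1) unfolding bundle_mem x' by simp_all
  have xp: "xpart (inv_param x) = \<phi> q"
    using chart_coord_zero[OF U qU[OF q]] by (auto simp: xpart_def inv_param_def x' fun_eq_iff)
  have z: "inv_param x i = 0" if "d \<le> i" for i
  proof -
    have "\<not> i < n" "\<not> i < d" using that k1 by linarith+
    then show ?thesis by (simp add: inv_param_def)
  qed
  show w: "inv_param x \<in> pdom" unfolding pdom_def using q xp z by blast
  have pt: "pt (inv_param x) = q" unfolding pt_def xp by (rule chart_inv[OF U qU[OF q]])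
  have H: "height \<omega> (gauss (q, \<eta>)) (X q ! j) = Hh j x" if "j < k" for j
    using X_nth[OF that] by (simp add: Hh_def x')
  have g: "gco (inv_param x) j = inverse (Hh 0 x) * Hh j x" if j: "j < k" for j
  proof (cases "j = 0")
    case True then show ?thesis using x(3) by (simp add: gco_def)
  next
    case False
    then have "n + j - 1 \<ge> n" "n + j - 1 < d" "n + j - 1 + 1 - n = j" using j by linarith+
    then show ?thesis using False by (simp add: gco_def inv_param_def divide_inverse)
  qed
  have pv: "pvec (inv_param x) = inverse (Hh 0 x) *\<^sub>R \<eta>"
  proof -
    note dv = dual_vec_def[OF U qU[OF q] XN[OF q]]
    have "inverse (Hh 0 x) *\<^sub>R \<eta> = inverse (Hh 0 x) *\<^sub>R dual_vec U \<phi> q (X q) (\<lambda>j. height \<omega> (gauss (q, \<eta>)) (X q ! j))"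
      using dual_vec_unique[OF U qU[OF q] XN[OF q] \<eta>] by simp
    also have "\<dots> = dual_vec U \<phi> q (X q) (gco (inv_param x))"
      unfolding dv scaleR_sum_right by (rule sum.cong) (use g H in \<open>simp_all add: mult.assoc\<close>)
    finally show ?thesis unfolding pvec_def pt by simp
  qed
  have "Q (inv_param x) = (inverse (Hh 0 x))\<^sup>2"
  proof -
    have gE: "gauss (q, \<eta>) \<in> E" using gS unfolding S_iff by simp
    have "Q (inv_param x) = (\<Sum>l<m. (inverse (Hh 0 x))\<^sup>2 * (coords \<zeta> (gauss (q, \<eta>)) l)\<^sup>2)"
      unfolding Q_def pt pv gauss_scale[OF U qU[OF q] \<eta>] coords_scale[OF gE] power_mult_distrib ..
    also have "\<dots> = (inverse (Hh 0 x))\<^sup>2" using gS unfolding S_iff sum_distrib_left[symmetric] by simp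
    finally show ?thesis .
  qed
  then have "(Rr (inv_param x))\<^sup>2 * (inverse (Hh 0 x))\<^sup>2 = 1" using Rr_sq[OF w] by simp
  then have "(Rr (inv_param x))\<^sup>2 = (Hh 0 x)\<^sup>2" using x(3) by (simp add: power_inverse field_simps)
  then have "Rr (inv_param x) = Hh 0 x" using Rr_pos[OF w] x(3) by (simp add: power2_eq_iff_nonneg)
  then show "\<psi> (inv_param x) = x" unfolding \<psi>_def Rr_def[symmetric] pt pv using x(3) x' by simp
qed

lemma image_\<psi>: "\<psi> ` pdom = {x \<in> B. fst x \<in> O' \<and> Hh 0 x > 0}"
proof (intro equalityI subsetI)
  fix x assume "x \<in> \<psi> ` pdom"
  then obtain w where w: "w \<in> pdom" "x = \<psi> w" by auto
  have "fst (\<psi> w) = pt w" by (simp add: \<psi>_def)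
  then show "x \<in> {x \<in> B. fst x \<in> O' \<and> Hh 0 x > 0}"
    using \<psi>_B[OF w(1)] pt_O'[OF w(1)] Hh_\<psi>[OF w(1) k0] Rr_pos[OF w(1)] w(2) by (simp add: gco_def)
next
  fix x assume "x \<in> {x \<in> B. fst x \<in> O' \<and> Hh 0 x > 0}"
  then have x: "x \<in> B" "fst x \<in> O'" "Hh 0 x > 0" by simp_all
  show "x \<in> \<psi> ` pdom" using \<psi>_inv_param[OF x] by (metis imageI)
qed

lemma image_\<psi>_open: "openin (top_of_set B) (\<psi> ` pdom)"
proof -
  let ?Z = "{x \<in> B. fst x \<in> O'}"
  have Z: "openin (top_of_set B) ?Z"
  proof -
    have "?Z = B \<inter> (O' \<times> UNIV)" by auto
    moreover have "open (O' \<times> (UNIV :: (('v list \<Rightarrow> real) \<Rightarrow> real) set))" using O'(1) by (intro open_Times) auto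
    ultimately show ?thesis by (auto simp: openin_open)
  qed
  have "openin (top_of_set ?Z) (?Z \<inter> Hh 0 -` {0<..})"
    by (rule continuous_openin_preimage_gen[OF continuous_Hh[OF k0]]) simp
  from openin_trans[OF this Z] show ?thesis unfolding image_\<psi> by (simp add: Int_def vimage_def conj_assoc)
qed

lemma C_k_snd_\<psi>:
  assumes "\<beta> \<in> forms (k - 1) V'"
  shows "C_k i d pdom (\<lambda>w. snd (\<psi> w) \<beta>)"
proof -
  have sm: "smooth_on n A O' (\<lambda>q. \<beta> (omit j (X q)))" if j: "j < k" for j
  proof -
    have "smooth_on n A O' (\<lambda>q. \<beta> (map (\<lambda>x. x q) (omit j \<xi>s)))"
    proof (rule smooth_on_multilinear[OF V' forms_linear[OF assms] O'(1) _ smooth_omit])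
      show "length (omit j \<xi>s) = k - 1" using length_omit[of j \<xi>s] \<xi>s(1) j by simp
      show "set (map (\<lambda>x. x q) (omit j \<xi>s)) \<subseteq> V'" if "q \<in> O'" for q
        unfolding omit_X[symmetric] by (rule omit_V'[OF U qU[OF that] XN[OF that]])
    qed
    then show ?thesis by (simp add: omit_X)
  qed
  have eq: "Rr w * (\<Sum>j<k. gco w j * (\<tau>' (pt w) * inverse (pair_fun j (pt w)) * \<beta> (omit j (X (pt w))))) = snd (\<psi> w) \<beta>"
    if w: "w \<in> pdom" for w
  proof -
    note q = pt_O'[OF w]
    have "wedge V' (omit j (X (pt w))) \<beta> = \<beta> (omit j (X (pt w)))" if "j < k" for j
      by (rule wedge_form) (use assms length_omit[of j "X (pt w)"] \<xi>s(1) that in \<open>simp add: X_def\<close>)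
    then show ?thesis
      unfolding \<psi>_def Rr_def[symmetric] pvec_def dual_vec_def[OF U qU[OF q] XN[OF q]] pair_fun_eq[OF q] \<tau>'_def
      by (simp add: scaleR_fun_def sum_fun_apply divide_inverse mult.assoc)
  qed
  have "C_k i d pdom (\<lambda>w. Rr w * (\<Sum>j<k. gco w j * (\<tau>' (pt w) * inverse (pair_fun j (pt w)) * \<beta> (omit j (X (pt w))))))"
  proof (rule C_k_mult[OF pdom_open C_k_Rr], rule C_k_sum[OF pdom_open], rule C_k_mult[OF pdom_open C_k_gco])
    fix j assume j: "j \<in> {..<k}"
    show "C_k i d pdom (\<lambda>w. \<tau>' (pt w) * inverse (pair_fun j (pt w)) * \<beta> (omit j (X (pt w))))"
    proof (rule C_k_pt)
      have "smooth_on n A O' (\<lambda>q. inverse (pair_fun j q))"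
        by (rule smooth_on_inverse[OF O'(1) smooth_pair_fun]) (use pair_fun_nonzero j in auto)
      then show "smooth_on n A O' (\<lambda>q. \<tau>' q * inverse (pair_fun j q) * \<beta> (omit j (X q)))"
        unfolding \<tau>'_def using j by (intro smooth_on_mult O'(1) smooth_\<tau> sm) auto
    qed
  qed
  then show ?thesis by (rule C_k_cong[OF pdom_open eq, rotated])
qed

lemma C_k_fst_\<psi>: "smooth n A h \<Longrightarrow> C_k i d pdom (\<lambda>w. h (fst (\<psi> w)) :: real)"
  unfolding \<psi>_def fst_conv by (rule C_k_pt[OF smooth_on_subset]) auto

section \<open>The chart is a homeomorphism and an immersion\<close>

lemma homeomorphism_\<psi>: "homeomorphism pdom (\<psi> ` pdom) \<psi> (inv_into pdom \<psi>)"
proof -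
  have inj: "inj_on \<psi> pdom" by (rule inj_on_inverseI[of _ inv_param]) (rule inv_param_\<psi>)
  have "continuous_on pdom pt"
  proof -
    have "continuous_on (\<phi> ` O') (inv_into U \<phi>)"
      using chart(3)[OF U] O'(2) unfolding homeomorphism_def by (auto intro: continuous_on_subset)
    then show ?thesis unfolding pt_def[abs_def]
    proof (rule continuous_on_compose2)
      show "continuous_on pdom xpart"
      proof (rule continuous_on_coordinatewise_then_product)
        fix i
        have "continuous_on pdom (\<lambda>w. w i)"
          by (rule continuous_on_subset[OF continuous_on_product_coordinates subset_UNIV])
        then show "continuous_on pdom (\<lambda>w. xpart w i)" by (cases "i < n") (simp_all add: xpart_def)
      qed
    qed (auto simp: pdom_def)
  qed
  moreover have "continuous_on pdom (\<lambda>w. snd (\<psi> w))"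
  proof (rule continuous_on_coordinatewise_then_product)
    fix \<beta>
    show "continuous_on pdom (\<lambda>w. snd (\<psi> w) \<beta>)"
    proof (cases "\<beta> \<in> forms (k - 1) V'")
      case True
      show ?thesis by (rule C_k_continuous[OF C_k_snd_\<psi>[OF True, of 0]])
    next
      case False
      have 0: "snd (\<psi> w) \<beta> = 0" if "w \<in> pdom" for w
      proof -
        have "snd (\<psi> w) \<in> ext_power V' (k - 1) (N (fst (\<psi> w)))" using \<psi>_B[OF that] by (simp add: bundle_mem)
        then show ?thesis by (rule ext_power_nonform[OF _ False])
      qed
      show ?thesis by (rule continuous_on_eq[OF continuous_on_const 0[symmetric]])
    qed
  qed
  ultimately have cont: "continuous_on pdom \<psi>"
    using continuous_on_Pair[of pdom pt "\<lambda>w. snd (\<psi> w)"] by (simp add: \<psi>_def)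
  have sub: "\<psi> ` pdom \<subseteq> {x \<in> B. fst x \<in> O'}" unfolding image_\<psi> by auto
  have "continuous_on (\<psi> ` pdom) inv_param"
  proof (rule continuous_on_coordinatewise_then_product)
    fix i
    consider "i < n" | "n \<le> i" "i < d" | "d \<le> i" by linarith
    then show "continuous_on (\<psi> ` pdom) (\<lambda>x. inv_param x i)"
    proof cases
      case 1
      have "continuous_on (\<psi> ` pdom) (\<lambda>x. \<phi> (fst x) i)"
      proof (rule continuous_on_product_then_coordinatewise)
        show "continuous_on (\<psi> ` pdom) (\<lambda>x. \<phi> (fst x))"
          by (rule continuous_on_compose2[OF chart(5)[OF U] continuous_on_fst[OF continuous_on_id]])
             (use sub O'(2) in auto)
      qed
      then show ?thesis using 1 by (simp add: inv_param_def)
    next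
      case 2
      then have j: "i + 1 - n < k" by linarith
      have "continuous_on (\<psi> ` pdom) (\<lambda>x. Hh (i + 1 - n) x / Hh 0 x)"
      proof (rule continuous_on_divide)
        show "continuous_on (\<psi> ` pdom) (Hh (i + 1 - n))" by (rule continuous_on_subset[OF continuous_Hh[OF j] sub])
        show "continuous_on (\<psi> ` pdom) (Hh 0)" by (rule continuous_on_subset[OF continuous_Hh[OF k0] sub])
        show "\<forall>x\<in>\<psi> ` pdom. Hh 0 x \<noteq> 0" unfolding image_\<psi> by auto
      qed
      then show ?thesis using 2 by (simp add: inv_param_def)
    next
      case 3
      then have "\<not> i < n" using k1 by linarith
      then show ?thesis using 3 by (simp add: inv_param_def)
    qed
  qed
  moreover have "inv_param x = inv_into pdom \<psi> x" if "x \<in> \<psi> ` pdom" for x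
    using that inv_into_f_f[OF inj] inv_param_\<psi> by auto
  ultimately have continv: "continuous_on (\<psi> ` pdom) (inv_into pdom \<psi>)" by (rule continuous_on_eq)
  show ?thesis
    unfolding homeomorphism_def using cont continv inj by (auto simp: inv_into_f_f f_inv_into_f image_image)
qed

lemma partial_slice:
  assumes "\<And>t. F (w(i := t)) = G (w(i := t))"
  shows "partial i F w = partial i G w"
  unfolding partial_def assms ..

text \<open>Functions on the manifold force \<open>c i = 0\<close> for \<open>i < n\<close>. In the
  remaining directions the base point is fixed, and suitable forms extract the products
  \<open>Rr w * gco w j\<close>. The case \<open>j = 0\<close> shows that the derivative of
  \<open>Rr\<close> along \<open>c\<close> is 0; after that, each other \<open>j\<close> isolates a
  single coefficient.\<close>

lemma immersive:
  fixes c :: "nat \<Rightarrow> real"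
  assumes w: "w \<in> pdom"
    and c1: "\<And>h :: 'm \<Rightarrow> real. smooth n A h \<Longrightarrow> (\<Sum>i<d. c i * partial i (\<lambda>w. h (fst (\<psi> w))) w) = 0"
    and c2: "\<And>\<beta>. \<beta> \<in> forms (k - 1) V' \<Longrightarrow> (\<Sum>i<d. c i * partial i (\<lambda>w. snd (\<psi> w) \<beta>) w) = 0"
    and i: "i < d"
  shows "c i = 0"
proof -
  have nd: "n \<le> d" using k1 by simp
  note q = pt_O'[OF w]
  have c0: "c j = 0" if "j < n" for j
  proof (rule coord_vec_independent[OF U qU[OF q] _ that])
    fix h :: "'m \<Rightarrow> real" assume h: "smooth n A h"
    have 1: "partial i (\<lambda>w. h (fst (\<psi> w))) w = partial i (\<lambda>x. h (inv_into U \<phi> x)) (\<phi> (pt w))" if "i < n" for i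
    proof -
      have "xpart (w(i := t)) = (xpart w)(i := t)" for t using that by (auto simp: xpart_def)
      moreover have "w i = xpart w i" using that by (simp add: xpart_def)
      moreover have e: "\<phi> (inv_into U \<phi> (xpart w)) = xpart w" using \<phi>_pt[OF w] by (simp add: pt_def)
      ultimately show ?thesis unfolding partial_def \<psi>_def pt_def fst_conv e by simp
    qed
    have 2: "partial i (\<lambda>w. h (fst (\<psi> w))) w = 0" if "\<not> i < n" for i
    proof -
      have "xpart (w(i := t)) = xpart w" for t using that by (auto simp: xpart_def)
      then show ?thesis unfolding partial_def \<psi>_def pt_def fst_conv by simp
    qed
    have "(\<Sum>i<n. c i * partial i (\<lambda>x. h (inv_into U \<phi> x)) (\<phi> (pt w))) = (\<Sum>i<d. c i * partial i (\<lambda>w. h (fst (\<psi> w))) w)"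
      by (rule sum.mono_neutral_cong_left) (use nd 1 2 in auto)
    then show "(\<Sum>i<n. c i * partial i (\<lambda>x. h (inv_into U \<phi> x)) (\<phi> (pt w))) = 0" using c1[OF h] by simp
  qed
  define tt where "tt = \<tau> U \<phi> (pt w)"
  have tt: "tt \<noteq> 0" unfolding tt_def by (rule \<tau>_nonzero[OF U qU[OF q]])
  have main: "(\<Sum>i<d. c i * partial i (\<lambda>w. Rr w * gco w j) w) = 0" if j: "j < k" for j
  proof -
    \<comment> \<open>Contraction with the frame and the \<open>j\<close>-th vector of
      \<open>N\<close> selects the \<open>j\<close>-th coefficient: as long as the base point stays
      fixed, \<beta> takes the value \<open>tt * (Rr w * gco w j)\<close> on the fibre part of
      \<psi>.\<close>
    define \<beta> where "\<beta> = (\<lambda>ws. \<omega> (frame U \<phi> (pt w) @ ws @ [X (pt w) ! j]))"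
    have XV: "X (pt w) ! j \<in> V'" using \<xi>s_V'[OF U qU[OF q] XN[OF q]] j \<xi>s(1) by (auto simp: X_def)
    have \<beta>: "\<beta> \<in> forms (k - 1) V'"
      unfolding \<beta>_def by (rule forms_contract)
        (use \<omega>_forms frame_V'[OF U qU[OF q]] XV k1 in \<open>auto simp: length_frame\<close>)
    have slice: "partial i (\<lambda>w. snd (\<psi> w) \<beta>) w = tt * partial i (\<lambda>w. Rr w * gco w j) w" if i: "i < d" "\<not> i < n" for i
    proof -
      have "snd (\<psi> (w(i := t))) \<beta> = tt * (Rr (w(i := t)) * gco (w(i := t)) j)" for t
      proof -
        let ?w = "w(i := t)"
        have xp: "xpart ?w = xpart w" using i by (auto simp: xpart_def)
        then have pt: "pt ?w = pt w" by (simp add: pt_def)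
        have "?w \<in> pdom" using w i xp unfolding pdom_def by simp
        have W: "wedge V' (omit l (X (pt w))) \<beta> = (if j = l then pair_fun l (pt w) else 0)" if l: "l < k" for l
        proof -
          have "wedge V' (omit l (X (pt w))) \<beta> = \<beta> (omit l (X (pt w)))"
            by (rule wedge_form) (use \<beta> length_omit[of l "X (pt w)"] \<xi>s(1) l in \<open>simp add: X_def\<close>)
          also have "\<dots> = (if j = l then pairing U \<phi> (pt w) (X (pt w)) l else 0)"
            unfolding \<beta>_def by (rule pairing_delta[OF U qU[OF q] XN[OF q] j l])
          finally show ?thesis unfolding pair_fun_eq[OF q] .
        qed
        have "snd (\<psi> ?w) \<beta> = Rr ?w * (\<Sum>l<k. gco ?w l * tt / pair_fun l (pt w) * wedge V' (omit l (X (pt w))) \<beta>)"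
          unfolding \<psi>_def Rr_def[symmetric] pvec_def pt dual_vec_def[OF U qU[OF q] XN[OF q]] pair_fun_eq[OF q] tt_def
          by (simp add: scaleR_fun_def sum_fun_apply)
        also have "(\<Sum>l<k. gco ?w l * tt / pair_fun l (pt w) * wedge V' (omit l (X (pt w))) \<beta>) =
            (\<Sum>l<k. if j = l then gco ?w j * tt else 0)"
          by (rule sum.cong) (use W pair_fun_nonzero[OF q] in auto)
        also have "\<dots> = gco ?w j * tt" using j by simp
        finally show ?thesis by (simp only: mult.commute mult.left_commute mult.assoc)
      qed
      then have "partial i (\<lambda>w. snd (\<psi> w) \<beta>) w = partial i (\<lambda>w. tt * (Rr w * gco w j)) w" by (rule partial_slice)
      also have "\<dots> = tt * partial i (\<lambda>w. Rr w * gco w j) w"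
        by (rule partial_bounded_linear[OF C_k_mult[OF pdom_open C_k_Rr C_k_gco] w i(1) bounded_linear_mult_right])
      finally show ?thesis .
    qed
    have "0 = (\<Sum>i<d. c i * partial i (\<lambda>w. snd (\<psi> w) \<beta>) w)" using c2[OF \<beta>] by simp
    also have "\<dots> = (\<Sum>i<d. tt * (c i * partial i (\<lambda>w. Rr w * gco w j) w))"
    proof (rule sum.cong)
      fix i assume "i \<in> {..<d}"
      then show "c i * partial i (\<lambda>w. snd (\<psi> w) \<beta>) w = tt * (c i * partial i (\<lambda>w. Rr w * gco w j) w)"
        using c0 slice by (cases "i < n") auto
    qed simp
    also have "\<dots> = tt * (\<Sum>i<d. c i * partial i (\<lambda>w. Rr w * gco w j) w)" by (simp add: sum_distrib_left)
    finally show ?thesis using tt by simp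
  qed
  have R0: "(\<Sum>i<d. c i * partial i Rr w) = 0" using main[OF k0] by (simp add: gco_def)
  show ?thesis
  proof (cases "i < n")
    case False
    define j where "j = i + 1 - n"
    have j: "j < k" "j \<noteq> 0" "n + j - 1 = i" using False i by (simp_all add: j_def)
    have gj: "(\<lambda>w. Rr w * gco w j) = (\<lambda>w. Rr w * w i)" using j by (simp add: gco_def)
    have p: "partial l (\<lambda>w. Rr w * w i) w = Rr w * (if l = i then 1 else 0) + partial l Rr w * w i" if "l < d" for l
      using partial_mult[OF C_k_Rr C_k_coord[OF pdom_open] w that, of i] by (simp add: partial_coord)
    have "0 = (\<Sum>l<d. c l * partial l (\<lambda>w. Rr w * w i) w)" using main[OF j(1)] unfolding gj by simp
    also have "\<dots> = (\<Sum>l<d. (if l = i then c i * Rr w else 0) + c l * partial l Rr w * w i)"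
      by (rule sum.cong) (use p in \<open>auto simp: algebra_simps\<close>)
    also have "\<dots> = c i * Rr w + (\<Sum>l<d. c l * partial l Rr w) * w i"
      using i by (simp add: sum.distrib sum_distrib_right)
    also have "\<dots> = c i * Rr w" using R0 by simp
    finally show ?thesis using Rr_pos[OF w] by simp
  qed (rule c0)
qed

lemma local_param_\<psi>: "local_param n A (k - 1) V' d B pdom \<psi>"
  unfolding local_param_def C_inf_def
proof (intro conjI allI impI ballI pdom_open image_\<psi>_open homeomorphism_\<psi>)
  show "C_k i d pdom (\<lambda>w. h (fst (\<psi> w)))" if "smooth n A h" for h :: "'m \<Rightarrow> real" and i by (rule C_k_fst_\<psi>[OF that])
  show "C_k i d pdom (\<lambda>w. snd (\<psi> w) \<beta>)" if "\<beta> \<in> forms (k - 1) V'" for \<beta> i by (rule C_k_snd_\<psi>[OF that])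
  fix w and c :: "nat \<Rightarrow> real" and i
  assume w: "w \<in> pdom" and c: "(\<forall>h :: 'm \<Rightarrow> real. smooth n A h \<longrightarrow> (\<Sum>i<d. c i * partial i (\<lambda>w. h (fst (\<psi> w))) w) = 0) \<and>
       (\<forall>\<beta>\<in>forms (k - 1) V'. (\<Sum>i<d. c i * partial i (\<lambda>w. snd (\<psi> w) \<beta>) w) = 0)" and i: "i < d"
  show "c i = 0"
    by (rule immersive[OF w _ _ i]) (use c in auto)
qed

end

lemma local_param_frame:
  assumes "(U, \<phi>) \<in> A" "open O'" "O' \<subseteq> U" "length \<xi>s = k" "\<And>x. x \<in> set \<xi>s \<Longrightarrow> smooth_on n A O' x"
      "\<And>q. q \<in> O' \<Longrightarrow> basis_of (N q) (map (\<lambda>x. x q) \<xi>s)"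
  shows "\<exists>W \<psi>. local_param n A (k - 1) V' d B W \<psi> \<and>
    \<psi> ` W = {x \<in> B. fst x \<in> O' \<and> height \<omega> (gauss x) ((\<xi>s ! 0) (fst x)) > 0}"
proof -
  have 1: "local_param n A (k - 1) V' d B (pdom O' \<phi>) (\<psi> U \<phi> \<xi>s)" by (rule local_param_\<psi>[OF assms])
  have 2: "\<psi> U \<phi> \<xi>s ` pdom O' \<phi> = {x \<in> B. fst x \<in> O' \<and> 0 < Hh \<xi>s 0 x}" by (rule image_\<psi>[OF assms])
  have 3: "Hh \<xi>s 0 x = height \<omega> (gauss x) ((\<xi>s ! 0) (fst x))" for x by (rule Hh_def[OF assms])
  show ?thesis
    by (intro exI conjI, rule 1) (simp only: 2 3)
qed

end

section \<open>The area formula for the Gauss map\<close>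

lemma sets_borel_openin_Euclidean_space: "openin (Euclidean_space d) W \<Longrightarrow> W \<in> sets borel"
proof -
  assume "openin (Euclidean_space d) W"
  then obtain U where U: "open U" "W = U \<inter> {x. \<forall>i\<ge>d. x i = 0}"
    unfolding openin_Euclidean_space_iff by (elim exE conjE)
  have "closed (\<Inter>i\<in>{d..}. {x :: nat \<Rightarrow> real. x i = 0})"
    by (intro closed_INT ballI closed_Collect_eq continuous_on_product_coordinates continuous_on_const)
  moreover have "{x :: nat \<Rightarrow> real. \<forall>i\<ge>d. x i = 0} = (\<Inter>i\<in>{d..}. {x. x i = 0})" by auto
  ultimately have "closed {x :: nat \<Rightarrow> real. \<forall>i\<ge>d. x i = 0}" by simp
  then show ?thesis unfolding U(2) using U(1) by (intro sets.Int borel_open borel_closed)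
qed

lemma sphere_form_cong:
  assumes "length xs = length ys" "m \<le> Suc (length xs)" "\<And>j. j < m \<Longrightarrow> a j = b j"
    "\<And>i j. i < length xs \<Longrightarrow> j < m \<Longrightarrow> (xs ! i) j = (ys ! i) j"
  shows "sphere_form m a xs = sphere_form m b ys"
proof -
  have "((a # xs) ! i) j = ((b # ys) ! i) j" if "i < m" "j < m" for i j
    using that assms by (cases i) auto
  then have "Matrix.mat m m (\<lambda>(i, j). ((a # xs) ! i) j) = Matrix.mat m m (\<lambda>(i, j). ((b # ys) ! i) j)"
    by (intro Matrix.eq_matI) simp_all
  then show ?thesis unfolding sphere_form_def by simp
qed

lemma emeasure_count_space_UN_disjoint:
  fixes l :: nat
  assumes "disjoint_family_on P {..<l}"
  shows "(\<Sum>i<l. emeasure (count_space UNIV) {x \<in> P i. R x}) =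
    emeasure (count_space UNIV) {x \<in> (\<Union>i<l. P i). R x}"
proof -
  have "disjoint_family_on (\<lambda>i. {x \<in> P i. R x}) {..<l}"
    using assms unfolding disjoint_family_on_def by blast
  then have "(\<Sum>i<l. emeasure (count_space UNIV) {x \<in> P i. R x}) =
      emeasure (count_space UNIV) (\<Union>i<l. {x \<in> P i. R x})"
    by (intro sum_emeasure) auto
  moreover have "(\<Union>i<l. {x \<in> P i. R x}) = {x \<in> (\<Union>i<l. P i). R x}" by auto
  ultimately show ?thesis by simp
qed

context ellipsoid_setup
begin

abbreviation param where "param \<equiv> local_param n A (k - 1) V' d B"

lemma paramD:
  assumes "param W \<Psi>"
  shows "openin (Euclidean_space d) W" "openin (top_of_set B) (\<Psi> ` W)" "continuous_on W \<Psi>" "inj_on \<Psi> W"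
    "\<And>w. w \<in> W \<Longrightarrow> \<Psi> w \<in> B"
    "\<And>h :: 'm \<Rightarrow> real. smooth n A h \<Longrightarrow> C_k i d W (\<lambda>w. h (fst (\<Psi> w)))"
    "\<And>\<beta>. \<beta> \<in> forms (k - 1) V' \<Longrightarrow> C_k i d W (\<lambda>w. snd (\<Psi> w) \<beta>)"
proof -
  note p = assms[unfolded local_param_def C_inf_def]
  show "openin (Euclidean_space d) W" and o: "openin (top_of_set B) (\<Psi> ` W)" using p by simp_all
  have h: "homeomorphism W (\<Psi> ` W) \<Psi> (inv_into W \<Psi>)" using p by simp
  then show "continuous_on W \<Psi>" by (simp add: homeomorphism_def)
  have "\<And>w. w \<in> W \<Longrightarrow> inv_into W \<Psi> (\<Psi> w) = w" using h by (simp add: homeomorphism_def)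
  then show "inj_on \<Psi> W" by (rule inj_on_inverseI)
  show "\<Psi> w \<in> B" if "w \<in> W" for w using openin_subset[OF o] that by auto
  show "C_k i d W (\<lambda>w. h (fst (\<Psi> w)))" if "smooth n A h" for h :: "'m \<Rightarrow> real" using p that by simp
  show "C_k i d W (\<lambda>w. snd (\<Psi> w) \<beta>)" if "\<beta> \<in> forms (k - 1) V'" for \<beta> using p that by simp
qed

lemma openin_param_vimage:
  assumes \<Psi>: "param W \<Psi>" and O': "open O'"
  shows "openin (Euclidean_space d) {w \<in> W. fst (\<Psi> w) \<in> O'}"
proof -
  have W: "W = topspace (subtopology (Euclidean_space d) W)"
    using openin_subset[OF paramD(1)[OF \<Psi>]] by auto
  obtain U where U: "open U" "W = U \<inter> {x. \<forall>i\<ge>d. x i = 0}"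
    using paramD(1)[OF \<Psi>] unfolding openin_Euclidean_space_iff by (elim exE conjE)
  have c: "continuous_on W (\<lambda>w. fst (\<Psi> w))" by (rule continuous_on_fst[OF paramD(3)[OF \<Psi>]])
  have "openin (top_of_set W) (W \<inter> (\<lambda>w. fst (\<Psi> w)) -` O')" by (rule continuous_openin_preimage_gen[OF c O'])
  then obtain G where G: "open G" "W \<inter> (\<lambda>w. fst (\<Psi> w)) -` O' = W \<inter> G"
    unfolding openin_open by (elim exE conjE)
  have "{w \<in> W. fst (\<Psi> w) \<in> O'} = (U \<inter> G) \<inter> {x. \<forall>i\<ge>d. x i = 0}" using G(2) U(2) by auto
  then show ?thesis unfolding openin_Euclidean_space_iff using U(1) G(1) by (intro exI[of _ "U \<inter> G"]) auto
qed

text \<open>\<open>local_param\<close> speaks of globally smooth functions only. Near a given point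
  \<open>g\<close> is the quotient of the extended product \<open>b * g\<close> and a bump function
  \<open>b\<close>.\<close>

lemma C_k_param_fst:
  fixes g :: "'m \<Rightarrow> real"
  assumes \<Psi>: "param W \<Psi>" and O': "open O'" and g: "smooth_on n A O' g"
  shows "C_k i d {w \<in> W. fst (\<Psi> w) \<in> O'} (\<lambda>w. g (fst (\<Psi> w)))"
proof (rule C_k_local[OF openin_param_vimage[OF \<Psi> O']])
  fix w1 assume w1: "w1 \<in> {w \<in> W. fst (\<Psi> w) \<in> O'}"
  then have p: "fst (\<Psi> w1) \<in> O'" by simp
  obtain b :: "'m \<Rightarrow> real" where b: "smooth n A b" "b (fst (\<Psi> w1)) \<noteq> 0"
    and bg: "\<And>g :: 'm \<Rightarrow> real. smooth_on n A O' g \<Longrightarrow> smooth n A (\<lambda>q. if q \<in> O' then b q * g q else 0)"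
    using bump[OF O' p] by metis
  define P where "P = O' \<inter> b -` (- {0})"
  have P: "open P" unfolding P_def
    by (rule continuous_open_preimage[OF continuous_on_subset[OF smooth_on_continuous[OF b(1) open_UNIV]] O'])
       (auto intro: open_Compl)
  let ?V = "{w \<in> W. fst (\<Psi> w) \<in> P}"
  note V = openin_param_vimage[OF \<Psi> P]
  have 1: "C_k i d ?V (\<lambda>w. inverse (b (fst (\<Psi> w))))"
    by (rule C_k_inverse[OF V _ C_k_subset[OF paramD(6)[OF \<Psi> b(1)]]]) (auto simp: P_def)
  have 2: "C_k i d ?V (\<lambda>w. (\<lambda>q. if q \<in> O' then b q * g q else 0) (fst (\<Psi> w)))"
    by (rule C_k_subset[OF paramD(6)[OF \<Psi> bg[OF g]]]) auto
  have "C_k i d ?V (\<lambda>w. g (fst (\<Psi> w)))"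
    by (rule C_k_cong[OF V _ C_k_mult[OF V 1 2]]) (auto simp: P_def)
  then show "\<exists>V. openin (Euclidean_space d) V \<and> w1 \<in> V \<and> C_k i d V (\<lambda>w. g (fst (\<Psi> w)))"
    using V w1 b(2) by (intro exI[of _ ?V]) (simp add: P_def)
qed

text \<open>The supremum in \<open>total_density\<close> admits arbitrary parametrizations, so
  regularity is established for all of them, beyond the charts constructed above. After multilinear
  expansion the parametrization enters only through functions of the base point and through values
  of its fibre part at fixed forms.\<close>

lemma C_k_param_height:
  assumes \<Psi>: "param W \<Psi>" and v: "v \<in> V'"
  shows "C_k i d W (\<lambda>w. height \<omega> (gauss (\<Psi> w)) v)"
proof (rule C_k_local[OF paramD(1)[OF \<Psi>]])
  fix w0 assume w0: "w0 \<in> W"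
  let ?p = "fst (\<Psi> w0)"
  obtain U \<phi> where U: "(U, \<phi>) \<in> A" "?p \<in> U" by (rule chart_cover)
  have "\<exists>O'' \<xi>s. open O'' \<and> ?p \<in> O'' \<and> length \<xi>s = k \<and> (\<forall>\<xi>\<in>set \<xi>s. smooth_on n A O'' \<xi>) \<and>
       (\<forall>q\<in>O''. basis_of (N q) (map (\<lambda>\<xi>. \<xi> q) \<xi>s))"
    using tb by (simp add: transversal_bundle_def)
  then obtain O'' \<xi>s where O'': "open O'' \<and> ?p \<in> O'' \<and> length \<xi>s = k \<and> (\<forall>\<xi>\<in>set \<xi>s. smooth_on n A O'' \<xi>) \<and>
       (\<forall>q\<in>O''. basis_of (N q) (map (\<lambda>\<xi>. \<xi> q) \<xi>s))" by (elim exE)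
  define O' where "O' = O'' \<inter> U"
  have O': "open O'" "O' \<subseteq> U" "?p \<in> O'" using O'' U chart(1)[OF U(1)] by (auto simp: O'_def)
  have \<xi>s: "length \<xi>s = k" "\<And>x. x \<in> set \<xi>s \<Longrightarrow> smooth_on n A O' x"
    "\<And>q. q \<in> O' \<Longrightarrow> basis_of (N q) (map (\<lambda>x. x q) \<xi>s)"
    using O'' smooth_on_subset[of O'' _ O'] by (auto simp: O'_def)
  have \<tau>s: "smooth_on n A O' (\<tau> U \<phi>)" by (rule smooth_\<tau>[OF U(1) O'(1,2) \<xi>s])
  have qU: "q \<in> U" if "q \<in> O'" for q using O'(2) that by auto
  define Z where "Z = {w \<in> W. fst (\<Psi> w) \<in> O'}"
  have Z: "openin (Euclidean_space d) Z" unfolding Z_def by (rule openin_param_vimage[OF \<Psi> O'(1)])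
  have comp: "C_k i d Z (\<lambda>w. g (fst (\<Psi> w)))" if "smooth_on n A O' g" for g :: "'m \<Rightarrow> real"
    unfolding Z_def by (rule C_k_param_fst[OF \<Psi> O'(1) that])
  have ext: "snd (\<Psi> w) \<in> ext_power V' (k - 1) (N (fst (\<Psi> w)))" if "w \<in> Z" for w
    using paramD(5)[OF \<Psi>] that by (simp add: Z_def bundle_mem)
  \<comment> \<open>The \<open>n + 1\<close> varying arguments of \<omega>; \<open>take n\<close>
    and \<open>drop n\<close> leave the gap between the frame and \<open>v\<close> into which the
    arguments of \<eta> go.\<close>
  let ?fs = "frame_funs U \<phi> @ [\<lambda>q. v]"
  let ?\<Lambda> = "\<lambda>w xs. snd (\<Psi> w) (\<lambda>ws. \<omega> (take n xs @ ws @ drop n xs))"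
  obtain e where e: "basis_of V' e" "\<And>v. v \<in> V' \<Longrightarrow> v = (\<Sum>b\<in>set e. (v \<bullet> b) *\<^sub>R b)"
    using orthonormal_list[OF V'] by metis
  have lenfs: "length ?fs = n + 1" by (simp add: frame_funs_def)
  have fsV: "set (map (\<lambda>y. y q) ?fs) \<subseteq> V'" if "q \<in> O'" for q
    using frame_V'[OF U(1) qU[OF that]] v by (auto simp: frame_funs)
  have form: "(\<lambda>ws. \<omega> (take n xs @ ws @ drop n xs)) \<in> forms (k - 1) V'" if "length xs = n + 1" "set xs \<subseteq> V'" for xs
    by (rule forms_contract) (use that \<omega>_forms k1 set_take_subset[of n xs] set_drop_subset[of n xs] in auto)
  have "C_k i d Z (\<lambda>w. ?\<Lambda> w (map (\<lambda>y. y (fst (\<Psi> w))) ?fs))"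
  proof (rule multilinear_on_closure[where P = "C_k i d Z" and R = "C_k i d Z" and Z = Z and B = "set e"
        and V = V' and k = "n + 1" and c = "\<lambda>i b w. (?fs ! i) (fst (\<Psi> w)) \<bullet> b" and \<Lambda> = ?\<Lambda>])
    show "C_k i d Z (\<lambda>z. 0)" by (rule C_k_const[OF Z])
    show "C_k i d Z (\<lambda>z. g z + h z)" if "C_k i d Z g" "C_k i d Z h" for g h :: "(nat \<Rightarrow> real) \<Rightarrow> real"
      by (rule C_k_add[OF Z that])
    show "C_k i d Z (\<lambda>z. g z * h z)" if "C_k i d Z g" "C_k i d Z h" for g h :: "(nat \<Rightarrow> real) \<Rightarrow> real"
      by (rule C_k_mult[OF Z that])
    show "C_k i d Z h" if "C_k i d Z g" "\<And>z. z \<in> Z \<Longrightarrow> g z = h z" for g h :: "(nat \<Rightarrow> real) \<Rightarrow> real"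
      by (rule C_k_cong[OF Z that(2,1)])
    show "set e \<subseteq> V'" by (rule basis_ofD(4)[OF e(1)])
    show "multilinear_on (n + 1) V' (?\<Lambda> w)" if w: "w \<in> Z" for w
    proof (rule multilinear_on_contract)
      from ext_power_linear[OF ext[OF w]]
      show "snd (\<Psi> w) (\<lambda>xs. a * \<beta> xs + b * \<gamma> xs) = a * snd (\<Psi> w) \<beta> + b * snd (\<Psi> w) \<gamma>"
        if "\<beta> \<in> forms (k - 1) V'" "\<gamma> \<in> forms (k - 1) V'" for \<beta> \<gamma> a b using that .
      show "\<omega> \<in> forms (n + (k - 1) + 1) V'" using \<omega>_forms k1 by simp
      show "(\<lambda>ws. \<omega> (take n xs @ ws @ drop n xs)) \<in> forms (k - 1) V'" if "length xs = n + 1" "set xs \<subseteq> V'" for xs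
        using that by (rule form)
    qed (rule V')
    show "map (\<lambda>y. y (fst (\<Psi> w))) ?fs ! i = (\<Sum>b\<in>set e. ((?fs ! i) (fst (\<Psi> w)) \<bullet> b) *\<^sub>R b)" if "w \<in> Z" "i < n + 1" for w i
    proof -
      have nth: "map (\<lambda>y. y (fst (\<Psi> w))) ?fs ! i = (?fs ! i) (fst (\<Psi> w))" using that(2) lenfs by (intro nth_map) simp
      have q: "fst (\<Psi> w) \<in> O'" using that(1) by (simp add: Z_def)
      have "map (\<lambda>y. y (fst (\<Psi> w))) ?fs ! i \<in> set (map (\<lambda>y. y (fst (\<Psi> w))) ?fs)"
        by (rule nth_mem) (use that(2) lenfs in simp)
      then have "(?fs ! i) (fst (\<Psi> w)) \<in> V'" using fsV[OF q] nth by auto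
      then show ?thesis unfolding nth by (rule e(2))
    qed
    show "C_k i d Z (\<lambda>w. (?fs ! j) (fst (\<Psi> w)) \<bullet> b)" if "j < n + 1" "b \<in> set e" for j b
    proof -
      have "?fs ! j \<in> set ?fs" using that(1) lenfs by (intro nth_mem) simp
      then have "smooth_on n A O' (?fs ! j)"
        using smooth_frame_funs[OF U(1) O'(2)] smooth_on_const[OF O'(1), of v] by auto
      from comp[OF smooth_on_inner[OF O'(1) this]] show ?thesis .
    qed
    show "C_k i d Z (\<lambda>w. ?\<Lambda> w bs)" for bs
    proof (cases "(\<lambda>ws. \<omega> (take n bs @ ws @ drop n bs)) \<in> forms (k - 1) V'")
      case True
      show ?thesis by (rule C_k_subset[OF paramD(7)[OF \<Psi> True]]) (auto simp: Z_def)
    next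
      case False
      show ?thesis
        by (rule C_k_cong[OF Z ext_power_nonform[OF ext False, symmetric] C_k_const[OF Z]])
    qed
    show "set (map (\<lambda>y. y (fst (\<Psi> w))) ?fs) \<subseteq> V'" if "w \<in> Z" for w
      by (rule fsV) (use that in \<open>simp add: Z_def\<close>)
  qed (use V' lenfs in simp_all)
  then have 1: "C_k i d Z (\<lambda>w. ?\<Lambda> w (map (\<lambda>y. y (fst (\<Psi> w))) ?fs) * inverse (\<tau> U \<phi> (fst (\<Psi> w))))"
    by (intro C_k_mult[OF Z] C_k_inverse[OF Z _ comp[OF \<tau>s]]) (use \<tau>_nonzero[OF U(1) qU] in \<open>auto simp: Z_def\<close>)
  have "C_k i d Z (\<lambda>w. height \<omega> (gauss (\<Psi> w)) v)"
  proof (rule C_k_cong[OF Z _ 1])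
    fix w assume w: "w \<in> Z"
    then have q: "fst (\<Psi> w) \<in> O'" by (simp add: Z_def)
    show "?\<Lambda> w (map (\<lambda>y. y (fst (\<Psi> w))) ?fs) * inverse (\<tau> U \<phi> (fst (\<Psi> w))) = height \<omega> (gauss (\<Psi> w)) v"
      using height_gauss[OF U(1) qU[OF q] ext[OF w] v] by (simp add: frame_funs frame_funs_def divide_inverse)
  qed
  then show "\<exists>Z. openin (Euclidean_space d) Z \<and> w0 \<in> Z \<and> C_k i d Z (\<lambda>w. height \<omega> (gauss (\<Psi> w)) v)"
    using Z w0 O'(3) by (intro exI[of _ Z]) (simp add: Z_def)
qed

lemma C_k_param_coords:
  assumes \<Psi>: "param W \<Psi>"
  shows "C_k i d W (\<lambda>w. coords \<zeta> (gauss (\<Psi> w)) l)"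
proof -
  obtain b c where "(\<forall>j<m. b j \<in> V') \<and> (\<forall>y\<in>E. \<forall>l. coords \<zeta> y l = (\<Sum>j<m. height \<omega> y (b j) * c j l))"
    using coords_height by (elim exE)
  then have bc: "\<And>j. j < m \<Longrightarrow> b j \<in> V'"
    "\<And>y l. y \<in> E \<Longrightarrow> coords \<zeta> y l = (\<Sum>j<m. height \<omega> y (b j) * c j l)" by simp_all
  note W = paramD(1)[OF \<Psi>]
  have E: "gauss (\<Psi> w) \<in> E" if "w \<in> W" for w using paramD(5)[OF \<Psi> that] by (simp add: bundle_mem S_iff)
  show ?thesis
  proof (rule C_k_cong[OF W bc(2)[symmetric, OF E]], assumption)
    show "C_k i d W (\<lambda>w. \<Sum>j<m. height \<omega> (gauss (\<Psi> w)) (b j) * c j l)"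
      by (rule C_k_sum[OF W], rule C_k_mult[OF W C_k_param_height[OF \<Psi>] C_k_const[OF W]]) (use bc(1) in simp)
  qed
qed

text \<open>\<open>pullback_density\<close> differentiates the Gauss map separately at each \<beta>.
  As the map stays in the span of \<zeta>, these derivatives are again combinations of \<zeta>, with
  the derivatives of the coordinates as coefficients.\<close>

lemma pullback_density_coords:
  assumes \<Psi>: "param W \<Psi>" and w: "w \<in> W"
  shows "pullback_density d \<zeta> (\<lambda>w. gauss (\<Psi> w)) w =
    sphere_form m (\<lambda>l. coords \<zeta> (gauss (\<Psi> w)) l) (map (\<lambda>i l. partial i (\<lambda>w. coords \<zeta> (gauss (\<Psi> w)) l) w) [0..<d])"
proof -
  let ?a = "\<lambda>l w. coords \<zeta> (gauss (\<Psi> w)) l"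
  note W = paramD(1)[OF \<Psi>]
  have E: "gauss (\<Psi> w) \<in> E" if "w \<in> W" for w using paramD(5)[OF \<Psi> that] by (simp add: bundle_mem S_iff)
  have dF: "partial i (\<lambda>w. gauss (\<Psi> w) \<beta>) w = (\<Sum>l<m. partial i (?a l) w * (\<zeta> ! l) \<beta>)" if i: "i < d" for i \<beta>
  proof -
    have "gauss (\<Psi> w) \<beta> = (\<Sum>l<m. ?a l w * (\<zeta> ! l) \<beta>)" if "w \<in> W" for w
      by (subst coords_expand[OF E[OF that]]) (simp add: sum_fun_apply scaleR_fun_def)
    then have "partial i (\<lambda>w. gauss (\<Psi> w) \<beta>) w = partial i (\<lambda>w. \<Sum>l<m. ?a l w * (\<zeta> ! l) \<beta>) w"
      by (rule partial_cong[OF W w i])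
    also have "\<dots> = (\<Sum>l<m. partial i (?a l) w * (\<zeta> ! l) \<beta>)"
      unfolding partial_def[of i "\<lambda>w. \<Sum>l<m. ?a l w * (\<zeta> ! l) \<beta>"]
    proof (rule vector_derivative_at, rule has_vector_derivative_sum, rule has_vector_derivative_mult_left)
      fix l
      show "((\<lambda>t. ?a l (w(i := t))) has_vector_derivative partial i (?a l) w) (at (w i))"
        by (rule C_k_SucD(2)[OF C_k_param_coords[OF \<Psi>, of "Suc 0"] i w])
    qed
    finally show ?thesis .
  qed
  have co: "coords \<zeta> (\<lambda>\<beta>. partial i (\<lambda>w. gauss (\<Psi> w) \<beta>) w) l = partial i (?a l) w" if "i < d" "l < m" for i l
  proof -
    have "(\<lambda>\<beta>. partial i (\<lambda>w. gauss (\<Psi> w) \<beta>) w) = (\<Sum>l<m. partial i (?a l) w *\<^sub>R \<zeta> ! l)"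
      using dF[OF that(1)] by (simp add: fun_eq_iff sum_fun_apply scaleR_fun_def)
    then show ?thesis using coords_comb[OF that(2), of "\<lambda>l. partial i (?a l) w"] by simp
  qed
  show ?thesis
    unfolding pullback_density_def ellipsoid_form_def length_\<zeta>
    by (rule sphere_form_cong) (use co k1 in \<open>simp_all add: nth_upt\<close>)
qed

section \<open>Counting the fibres of the Gauss map\<close>

definition Y :: "(nat \<Rightarrow> 'e::{finite,wellorder}) \<Rightarrow> real ^ 'e::{finite,wellorder} \<Rightarrow> ('v list \<Rightarrow> real) \<Rightarrow> real"
  where "Y \<iota> z = (\<Sum>l<m. vec_nth z (\<iota> l) *\<^sub>R \<zeta> ! l)"

lemma gauss_eq_Y_iff:
  assumes x: "x \<in> B" and z: "norm z > 0"
  shows "gauss x = Y \<iota> (z /\<^sub>R norm z) \<longleftrightarrow> (\<forall>l<m. norm z * coords \<zeta> (gauss x) l = vec_nth z (\<iota> l))"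
proof -
  have E: "gauss x \<in> E" using x by (simp add: bundle_mem S_iff)
  have "gauss x = Y \<iota> (z /\<^sub>R norm z) \<longleftrightarrow> (\<forall>l<m. coords \<zeta> (gauss x) l = vec_nth (z /\<^sub>R norm z) (\<iota> l))"
  proof
    assume "gauss x = Y \<iota> (z /\<^sub>R norm z)"
    then show "\<forall>l<m. coords \<zeta> (gauss x) l = vec_nth (z /\<^sub>R norm z) (\<iota> l)"
      unfolding Y_def using coords_comb by metis
  next
    assume *: "\<forall>l<m. coords \<zeta> (gauss x) l = vec_nth (z /\<^sub>R norm z) (\<iota> l)"
    have "gauss x = (\<Sum>l<m. coords \<zeta> (gauss x) l *\<^sub>R \<zeta> ! l)" by (rule coords_expand[OF E])
    also have "\<dots> = Y \<iota> (z /\<^sub>R norm z)" unfolding Y_def by (rule sum.cong) (use * in auto)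
    finally show "gauss x = Y \<iota> (z /\<^sub>R norm z)" .
  qed
  also have "\<dots> \<longleftrightarrow> (\<forall>l<m. norm z * coords \<zeta> (gauss x) l = vec_nth z (\<iota> l))"
  proof (intro all_cong1 imp_cong refl)
    fix l
    show "(coords \<zeta> (gauss x) l = vec_nth (z /\<^sub>R norm z) (\<iota> l)) = (norm z * coords \<zeta> (gauss x) l = vec_nth z (\<iota> l))"
      using z by (auto simp: field_simps)
  qed
  finally show ?thesis .
qed

text \<open>\<open>sphere_param\<close> is used with the coordinates of the Gauss map, which have
  length 1 because the map takes its values in the ellipsoid. A parametrization is injective, so
  counting parameters is counting points of the bundle.\<close>

lemma param_area:
  fixes \<iota> :: "nat \<Rightarrow> 'e::{finite,wellorder}"
  assumes \<iota>: "bij_betw \<iota> {..<m} UNIV" and \<Psi>: "param W \<Psi>" and K: "K \<subseteq> W" "K \<in> sets borel"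
  shows "\<exists>g\<in>borel_measurable lebesgue. (AE y in lebesgue. g y = (if 0 < norm y \<and> norm y \<le> 1
       then emeasure (count_space UNIV) {x \<in> \<Psi> ` K. gauss x = Y \<iota> (y /\<^sub>R norm y)} else 0)) \<and>
    integral_Rd d K (\<lambda>w. \<bar>pullback_density d \<zeta> (\<lambda>w. gauss (\<Psi> w)) w\<bar>) = ennreal (real m) * (\<integral>\<^sup>+y. g y \<partial>lebesgue)"
proof -
  define a where "a l w = coords \<zeta> (gauss (\<Psi> w)) l" for l w
  have Sd: "Suc d = m" using k1 by simp
  interpret sphere_param d W a \<iota> "inv_into {..<m} \<iota>"
  proof (unfold_locales, unfold Sd)
    show "1 \<le> d" using n1 k1 by simp
    show "openin (Euclidean_space d) W" by (rule paramD(1)[OF \<Psi>])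
    show "C_k 1 d W (a l)" for l unfolding a_def[abs_def] by (rule C_k_param_coords[OF \<Psi>])
    show "(\<Sum>l<m. (a l w)\<^sup>2) = 1" if "w \<in> W" for w
      using paramD(5)[OF \<Psi> that] by (simp add: bundle_mem S_iff a_def)
    show "bij_betw \<iota> {..<m} UNIV" by (rule \<iota>)
    show "inv_into {..<m} \<iota> (\<iota> i) = i" if "i < m" for i
      using inv_into_f_f[OF bij_betw_imp_inj_on[OF \<iota>]] that by simp
  qed
  have "\<exists>g. g \<in> borel_measurable lebesgue \<and> (AE y in lebesgue. g y = (if 0 < norm y \<and> norm y \<le> 1
       then emeasure (count_space UNIV) {w\<in>K. \<forall>l<Suc d. norm y * a l w = vec_nth y (\<iota> l)} else 0)) \<and>
    integral_Rd d K (\<lambda>w. \<bar>jac w\<bar>) = ennreal (real (Suc d)) * (\<integral>\<^sup>+y. g y \<partial>lebesgue)"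
    by (rule sphere_area[OF K(2,1)]) blast
  then obtain g where g: "g \<in> borel_measurable lebesgue" "AE y in lebesgue. g y = (if 0 < norm y \<and> norm y \<le> 1
       then emeasure (count_space UNIV) {w\<in>K. \<forall>l<m. norm y * a l w = vec_nth y (\<iota> l)} else 0)"
    "integral_Rd d K (\<lambda>w. \<bar>jac w\<bar>) = ennreal (real m) * (\<integral>\<^sup>+y. g y \<partial>lebesgue)"
    unfolding Sd by (elim exE conjE)
  have cnt: "emeasure (count_space UNIV) {w\<in>K. \<forall>l<m. norm y * a l w = vec_nth y (\<iota> l)} =
      emeasure (count_space UNIV) {x \<in> \<Psi> ` K. gauss x = Y \<iota> (y /\<^sub>R norm y)}" if y: "norm y > 0" for y
  proof (rule emeasure_count_space_bij)
    have "gauss (\<Psi> w) = Y \<iota> (y /\<^sub>R norm y) \<longleftrightarrow> (\<forall>l<m. norm y * a l w = vec_nth y (\<iota> l))" if "w \<in> K" for w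
      unfolding a_def by (rule gauss_eq_Y_iff[OF paramD(5)[OF \<Psi>] y]) (use that K(1) in auto)
    then have "\<Psi> ` {w\<in>K. \<forall>l<m. norm y * a l w = vec_nth y (\<iota> l)} = {x \<in> \<Psi> ` K. gauss x = Y \<iota> (y /\<^sub>R norm y)}"
      by auto
    moreover have "inj_on \<Psi> {w\<in>K. \<forall>l<m. norm y * a l w = vec_nth y (\<iota> l)}"
      by (rule inj_on_subset[OF paramD(4)[OF \<Psi>]]) (use K(1) in auto)
    ultimately show "bij_betw \<Psi> {w\<in>K. \<forall>l<m. norm y * a l w = vec_nth y (\<iota> l)} {x \<in> \<Psi> ` K. gauss x = Y \<iota> (y /\<^sub>R norm y)}"
      by (simp add: bij_betw_def)
  qed
  have pj: "pullback_density d \<zeta> (\<lambda>w. gauss (\<Psi> w)) w = jac w" if "w \<in> K" for w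
    unfolding jac_def unfolding Sd a_def[abs_def] by (rule pullback_density_coords[OF \<Psi>]) (use that K(1) in auto)
  have int: "integral_Rd d K (\<lambda>w. \<bar>pullback_density d \<zeta> (\<lambda>w. gauss (\<Psi> w)) w\<bar>) = integral_Rd d K (\<lambda>w. \<bar>jac w\<bar>)"
    unfolding integral_Rd_def Let_def by (rule nn_integral_cong) (use pj in \<open>auto simp: indicator_def\<close>)
  show ?thesis
  proof (rule bexI[OF _ g(1)], rule conjI)
    show "AE y in lebesgue. g y = (if 0 < norm y \<and> norm y \<le> 1
       then emeasure (count_space UNIV) {x \<in> \<Psi> ` K. gauss x = Y \<iota> (y /\<^sub>R norm y)} else 0)"
      using g(2)
    proof (rule eventually_mono)
      fix y assume *: "g y = (if 0 < norm y \<and> norm y \<le> 1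
       then emeasure (count_space UNIV) {w\<in>K. \<forall>l<m. norm y * a l w = vec_nth y (\<iota> l)} else 0)"
      show "g y = (if 0 < norm y \<and> norm y \<le> 1
       then emeasure (count_space UNIV) {x \<in> \<Psi> ` K. gauss x = Y \<iota> (y /\<^sub>R norm y)} else 0)"
      proof (cases "0 < norm y \<and> norm y \<le> 1")
        case True
        show ?thesis unfolding * if_P[OF True] by (rule cnt[OF conjunct1[OF True]])
      next
        case False
        show ?thesis unfolding * if_not_P[OF False] by (rule refl)
      qed
    qed
    show "integral_Rd d K (\<lambda>w. \<bar>pullback_density d \<zeta> (\<lambda>w. gauss (\<Psi> w)) w\<bar>) = ennreal (real m) * (\<integral>\<^sup>+y. g y \<partial>lebesgue)"
      unfolding int by (rule g(3))
  qed
qed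

section \<open>Decompositions of the bundle into parametrized Borel pieces\<close>

definition pieces where
  "pieces l W \<Psi> K \<longleftrightarrow> (\<forall>i<l. param (W i) (\<Psi> i) \<and> K i \<subseteq> W i \<and> K i \<in> sets borel) \<and>
     disjoint_family_on (\<lambda>i. \<Psi> i ` K i) {..<l}" for l :: nat

lemma pieces_area:
  fixes \<iota> :: "nat \<Rightarrow> 'e::{finite,wellorder}"
  assumes \<iota>: "bij_betw \<iota> {..<m} UNIV" and P: "pieces l W \<Psi> K"
  shows "\<exists>g\<in>borel_measurable lebesgue. (AE y in lebesgue. g y = (if 0 < norm y \<and> norm y \<le> 1
       then emeasure (count_space UNIV) {x \<in> (\<Union>i<l. \<Psi> i ` K i). gauss x = Y \<iota> (y /\<^sub>R norm y)} else 0)) \<and>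
    (\<Sum>i<l. integral_Rd d (K i) (\<lambda>w. \<bar>pullback_density d \<zeta> (\<lambda>w. gauss (\<Psi> i w)) w\<bar>)) =
      ennreal (real m) * (\<integral>\<^sup>+y. g y \<partial>lebesgue)"
proof -
  have "\<forall>i\<in>{..<l}. \<exists>g. g\<in>borel_measurable lebesgue \<and> (AE y in lebesgue. g y = (if 0 < norm y \<and> norm y \<le> 1
       then emeasure (count_space UNIV) {x \<in> \<Psi> i ` K i. gauss x = Y \<iota> (y /\<^sub>R norm y)} else 0)) \<and>
    integral_Rd d (K i) (\<lambda>w. \<bar>pullback_density d \<zeta> (\<lambda>w. gauss (\<Psi> i w)) w\<bar>) = ennreal (real m) * (\<integral>\<^sup>+y. g y \<partial>lebesgue)"
  proof
    fix i assume i: "i \<in> {..<l}"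
    have "param (W i) (\<Psi> i)" "K i \<subseteq> W i" "K i \<in> sets borel" using P i by (simp_all add: pieces_def)
    from param_area[OF \<iota> this, unfolded Bex_def] show "\<exists>g. g\<in>borel_measurable lebesgue \<and> (AE y in lebesgue. g y = (if 0 < norm y \<and> norm y \<le> 1
       then emeasure (count_space UNIV) {x \<in> \<Psi> i ` K i. gauss x = Y \<iota> (y /\<^sub>R norm y)} else 0)) \<and>
    integral_Rd d (K i) (\<lambda>w. \<bar>pullback_density d \<zeta> (\<lambda>w. gauss (\<Psi> i w)) w\<bar>) = ennreal (real m) * (\<integral>\<^sup>+y. g y \<partial>lebesgue)" .
  qed
  from bchoice[OF this] obtain g where g: "\<forall>i\<in>{..<l}. g i\<in>borel_measurable lebesgue \<and> (AE y in lebesgue. g i y = (if 0 < norm y \<and> norm y \<le> 1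
       then emeasure (count_space UNIV) {x \<in> \<Psi> i ` K i. gauss x = Y \<iota> (y /\<^sub>R norm y)} else 0)) \<and>
    integral_Rd d (K i) (\<lambda>w. \<bar>pullback_density d \<zeta> (\<lambda>w. gauss (\<Psi> i w)) w\<bar>) = ennreal (real m) * (\<integral>\<^sup>+y. g i y \<partial>lebesgue)"
    by (rule exE)
  have disj: "disjoint_family_on (\<lambda>i. \<Psi> i ` K i) {..<l}" using P by (simp add: pieces_def)
  have ae: "AE y in lebesgue. \<forall>i\<in>{..<l}. g i y = (if 0 < norm y \<and> norm y \<le> 1
       then emeasure (count_space UNIV) {x \<in> \<Psi> i ` K i. gauss x = Y \<iota> (y /\<^sub>R norm y)} else 0)"
    by (rule AE_finite_allI) (use g in auto)
  have m: "\<And>i. i \<in> {..<l} \<Longrightarrow> g i \<in> borel_measurable lebesgue" using g by simp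
  show ?thesis
  proof (intro bexI[of _ "\<lambda>y. \<Sum>i<l. g i y"] conjI)
    show "(\<lambda>y. \<Sum>i<l. g i y) \<in> borel_measurable lebesgue" by (rule borel_measurable_sum[OF m])
    show "AE y in lebesgue. (\<Sum>i<l. g i y) = (if 0 < norm y \<and> norm y \<le> 1
       then emeasure (count_space UNIV) {x \<in> (\<Union>i<l. \<Psi> i ` K i). gauss x = Y \<iota> (y /\<^sub>R norm y)} else 0)"
      using ae
    proof (rule eventually_mono)
      fix y assume *: "\<forall>i\<in>{..<l}. g i y = (if 0 < norm y \<and> norm y \<le> 1
       then emeasure (count_space UNIV) {x \<in> \<Psi> i ` K i. gauss x = Y \<iota> (y /\<^sub>R norm y)} else 0)"
      show "(\<Sum>i<l. g i y) = (if 0 < norm y \<and> norm y \<le> 1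
       then emeasure (count_space UNIV) {x \<in> (\<Union>i<l. \<Psi> i ` K i). gauss x = Y \<iota> (y /\<^sub>R norm y)} else 0)"
        unfolding emeasure_count_space_UN_disjoint[OF disj, symmetric] using * by simp
    qed
    have "(\<Sum>i<l. integral_Rd d (K i) (\<lambda>w. \<bar>pullback_density d \<zeta> (\<lambda>w. gauss (\<Psi> i w)) w\<bar>)) =
        (\<Sum>i<l. ennreal (real m) * (\<integral>\<^sup>+y. g i y \<partial>lebesgue))" by (rule sum.cong) (use g in auto)
    also have "\<dots> = ennreal (real m) * (\<integral>\<^sup>+y. (\<Sum>i<l. g i y) \<partial>lebesgue)"
      by (simp only: nn_integral_sum[of "{..<l}" g lebesgue, OF m] sum_distrib_left)
    finally show "(\<Sum>i<l. integral_Rd d (K i) (\<lambda>w. \<bar>pullback_density d \<zeta> (\<lambda>w. gauss (\<Psi> i w)) w\<bar>)) =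
      ennreal (real m) * (\<integral>\<^sup>+y. (\<Sum>i<l. g i y) \<partial>lebesgue)" .
  qed
qed

lemma height_scale: "y \<in> E \<Longrightarrow> v \<in> V' \<Longrightarrow> height \<omega> y (c *\<^sub>R v) = c * height \<omega> y v"
  using height_linear[OF V' \<omega>_forms _, of y V' "{()}" "\<lambda>_. v" "\<lambda>_. c"] n1 by simp

text \<open>If all these heights were 0, the fibre element would be 0 by
  \<open>dual_vec_unique\<close>, but the ellipsoid does not contain 0. Hence every point lies in
  the half-space chart of some frame vector or of its negative.\<close>

lemma bundle_height_nonzero:
  assumes U: "(U, \<phi>) \<in> A" "q \<in> U" and \<xi>s: "basis_of (N q) \<xi>s" and x: "(q, \<eta>) \<in> B"
  shows "\<exists>j<k. height \<omega> (gauss (q, \<eta>)) (\<xi>s ! j) \<noteq> 0"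
proof (rule ccontr)
  assume "\<not> ?thesis"
  then have 0: "height \<omega> (gauss (q, \<eta>)) (\<xi>s ! j) = 0" if "j < k" for j using that by auto
  have \<eta>: "\<eta> \<in> ext_power V' (k - 1) (N q)" and g: "gauss (q, \<eta>) \<in> S" using x by (simp_all add: bundle_mem)
  have "\<eta> = dual_vec U \<phi> q \<xi>s (\<lambda>j. height \<omega> (gauss (q, \<eta>)) (\<xi>s ! j))" by (rule dual_vec_unique[OF U \<xi>s \<eta>])
  also have "\<dots> = 0" unfolding dual_vec_def[OF U \<xi>s] by (rule sum.neutral) (use 0 in auto)
  finally have "\<eta> = 0" .
  then have "gauss (q, \<eta>) = 0" using gauss_scale[OF U \<eta>, of 0] by simp
  then show False using g zero_notin_S by simp
qed

lemma local_cover: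
  "\<exists>O' F. open O' \<and> p \<in> O' \<and> finite F \<and> (\<forall>(W, \<Psi>)\<in>F. param W \<Psi>) \<and>
    (\<forall>x\<in>B. fst x \<in> O' \<longrightarrow> (\<exists>(W, \<Psi>)\<in>F. x \<in> \<Psi> ` W))"
proof -
  obtain U \<phi> where U: "(U, \<phi>) \<in> A" "p \<in> U" by (rule chart_cover)
  have "\<exists>O'' \<xi>s. open O'' \<and> p \<in> O'' \<and> length \<xi>s = k \<and> (\<forall>\<xi>\<in>set \<xi>s. smooth_on n A O'' \<xi>) \<and>
       (\<forall>q\<in>O''. basis_of (N q) (map (\<lambda>\<xi>. \<xi> q) \<xi>s))"
    using tb by (simp add: transversal_bundle_def)
  then obtain O'' \<xi>s where O'': "open O'' \<and> p \<in> O'' \<and> length \<xi>s = k \<and> (\<forall>\<xi>\<in>set \<xi>s. smooth_on n A O'' \<xi>) \<and>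
       (\<forall>q\<in>O''. basis_of (N q) (map (\<lambda>\<xi>. \<xi> q) \<xi>s))" by (elim exE)
  define O' where "O' = O'' \<inter> U"
  have O': "open O'" "O' \<subseteq> U" "p \<in> O'" using O'' U chart(1)[OF U(1)] by (auto simp: O'_def)
  have \<xi>s: "length \<xi>s = k" "\<And>x. x \<in> set \<xi>s \<Longrightarrow> smooth_on n A O' x"
    "\<And>q. q \<in> O' \<Longrightarrow> basis_of (N q) (map (\<lambda>x. x q) \<xi>s)"
    using O'' smooth_on_subset[of O'' _ O'] by (auto simp: O'_def)
  let ?H = "\<lambda>j c. {x \<in> B. fst x \<in> O' \<and> height \<omega> (gauss x) (c *\<^sub>R (\<xi>s ! j) (fst x)) > 0}"
  have ex: "\<exists>W \<Psi>. param W \<Psi> \<and> \<Psi> ` W = ?H j c" if j: "j < k" and c: "c \<noteq> 0" for j and c :: real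
  proof -
    \<comment> \<open>The chart asks for positive height at the first frame vector, so the
      \<open>j\<close>-th vector is moved to the front with the factor \<open>c\<close>.\<close>
    let ?\<Xi> = "(\<lambda>q. c *\<^sub>R (\<xi>s ! j) q) # omit j \<xi>s"
    have len: "length ?\<Xi> = k" using length_omit[of j \<xi>s] \<xi>s(1) j by simp
    have sm: "smooth_on n A O' x" if "x \<in> set ?\<Xi>" for x
    proof (cases "x \<in> set (omit j \<xi>s)")
      case True
      then show ?thesis using \<xi>s(2) set_omit_subset[of j \<xi>s] by auto
    next
      case False
      then have "x = (\<lambda>q. c *\<^sub>R (\<xi>s ! j) q)" using that by simp
      moreover have "smooth_on n A O' (\<xi>s ! j)" using \<xi>s(1,2) j by simp
      ultimately show ?thesis using smooth_on_scaleR[OF O'(1) smooth_on_const[OF O'(1), of c]] by simp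
    qed
    have bas: "basis_of (N q) (map (\<lambda>x. x q) ?\<Xi>)" if q: "q \<in> O'" for q
    proof -
      let ?vs = "map (\<lambda>x. x q) \<xi>s"
      have b: "basis_of (N q) ?vs" by (rule \<xi>s(3)[OF q])
      have om: "map (\<lambda>x. x q) (omit j \<xi>s) = omit j ?vs" by (simp add: omit_def take_map drop_map)
      have vj: "?vs ! j = (\<xi>s ! j) q" using j \<xi>s(1) by simp
      have "mset (?vs ! j # omit j ?vs) = mset ?vs"
      proof -
        have "mset (take j ?vs @ ?vs ! j # drop (Suc j) ?vs) = mset ?vs"
          by (subst id_take_nth_drop[symmetric]) (use j \<xi>s(1) in simp_all)
        then show ?thesis by (simp add: omit_def)
      qed
      then have b': "basis_of (N q) (?vs ! j # omit j ?vs)" using basis_of_mset[OF b] by metis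
      have \<theta>: "\<theta>N q \<in> forms k (N q)" using N(3)[of q] by (simp add: volume_form_def)
      have lb: "length (?vs ! j # omit j ?vs) = k" using length_omit[of j ?vs] \<xi>s(1) j by simp
      have sb: "set (?vs ! j # omit j ?vs) \<subseteq> N q" by (rule basis_ofD(4)[OF b'])
      have "\<theta>N q ([] @ (c *\<^sub>R (?vs ! j) + 0 *\<^sub>R (?vs ! j)) # omit j ?vs) =
          c * \<theta>N q ([] @ (?vs ! j) # omit j ?vs) + 0 * \<theta>N q ([] @ (?vs ! j) # omit j ?vs)"
        by (rule multilinear_onD[OF forms_linear[OF \<theta>]]) (use lb sb in auto)
      then have "\<theta>N q (c *\<^sub>R (?vs ! j) # omit j ?vs) = c * \<theta>N q (?vs ! j # omit j ?vs)" by simp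
      then have "\<theta>N q (map (\<lambda>x. x q) ?\<Xi>) \<noteq> 0"
        using volume_form_basis(2)[OF N(3) b'] c om vj by simp
      moreover have "length ?vs = k" using \<xi>s(1) by simp
      ultimately show ?thesis using form_nonzero_basis[OF b] \<theta> by simp
    qed
    have "\<exists>W \<Psi>. param W \<Psi> \<and> \<Psi> ` W = {x \<in> B. fst x \<in> O' \<and> height \<omega> (gauss x) ((?\<Xi> ! 0) (fst x)) > 0}"
      by (rule local_param_frame[OF U(1) O'(1,2) len sm bas])
    then show ?thesis by simp
  qed
  \<comment> \<open>One chart for each of the \<open>k\<close> frame vectors and each sign.\<close>
  define F where "F = (\<lambda>(j, c). SOME (W, \<Psi>). param W \<Psi> \<and> \<Psi> ` W = ?H j c) ` ({..<k} \<times> {1, -1 :: real})"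
  have choice: "\<exists>W \<Psi>. (W, \<Psi>) \<in> F \<and> param W \<Psi> \<and> \<Psi> ` W = ?H j c" if "j < k" "c = 1 \<or> c = -1" for j c
  proof -
    have "\<exists>P. case P of (W, \<Psi>) \<Rightarrow> param W \<Psi> \<and> \<Psi> ` W = ?H j c" using ex[OF that(1), of c] that(2) by auto
    from someI_ex[OF this] have "case (SOME (W, \<Psi>). param W \<Psi> \<and> \<Psi> ` W = ?H j c) of (W, \<Psi>) \<Rightarrow> param W \<Psi> \<and> \<Psi> ` W = ?H j c" .
    moreover have "(SOME (W, \<Psi>). param W \<Psi> \<and> \<Psi> ` W = ?H j c) \<in> F"
      unfolding F_def by (rule image_eqI[where x = "(j, c)"]) (use that in auto)
    ultimately show ?thesis by (cases "SOME (W, \<Psi>). param W \<Psi> \<and> \<Psi> ` W = ?H j c") auto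
  qed
  have par: "param W \<Psi>" if W: "(W, \<Psi>) \<in> F" for W \<Psi>
  proof -
    obtain j c where jc: "j < k" "c = 1 \<or> c = -1" "(W, \<Psi>) = (SOME (W, \<Psi>). param W \<Psi> \<and> \<Psi> ` W = ?H j c)"
      using W unfolding F_def by auto
    have "\<exists>P. case P of (W, \<Psi>) \<Rightarrow> param W \<Psi> \<and> \<Psi> ` W = ?H j c" using ex[OF jc(1), of c] jc(2) by auto
    from someI_ex[OF this, folded jc(3)] show ?thesis by simp
  qed
  have cov: "\<exists>W \<Psi>. (W, \<Psi>) \<in> F \<and> x \<in> \<Psi> ` W" if x: "x \<in> B" "fst x \<in> O'" for x
  proof -
    obtain q \<eta> where x': "x = (q, \<eta>)" by (cases x)
    have q: "q \<in> O'" "q \<in> U" using x(2) x' O'(2) by auto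
    obtain j where j: "j < k" "height \<omega> (gauss (q, \<eta>)) (map (\<lambda>x. x q) \<xi>s ! j) \<noteq> 0"
      using bundle_height_nonzero[OF U(1) q(2) \<xi>s(3)[OF q(1)]] x(1) x' by blast
    have E: "gauss (q, \<eta>) \<in> E" using x(1) x' by (simp add: bundle_mem S_iff)
    have "(\<xi>s ! j) q \<in> N q" using basis_ofD(4)[OF \<xi>s(3)[OF q(1)]] j(1) \<xi>s(1) by auto
    then have v: "(\<xi>s ! j) q \<in> V'" using N_V' by blast
    have "\<exists>c. (c = 1 \<or> c = -1) \<and> c * height \<omega> (gauss (q, \<eta>)) ((\<xi>s ! j) q) > 0"
    proof (cases "height \<omega> (gauss (q, \<eta>)) ((\<xi>s ! j) q) > 0")
      case True then show ?thesis by (intro exI[of _ 1]) simp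
    next
      case False then show ?thesis using j \<xi>s(1) by (intro exI[of _ "-1"]) simp
    qed
    then obtain c :: real where c: "c = 1 \<or> c = -1" "c * height \<omega> (gauss (q, \<eta>)) ((\<xi>s ! j) q) > 0" by (elim exE conjE)
    then have "x \<in> ?H j c" using x x' height_scale[OF E v] by simp
    then show ?thesis using choice[OF j(1) c(1)] by (elim exE conjE) (intro exI conjI, assumption, simp)
  qed
  show ?thesis
  proof (intro exI[of _ O'] exI[of _ F] conjI O')
    show "finite F" unfolding F_def by simp
    show "\<forall>(W, \<Psi>)\<in>F. param W \<Psi>" using par by auto
    show "\<forall>x\<in>B. fst x \<in> O' \<longrightarrow> (\<exists>(W, \<Psi>)\<in>F. x \<in> \<Psi> ` W)"
    proof (intro ballI impI)
      fix x assume x: "x \<in> B" "fst x \<in> O'"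
      obtain W \<Psi> where "(W, \<Psi>) \<in> F" "x \<in> \<Psi> ` W" using cov[OF x] by (elim exE conjE)
      then show "\<exists>(W, \<Psi>)\<in>F. x \<in> \<Psi> ` W" by (intro bexI[of _ "(W, \<Psi>)"]) simp_all
    qed
  qed
qed

lemma finite_cover:
  "\<exists>(l::nat) W \<Psi>. (\<forall>i<l. param (W i) (\<Psi> i)) \<and> (\<Union>i<l. \<Psi> i ` W i) = B"
proof -
  from choice[OF allI[OF local_cover]] obtain O' where "\<forall>p. \<exists>F. open (O' p) \<and> p \<in> O' p \<and> finite F \<and> (\<forall>(W, \<Psi>)\<in>F. param W \<Psi>) \<and>
    (\<forall>x\<in>B. fst x \<in> O' p \<longrightarrow> (\<exists>(W, \<Psi>)\<in>F. x \<in> \<Psi> ` W))" by (rule exE)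
  from choice[OF this] obtain F where OF: "\<forall>p. open (O' p) \<and> p \<in> O' p \<and> finite (F p) \<and> (\<forall>(W, \<Psi>)\<in>F p. param W \<Psi>) \<and>
    (\<forall>x\<in>B. fst x \<in> O' p \<longrightarrow> (\<exists>(W, \<Psi>)\<in>F p. x \<in> \<Psi> ` W))" by (rule exE)
  have op: "\<And>p. p \<in> UNIV \<Longrightarrow> open (O' p)" using OF by simp
  have co: "UNIV \<subseteq> (\<Union>p\<in>UNIV. O' p)" using OF by auto
  obtain P where P: "finite P" "UNIV \<subseteq> (\<Union>p\<in>P. O' p)"
    using compactE_image[OF cpt op co] by metis
  let ?F = "\<Union>p\<in>P. F p"
  have fin: "finite ?F" using P(1) OF by simp
  obtain h where h: "bij_betw h {0..<card ?F} ?F" using ex_bij_betw_nat_finite[OF fin] by (rule exE)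
  have hF: "h i \<in> ?F" if "i < card ?F" for i using bij_betwE[OF h] that by simp
  have par: "param (fst (h i)) (snd (h i))" if i: "i < card ?F" for i
  proof -
    obtain p where "h i \<in> F p" using hF[OF i] by blast
    then show ?thesis using OF[rule_format, of p] by (cases "h i") auto
  qed
  have "(\<Union>i<card ?F. snd (h i) ` fst (h i)) = B"
  proof (intro equalityI subsetI)
    fix x assume "x \<in> (\<Union>i<card ?F. snd (h i) ` fst (h i))"
    then show "x \<in> B" using paramD(5)[OF par] by auto
  next
    fix x assume x: "x \<in> B"
    obtain p where p: "p \<in> P" "fst x \<in> O' p" using P(2) by blast
    then have "\<exists>(W, \<Psi>)\<in>F p. x \<in> \<Psi> ` W" using OF[rule_format, of p] x by blast
    then obtain W \<Psi> where W: "(W, \<Psi>) \<in> F p" "x \<in> \<Psi> ` W" by auto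
    then have "(W, \<Psi>) \<in> h ` {0..<card ?F}" using bij_betw_imp_surj_on[OF h] p(1) by blast
    then obtain i where i: "i < card ?F" "(W, \<Psi>) = h i" by auto
    then have "x \<in> snd (h i) ` fst (h i)" using W(2) by (metis fst_conv snd_conv)
    then show "x \<in> (\<Union>i<card ?F. snd (h i) ` fst (h i))" using i(1) by blast
  qed
  then show ?thesis using par
    by (intro exI[of _ "card ?F"] exI[of _ "\<lambda>i. fst (h i)"] exI[of _ "\<lambda>i. snd (h i)"]) simp
qed

lemma exhausting_pieces: "\<exists>l W \<Psi> K. pieces l W \<Psi> K \<and> (\<Union>i<l. \<Psi> i ` K i) = B"
proof -
  obtain l :: nat and W \<Psi> where "(\<forall>i<l. param (W i) (\<Psi> i)) \<and> (\<Union>i<l. \<Psi> i ` W i) = B"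
    using finite_cover by (elim exE)
  then have par: "\<And>i. i < l \<Longrightarrow> param (W i) (\<Psi> i)" and B: "(\<Union>i<l. \<Psi> i ` W i) = B" by simp_all
  \<comment> \<open>Parameters of points already reached by an earlier chart are removed. What
    remains is a Borel set, because the images of the charts are open in the bundle and the charts
    are continuous.\<close>
  define K where "K i = W i - (\<Union>j<i. {w \<in> W i. \<Psi> i w \<in> \<Psi> j ` W j})" for i
  have KW: "K i \<subseteq> W i" for i by (auto simp: K_def)
  have "K i \<in> sets borel" if i: "i < l" for i
  proof -
    have Wb: "W i \<in> sets borel" by (rule sets_borel_openin_Euclidean_space[OF paramD(1)[OF par[OF i]]])
    have "{w \<in> W i. \<Psi> i w \<in> \<Psi> j ` W j} \<in> sets borel" if j: "j < i" for j
    proof -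
      obtain G where G: "open G" "\<Psi> j ` W j = B \<inter> G"
        using paramD(2)[OF par[OF less_trans[OF j i]]] unfolding openin_open by (elim exE conjE)
      have "openin (top_of_set (W i)) (W i \<inter> \<Psi> i -` G)"
        by (rule continuous_openin_preimage_gen[OF paramD(3)[OF par[OF i]] G(1)])
      then obtain T where T: "open T" "W i \<inter> \<Psi> i -` G = W i \<inter> T" unfolding openin_open by (elim exE conjE)
      have "{w \<in> W i. \<Psi> i w \<in> \<Psi> j ` W j} = W i \<inter> \<Psi> i -` G" unfolding G(2) using paramD(5)[OF par[OF i]] by auto
      then show ?thesis unfolding T(2) using Wb T(1) by (simp add: sets.Int borel_open)
    qed
    then have "(\<Union>j\<in>{..<i}. {w \<in> W i. \<Psi> i w \<in> \<Psi> j ` W j}) \<in> sets borel" by (intro sets.finite_UN) auto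
    then show ?thesis unfolding K_def using Wb by (intro sets.Diff)
  qed
  moreover have "disjoint_family_on (\<lambda>i. \<Psi> i ` K i) {..<l}"
  proof -
    have *: "\<Psi> i ` K i \<inter> \<Psi> j ` K j = {}" if "j < i" for i j
    proof (rule equals0I)
      fix y assume "y \<in> \<Psi> i ` K i \<inter> \<Psi> j ` K j"
      then obtain w v where w: "w \<in> K i" "y = \<Psi> i w" and v: "v \<in> K j" "y = \<Psi> j v" by blast
      have "v \<in> W j" using v(1) KW by blast
      then have "\<Psi> i w \<in> \<Psi> j ` W j" using w(2) v(2) by (metis imageI)
      then show False using w(1) that unfolding K_def by blast
    qed
    show ?thesis unfolding disjoint_family_on_def
    proof (intro ballI impI)
      fix i j :: nat assume "i \<noteq> j"
      then show "\<Psi> i ` K i \<inter> \<Psi> j ` K j = {}" using *[of j i] *[of i j] by (cases "i < j") (auto simp: Int_commute)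
    qed
  qed
  moreover have "(\<Union>i<l. \<Psi> i ` K i) = B"
  proof (intro equalityI subsetI)
    fix x assume "x \<in> (\<Union>i<l. \<Psi> i ` K i)"
    then show "x \<in> B" unfolding B[symmetric] using KW by blast
  next
    fix x assume "x \<in> B"
    then have ex: "\<exists>i. i < l \<and> x \<in> \<Psi> i ` W i" unfolding B[symmetric] by auto
    define i where "i = (LEAST i. i < l \<and> x \<in> \<Psi> i ` W i)"
    have i: "i < l" "x \<in> \<Psi> i ` W i" using LeastI_ex[OF ex] unfolding i_def by simp_all
    have min: "x \<notin> \<Psi> j ` W j" if "j < i" for j
    proof
      assume "x \<in> \<Psi> j ` W j"
      then have "j < l \<and> x \<in> \<Psi> j ` W j" using that i(1) by simp
      then show False using not_less_Least[of j "\<lambda>i. i < l \<and> x \<in> \<Psi> i ` W i"] that unfolding i_def by blast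
    qed
    obtain w where w: "w \<in> W i" "x = \<Psi> i w" using i(2) by auto
    then have "w \<in> K i" using min by (auto simp: K_def)
    then show "x \<in> (\<Union>i<l. \<Psi> i ` K i)" using w(2) i(1) by blast
  qed
  ultimately show ?thesis using par KW
    by (intro exI[of _ l] exI[of _ W] exI[of _ \<Psi>] exI[of _ K]) (simp add: pieces_def)
qed

section \<open>Critical points of linear functions of \<open>f\<close>\<close>

definition critical :: "'v \<Rightarrow> 'm set"
  where "critical w = {p. \<forall>v\<in>T p. deriv_along v f \<bullet> w = 0}"

text \<open>For an orthonormal basis \<open>e\<close>, the vector whose inner products are the
  heights of \<open>Y \<iota> z\<close>. It translates height functions of the exterior power into
  linear functions \<open>f \<bullet> w\<close>.\<close>

definition Zmap :: "'v list \<Rightarrow> (nat \<Rightarrow> 'e::{finite,wellorder}) \<Rightarrow> real ^ 'e::{finite,wellorder} \<Rightarrow> 'v"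
  where "Zmap e \<iota> z = (\<Sum>b\<in>set e. (\<Sum>l<m. vec_nth z (\<iota> l) * height \<omega> (\<zeta> ! l) b) *\<^sub>R b)"

lemma Y_mem: "Y \<iota> z \<in> E"
  unfolding Y_def by (rule comb_mem)

lemma height_Y: "height \<omega> (Y \<iota> z) v = (\<Sum>l<m. vec_nth z (\<iota> l) * height \<omega> (\<zeta> ! l) v)"
  unfolding Y_def by (rule height_sum)

lemma linear_Zmap: "linear (Zmap e \<iota>)"
  by (rule linearI)
     (simp_all add: Zmap_def algebra_simps sum.distrib scaleR_sum_right sum_distrib_left scaleR_add_left)

lemma height_Y_Zmap:
  assumes e: "\<And>v. v \<in> V' \<Longrightarrow> v = (\<Sum>b\<in>set e. (v \<bullet> b) *\<^sub>R b)" "set e \<subseteq> V'" and v: "v \<in> V'"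
  shows "height \<omega> (Y \<iota> z) v = v \<bullet> Zmap e \<iota> z"
proof -
  have "height \<omega> (Y \<iota> z) v = height \<omega> (Y \<iota> z) (\<Sum>b\<in>set e. (v \<bullet> b) *\<^sub>R b)" using e(1)[OF v] by simp
  also have "\<dots> = (\<Sum>b\<in>set e. (v \<bullet> b) * height \<omega> (Y \<iota> z) b)"
    by (rule height_linear[OF V' \<omega>_forms _ Y_mem]) (use n1 e(2) in auto)
  also have "\<dots> = v \<bullet> Zmap e \<iota> z" unfolding Zmap_def height_Y by (simp add: inner_sum_right mult.commute)
  finally show ?thesis .
qed

lemma Zmap_inj_range:
  fixes \<iota> :: "nat \<Rightarrow> 'e::{finite,wellorder}"
  assumes \<iota>: "bij_betw \<iota> {..<m} UNIV"
    and e: "\<And>v. v \<in> V' \<Longrightarrow> v = (\<Sum>b\<in>set e. (v \<bullet> b) *\<^sub>R b)" and be: "basis_of V' e"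
  shows "inj (Zmap e \<iota>)" "range (Zmap e \<iota>) = V'"
proof -
  note eV = basis_ofD(4)[OF be]
  show inj: "inj (Zmap e \<iota>)"
  proof (rule linear_injective_0[THEN iffD2, OF linear_Zmap], intro allI impI)
    fix z assume z: "Zmap e \<iota> z = 0"
    have "Y \<iota> z = 0"
    proof (rule height_eq_zero[OF be \<omega> _ Y_mem])
      show "height \<omega> (Y \<iota> z) v = 0" if "v \<in> set e" for v
      proof -
        have "height \<omega> (Y \<iota> z) v = v \<bullet> Zmap e \<iota> z" by (rule height_Y_Zmap[OF e eV]) (use that eV in auto)
        then show ?thesis using z by simp
      qed
    qed (use n1 in simp)
    then have "vec_nth z (\<iota> l) = 0" if "l < m" for l
      using coords_comb[OF that, of "\<lambda>l. vec_nth z (\<iota> l)"] coords_sum[of "{}"] unfolding Y_def by simp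
    then have "vec_nth z i = 0" for i
      using bij_betw_imp_surj_on[OF \<iota>] by (metis UNIV_I imageE lessThan_iff)
    then show "z = 0" by (simp add: Finite_Cartesian_Product.vec_eq_iff)
  qed
  have sub: "range (Zmap e \<iota>) \<subseteq> V'"
    unfolding Zmap_def using V' eV by (auto intro!: subspace_sum subspace_scale)
  have "dim (range (Zmap e \<iota>)) = m"
    using dim_image_eq[OF linear_Zmap, of e \<iota> UNIV] inj bij_betw_same_card[OF \<iota>] by simp
  then show "range (Zmap e \<iota>) = V'"
    using subspace_dim_equal[OF linear_subspace_image[OF linear_Zmap subspace_UNIV] V' sub] dim_V' by simp
qed

text \<open>Normalising \<open>z\<close> puts \<open>Y\<close> on the ellipsoid, while the critical
  points do not see the positive factor.\<close>

lemma count_fibre: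
  assumes e: "\<And>v. v \<in> V' \<Longrightarrow> v = (\<Sum>b\<in>set e. (v \<bullet> b) *\<^sub>R b)" "set e \<subseteq> V'"
    and \<iota>: "bij_betw \<iota> {..<m} UNIV" and z: "norm z > 0"
  shows "emeasure (count_space UNIV) {x \<in> B. gauss x = Y \<iota> (z /\<^sub>R norm z)} =
    emeasure (count_space UNIV) (critical (Zmap e \<iota> z))"
proof -
  let ?u = "z /\<^sub>R norm z"
  have YS: "Y \<iota> ?u \<in> S"
    unfolding S_iff
  proof (intro conjI Y_mem)
    have "(\<Sum>l<m. (coords \<zeta> (Y \<iota> ?u) l)\<^sup>2) = (\<Sum>l<m. (vec_nth ?u (\<iota> l))\<^sup>2)"
      unfolding Y_def by (rule sum.cong) (simp_all add: coords_comb)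
    also have "\<dots> = (\<Sum>i\<in>UNIV. (vec_nth ?u i)\<^sup>2)" by (rule sum.reindex_bij_betw[OF \<iota>])
    also have "\<dots> = (norm ?u)\<^sup>2" by (simp add: norm_vec_def L2_set_def sum_nonneg)
    also have "\<dots> = 1" using z by simp
    finally show "(\<Sum>l<m. (coords \<zeta> (Y \<iota> ?u) l)\<^sup>2) = 1" .
  qed
  have "S \<subseteq> E" using S_iff by auto
  from emeasure_count_space_bij[OF bij_fiber_crit[OF this YS]]
  have "emeasure (count_space UNIV) {x \<in> B. gauss x = Y \<iota> ?u} = emeasure (count_space UNIV) (crit (Y \<iota> ?u))" .
  also have "crit (Y \<iota> ?u) = critical (Zmap e \<iota> z)"
  proof -
    have "height \<omega> (Y \<iota> ?u) (deriv_along v f) = 0 \<longleftrightarrow> deriv_along v f \<bullet> Zmap e \<iota> z = 0" if "v \<in> T p" for p v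
      using height_Y_Zmap[OF e df_V'[OF that], of \<iota> ?u] z linear_scale[OF linear_Zmap, of e \<iota> "inverse (norm z)" z]
      by simp
    then show ?thesis by (auto simp: crit_def critical_def)
  qed
  finally show ?thesis .
qed

text \<open>The disjoint pieces that exhaust the bundle count whole fibres of the Gauss map. Any
  other admissible family covers a part of the bundle and counts at most as much, so the supremum is
  attained by the exhausting pieces.\<close>

theorem total_density_critical:
  fixes \<iota> :: "nat \<Rightarrow> 'e::{finite,wellorder}"
  assumes \<iota>: "bij_betw \<iota> {..<m} UNIV"
  shows "\<exists>Z :: real ^ 'e::_ \<Rightarrow> 'v. linear Z \<and> inj Z \<and> range Z = V' \<and>
    (\<exists>g\<in>borel_measurable lebesgue. (AE z in lebesgue. g z = (if 0 < norm z \<and> norm z \<le> 1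
       then emeasure (count_space UNIV) (critical (Z z)) else 0)) \<and>
     total_density n A (k - 1) V' d B \<zeta> gauss = ennreal (real m) * (\<integral>\<^sup>+z. g z \<partial>lebesgue))"
proof -
  obtain e where e: "basis_of V' e" "\<And>v. v \<in> V' \<Longrightarrow> v = (\<Sum>b\<in>set e. (v \<bullet> b) *\<^sub>R b)"
    using orthonormal_list[OF V'] by metis
  note eV = basis_ofD(4)[OF e(1)]
  obtain l W \<Psi> K where lW: "pieces l W \<Psi> K \<and> (\<Union>i<l. \<Psi> i ` K i) = B" using exhausting_pieces by (elim exE)
  from pieces_area[OF \<iota> conjunct1[OF lW], unfolded conjunct2[OF lW]]
  obtain g where g: "g \<in> borel_measurable lebesgue" "AE y in lebesgue. g y = (if 0 < norm y \<and> norm y \<le> 1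
       then emeasure (count_space UNIV) {x \<in> B. gauss x = Y \<iota> (y /\<^sub>R norm y)} else 0)"
    "(\<Sum>i<l. integral_Rd d (K i) (\<lambda>w. \<bar>pullback_density d \<zeta> (\<lambda>w. gauss (\<Psi> i w)) w\<bar>)) =
      ennreal (real m) * (\<integral>\<^sup>+y. g y \<partial>lebesgue)" by (elim bexE conjE)
  have tot: "total_density n A (k - 1) V' d B \<zeta> gauss =
      Sup {\<Sum>i<l. integral_Rd d (K i) (\<lambda>w. \<bar>pullback_density d \<zeta> (\<lambda>w. gauss (\<Psi> i w)) w\<bar>) | l W \<Psi> K. pieces l W \<Psi> K}"
    unfolding total_density_def pieces_def ..
  have "total_density n A (k - 1) V' d B \<zeta> gauss = ennreal (real m) * (\<integral>\<^sup>+y. g y \<partial>lebesgue)"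
    unfolding tot
  proof (rule antisym)
    show "ennreal (real m) * (\<integral>\<^sup>+y. g y \<partial>lebesgue) \<le>
      Sup {\<Sum>i<l. integral_Rd d (K i) (\<lambda>w. \<bar>pullback_density d \<zeta> (\<lambda>w. gauss (\<Psi> i w)) w\<bar>) | l W \<Psi> K. pieces l W \<Psi> K}"
      unfolding g(3)[symmetric] by (rule Sup_upper) (use lW in blast)
    show "Sup {\<Sum>i<l. integral_Rd d (K i) (\<lambda>w. \<bar>pullback_density d \<zeta> (\<lambda>w. gauss (\<Psi> i w)) w\<bar>) | l W \<Psi> K. pieces l W \<Psi> K}
      \<le> ennreal (real m) * (\<integral>\<^sup>+y. g y \<partial>lebesgue)"
    proof (rule Sup_least)
      fix s assume "s \<in> {\<Sum>i<l. integral_Rd d (K i) (\<lambda>w. \<bar>pullback_density d \<zeta> (\<lambda>w. gauss (\<Psi> i w)) w\<bar>) | l W \<Psi> K. pieces l W \<Psi> K}"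
      then obtain l' W' \<Psi>' K' where s: "s = (\<Sum>i<l'. integral_Rd d (K' i) (\<lambda>w. \<bar>pullback_density d \<zeta> (\<lambda>w. gauss (\<Psi>' i w)) w\<bar>))"
        and P: "pieces l' W' \<Psi>' K'" by (simp only: mem_Collect_eq) (elim exE conjE)
      from pieces_area[OF \<iota> P, folded s]
      obtain g' where g': "AE y in lebesgue. g' y = (if 0 < norm y \<and> norm y \<le> 1
         then emeasure (count_space UNIV) {x \<in> (\<Union>i<l'. \<Psi>' i ` K' i). gauss x = Y \<iota> (y /\<^sub>R norm y)} else 0)"
        "s = ennreal (real m) * (\<integral>\<^sup>+y. g' y \<partial>lebesgue)" by (elim bexE conjE)
      have "(\<Union>i<l'. \<Psi>' i ` K' i) \<subseteq> B"
      proof (intro UN_least image_subsetI)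
        fix i w assume "i \<in> {..<l'}" "w \<in> K' i"
        then have "param (W' i) (\<Psi>' i)" "w \<in> W' i" using P by (auto simp: pieces_def)
        then show "\<Psi>' i w \<in> B" by (rule paramD(5))
      qed
      then have mono: "emeasure (count_space UNIV) {x \<in> (\<Union>i<l'. \<Psi>' i ` K' i). R x} \<le>
          emeasure (count_space UNIV) {x \<in> B. R x}" for R by (intro emeasure_mono) auto
      have "AE y in lebesgue. g' y \<le> g y"
        using g'(1) g(2) by eventually_elim (use mono in auto)
      then have "(\<integral>\<^sup>+y. g' y \<partial>lebesgue) \<le> (\<integral>\<^sup>+y. g y \<partial>lebesgue)" by (rule nn_integral_mono_AE)
      then show "s \<le> ennreal (real m) * (\<integral>\<^sup>+y. g y \<partial>lebesgue)" unfolding g'(2) by (rule mult_left_mono) simp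
    qed
  qed
  moreover have "AE z in lebesgue. g z = (if 0 < norm z \<and> norm z \<le> 1
       then emeasure (count_space UNIV) (critical (Zmap e \<iota> z)) else 0)"
    using g(2) by (rule eventually_mono) (use count_fibre[OF e(2) eV \<iota>] in auto)
  ultimately show ?thesis
    using linear_Zmap Zmap_inj_range[OF \<iota> e(2,1)] g(1)
    by (intro exI[of _ "Zmap e \<iota>"] conjI bexI[of _ g])
qed

lemma critical_ge_2: "2 \<le> emeasure (count_space UNIV) (critical w)"
proof -
  have 1: "smooth n A (\<lambda>p. f p \<bullet> w)" by (rule smooth_on_inner[OF open_UNIV f])
  obtain p q where pq: "p \<noteq> q" "\<forall>v\<in>T p. v (\<lambda>p. f p \<bullet> w) = 0" "\<forall>v\<in>T q. v (\<lambda>p. f p \<bullet> w) = 0"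
    using two_critical_points[OF 1 dim_T n1 cpt] by metis
  have "{p, q} \<subseteq> critical w"
    using pq(2,3) deriv_along_inner[OF _ f] by (auto simp: critical_def)
  then have "emeasure (count_space UNIV) {p, q} \<le> emeasure (count_space UNIV) (critical w)"
    by (intro emeasure_mono) auto
  moreover have "emeasure (count_space UNIV) {p, q} = 2" using pq(1) by (simp add: emeasure_count_space_finite)
  ultimately show ?thesis by simp
qed

lemma critical_scale: "c \<noteq> 0 \<Longrightarrow> critical (c *\<^sub>R w) = critical w"
  by (auto simp: critical_def)

end

section \<open>Immersions into a hyperplane\<close>

lemma direction_translate:
  assumes "affine L" "a \<in> L"
  shows "direction L = (\<lambda>x. x - a) ` L"
proof (intro equalityI subsetI)
  fix z assume "z \<in> direction L"
  then obtain x y where z: "z = x - y" "x \<in> L" "y \<in> L" by (auto simp: direction_def)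
  have "a + 1 *\<^sub>R (x - y) \<in> L" by (rule mem_affine_3_minus[OF assms z(2,3)])
  then show "z \<in> (\<lambda>x. x - a) ` L" unfolding z(1) by (rule rev_image_eqI) simp
qed (use assms(2) in \<open>auto simp: direction_def\<close>)

lemma subspace_direction: "affine L \<Longrightarrow> a \<in> L \<Longrightarrow> subspace (direction L)"
  unfolding direction_translate[of L a] by (rule affine_diffs_subspace_subtract)

lemma dim_direction:
  fixes L :: "'v::euclidean_space set"
  assumes "affine L" "a \<in> L" "aff_dim L = int d"
  shows "dim (direction L) = d"
proof -
  have "aff_dim L = int (dim ((+) (- a) ` L))" by (rule aff_dim_eq_dim) (rule hull_inc[OF assms(2)])
  moreover have "(+) (- a) ` L = (\<lambda>x. x - a) ` L" by (rule image_cong) simp_all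
  ultimately show ?thesis using assms(3) direction_translate[OF assms(1,2)] by simp
qed

lemma direction_UNIV: "direction (UNIV :: 'v::real_vector set) = UNIV"
proof -
  have "z \<in> direction UNIV" for z :: 'v
    unfolding direction_def by (rule CollectI, rule exI[of _ z], rule exI[of _ 0]) simp
  then show ?thesis by auto
qed

locale hyperplane_setup = gauss_setup n A \<theta> r UNIV \<omega> f N \<theta>N
  for n :: nat and A :: "'m::{t2_space, second_countable_topology} atlas"
    and \<theta> :: "'m \<Rightarrow> (('m \<Rightarrow> real) \<Rightarrow> real) list \<Rightarrow> real" and r :: nat
    and \<omega> :: "'v::euclidean_space list \<Rightarrow> real" and f :: "'m \<Rightarrow> 'v::euclidean_space"
    and N :: "'m \<Rightarrow> 'v::euclidean_space set" and \<theta>N :: "'m \<Rightarrow> 'v::euclidean_space list \<Rightarrow> real" +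
  fixes L :: "'v::euclidean_space set" and \<xi> :: "'v::euclidean_space"
  assumes r2: "r \<ge> 2" and L: "affine L" "aff_dim L = int (n + r - 1)" "range f \<subseteq> L"
    and \<xi>: "\<xi> \<notin> direction L" and dimV: "DIM('v::euclidean_space) = n + r"
begin

abbreviation L' :: "'v set" where "L' \<equiv> direction L"
abbreviation \<omega>L where "\<omega>L \<equiv> hyperplane_volume (n + r - 1) L' \<omega> \<xi>"

lemma L': "subspace L'" "dim L' = n + r - 1"
proof -
  have "f undefined \<in> L" using L(3) by auto
  then show "subspace L'" "dim L' = n + r - 1"
    by (rule subspace_direction[OF L(1)], rule dim_direction[OF L(1) _ L(2)])
qed

lemma ex_normal: "\<exists>l. l \<bullet> \<xi> = 1 \<and> (\<forall>x. x \<in> L' \<longleftrightarrow> l \<bullet> x = 0)"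
proof -
  have "dim L' = DIM('v) - 1" using L'(2) dimV by simp
  from dim_eq_hyperplane[THEN iffD1, OF this]
  obtain a where a: "a \<noteq> 0" "span L' = {x. a \<bullet> x = 0}" by blast
  have a2: "L' = {x. a \<bullet> x = 0}" using a(2) L'(1) by (simp add: span_eq_iff[THEN iffD2])
  then have "a \<bullet> \<xi> \<noteq> 0" using \<xi> by auto
  then show ?thesis by (intro exI[of _ "(1 / (a \<bullet> \<xi>)) *\<^sub>R a"]) (simp add: a2)
qed

text \<open>The normal vector of the hyperplane, scaled by \<xi>: \<open>l \<bullet> x\<close> is
  the coefficient of \<xi> in \<open>x\<close> modulo \<open>L'\<close>.\<close>

definition l :: 'v where "l = (SOME l. l \<bullet> \<xi> = 1 \<and> (\<forall>x. x \<in> L' \<longleftrightarrow> l \<bullet> x = 0))"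

lemma l: "l \<bullet> \<xi> = 1" "x \<in> L' \<longleftrightarrow> l \<bullet> x = 0"
  using someI_ex[OF ex_normal] unfolding l_def[symmetric] by auto

lemma deriv_along_L':
  fixes W :: "'m \<Rightarrow> 'v"
  assumes "v \<in> T p" "smooth n A W" "\<And>q. l \<bullet> W q = c"
  shows "deriv_along v W \<in> L'"
proof -
  have "deriv_along v W \<bullet> l = v (\<lambda>q. W q \<bullet> l)" by (rule deriv_along_inner[OF assms(1,2)])
  also have "(\<lambda>q. W q \<bullet> l) = (\<lambda>q. c)" using assms(3) by (simp add: inner_commute)
  also have "v (\<lambda>q. c) = 0" by (rule tangent_const[OF assms(1)])
  finally show ?thesis unfolding l(2) by (simp add: inner_commute)
qed

lemma f_const: "l \<bullet> f q = l \<bullet> f q'"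
proof -
  have "f q - f q' \<in> L'" unfolding direction_def using L(3) by blast
  then show ?thesis unfolding l(2) by (simp add: inner_diff_right)
qed

lemma df_L': "v \<in> T p \<Longrightarrow> deriv_along v f \<in> L'"
  using deriv_along_L'[OF _ f f_const] by blast

lemma UNIV_dir: "direction (UNIV :: 'v set) = UNIV"
  by (rule direction_UNIV)

section \<open>The transversal bundle inside the hyperplane and its volume element\<close>

definition NL :: "'m \<Rightarrow> 'v set" where "NL p = N p \<inter> L'"

lemma subspace_NL: "subspace (NL p)"
  unfolding NL_def by (rule subspace_inter[OF N(1) L'(1)])

text \<open>The image of \<open>df\<close> lies in \<open>L'\<close>, so the component of \<xi> in
  \<open>N p\<close> has the same value under \<open>l\<close> as \<xi> itself.\<close>

lemma ex_height_one: "\<exists>u\<in>N p. l \<bullet> u = 1"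
proof -
  have "\<xi> \<in> direction (UNIV :: 'v set)" by (simp add: UNIV_dir)
  then obtain v u where vu: "\<xi> = deriv_along v f + u" "v \<in> T p" "u \<in> N p"
    unfolding direction_eq[of p] by auto
  have "l \<bullet> deriv_along v f = 0" using df_L'[OF vu(2)] unfolding l(2) .
  then have "l \<bullet> u = 1" using l(1) unfolding vu(1) by (simp add: inner_add_right)
  then show ?thesis using vu(3) by (rule bexI)
qed

lemma NL_extend:
  assumes \<xi>s: "basis_of (NL p) \<xi>s" and u: "u \<in> N p" "l \<bullet> u = 1"
  shows "basis_of (N p) (\<xi>s @ [u])"
proof -
  note b = basis_ofD[OF \<xi>s]
  have uS: "u \<notin> span (set \<xi>s)" unfolding b(3) using u(2) by (auto simp: NL_def l(2))
  have "u \<notin> set \<xi>s" using uS span_base by blast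
  moreover have "independent (insert u (set \<xi>s))" by (rule independent_insertI[OF uS b(2)])
  moreover have "span (insert u (set \<xi>s)) = N p"
  proof (intro equalityI subsetI)
    fix x assume "x \<in> span (insert u (set \<xi>s))"
    moreover have "span (insert u (set \<xi>s)) \<subseteq> N p"
      by (rule span_minimal[OF _ N(1)]) (use b(4) u(1) in \<open>auto simp: NL_def\<close>)
    ultimately show "x \<in> N p" by auto
  next
    fix x assume x: "x \<in> N p"
    have "x - (l \<bullet> x) *\<^sub>R u \<in> NL p"
      unfolding NL_def l(2) using x u N(1)
      by (auto simp: inner_diff_right intro: subspace_diff subspace_scale)
        (simp add: l(2) inner_diff_right)
    then have "x - (l \<bullet> x) *\<^sub>R u \<in> span (set \<xi>s)" unfolding b(3) .
    then show "x \<in> span (insert u (set \<xi>s))" by (rule span_breakdown_eq[THEN iffD2, OF exI])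
  qed
  ultimately show ?thesis using b(1) by (simp add: basis_of_def)
qed

lemma dim_NL: "dim (NL p) = r - 1"
proof -
  obtain \<xi>s where \<xi>s: "basis_of (NL p) \<xi>s" by (rule orthonormal_list[OF subspace_NL])
  obtain u where u: "u \<in> N p" "l \<bullet> u = 1" using ex_height_one by blast
  show ?thesis
    using basis_ofD(5)[OF NL_extend[OF \<xi>s u]] basis_ofD(5)[OF \<xi>s] N(2)[of p] by simp
qed

text \<open>Built from \<open>\<theta>N\<close> in the way \<omega>L is built from \<omega>, with a
  vector of \<open>N p\<close> in place of \<xi>. Its choice does not matter, since two candidates
  differ by an element of \<open>NL p\<close>.\<close>

definition \<theta>NL :: "'m \<Rightarrow> 'v list \<Rightarrow> real"
  where "\<theta>NL p xs = (if length xs = r - 1 \<and> set xs \<subseteq> NL p then \<theta>N p (xs @ [SOME u. u \<in> N p \<and> l \<bullet> u = 1]) else 0)"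

lemma restrict_append_form:
  assumes \<beta>: "\<beta> \<in> forms (Suc j) V" and v: "v \<in> V" and W: "W \<subseteq> V" "subspace W"
  shows "(\<lambda>xs. if length xs = j \<and> set xs \<subseteq> W then \<beta> (xs @ [v]) else 0) \<in> forms j W"
proof -
  have "(\<lambda>xs. \<beta> ([] @ xs @ [v])) \<in> forms j V" by (rule forms_contract) (use \<beta> v in auto)
  from forms_restrict[OF this W] have F: "(\<lambda>xs. if set xs \<subseteq> W then \<beta> ([] @ xs @ [v]) else 0) \<in> forms j W" .
  moreover have "(\<lambda>xs. if set xs \<subseteq> W then \<beta> ([] @ xs @ [v]) else 0) = (\<lambda>xs. if length xs = j \<and> set xs \<subseteq> W then \<beta> (xs @ [v]) else 0)"
  proof
    fix xs show "(if set xs \<subseteq> W then \<beta> ([] @ xs @ [v]) else 0) = (if length xs = j \<and> set xs \<subseteq> W then \<beta> (xs @ [v]) else 0)"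
      using forms_zero[OF F, of xs] by auto
  qed
  ultimately show ?thesis by simp
qed

text \<open>A form of degree above \<open>dim W\<close> vanishes on \<open>W\<close>, so only the class of the last argument modulo
  \<open>W\<close> matters.\<close>

lemma last_modulo:
  assumes V: "subspace V" and \<beta>: "\<beta> \<in> forms (Suc (dim W)) V" and W: "W \<subseteq> V" "subspace (W :: 'v set)"
    and xs: "length xs = dim W" "set xs \<subseteq> W" and v: "v \<in> V" "u \<in> V" "v - u \<in> W"
  shows "\<beta> (xs @ [v]) = \<beta> (xs @ [u])"
proof -
  obtain e where e: "basis_of W e" by (rule orthonormal_list[OF W(2)])
  have "\<beta> (xs @ (1 *\<^sub>R v + (- 1) *\<^sub>R u) # []) = 1 * \<beta> (xs @ v # []) + (- 1) * \<beta> (xs @ u # [])"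
    by (rule multilinear_onD[OF forms_linear[OF \<beta>]]) (use xs W v in auto)
  moreover have "(\<lambda>xs. if set xs \<subseteq> W then \<beta> xs else 0) = (\<lambda>_. 0)"
    by (rule forms_above_dim[OF e forms_restrict[OF \<beta> W]]) (use basis_ofD(5)[OF e] in simp)
  then have "\<beta> (xs @ [v - u]) = 0" using fun_cong[of _ _ "xs @ [v - u]"] xs v by (metis (mono_tags, lifting) empty_subsetI insert_subset le_sup_iff list.set(1) list.simps(15) set_append)
  ultimately show ?thesis by simp
qed

lemma \<theta>NL_eq:
  assumes u: "u \<in> N p" "l \<bullet> u = 1" and xs: "length xs = r - 1" "set xs \<subseteq> NL p"
  shows "\<theta>NL p xs = \<theta>N p (xs @ [u])"
proof -
  have "\<exists>u. u \<in> N p \<and> l \<bullet> u = 1" using u by blast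
  from someI_ex[OF this] have s: "(SOME u. u \<in> N p \<and> l \<bullet> u = 1) \<in> N p" "l \<bullet> (SOME u. u \<in> N p \<and> l \<bullet> u = 1) = 1" by simp_all
  have "\<theta>N p (xs @ [SOME u. u \<in> N p \<and> l \<bullet> u = 1]) = \<theta>N p (xs @ [u])"
  proof (rule last_modulo[OF N(1) _ _ subspace_NL[of p]])
    show "\<theta>N p \<in> forms (Suc (dim (NL p))) (N p)" using N(3)[of p] r2 by (simp add: volume_form_def dim_NL)
    show "(SOME u. u \<in> N p \<and> l \<bullet> u = 1) - u \<in> NL p"
      unfolding NL_def using s u N(1)[of p] by (auto simp: l(2) inner_diff_right intro: subspace_diff)
    show "length xs = dim (NL p)" using xs(1) by (simp add: dim_NL)
    show "NL p \<subseteq> N p" by (auto simp: NL_def)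
  qed (use xs s u in auto)
  then show ?thesis using xs by (simp add: \<theta>NL_def)
qed

lemma \<theta>NL_nonzero:
  assumes "basis_of (NL p) \<xi>s"
  shows "\<theta>NL p \<xi>s \<noteq> 0"
proof -
  obtain u where u: "u \<in> N p" "l \<bullet> u = 1" using ex_height_one by blast
  have "\<theta>NL p \<xi>s = \<theta>N p (\<xi>s @ [u])"
    by (rule \<theta>NL_eq[OF u]) (use basis_ofD(4,5)[OF assms] dim_NL in auto)
  then show ?thesis using volume_form_basis(2)[OF N(3) NL_extend[OF assms u]] by simp
qed

lemma volume_form_\<theta>NL: "volume_form (r - 1) (NL p) (\<theta>NL p)"
  unfolding volume_form_def
proof (intro conjI)
  obtain u where u: "u \<in> N p \<and> l \<bullet> u = 1" using ex_height_one by blast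
  from someI[of "\<lambda>u. u \<in> N p \<and> l \<bullet> u = 1", OF u] have s: "(SOME u. u \<in> N p \<and> l \<bullet> u = 1) \<in> N p" by simp
  show "\<theta>NL p \<in> forms (r - 1) (NL p)"
    unfolding \<theta>NL_def[abs_def]
    by (rule restrict_append_form[OF _ s _ subspace_NL]) (use N(3)[of p] r2 in \<open>auto simp: volume_form_def NL_def\<close>)
  obtain \<xi>s where \<xi>s: "basis_of (NL p) \<xi>s" by (rule orthonormal_list[OF subspace_NL])
  from \<theta>NL_nonzero[OF this] show "\<theta>NL p \<noteq> 0" by auto
qed (rule dim_NL)

lemma volume_form_\<omega>L: "volume_form (n + r - 1) L' \<omega>L"
  unfolding volume_form_def
proof (intro conjI)
  have \<omega>': "\<omega> \<in> forms (Suc (n + r - 1)) (UNIV :: 'v set)" using \<omega>_forms n1 by (simp add: UNIV_dir)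
  show "\<omega>L \<in> forms (n + r - 1) L'"
    unfolding hyperplane_volume_def by (rule restrict_append_form[OF \<omega>' _ _ L'(1)]) auto
  obtain e where e: "basis_of L' e" by (rule orthonormal_list[OF L'(1)])
  have "\<xi> \<notin> span (set e)" using \<xi> basis_ofD(3)[OF e] by simp
  then have i: "independent (insert \<xi> (set e))" "\<xi> \<notin> set e"
    using independent_insertI[OF _ basis_ofD(2)[OF e]] span_base[of \<xi> "set e"] by auto
  have b: "basis_of UNIV (e @ [\<xi>])"
  proof -
    obtain e' where e': "basis_of (UNIV :: 'v set) e'" by (rule orthonormal_list[OF subspace_UNIV])
    have le: "length e = n + r - 1" using basis_ofD(5)[OF e] L'(2) by simp
    have "span (insert \<xi> (set e)) = UNIV"
      by (rule basis_of_span_independent[OF e' subset_UNIV i(1)])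
         (use i(2) le n1 basis_ofD(5)[OF e'] dimV distinct_card[OF basis_ofD(1)[OF e]] in simp_all)
    then show ?thesis using i basis_ofD(1)[OF e] by (simp add: basis_of_def)
  qed
  have "\<omega> (e @ [\<xi>]) \<noteq> 0" by (rule volume_form_basis(2)[of m UNIV]) (use \<omega> b in \<open>simp_all add: UNIV_dir\<close>)
  then have "\<omega>L e \<noteq> 0" using basis_ofD(4,5)[OF e] L'(2) by (simp add: hyperplane_volume_def)
  then show "\<omega>L \<noteq> 0" by auto
qed (rule L'(2))

lemma local_frame:
  "\<exists>O' \<xi>s. open O' \<and> p \<in> O' \<and> length \<xi>s = r \<and> (\<forall>x\<in>set \<xi>s. smooth_on n A O' x) \<and>
    (\<forall>q\<in>O'. basis_of (N q) (map (\<lambda>x. x q) \<xi>s))"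
  using tb by (simp add: transversal_bundle_def)

text \<open>Some vector of a local frame of \<open>N\<close> leaves \<open>L'\<close> at
  \<open>p\<close>, and by continuity near \<open>p\<close>. Divided by its value under
  \<open>l\<close> it becomes \<open>u\<close>; subtracting multiples of \<open>u\<close> moves the
  other frame vectors into \<open>L'\<close>.\<close>

lemma local_height_one:
  "\<exists>O' u \<xi>s. open O' \<and> p \<in> O' \<and> smooth_on n A O' u \<and> (\<forall>q\<in>O'. u q \<in> N q \<and> l \<bullet> u q = 1) \<and>
    length \<xi>s = r - 1 \<and> (\<forall>x\<in>set \<xi>s. smooth_on n A O' x) \<and>
    (\<forall>q\<in>O'. basis_of (NL q) (map (\<lambda>x. x q) \<xi>s))"
proof -
  obtain P xs where P0: "open P \<and> p \<in> P \<and> length xs = r \<and> (\<forall>x\<in>set xs. smooth_on n A P x) \<and>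
    (\<forall>q\<in>P. basis_of (N q) (map (\<lambda>x. x q) xs))" using local_frame[of p] by (elim exE)
  then have P: "open P" "p \<in> P" "length xs = r" "\<And>x. x \<in> set xs \<Longrightarrow> smooth_on n A P x"
    "\<And>q. q \<in> P \<Longrightarrow> basis_of (N q) (map (\<lambda>x. x q) xs)" by simp_all
  have "\<exists>j<r. l \<bullet> (xs ! j) p \<noteq> 0"
  proof (rule ccontr)
    assume "\<not> ?thesis"
    then have "set (map (\<lambda>x. x p) xs) \<subseteq> L'" using P(3) by (auto simp: l(2) in_set_conv_nth)
    then have "N p \<subseteq> L'" using span_minimal[OF _ L'(1)] basis_ofD(3)[OF P(5)[OF P(2)]] by blast
    then show False using ex_height_one[of p] l(2) by auto
  qed
  then obtain j where j: "j < r" "l \<bullet> (xs ! j) p \<noteq> 0" by auto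
  have sj: "smooth_on n A P (xs ! j)" using P(3,4) j by simp
  define h where "h q = (xs ! j) q \<bullet> l" for q
  have h: "smooth_on n A P h" unfolding h_def[abs_def] by (rule smooth_on_inner[OF P(1) sj])
  define Q where "Q = {q\<in>P. h q \<noteq> 0}"
  have Q: "open Q"
  proof -
    have "Q = P \<inter> h -` (- {0})" by (auto simp: Q_def)
    moreover have "open (P \<inter> h -` (- {0}))"
      by (rule continuous_open_preimage[OF smooth_on_continuous[OF h P(1)] P(1)]) (rule open_Compl[OF closed_singleton])
    ultimately show ?thesis by simp
  qed
  have pQ: "p \<in> Q" using P(2) j by (simp add: Q_def h_def inner_commute)
  have QP: "Q \<subseteq> P" by (auto simp: Q_def)
  define u where "u q = inverse (h q) *\<^sub>R (xs ! j) q" for q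
  define proj where "proj x q = x q + (- (x q \<bullet> l)) *\<^sub>R u q" for x :: "'m \<Rightarrow> 'v" and q
  have hinv: "smooth_on n A Q (\<lambda>q. inverse (h q))"
    by (rule smooth_on_inverse[OF Q smooth_on_subset[OF h QP]]) (simp add: Q_def)
  have u: "smooth_on n A Q u"
    unfolding u_def[abs_def] by (rule smooth_on_scaleR[OF Q hinv smooth_on_subset[OF sj QP]])
  have mem: "x q \<in> N q" if "x \<in> set xs" "q \<in> P" for x q
    using basis_ofD(4)[OF P(5)[OF that(2)]] that(1) by auto
  have jm: "xs ! j \<in> set xs" using P(3) j by simp
  have uN: "u q \<in> N q \<and> l \<bullet> u q = 1" if "q \<in> Q" for q
    using that mem[OF jm] N(1) by (auto simp: u_def Q_def h_def inner_commute intro: subspace_scale)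
  have proj: "smooth_on n A Q (proj x)" if "x \<in> set xs" for x
  proof -
    have x: "smooth_on n A Q x" by (rule smooth_on_subset[OF P(4)[OF that] QP])
    have "smooth_on n A Q (\<lambda>q. (-1) * (x q \<bullet> l))"
      by (rule smooth_on_mult[OF Q smooth_on_const[OF Q] smooth_on_inner[OF Q x]])
    then have "smooth_on n A Q (\<lambda>q. - (x q \<bullet> l))" by simp
    then show ?thesis unfolding proj_def[abs_def]
      by (rule smooth_on_add[OF Q x smooth_on_scaleR[OF Q _ u]])
  qed
  have projN: "proj x q \<in> NL q" if "x \<in> set xs" "q \<in> Q" for x q
  proof -
    have "l \<bullet> proj x q = 0" using uN[OF that(2)] by (simp add: proj_def inner_diff_right inner_commute[of l "x q"])
    moreover have "proj x q \<in> N q"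
      unfolding proj_def by (intro subspace_add subspace_scale N(1)) (use mem[OF that(1)] uN[OF that(2)] that(2) QP in auto)
    ultimately show ?thesis by (simp add: NL_def l(2))
  qed
  define ys where "ys = map proj (omit j xs)"
  have ly: "length ys = r - 1" using length_omit[of j xs] P(3) j by (simp add: ys_def)
  have sub: "set (omit j xs) \<subseteq> set xs" by (rule set_omit_subset)
  show ?thesis
  proof (intro exI[of _ Q] exI[of _ u] exI[of _ ys] conjI Q pQ u ly ballI)
    show "u q \<in> N q" "l \<bullet> u q = 1" if "q \<in> Q" for q using uN[OF that] by simp_all
    show "smooth_on n A Q x" if "x \<in> set ys" for x using that proj sub by (auto simp: ys_def)
    fix q assume q: "q \<in> Q"
    let ?ys = "map (\<lambda>x. x q) ys"
    have ysN: "set ?ys \<subseteq> NL q" using projN[OF _ q] sub by (auto simp: ys_def)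
    have spans: "x q \<in> span (insert (u q) (set ?ys))" if "x \<in> set xs" for x
    proof (cases "x \<in> set (omit j xs)")
      case True
      then have "proj x q \<in> set ?ys" by (auto simp: ys_def)
      then have "proj x q + (x q \<bullet> l) *\<^sub>R u q \<in> span (insert (u q) (set ?ys))"
        by (intro span_add span_scale span_base) auto
      then show ?thesis by (simp add: proj_def)
    next
      case False
      then have "x = xs ! j" using that nth_in_omit[of j xs] j P(3) by (auto simp: in_set_conv_nth)
      then have "x q = h q *\<^sub>R u q" using q by (simp add: u_def Q_def)
      then show ?thesis using span_scale[OF span_base, of "u q"] by simp
    qed
    have "N q \<subseteq> span (insert (u q) (set ?ys))"
    proof -
      have "set (map (\<lambda>x. x q) xs) \<subseteq> span (insert (u q) (set ?ys))" using spans by auto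
      then have "span (set (map (\<lambda>x. x q) xs)) \<subseteq> span (insert (u q) (set ?ys))"
        by (rule span_minimal[OF _ subspace_span])
      then show ?thesis using basis_ofD(3)[OF P(5)] q QP by auto
    qed
    then have NLs: "NL q \<subseteq> span (set ?ys)"
    proof (intro subsetI)
      fix x assume x: "x \<in> NL q"
      then have "x \<in> span (insert (u q) (set ?ys))" using \<open>N q \<subseteq> _\<close> by (auto simp: NL_def)
      then obtain c where c: "x - c *\<^sub>R u q \<in> span (set ?ys)" unfolding span_breakdown_eq by (rule exE)
      have "span (set ?ys) \<subseteq> L'" by (rule span_minimal[OF _ L'(1)]) (use ysN in \<open>auto simp: NL_def\<close>)
      then have "l \<bullet> (x - c *\<^sub>R u q) = 0" using c l(2) by blast
      moreover have "l \<bullet> x = 0" using x by (simp add: NL_def l(2))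
      ultimately have "c = 0" using uN[OF q] by (simp add: inner_diff_right)
      then show "x \<in> span (set ?ys)" using c by simp
    qed
    have sp: "span (set ?ys) = NL q" using span_minimal[OF ysN subspace_NL] NLs by (rule antisym)
    \<comment> \<open>A spanning list of \<open>r - 1\<close> vectors in a space of dimension
      \<open>r - 1\<close> can neither repeat a vector nor be dependent.\<close>
    have "card (set ?ys) \<le> r - 1" using card_length[of ?ys] ly by simp
    moreover have "r - 1 \<le> card (set ?ys)"
      using dim_le_card[OF NLs] dim_NL[of q] by simp
    ultimately have c: "card (set ?ys) = r - 1" by simp
    then have "distinct ?ys" using ly by (simp add: card_distinct)
    moreover have "independent (set ?ys)"
      using card_eq_dim[OF ysN _ List.finite_set] c dim_NL[of q] NLs by simp
    ultimately show "basis_of (NL q) ?ys" using sp by (simp add: basis_of_def)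
  qed
qed

text \<open>If a vector of \<open>L'\<close> is split along the image of \<open>df\<close> and
  \<open>N p\<close>, the component in \<open>N p\<close> is a difference of two vectors of
  \<open>L'\<close>.\<close>

lemma transversal_NL: "transversal_bundle n A (r - 1) L f NL"
  unfolding transversal_bundle_def Let_def
proof (intro conjI allI)
  fix p
  show "subspace (NL p)" "dim (NL p) = r - 1" by (rule subspace_NL, rule dim_NL)
  have 0: "(\<lambda>v. deriv_along v f) ` T p \<inter> N p = {0}" using tb by (simp add: transversal_bundle_def Let_def)
  then show "(\<lambda>v. deriv_along v f) ` T p \<inter> NL p = {0}"
    using subspace_0[OF L'(1)] by (auto simp: NL_def)
  show "L' = {x + y |x y. x \<in> (\<lambda>v. deriv_along v f) ` T p \<and> y \<in> NL p}"
  proof (intro equalityI subsetI)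
    fix z assume z: "z \<in> L'"
    have "z \<in> direction (UNIV :: 'v set)" by (simp add: UNIV_dir)
    then obtain v y where vy: "z = deriv_along v f + y" "v \<in> T p" "y \<in> N p" unfolding direction_eq[of p] by auto
    have "y = z - deriv_along v f" using vy(1) by simp
    then have "y \<in> L'" using z df_L'[OF vy(2)] L'(1) by (simp add: subspace_diff)
    then show "z \<in> {x + y |x y. x \<in> (\<lambda>v. deriv_along v f) ` T p \<and> y \<in> NL p}"
      using vy by (auto simp: NL_def)
  next
    fix z assume "z \<in> {x + y |x y. x \<in> (\<lambda>v. deriv_along v f) ` T p \<and> y \<in> NL p}"
    then show "z \<in> L'" using df_L' L'(1) by (auto simp: NL_def intro!: subspace_add)
  qed
  show "\<exists>U \<xi>s. open U \<and> p \<in> U \<and> length \<xi>s = r - 1 \<and> (\<forall>\<xi>\<in>set \<xi>s. smooth_on n A U \<xi>) \<and>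
      (\<forall>q\<in>U. basis_of (NL q) (map (\<lambda>\<xi>. \<xi> q) \<xi>s))"
  proof -
    obtain O' u \<xi>s where "open O' \<and> p \<in> O' \<and> smooth_on n A O' u \<and> (\<forall>q\<in>O'. u q \<in> N q \<and> l \<bullet> u q = 1) \<and>
      length \<xi>s = r - 1 \<and> (\<forall>x\<in>set \<xi>s. smooth_on n A O' x) \<and>
      (\<forall>q\<in>O'. basis_of (NL q) (map (\<lambda>x. x q) \<xi>s))" using local_height_one[of p] by (elim exE)
    then show ?thesis by (intro exI[of _ O'] exI[of _ \<xi>s]) simp
  qed
qed

text \<open>The vector chosen in \<open>\<theta>NL\<close> need not depend smoothly on the point.
  Locally it is exchanged for the smooth field \<open>u\<close>, which leaves the values
  unchanged.\<close>

lemma volume_NL: "bundle_volume_element n A (r - 1) NL \<theta>NL"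
  unfolding bundle_volume_element_def
proof (intro conjI allI impI)
  show "volume_form (r - 1) (NL p) (\<theta>NL p)" for p by (rule volume_form_\<theta>NL)
  fix U :: "'m set" and \<xi>s
  assume *: "open U \<and> length \<xi>s = r - 1 \<and> (\<forall>\<xi>\<in>set \<xi>s. smooth_on n A U \<xi> \<and> (\<forall>q\<in>U. \<xi> q \<in> NL q))"
  show "smooth_on n A U (\<lambda>q. \<theta>NL q (map (\<lambda>\<xi>. \<xi> q) \<xi>s))"
  proof (rule smooth_on_local)
    show "open U" using * by simp
    fix p assume p: "p \<in> U"
    obtain O' u xs where "open O' \<and> p \<in> O' \<and> smooth_on n A O' u \<and> (\<forall>q\<in>O'. u q \<in> N q \<and> l \<bullet> u q = 1) \<and>
      length xs = r - 1 \<and> (\<forall>x\<in>set xs. smooth_on n A O' x) \<and>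
      (\<forall>q\<in>O'. basis_of (NL q) (map (\<lambda>x. x q) xs))" using local_height_one[of p] by (elim exE)
    then have O': "open O'" "p \<in> O'" "smooth_on n A O' u" "\<And>q. q \<in> O' \<Longrightarrow> u q \<in> N q \<and> l \<bullet> u q = 1"
      by simp_all
    let ?W = "U \<inter> O'"
    have W: "open ?W" using * O'(1) by auto
    have "smooth_on n A ?W (\<lambda>q. \<theta>N q (map (\<lambda>\<xi>. \<xi> q) (\<xi>s @ [u])))"
    proof -
      have "length (\<xi>s @ [u]) = r" using * r2 by simp
      moreover have "smooth_on n A ?W x \<and> (\<forall>q\<in>?W. x q \<in> N q)" if "x \<in> set (\<xi>s @ [u])" for x
      proof (cases "x = u")
        case True
        then show ?thesis using smooth_on_subset[OF O'(3), of ?W] O'(4) by auto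
      next
        case False
        then have "x \<in> set \<xi>s" using that by simp
        then show ?thesis using * smooth_on_subset[of U x ?W] by (auto simp: NL_def)
      qed
      ultimately show ?thesis using bv W unfolding bundle_volume_element_def by blast
    qed
    then have "smooth_on n A ?W (\<lambda>q. \<theta>NL q (map (\<lambda>\<xi>. \<xi> q) \<xi>s))"
    proof (rule smooth_on_cong[OF W])
      fix q assume q: "q \<in> ?W"
      show "\<theta>N q (map (\<lambda>\<xi>. \<xi> q) (\<xi>s @ [u])) = \<theta>NL q (map (\<lambda>\<xi>. \<xi> q) \<xi>s)"
      proof -
        have "set (map (\<lambda>\<xi>. \<xi> q) \<xi>s) \<subseteq> NL q" using * q by auto
        then show ?thesis
          using \<theta>NL_eq[of "u q" q "map (\<lambda>\<xi>. \<xi> q) \<xi>s"] O'(4)[of q] q * by simp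
      qed
    qed
    then show "\<exists>W. open W \<and> p \<in> W \<and> smooth_on n A W (\<lambda>q. \<theta>NL q (map (\<lambda>\<xi>. \<xi> q) \<xi>s))"
      using W p O'(2) by (intro exI[of _ ?W]) simp
  qed
qed

text \<open>In the formula for \<open>N\<close> the basis is completed by \<open>u\<close>. As
  \<open>u - \<xi>\<close> lies in \<open>L'\<close>, replacing \<open>u\<close> by \<xi> does not
  change the numerator, and the denominator is \<open>\<theta>NL\<close> by
  \<open>\<theta>NL_eq\<close>.\<close>

lemma induced_volume:
  assumes vs: "length vs = n" "set vs \<subseteq> T p" and \<xi>s: "basis_of (NL p) \<xi>s"
  shows "\<theta> p vs = \<omega>L (map (\<lambda>v. deriv_along v f) vs @ \<xi>s) / \<theta>NL p \<xi>s"
proof -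
  obtain u where u: "u \<in> N p" "l \<bullet> u = 1" using ex_height_one by blast
  have \<xi>: "length \<xi>s = r - 1" "set \<xi>s \<subseteq> NL p" using basis_ofD(4,5)[OF \<xi>s] dim_NL by simp_all
  let ?xs = "map (\<lambda>v. deriv_along v f) vs @ \<xi>s"
  have xs: "length ?xs = n + r - 1" "set ?xs \<subseteq> L'"
    using vs \<xi> r2 df_L' by (auto simp: NL_def)
  have "\<theta> p vs = \<omega> (map (\<lambda>v. deriv_along v f) vs @ \<xi>s @ [u]) / \<theta>N p (\<xi>s @ [u])"
    by (rule ind[OF vs NL_extend[OF \<xi>s u]])
  also have "\<omega> (map (\<lambda>v. deriv_along v f) vs @ \<xi>s @ [u]) = \<omega> (?xs @ [u])" by simp
  also have "\<omega> (?xs @ [u]) = \<omega> (?xs @ [\<xi>])"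
  proof (rule last_modulo[OF subspace_UNIV _ subset_UNIV L'(1)])
    show "\<omega> \<in> forms (Suc (dim L')) UNIV" using \<omega>_forms n1 by (simp add: UNIV_dir L'(2))
    show "u - \<xi> \<in> L'" by (simp add: l inner_diff_right u(2))
  qed (use xs L'(2) in auto)
  also have "\<dots> = \<omega>L ?xs" using xs by (simp add: hyperplane_volume_def)
  also have "\<theta>N p (\<xi>s @ [u]) = \<theta>NL p \<xi>s" by (rule \<theta>NL_eq[OF u \<xi>, symmetric])
  finally show ?thesis .
qed

text \<open>Both terms of the difference that defines the fundamental form are derivatives of maps
  on which \<open>l\<close> is constant, so the difference lies in \<open>L'\<close> as well as in
  \<open>N p\<close>.\<close>

lemma induces_NL:
  assumes D: "torsion_free_connection n A D"
    and \<alpha>: "\<And>X Y p. X \<in> vector_fields n A \<Longrightarrow> Y \<in> vector_fields n A \<Longrightarrow>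
       deriv_along (X p) (\<lambda>q. deriv_along (Y q) f) - deriv_along (D X Y p) f \<in> N p"
  shows "induces n A D \<theta> (r - 1) L \<omega>L f NL \<theta>NL"
  unfolding induces_def
proof (intro conjI transversal_NL volume_NL ballI allI impI)
  fix X Y p assume X: "X \<in> vector_fields n A" and Y: "Y \<in> vector_fields n A"
  have Xp: "X p \<in> T p" for p using X by (simp add: vector_fields_def)
  have Yp: "Y p \<in> T p" for p using Y by (simp add: vector_fields_def)
  have "D X Y \<in> vector_fields n A" using D X Y by (simp add: torsion_free_connection_def)
  then have Dp: "D X Y p \<in> T p" by (simp add: vector_fields_def)
  have "smooth n A (\<lambda>q. deriv_along (Y q) f)"
  proof (rule smooth_on_componentwise[OF open_UNIV])
    fix b :: 'v
    have "smooth n A (\<lambda>q. f q \<bullet> b)" by (rule smooth_on_inner[OF open_UNIV f])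
    then have "smooth n A (\<lambda>q. Y q (\<lambda>q. f q \<bullet> b))" using Y by (simp add: vector_fields_def)
    then show "smooth n A (\<lambda>q. deriv_along (Y q) f \<bullet> b)" by (simp add: deriv_along_inner[OF Yp f])
  qed
  then have "deriv_along (X p) (\<lambda>q. deriv_along (Y q) f) \<in> L'"
    by (rule deriv_along_L'[OF Xp]) (use df_L'[OF Yp] l(2) in simp)
  then have "deriv_along (X p) (\<lambda>q. deriv_along (Y q) f) - deriv_along (D X Y p) f \<in> L'"
    by (rule subspace_diff[OF L'(1) _ df_L'[OF Dp]])
  then show "deriv_along (X p) (\<lambda>q. deriv_along (Y q) f) - deriv_along (D X Y p) f \<in> NL p"
    using \<alpha>[OF X Y] by (simp add: NL_def)
next
  fix p vs \<xi>s
  assume "length vs = n \<and> set vs \<subseteq> T p \<and> basis_of (NL p) \<xi>s"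
  then show "\<theta> p vs = \<omega>L (map (\<lambda>v. deriv_along v f) vs @ \<xi>s) / \<theta>NL p \<xi>s" by (intro induced_volume) auto
qed

end

section \<open>Almost every height function has two critical points\<close>

lemma negligible_if_AE:
  assumes "AE x in lebesgue. x \<notin> S"
  shows "negligible S"
proof -
  have "AE x in lborel. x \<notin> S" using assms by (simp only: AE_completion_iff)
  then obtain P where P: "P \<in> null_sets lborel" "{x \<in> space lborel. \<not> x \<notin> S} \<subseteq> P"
    unfolding eventually_ae_filter by blast
  have "negligible P" using null_sets_completionI[OF P(1)] by (simp add: negligible_iff_null_sets)
  then show ?thesis by (rule negligible_subset) (use P(2) in auto)
qed

lemma AE_not_in_negligible: "negligible S \<Longrightarrow> AE x in lebesgue. x \<notin> S"
  by (rule AE_not_in) (simp add: negligible_iff_null_sets)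

text \<open>By Fubini's theorem, for almost every \<open>x\<close> the line over \<open>x\<close>
  meets a null set in a null set, which a full line is not.\<close>

lemma negligible_Times_UNIV:
  fixes S :: "'a::euclidean_space set"
  assumes "negligible (S \<times> (UNIV :: real set))"
  shows "negligible S"
proof (rule negligible_if_AE)
  have "S \<times> (UNIV :: real set) \<in> null_sets lebesgue" using assms by (simp only: negligible_iff_null_sets)
  \<comment> \<open>The product need not be a Borel set, so Fubini's theorem is applied to a Borel
    null set that contains it.\<close>
  then obtain P where P: "P \<in> null_sets lborel" "S \<times> (UNIV :: real set) \<subseteq> P"
    unfolding null_sets_completion_iff2 by blast
  have "AE x in (lborel \<Otimes>\<^sub>M lborel). x \<notin> P" unfolding lborel_prod by (rule AE_not_in[OF P(1)])
  then have "AE x in lborel. AE y in lborel. (x, y) \<notin> P" by (rule lborel_pair.AE_pair)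
  then have "AE x in lborel. x \<notin> S"
  proof (rule eventually_mono)
    fix x assume *: "AE y in lborel. (x, y) \<notin> P"
    show "x \<notin> S"
    proof
      assume "x \<in> S"
      then have "(x, y) \<in> P" for y using P(2) by auto
      then have "AE y in (lborel :: real measure). False" using * by simp
      then have "ae_filter (lborel :: real measure) = bot" by (simp only: eventually_False)
      then show False by (simp add: ae_filter_eq_bot_iff)
    qed
  qed
  then show "AE x in lebesgue. x \<notin> S" by (rule AE_completion)
qed

lemma negligible_linear_image:
  fixes Z :: "'a::euclidean_space \<Rightarrow> 'b::euclidean_space"
  assumes "linear Z" "DIM('a) \<le> DIM('b)" "negligible S"
  shows "negligible (Z ` S)"
  by (rule negligible_differentiable_image_negligible[OF assms(2,3) linear_imp_differentiable_on[OF assms(1)]])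

text \<open>By homogeneity of \<open>C\<close>, its values on the unit ball determine it.\<close>

lemma integral_eq_iff_negligible:
  fixes C g :: "'a::euclidean_space \<Rightarrow> ennreal"
  assumes g: "g \<in> borel_measurable lebesgue"
    and gC: "AE z in lebesgue. g z = (if 0 < norm z \<and> norm z \<le> 1 then C z else 0)"
    and C2: "\<And>z. 2 \<le> C z" and Cs: "\<And>c z. c \<noteq> 0 \<Longrightarrow> C (c *\<^sub>R z) = C z"
  shows "(\<integral>\<^sup>+z. g z \<partial>lebesgue) = ennreal (2 * unit_ball_vol (real DIM('a))) \<longleftrightarrow> negligible {z. C z \<noteq> 2}"
proof -
  \<comment> \<open>The integrand for the smallest admissible count. Since \<open>h \<le> g\<close>
    almost everywhere and \<open>h\<close> has a finite integral, equal integrals force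
    \<open>g = h\<close> almost everywhere.\<close>
  define h :: "'a \<Rightarrow> ennreal" where "h z = 2 * indicator (cball 0 1) z" for z
  have "cball (0 :: 'a) 1 \<in> sets lebesgue" by (rule sets_completionI_sets) simp
  then have hm: "h \<in> borel_measurable lebesgue"
    unfolding h_def[abs_def] by (intro borel_measurable_times_ennreal borel_measurable_const borel_measurable_indicator)
  have h: "(\<integral>\<^sup>+z. h z \<partial>lebesgue) = ennreal (2 * unit_ball_vol (real DIM('a)))"
  proof -
    have "(\<integral>\<^sup>+z. h z \<partial>lebesgue) = 2 * emeasure lborel (cball (0 :: 'a) 1)"
      unfolding h_def nn_integral_completion by (rule nn_integral_cmult_indicator) simp
    also have "\<dots> = ennreal 2 * ennreal (unit_ball_vol (real DIM('a)))"
      using emeasure_cball[of 1 "0 :: 'a"] by simp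
    also have "\<dots> = ennreal (2 * unit_ball_vol (real DIM('a)))"
      by (rule ennreal_mult'[symmetric]) simp
    finally show ?thesis .
  qed
  have n0: "AE z in lebesgue. (z :: 'a) \<noteq> 0" by (rule AE_completion[OF AE_lborel_singleton])
  show ?thesis
  proof
    assume I: "(\<integral>\<^sup>+z. g z \<partial>lebesgue) = ennreal (2 * unit_ball_vol (real DIM('a)))"
    have le: "AE z in lebesgue. h z \<le> g z"
      using gC n0 by eventually_elim (use C2 in \<open>auto simp: h_def indicator_def\<close>)
    have "(\<integral>\<^sup>+z. g z - h z \<partial>lebesgue) = (\<integral>\<^sup>+z. g z \<partial>lebesgue) - (\<integral>\<^sup>+z. h z \<partial>lebesgue)"
      by (rule nn_integral_diff[OF g hm _ le]) (simp add: h)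
    then have "(\<integral>\<^sup>+z. g z - h z \<partial>lebesgue) = 0" unfolding I h by simp
    then have "AE z in lebesgue. g z - h z = 0"
    proof -
      note [measurable] = g hm
      have "(\<lambda>z. g z - h z) \<in> borel_measurable lebesgue" by measurable
      from nn_integral_0_iff_AE[OF this] show ?thesis using \<open>(\<integral>\<^sup>+z. g z - h z \<partial>lebesgue) = 0\<close> by simp
    qed
    then have ae: "AE z in lebesgue. z \<notin> {z \<in> cball 0 1. C z \<noteq> 2}"
      using gC n0 le
    proof eventually_elim
      case (elim z)
      have "g z \<le> h z" by (rule ennreal_minus_eq_0[OF elim(1)])
      then have "g z = h z" using elim(4) by simp
      then show ?case using elim(2,3) by (auto simp: h_def indicator_def)
    qed
    let ?B = "{z \<in> cball 0 1. C z \<noteq> 2}"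
    have "negligible (\<Union>i. (\<lambda>z. real (Suc i) *\<^sub>R z) ` ?B)"
    proof (rule negligible_countable_Union)
      show "countable (range (\<lambda>i. (\<lambda>z. real (Suc i) *\<^sub>R z) ` ?B))" by simp
      fix X assume "X \<in> range (\<lambda>i. (\<lambda>z. real (Suc i) *\<^sub>R z) ` ?B)"
      then obtain i where X: "X = (\<lambda>z. real (Suc i) *\<^sub>R z) ` ?B" by auto
      show "negligible X" unfolding X
        by (rule negligible_linear_image[OF _ _ negligible_if_AE[OF ae]]) (auto intro: linear_scaleR)
    qed
    then show "negligible {z. C z \<noteq> 2}"
    proof (rule negligible_subset, intro subsetI)
      fix z assume z: "z \<in> {z. C z \<noteq> 2}"
      obtain i :: nat where i: "norm z \<le> real i" using real_arch_simple by blast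
      define y where "y = inverse (real (Suc i)) *\<^sub>R z"
      have zy: "z = real (Suc i) *\<^sub>R y" by (simp add: y_def)
      have "norm y \<le> 1" using i by (simp add: y_def field_simps)
      moreover have "C y \<noteq> 2" using z Cs[of "real (Suc i)" y] unfolding zy by simp
      ultimately have "y \<in> ?B" by simp
      then show "z \<in> (\<Union>i. (\<lambda>z. real (Suc i) *\<^sub>R z) ` ?B)" unfolding zy by blast
    qed
  next
    assume neg: "negligible {z. C z \<noteq> 2}"
    have "AE z in lebesgue. g z = h z"
      using gC n0 AE_not_in_negligible[OF neg] by eventually_elim (auto simp: h_def indicator_def)
    then have "(\<integral>\<^sup>+z. g z \<partial>lebesgue) = (\<integral>\<^sup>+z. h z \<partial>lebesgue)" by (rule nn_integral_cong_AE)
    then show "(\<integral>\<^sup>+z. g z \<partial>lebesgue) = ennreal (2 * unit_ball_vol (real DIM('a)))" unfolding h .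
  qed
qed

lemma ennreal_mult_divide_eq_2_iff:
  assumes "a > 0" "u > 0"
  shows "ennreal a * I / ennreal (a * u) = 2 \<longleftrightarrow> I = ennreal (2 * u)"
proof (cases I)
  case (real i)
  have "ennreal a * ennreal i / ennreal (a * u) = ennreal (i / u)"
    using assms real by (simp add: ennreal_mult'[symmetric] divide_ennreal)
  moreover have "ennreal (i / u) = 2 \<longleftrightarrow> i / u = 2"
    using assms real ennreal_inj[of "i / u" 2] by simp
  moreover have "ennreal i = ennreal (2 * u) \<longleftrightarrow> i = 2 * u"
    using assms real by (intro ennreal_inj) auto
  moreover have "i / u = 2 \<longleftrightarrow> i = 2 * u" using assms by (simp add: field_simps)
  ultimately show ?thesis using real by simp
next
  case top
  have p: "0 < inverse (a * u)" "0 < a * u" using assms by simp_all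
  have "inverse (ennreal (a * u)) \<noteq> 0"
    unfolding inverse_ennreal[OF p(2)] using p(1) by (metis ennreal_eq_0_iff not_less)
  moreover have "ennreal a \<noteq> 0" using assms by (simp add: ennreal_eq_0_iff)
  ultimately have "ennreal a * I / ennreal (a * u) = top_class.top"
    using top by (simp add: divide_ennreal_def ennreal_mult_top ennreal_top_mult)
  then show ?thesis using top by simp
qed

context ellipsoid_setup
begin

text \<open>The factor \<open>m\<close> from the radial integral cancels the one in
  \<open>sphere_volume\<close>, so the value 2 means that the number of critical points has mean 2
  over the unit ball. The substitution \<open>Z\<close> depends on \<omega> and \<zeta>, but only
  its linearity, injectivity and range are handed on.\<close>

lemma total_absolute_curvature_eq_2_iff:
  fixes \<iota> :: "nat \<Rightarrow> 'e::{finite,wellorder}"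
  assumes \<iota>: "bij_betw \<iota> {..<m} UNIV"
  shows "\<exists>Z :: real ^ 'e::_ \<Rightarrow> 'v. linear Z \<and> inj Z \<and> range Z = V' \<and>
    (total_absolute_curvature n A \<theta> k V f N \<zeta> S = 2 \<longleftrightarrow>
     negligible {z. emeasure (count_space UNIV) (critical (Z z)) \<noteq> 2})"
proof -
  obtain Z :: "real ^ 'e::_ \<Rightarrow> 'v" where Z: "linear Z \<and> inj Z \<and> range Z = V' \<and>
    (\<exists>g\<in>borel_measurable lebesgue. (AE z in lebesgue. g z = (if 0 < norm z \<and> norm z \<le> 1
       then emeasure (count_space UNIV) (critical (Z z)) else 0)) \<and>
     total_density n A (k - 1) V' d B \<zeta> gauss = ennreal (real m) * (\<integral>\<^sup>+z. g z \<partial>lebesgue))"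
    using total_density_critical[OF \<iota>] by (rule exE)
  then obtain g where g: "g \<in> borel_measurable lebesgue" "AE z in lebesgue. g z = (if 0 < norm z \<and> norm z \<le> 1
       then emeasure (count_space UNIV) (critical (Z z)) else 0)"
     "total_density n A (k - 1) V' d B \<zeta> gauss = ennreal (real m) * (\<integral>\<^sup>+z. g z \<partial>lebesgue)"
    by (elim conjE bexE)
  have lin: "linear Z" using Z by simp
  have dimE: "DIM(real ^ 'e::_) = m" using bij_betw_same_card[OF \<iota>] by simp
  have "(\<integral>\<^sup>+z. g z \<partial>lebesgue) = ennreal (2 * unit_ball_vol (real DIM(real ^ 'e::_))) \<longleftrightarrow>
      negligible {z. emeasure (count_space UNIV) (critical (Z z)) \<noteq> 2}"
    by (rule integral_eq_iff_negligible[OF g(1,2) critical_ge_2])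
       (simp add: linear_scale[OF lin] critical_scale)
  moreover have "total_absolute_curvature n A \<theta> k V f N \<zeta> S = 2 \<longleftrightarrow>
      (\<integral>\<^sup>+z. g z \<partial>lebesgue) = ennreal (2 * unit_ball_vol (real m))"
    unfolding total_absolute_curvature_def g(3) sphere_volume_def
    by (rule ennreal_mult_divide_eq_2_iff) (use n1 in simp_all)
  ultimately show ?thesis using Z unfolding dimE by blast
qed

end

lemma gauss_setupI:
  assumes "smooth_manifold n A" "n \<ge> 1" "k \<ge> 1" "compact (UNIV :: 'm::{t2_space, second_countable_topology} set)"
    and "equiaffine_structure n A D \<theta>"
    and "subspace (direction V)" "volume_form (n + k) (direction V) \<omega>" "immersion n A V f"
    and "induces n A D \<theta> k V \<omega> f N \<theta>N"
  shows "gauss_setup n A \<theta> k V \<omega> (f :: 'm \<Rightarrow> 'v::euclidean_space) N \<theta>N"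
proof
  show "\<And>p. volume_form n (tangent_space n A p) (\<theta> p)"
    using assms(5) by (simp add: equiaffine_structure_def volume_element_def)
  show "transversal_bundle n A k V f N" "bundle_volume_element n A k N \<theta>N"
    using assms(9) by (simp_all add: induces_def)
  show "\<And>p vs \<xi>s. length vs = n \<Longrightarrow> set vs \<subseteq> tangent_space n A p \<Longrightarrow> basis_of (N p) \<xi>s \<Longrightarrow>
       \<theta> p vs = \<omega> (map (\<lambda>v. deriv_along v f) vs @ \<xi>s) / \<theta>N p \<xi>s"
    using assms(9) unfolding induces_def by blast
qed (use assms in simp_all)

lemma ellipsoid_setupI:
  assumes "gauss_setup n A \<theta> k V \<omega> f N \<theta>N" "unit_ellipsoid (n + k) (direction V) \<omega> \<zeta> S"
  shows "ellipsoid_setup n A \<theta> k V \<omega> f N \<theta>N \<zeta> S"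
proof -
  have b: "basis_of (ext_power (direction V) (n + k - 1) (direction V)) \<zeta>"
    using assms(2) by (simp add: unit_ellipsoid_def)
  have "dim (ext_power (direction V) (n + k - 1) (direction V)) = n + k"
    using assms(2) unfolding unit_ellipsoid_def is_dual_volume_def volume_form_def by blast
  then have "length \<zeta> = n + k" using basis_ofD(5)[OF b] by simp
  moreover have "S = {\<Sum>i<n + k. a i *\<^sub>R \<zeta> ! i | a :: nat \<Rightarrow> real. (\<Sum>i<n + k. (a i)\<^sup>2) = 1}"
    using assms(2) unfolding unit_ellipsoid_def by (elim conjE)
  ultimately show ?thesis
    using assms(1) b unfolding ellipsoid_setup_def ellipsoid_setup_axioms_def by simp
qed

text \<open>As \<open>C\<close> is constant along \<open>l\<close>, the exceptional set in the whole
  space contains the sums \<open>Z' z + s *\<^sub>R l\<close> for all exceptional \<open>z\<close>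
  and all \<open>s\<close>. The linear map \<Phi> straightens these into a product with the line,
  and \<open>negligible_Times_UNIV\<close> removes the line.\<close>

lemma negligible_hyperplane:
  fixes C :: "'v::euclidean_space \<Rightarrow> 'c" and Z :: "'a::euclidean_space \<Rightarrow> 'v" and Z' :: "'b::euclidean_space \<Rightarrow> 'v"
  assumes Z: "linear Z" "inj Z" "range Z = UNIV" and Z': "linear Z'" "inj Z'" "range Z' = {x. l \<bullet> x = 0}"
    and l: "l \<noteq> 0" and C: "\<And>w c. C (w + c *\<^sub>R l) = C w" and neg: "negligible {z. C (Z z) \<noteq> a}"
  shows "negligible {z. C (Z' z) \<noteq> a}"
proof (rule negligible_Times_UNIV)
  have dimZ: "DIM('a) = DIM('v)" using dim_image_eq[OF Z(1), of UNIV] Z(2,3) by simp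
  have "DIM('b) = DIM('v) - 1" using dim_image_eq[OF Z'(1), of UNIV] Z'(2,3) dim_hyperplane[OF l] by simp
  then have dimZ': "DIM('v) \<le> DIM('b \<times> real)" by simp
  have "{w. C w \<noteq> a} = Z ` {z. C (Z z) \<noteq> a}"
  proof (intro equalityI subsetI)
    fix w assume w: "w \<in> {w. C w \<noteq> a}"
    obtain z where "w = Z z" using Z(3) by (metis UNIV_I imageE)
    then show "w \<in> Z ` {z. C (Z z) \<noteq> a}" using w by auto
  qed auto
  then have negC: "negligible {w. C w \<noteq> a}"
    using negligible_linear_image[OF Z(1) _ neg] dimZ by simp
  define \<Phi> where "\<Phi> p = Z' (fst p) + snd p *\<^sub>R l" for p :: "'b \<times> real"
  have lin: "linear \<Phi>"
    by (rule linearI) (simp_all add: \<Phi>_def linear_add[OF Z'(1)] linear_scale[OF Z'(1)] algebra_simps)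
  have "inj \<Phi>"
  proof (rule linear_injective_0[THEN iffD2, OF lin], intro allI impI)
    fix p assume p: "\<Phi> p = 0"
    have "l \<bullet> Z' (fst p) = 0" using Z'(3) by auto
    then have "snd p * (l \<bullet> l) = 0" using arg_cong[OF p, of "\<lambda>x. l \<bullet> x"] by (simp add: \<Phi>_def inner_add_right)
    then have s: "snd p = 0" using l by simp
    then have "Z' (fst p) = Z' 0" using p linear_0[OF Z'(1)] by (simp add: \<Phi>_def)
    then show "p = 0" using s injD[OF Z'(2)] by (simp add: prod_eq_iff)
  qed
  \<comment> \<open>Null sets are known to have null images under linear maps, so the product is
    reached as a subset of an image under a left inverse of \<Phi>.\<close>
  then obtain \<Psi> where \<Psi>: "linear \<Psi>" "\<Psi> \<circ> \<Phi> = id"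
    using linear_injective_left_inverse[OF lin] by blast
  have "negligible (\<Psi> ` {w. C w \<noteq> a})" by (rule negligible_linear_image[OF \<Psi>(1) dimZ' negC])
  then show "negligible ({z. C (Z' z) \<noteq> a} \<times> (UNIV :: real set))"
  proof (rule negligible_subset, intro subsetI)
    fix p :: "'b \<times> real" assume p: "p \<in> {z. C (Z' z) \<noteq> a} \<times> UNIV"
    then have "C (\<Phi> p) \<noteq> a" using C by (auto simp: \<Phi>_def)
    moreover have "p = \<Psi> (\<Phi> p)" using fun_cong[OF \<Psi>(2), of p] by simp
    ultimately show "p \<in> \<Psi> ` {w. C w \<noteq> a}" by blast
  qed
qed

text \<open>The coordinates of \<open>\<real>\<^sup>m\<close> and \<open>\<real>\<^sup>m\<^sup>-\<^sup>1\<close>, where \<open>m = CARD('d)\<close>, are indexed by the types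
  \<open>'d option below\<close> and \<open>'d below\<close>.\<close>

typedef 'a below = "{..<max 1 (CARD('a::finite) - 1)}"
  by (rule exI[of _ 0]) simp

instantiation below :: (finite) linorder
begin

definition less_eq_below :: "'a below \<Rightarrow> 'a below \<Rightarrow> bool"
  where "less_eq_below x y \<longleftrightarrow> Rep_below x \<le> Rep_below y"

definition less_below :: "'a below \<Rightarrow> 'a below \<Rightarrow> bool"
  where "less_below x y \<longleftrightarrow> Rep_below x < Rep_below y"

instance
  by standard (auto simp: less_eq_below_def less_below_def Rep_below_inject)

end

lemma bij_betw_Abs_below: "bij_betw Abs_below {..<max 1 (CARD('a::finite) - 1)} (UNIV :: 'a below set)"
  unfolding bij_betw_def
  using type_definition.Abs_image[OF type_definition_below[where 'a = 'a]]
  by (auto intro!: inj_onI simp: Abs_below_inject)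

instance below :: (finite) finite
proof
  show "finite (UNIV :: 'a below set)" using bij_betw_finite[OF bij_betw_Abs_below[where 'a = 'a]] by simp
qed

instance below :: (finite) wellorder
proof
  fix P :: "'a below \<Rightarrow> bool" and a
  assume *: "\<And>x. (\<And>y. y < x \<Longrightarrow> P y) \<Longrightarrow> P x"
  show "P a"
  proof (induction a rule: measure_induct_rule[where f = Rep_below])
    case (less x)
    show ?case by (rule *) (rule less, simp add: less_below_def)
  qed
qed

theorem proposition3p3:
  fixes n r :: nat
    and A :: "'m::{t2_space, second_countable_topology} atlas"
    and D :: "'m vfield \<Rightarrow> 'm vfield \<Rightarrow> 'm vfield"
    and \<theta> :: "'m \<Rightarrow> (('m \<Rightarrow> real) \<Rightarrow> real) list \<Rightarrow> real"
    and f :: "'m \<Rightarrow> real ^ 'd"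
    and \<omega> \<omega>L :: "(real ^ 'd) list \<Rightarrow> real"
    and \<zeta> :: "(((real ^ 'd) list \<Rightarrow> real) \<Rightarrow> real) list"
    and S :: "(((real ^ 'd) list \<Rightarrow> real) \<Rightarrow> real) set"
    and N :: "'m \<Rightarrow> (real ^ 'd) set"
    and \<theta>N :: "'m \<Rightarrow> (real ^ 'd) list \<Rightarrow> real"
    and L L' :: "(real ^ 'd) set"
    and \<xi> :: "real ^ 'd"
  assumes "n \<ge> 1" and "r \<ge> 2" and "CARD('d) = n + r"
    and "smooth_manifold n A" and "oriented_atlas n A" and "compact (UNIV :: 'm set)"
    and "equiaffine_structure n A D \<theta>"
    and "volume_form (n + r) UNIV \<omega>"
    and "equiaffine_immersion n A D \<theta> r UNIV \<omega> f"
    and "unit_ellipsoid (n + r) UNIV \<omega> \<zeta> S"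
    and "induces n A D \<theta> r UNIV \<omega> f N \<theta>N"
    and "total_absolute_curvature n A \<theta> r UNIV f N \<zeta> S = 2"
    and "affine L" and "aff_dim L = int (n + r - 1)" and "range f \<subseteq> L"
    and "L' = direction L" and "\<xi> \<notin> L'"
    and "\<omega>L = hyperplane_volume (n + r - 1) L' \<omega> \<xi>"
  shows "equiaffine_immersion n A D \<theta> (r - 1) L \<omega>L f \<and>
    (\<forall>\<zeta>L SL. unit_ellipsoid (n + r - 1) L' \<omega>L \<zeta>L SL \<longrightarrow>
       (\<forall>NL \<theta>NL. induces n A D \<theta> (r - 1) L \<omega>L f NL \<theta>NL \<longrightarrow>
          total_absolute_curvature n A \<theta> (r - 1) L f NL \<zeta>L SL = 2))"
proof -
  note n1 = assms(1) and r2 = assms(2) and card = assms(3) and man = assms(4) and cpt = assms(6)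
    and eq = assms(7) and \<omega> = assms(8) and unit = assms(10) and ind = assms(11) and tac = assms(12)
    and L = assms(13-15) and L' = assms(16) and \<xi> = assms(17) and \<omega>L = assms(18)
  note dU = direction_UNIV[where 'v = "real ^ 'd"]
  have nr: "n + r - 1 = n + (r - 1)" using r2 by simp
  have imm: "immersion n A UNIV f" using assms(9) by (simp add: equiaffine_immersion_def)
  then have immL: "immersion n A L f" using L(3) by (simp add: immersion_def)
  have gs: "gauss_setup n A \<theta> r UNIV \<omega> f N \<theta>N"
    by (rule gauss_setupI[OF man n1 _ cpt eq _ _ imm ind]) (use r2 \<omega> dU in simp_all)
  have "hyperplane_setup n A \<theta> r \<omega> f N \<theta>N L \<xi>"
    unfolding hyperplane_setup_def hyperplane_setup_axioms_def
    using gs r2 L \<xi> card unfolding L' by simp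
  then interpret H: hyperplane_setup n A \<theta> r \<omega> f N \<theta>N L \<xi> .
  have vol: "volume_form (n + (r - 1)) (direction L) \<omega>L"
    using H.volume_form_\<omega>L unfolding \<omega>L L' nr .
  have subL: "subspace (direction L)" by (rule H.L'(1))
  have "induces n A D \<theta> (r - 1) L \<omega>L f H.NL H.\<theta>NL"
    unfolding \<omega>L L'
  proof (rule H.induces_NL)
    show "torsion_free_connection n A D" using eq by (simp add: equiaffine_structure_def)
    show "deriv_along (X p) (\<lambda>q. deriv_along (Y q) f) - deriv_along (D X Y p) f \<in> N p"
      if "X \<in> vector_fields n A" "Y \<in> vector_fields n A" for X Y p
      using ind that unfolding induces_def by blast
  qed
  then have "\<exists>NL \<theta>NL. induces n A D \<theta> (r - 1) L \<omega>L f NL \<theta>NL" by blast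
  then have 1: "equiaffine_immersion n A D \<theta> (r - 1) L \<omega>L f"
    unfolding equiaffine_immersion_def using r2 L(1,2) vol eq immL nr by simp
  \<comment> \<open>\<open>NL\<close> and \<open>\<theta>NL\<close> are arbitrary here, not the pair
    constructed for (1): the criterion for the value 2 holds for every inducing pair.\<close>
  have 2: "total_absolute_curvature n A \<theta> (r - 1) L f NL \<zeta>L SL = 2"
    if unitL: "unit_ellipsoid (n + r - 1) L' \<omega>L \<zeta>L SL" and indL: "induces n A D \<theta> (r - 1) L \<omega>L f NL \<theta>NL"
    for \<zeta>L SL NL \<theta>NL
  proof -
    have gsL: "gauss_setup n A \<theta> (r - 1) L \<omega>L f NL \<theta>NL"
      by (rule gauss_setupI[OF man n1 _ cpt eq subL vol immL indL]) (use r2 in simp)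
    interpret P: ellipsoid_setup n A \<theta> r UNIV \<omega> f N \<theta>N \<zeta> S
      by (rule ellipsoid_setupI[OF gs]) (use unit dU in simp)
    interpret Q: ellipsoid_setup n A \<theta> "r - 1" L \<omega>L f NL \<theta>NL \<zeta>L SL
      by (rule ellipsoid_setupI[OF gsL]) (use unitL L' nr in simp)
    \<comment> \<open>The area formula needs index types in \<open>wellorder\<close> of exactly the
      right size. \<open>below\<close> removes one element, so \<open>'d option below\<close> has as
      many elements as \<open>'d\<close>, namely \<open>n + r\<close>, and \<open>'d below\<close>
      has one fewer.\<close>
    have i1: "bij_betw Abs_below {..<n + r} (UNIV :: 'd option below set)"
      using bij_betw_Abs_below[where 'a = "'d option"] card n1 by (simp add: max_def)
    have mx: "max 1 (CARD('d) - 1) = n + (r - 1)" unfolding max_def card using n1 r2 by auto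
    have i2: "bij_betw Abs_below {..<n + (r - 1)} (UNIV :: 'd below set)"
      using bij_betw_Abs_below[where 'a = 'd] unfolding mx .
    \<comment> \<open>\<open>critical\<close> depends on the atlas and on \<open>f\<close> only, so
      the same function occurs in the criteria for \<open>f\<close> and for its restriction.\<close>
    let ?C = "\<lambda>w. emeasure (count_space UNIV) (P.critical w)"
    obtain Z :: "real ^ ('d option below) \<Rightarrow> real ^ 'd" where Z: "linear Z \<and> inj Z \<and> range Z = direction UNIV \<and>
        (total_absolute_curvature n A \<theta> r UNIV f N \<zeta> S = 2 \<longleftrightarrow> negligible {z. ?C (Z z) \<noteq> 2})"
      using P.total_absolute_curvature_eq_2_iff[OF i1] by (rule exE)
    obtain Z' :: "real ^ ('d below) \<Rightarrow> real ^ 'd" where Z': "linear Z' \<and> inj Z' \<and> range Z' = direction L \<and>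
        (total_absolute_curvature n A \<theta> (r - 1) L f NL \<zeta>L SL = 2 \<longleftrightarrow> negligible {z. ?C (Z' z) \<noteq> 2})"
      using Q.total_absolute_curvature_eq_2_iff[OF i2] by (rule exE)
    have "negligible {z. ?C (Z' z) \<noteq> 2}"
    proof (rule negligible_hyperplane[where Z = Z and l = H.l])
      show "range Z = UNIV" using Z dU by simp
      show "range Z' = {x. H.l \<bullet> x = 0}" using Z' H.l(2) by auto
      show "H.l \<noteq> 0" using H.l(1) by auto
      show "?C (w + c *\<^sub>R H.l) = ?C w" for w c
      proof -
        have "deriv_along v f \<bullet> H.l = 0" if "v \<in> tangent_space n A p" for v p
          using H.df_L'[OF that] H.l(2) by (simp add: inner_commute)
        then have "P.critical (w + c *\<^sub>R H.l) = P.critical w"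
          unfolding P.critical_def by (simp add: inner_add_right)
        then show ?thesis by simp
      qed
      show "negligible {z. ?C (Z z) \<noteq> 2}" using Z tac by simp
    qed (use Z Z' in simp_all)
    then show ?thesis using Z' by simp
  qed
  show ?thesis using 1 2 by blast
qed

end
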